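(* Let $R$ be a graded-commutative algebra in chain complexes over $\mathbb{Q}$, $A$ a cofibrant graded-commutative $R$-algebra in chain complexes, and $n\in\mathbb{Z}$. For $\omega\in\mathrm{DR}(A/R)/F^p$ and $\pi\in F^2\widehat{\mathrm{Pol}}(A,n)^{n+2}/F^p$, we have $$[\pi,\mu(\omega,\pi)]=\mu(d\omega,\pi)+\tfrac12\nu(\omega,\pi,[\pi,\pi]),$$ $$\delta_\pi\mu(\omega,\pi)=\mu(D\omega,\pi)+\nu(\omega,\pi,\kappa(\pi)),$$ where $\delta_\pi=[\delta+\pi,-]$, $D=d\pm\delta$ is the total differential on $\mathrm{DR}(A/R)/F^p$, and $\kappa(\pi)=[\delta,\pi]+\tfrac12[\pi,\pi]$.
   Context: $\delta$ is the differential of $A$; $\Omega^p_{A/R}=\Lambda^p_A\Omega^1_{A/R}$ (Kähler differentials), $d$ the de Rham differential. $(M_{[i]})_m=M_{i+m}$ for chain complexes, $(M^{[j]})^m=M^{j+m}$ for cochain complexes; a chain complex is viewed as a cochain complex via $V^i=V_{-i}$. $\underline{\mathrm{Hom}}_A(M,P)^i$ is the $A$-linear maps of graded modules $M\to P_{[-i]}$, with the usual differential. $\mathrm{CoS}^j_A(M)=(M^{\otimes_Aj})^{\Sigma_j}$. $\widehat{\mathrm{Pol}}(A,n)=\underline{\mathrm{Hom}}_A(\bigoplus_{j\ge0}\mathrm{CoS}^j_A((\Omega^1_{A/R})_{[-n-1]}),A)$, a cochain complex with $F^i$ the part $j\ge i$; it has a graded-commutative product and the Schouten–Nijenhuis bracket,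 the biderivation of degree $-1-n$ extending the Lie bracket on $\underline{\mathrm{Hom}}_A(\Omega^1_{A/R},A)$ (and the action of derivations on $A$), making $\widehat{\mathrm{Pol}}(A,n)^{[n+1]}$ a DGLA with $[F^i,F^j]\subset F^{i+j-1}$, $F^iF^j\subset F^{i+j}$. The differential on $\widehat{\mathrm{Pol}}(A,n)$ is $[\delta,-]$, where $\delta\in\widehat{\mathrm{Pol}}(A,n)^{n+2}$ denotes the element defined by the derivation $\delta$ of $A$. $\mathrm{DR}(A/R)$ is the product total cochain complex of $A\xrightarrow{d}\Omega^1_{A/R}\xrightarrow{d}\Omega^2_{A/R}\to\cdots$, with total differential $D=d\pm\delta$; $F^p\mathrm{DR}(A/R)$ consists of the terms $\Omega^i_{A/R}$ with $i\ge p$. For $\pi\in(F^2\widehat{\mathrm{Pol}}(A,n)/F^p)^{n+2}$, $\mu(-,\pi):\mathrm{DR}(A/R)/F^p\to\widehat{\mathrm{Pol}}(A,n)/F^p$ is the morphism of graded $A$-algebras given on generators by $\mu(a\,df,\pi)=a[\pi,f]$. For $b\in F^2\widehat{\mathrm{Pol}}(A,n)/F^p$, $\nu(-,\pi,b):\mathrm{DR}(A/R)/F^p\to\widehat{\mathrm{Pol}}(A,n)/F^p$ is the $A$-linear derivation with respect to the ring homomorphism $\mu(-,\pi)$ given on generators by $\nu(a\,df,\pi,b)=a[b,f]$; equivalently $\mu(\omega,\pi+b\epsilon)=\mu(\omega,\pi)+\nu(\omega,\pi,b)\epsilon$ with $\epsilon^2=0$. Explicitly $\mu(a\,df_1\wedge\dots\wedge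 df_r,\pi)=a[\pi,f_1]\cdots[\pi,f_r]$ and $\nu(a\,df_1\wedge\dots\wedge df_r,\pi,b)=\sum_i\pm a[\pi,f_1]\cdots[b,f_i]\cdots[\pi,f_r]$, with Koszul signs.
   Formalization: Since [π,f] mod F^p is not determined by π mod F^p, π is any representative in F^2 Pol^{n+2}, with [π,π] and κ(π) formed from it untruncated; the identities hold mod F^p. ν(-,π,b) carries Koszul signs: for b of degree n+3, ν(a df,π,b) = (-1)^{|a|} a[b,f]. *)

theory Defs
  imports
    "HOL-Algebra.AbelCoset"
    "HOL-Combinatorics.Permutations"
    "HOL-Computational_Algebra.Group_Closure"
    "HOL-Library.Poly_Mapping"
    "HOL-Library.Set_Algebras"
    "HOL-Library.Function_Algebras"
begin

text \<open>
  Conventions.  Gradings of algebras and modules are by chain degree, so that an element of chain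
  degree \<open>m\<close> has cochain degree \<open>-m\<close>; degrees in the polyvector and de Rham complexes are cochain
  degrees.  All signs are Koszul signs.  Since the degree of a homogeneous element enters the
  signs, operations take the degrees of their arguments as explicit parameters.
\<close>

definition ksgn :: "int \<Rightarrow> 'b \<Rightarrow> 'b::uminus"
  where "ksgn e x = (if even e then x else - x)"


section \<open>Graded-commutative algebras in chain complexes\<close>

record 'b dga = "'b ring" +
  part :: "int \<Rightarrow> 'b set"
  bdry :: "'b \<Rightarrow> 'b"

text \<open>
  The underlying ring is the total ring, the direct sum of the parts.  It is an algebra over the
  rationals iff all positive integers are invertible in it.
\<close>

definition cdga :: "'b dga \<Rightarrow> bool"
  where "cdga B \<longleftrightarrow>
    ring B \<and>
    (\<forall>k::nat. k > 0 \<longrightarrow> add_pow B k \<one>\<^bsub>B\<^esub> \<in> Units B) \<and>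
    (\<forall>i. additive_subgroup (part B i) B) \<and>
    (\<forall>x \<in> carrier B. \<exists>!c. (\<forall>i. c i \<in> part B i) \<and> finite {i. c i \<noteq> \<zero>\<^bsub>B\<^esub>} \<and>
        x = finsum B c {i. c i \<noteq> \<zero>\<^bsub>B\<^esub>}) \<and>
    \<one>\<^bsub>B\<^esub> \<in> part B 0 \<and>
    (\<forall>i j. \<forall>x \<in> part B i. \<forall>y \<in> part B j.
        x \<otimes>\<^bsub>B\<^esub> y \<in> part B (i + j) \<and>
        x \<otimes>\<^bsub>B\<^esub> y = (if even (i * j) then y \<otimes>\<^bsub>B\<^esub> x else \<ominus>\<^bsub>B\<^esub> (y \<otimes>\<^bsub>B\<^esub> x))) \<and>
    (\<forall>x \<in> carrier B. \<forall>y \<in> carrier B. bdry B (x \<oplus>\<^bsub>B\<^esub> y) = bdry B x \<oplus>\<^bsub>B\<^esub> bdry B y) \<and>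
    (\<forall>i. \<forall>x \<in> part B i. bdry B x \<in> part B (i - 1) \<and> bdry B (bdry B x) = \<zero>\<^bsub>B\<^esub>) \<and>
    (\<forall>i. \<forall>x \<in> part B i. \<forall>y \<in> carrier B.
        bdry B (x \<otimes>\<^bsub>B\<^esub> y) = (bdry B x \<otimes>\<^bsub>B\<^esub> y) \<oplus>\<^bsub>B\<^esub>
          (if even i then x \<otimes>\<^bsub>B\<^esub> bdry B y else \<ominus>\<^bsub>B\<^esub> (x \<otimes>\<^bsub>B\<^esub> bdry B y)))"

definition dga_hom :: "'b dga \<Rightarrow> 'c dga \<Rightarrow> ('b \<Rightarrow> 'c) set"
  where "dga_hom B C = {f \<in> ring_hom B C.
    (\<forall>i. f ` part B i \<subseteq> part C i) \<and> (\<forall>x \<in> carrier B. f (bdry B x) = bdry C (f x))}"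

definition cycles :: "'b dga \<Rightarrow> int \<Rightarrow> 'b set"
  where "cycles B i = {x \<in> part B i. bdry B x = \<zero>\<^bsub>B\<^esub>}"

definition boundaries :: "'b dga \<Rightarrow> int \<Rightarrow> 'b set"
  where "boundaries B i = bdry B ` part B (i + 1)"

text \<open>The second and third conjuncts are bijectivity on homology.\<close>

definition trivial_fibration :: "'b dga \<Rightarrow> 'c dga \<Rightarrow> ('b \<Rightarrow> 'c) \<Rightarrow> bool"
  where "trivial_fibration B C f \<longleftrightarrow>
    f \<in> dga_hom B C \<and> f ` carrier B = carrier C \<and>
    (\<forall>i. \<forall>z \<in> cycles C i. \<exists>y \<in> cycles B i. \<exists>w \<in> boundaries C i. z = f y \<oplus>\<^bsub>C\<^esub> w) \<and>
    (\<forall>i. \<forall>y \<in> cycles B i. f y \<in> boundaries C i \<longrightarrow> y \<in> boundaries B i)"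

text \<open>
  Left lifting property of \<open>h : R \<rightarrow> A\<close> against all surjective quasi-isomorphisms.  The test
  algebras live on subsets of \<open>('r + 'a) list\<close>, a type with \<open>max(|R|, |A|, \<aleph>\<^sub>0)\<close> elements.  This
  is no restriction: the small object argument factors \<open>R \<rightarrow> A\<close> as a cofibration followed by a
  trivial fibration \<open>Q \<rightarrow> A\<close> with \<open>Q\<close> of at most that cardinality, and lifting the identity of \<open>A\<close>
  through \<open>Q \<rightarrow> A\<close> exhibits \<open>A\<close> as a retract of the cofibrant algebra \<open>Q\<close>.
\<close>

definition cofibrant :: "'r dga \<Rightarrow> 'a dga \<Rightarrow> ('r \<Rightarrow> 'a) \<Rightarrow> bool"
  where "cofibrant R A h \<longleftrightarrow>
    (\<forall>(B :: ('r + 'a) list dga) (C :: ('r + 'a) list dga) q u g.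
      cdga B \<longrightarrow> cdga C \<longrightarrow> trivial_fibration B C q \<longrightarrow>
      u \<in> dga_hom R B \<longrightarrow> g \<in> dga_hom A C \<longrightarrow>
      (\<forall>r \<in> carrier R. g (h r) = q (u r)) \<longrightarrow>
      (\<exists>l \<in> dga_hom A B. (\<forall>a \<in> carrier A. q (l a) = g a) \<and>
        (\<forall>r \<in> carrier R. l (h r) = u r)))"

text \<open>
  The algebras \<open>R\<close> and \<open>A\<close> themselves have a type as carrier.  (The sort does not include
  \<open>0 \<noteq> 1\<close>.)
\<close>

definition dga_of :: "(int \<Rightarrow> 'a set) \<Rightarrow> ('a \<Rightarrow> 'a) \<Rightarrow> ('a::{ring, monoid_mult}) dga"
  where "dga_of G \<delta> = \<lparr>carrier = UNIV, monoid.mult = (*), one = 1, zero = 0, add = (+),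
    part = G, bdry = \<delta>\<rparr>"

text \<open>An \<open>R\<close>-algebra \<open>A\<close>: the grading, the differential, and the structure map \<open>R \<rightarrow> A\<close>.\<close>

record ('r, 'a) alg =
  gr :: "int \<Rightarrow> 'a set"
  del :: "'a \<Rightarrow> 'a"
  str :: "'r \<Rightarrow> 'a"


section \<open>Graded modules, shifts, Kaehler differentials\<close>

text \<open>\<open>mact M e c x\<close> is the left action of a scalar \<open>c\<close> of degree \<open>e\<close>.\<close>

record ('a, 'm) gmod =
  mpart :: "int \<Rightarrow> 'm set"
  mact :: "int \<Rightarrow> 'a \<Rightarrow> 'm \<Rightarrow> 'm"

text \<open>
  \<open>(M\<^bsub>[s]\<^esub>)\<^sub>m = M\<^bsub>s+m\<^esub>\<close>; moving a scalar past the shift produces a sign.  Together with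
  left linearity this gives the usual sign \<open>\<phi>(c x) = \<plusminus> c \<phi>(x)\<close> for linear maps into a shift.
\<close>

definition shift :: "int \<Rightarrow> ('a::uminus, 'm) gmod \<Rightarrow> ('a, 'm) gmod"
  where "shift s M = \<lparr>mpart = (\<lambda>m. mpart M (s + m)), mact = (\<lambda>e c. mact M e (ksgn (s * e) c))\<rparr>"

text \<open>
  Kaehler differentials: the \<open>A\<close>-module of formal sums of symbols \<open>a df\<close>, written \<open>(a, f)\<close>,
  modulo the relations below.  Its elements are cosets.
\<close>

inductive_set omega_rel :: "('r, 'a::{ring, monoid_mult}) alg \<Rightarrow> ('a \<times> 'a \<Rightarrow>\<^sub>0 int) set"
  for A :: "('r, 'a) alg" where
  "\<lbrakk>a \<in> gr A i; b \<in> gr A i; f \<in> gr A j\<rbrakk> \<Longrightarrow>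
     frag_of (a + b, f) - frag_of (a, f) - frag_of (b, f) \<in> omega_rel A"
| "\<lbrakk>a \<in> gr A i; f \<in> gr A j; g \<in> gr A j\<rbrakk> \<Longrightarrow>
     frag_of (a, f + g) - frag_of (a, f) - frag_of (a, g) \<in> omega_rel A"
| "\<lbrakk>a \<in> gr A i; f \<in> gr A j; g \<in> gr A k\<rbrakk> \<Longrightarrow>
     frag_of (a, f * g) - frag_of (a * f, g) - frag_of (ksgn (j * k) (a * g), f) \<in> omega_rel A"
| "\<lbrakk>a \<in> gr A i; str A r \<in> gr A j\<rbrakk> \<Longrightarrow> frag_of (a, str A r) \<in> omega_rel A"

abbreviation omega_sub :: "('r, 'a::{ring, monoid_mult}) alg \<Rightarrow> ('a \<times> 'a \<Rightarrow>\<^sub>0 int) set"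
  where "omega_sub A \<equiv> group_closure (omega_rel A)"

definition omega :: "('r, 'a::{ring, monoid_mult}) alg \<Rightarrow> ('a, ('a \<times> 'a \<Rightarrow>\<^sub>0 int) set) gmod"
  where "omega A = \<lparr>
    mpart = (\<lambda>m. (\<lambda>x. x +o omega_sub A) `
      group_closure {frag_of (a, f) | a f i j. a \<in> gr A i \<and> f \<in> gr A j \<and> i + j = m}),
    mact = (\<lambda>e c X. frag_extend (\<lambda>(a, f). frag_of (c * a, f)) ` X + omega_sub A)\<rparr>"

definition dd :: "('r, 'a::{ring, monoid_mult}) alg \<Rightarrow> 'a \<Rightarrow> ('a \<times> 'a \<Rightarrow>\<^sub>0 int) set"
  where "dd A f = frag_of (1, f) +o omega_sub A"


section \<open>Tensor powers and exterior powers\<close>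

text \<open>
  The pair \<open>(a, [(d\<^sub>1, x\<^sub>1), \<dots>, (d\<^sub>j, x\<^sub>j)])\<close> stands for \<open>a \<otimes> x\<^sub>1 \<otimes> \<dots> \<otimes> x\<^sub>j\<close> with \<open>x\<^sub>i\<close> of degree \<open>d\<^sub>i\<close>.
  The factor \<open>a\<close> is there so that the case \<open>j = 0\<close> gives \<open>A\<close>.  In the last relation, the right
  action is \<open>x c = \<plusminus> c x\<close>.
\<close>

type_synonym ('a, 'm) tens = "'a \<times> (int \<times> 'm) list \<Rightarrow>\<^sub>0 int"

definition factors :: "('a, 'm) gmod \<Rightarrow> nat \<Rightarrow> (int \<times> 'm) list set"
  where "factors M j = {ms. length ms = j \<and> (\<forall>(d, x) \<in> set ms. x \<in> mpart M d)}"

inductive_set tens_rel ::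
    "(int \<Rightarrow> 'a set) \<Rightarrow> ('a::{ring, monoid_mult}, 'm::plus) gmod \<Rightarrow> nat \<Rightarrow> ('a, 'm) tens set"
  for G :: "int \<Rightarrow> 'a set" and M :: "('a, 'm) gmod" and j :: nat where
  "\<lbrakk>a \<in> G i; b \<in> G i; ms \<in> factors M j\<rbrakk> \<Longrightarrow>
     frag_of (a + b, ms) - frag_of (a, ms) - frag_of (b, ms) \<in> tens_rel G M j"
| "\<lbrakk>a \<in> G i; x \<in> mpart M d; y \<in> mpart M d; xs @ [(d, x)] @ ys \<in> factors M j\<rbrakk> \<Longrightarrow>
     frag_of (a, xs @ [(d, x + y)] @ ys)
       - frag_of (a, xs @ [(d, x)] @ ys) - frag_of (a, xs @ [(d, y)] @ ys) \<in> tens_rel G M j"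
| "\<lbrakk>a \<in> G i; c \<in> G e; (d, x) # ys \<in> factors M j\<rbrakk> \<Longrightarrow>
     frag_of (a * c, (d, x) # ys) - frag_of (a, (e + d, mact M e c x) # ys) \<in> tens_rel G M j"
| "\<lbrakk>a \<in> G i; c \<in> G e; xs @ [(d, x), (d', y)] @ ys \<in> factors M j\<rbrakk> \<Longrightarrow>
     frag_of (a, xs @ [(d + e, mact M e (ksgn (d * e) c) x), (d', y)] @ ys)
       - frag_of (a, xs @ [(d, x), (e + d', mact M e c y)] @ ys) \<in> tens_rel G M j"

text \<open>The formal sums of total degree \<open>m\<close> with \<open>j\<close> factors.\<close>

definition tens_pre ::
    "(int \<Rightarrow> 'a set) \<Rightarrow> ('a::{ring, monoid_mult}, 'm::plus) gmod \<Rightarrow> nat \<Rightarrow> int \<Rightarrow> ('a, 'm) tens set"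
  where "tens_pre G M j m = group_closure
    {frag_of (a, ms) | a ms i. a \<in> G i \<and> ms \<in> factors M j \<and> i + sum_list (map fst ms) = m}"

abbreviation tens_sub ::
    "(int \<Rightarrow> 'a set) \<Rightarrow> ('a::{ring, monoid_mult}, 'm::plus) gmod \<Rightarrow> nat \<Rightarrow> ('a, 'm) tens set"
  where "tens_sub G M j \<equiv> group_closure (tens_rel G M j)"

definition tens_pow ::
    "(int \<Rightarrow> 'a set) \<Rightarrow> ('a::{ring, monoid_mult}, 'm::plus) gmod \<Rightarrow> nat \<Rightarrow> int \<Rightarrow>
      ('a, 'm) tens set set"
  where "tens_pow G M j m = (\<lambda>x. x +o tens_sub G M j) ` tens_pre G M j m"

definition tens_act ::
    "(int \<Rightarrow> 'a set) \<Rightarrow> ('a::{ring, monoid_mult}, 'm::plus) gmod \<Rightarrow> nat \<Rightarrow> 'a \<Rightarrow>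
      ('a, 'm) tens set \<Rightarrow> ('a, 'm) tens set"
  where "tens_act G M j c X =
    frag_extend (\<lambda>(a, ms). frag_of (c * a, ms)) ` X + tens_sub G M j"

text \<open>
  Action of a permutation with its Koszul sign, the product over the inversions.  The condition in
  \<open>CoS\<close> says that the class of \<open>\<sigma> t\<close> is \<open>t\<close>.
\<close>

definition perm_exp :: "(nat \<Rightarrow> nat) \<Rightarrow> int list \<Rightarrow> int"
  where "perm_exp \<sigma> ds =
    (\<Sum>(k, l) \<in> {(k, l). k < l \<and> l < length ds \<and> \<sigma> l < \<sigma> k}. ds ! \<sigma> k * ds ! \<sigma> l)"

definition perm_tens :: "(nat \<Rightarrow> nat) \<Rightarrow> ('a, 'm) tens \<Rightarrow> ('a, 'm) tens"
  where "perm_tens \<sigma> = frag_extend (\<lambda>(a, ms).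
    ksgn (perm_exp \<sigma> (map fst ms)) (frag_of (a, permute_list \<sigma> ms)))"

definition CoS ::
    "(int \<Rightarrow> 'a set) \<Rightarrow> ('a::{ring, monoid_mult}, 'm::plus) gmod \<Rightarrow> nat \<Rightarrow> int \<Rightarrow>
      ('a, 'm) tens set set"
  where "CoS G M j m =
    {t \<in> tens_pow G M j m. \<forall>\<sigma>. \<sigma> permutes {..<j} \<longrightarrow> perm_tens \<sigma> ` t \<subseteq> t}"

text \<open>
  The free graded-commutative algebra on \<open>M\<close> in weight \<open>j\<close>.  With \<open>M = \<Omega>\<^sup>1\<^bsub>[1]\<^esub>\<close> this is the
  exterior power \<open>\<Lambda>\<^sup>j \<Omega>\<^sup>1\<close>, placed in de Rham degree \<open>j\<close>.  Giving \<open>df\<close> its total degree here makes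
  the de Rham complex graded-commutative for the total degree, and \<open>d\<close> a derivation of degree 1.
\<close>

definition sym_rel ::
    "(int \<Rightarrow> 'a set) \<Rightarrow> ('a::{ring, monoid_mult}, 'm::plus) gmod \<Rightarrow> nat \<Rightarrow> ('a, 'm) tens set"
  where "sym_rel G M j = tens_rel G M j \<union>
    {frag_of (a, xs @ [(d, x), (d', y)] @ ys)
       - ksgn (d * d') (frag_of (a, xs @ [(d', y), (d, x)] @ ys)) | a i xs d x d' y ys.
     a \<in> G i \<and> xs @ [(d, x), (d', y)] @ ys \<in> factors M j}"

abbreviation sym_sub ::
    "(int \<Rightarrow> 'a set) \<Rightarrow> ('a::{ring, monoid_mult}, 'm::plus) gmod \<Rightarrow> nat \<Rightarrow> ('a, 'm) tens set"
  where "sym_sub G M j \<equiv> group_closure (sym_rel G M j)"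

definition sym_pow ::
    "(int \<Rightarrow> 'a set) \<Rightarrow> ('a::{ring, monoid_mult}, 'm::plus) gmod \<Rightarrow> nat \<Rightarrow> int \<Rightarrow>
      ('a, 'm) tens set set"
  where "sym_pow G M j m = (\<lambda>x. x +o sym_sub G M j) ` tens_pre G M j m"


section \<open>Polyvectors\<close>

type_synonym 'a kahler_tens = "('a, ('a \<times> 'a \<Rightarrow>\<^sub>0 int) set) tens set"
type_synonym 'a polyvec = "nat \<Rightarrow> 'a kahler_tens \<Rightarrow> 'a"

definition pol_mod ::
    "('r, 'a::{ring, monoid_mult}) alg \<Rightarrow> int \<Rightarrow> ('a, ('a \<times> 'a \<Rightarrow>\<^sub>0 int) set) gmod"
  where "pol_mod A n = shift (- n - 1) (omega A)"

text \<open>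
  A polyvector of cochain degree \<open>i\<close> is the family of its restrictions to the summands of
  \<open>\<Oplus>\<^sub>j CoS\<^sup>j\<close>; it is extended by \<open>0\<close> to arguments that are not homogeneous elements of \<open>CoS\<^sup>j\<close>.
\<close>

definition Pol :: "('r, 'a::{ring, monoid_mult}) alg \<Rightarrow> int \<Rightarrow> int \<Rightarrow> 'a polyvec set"
  where "Pol A n i = {\<phi>. \<forall>j.
    (\<forall>t. t \<notin> (\<Union>m. CoS (gr A) (pol_mod A n) j m) \<longrightarrow> \<phi> j t = 0) \<and>
    (\<forall>m. \<forall>t \<in> CoS (gr A) (pol_mod A n) j m.
       \<phi> j t \<in> gr A (m - i) \<and>
       (\<forall>u \<in> CoS (gr A) (pol_mod A n) j m. \<phi> j (t + u) = \<phi> j t + \<phi> j u) \<and>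
       (\<forall>e. \<forall>c \<in> gr A e.
          \<phi> j (tens_act (gr A) (pol_mod A n) j c t) = ksgn (i * e) (c * \<phi> j t)))}"

definition Fil :: "nat \<Rightarrow> ('a::zero) polyvec set"
  where "Fil q = {\<phi>. \<forall>j < q. \<phi> j = 0}"

text \<open>
  Polyvectors are polyderivations: \<open>ev \<phi> (f\<^sub>1, \<dots>, f\<^sub>j)\<close> is the value of \<open>\<phi>\<close> on the symmetrisation
  \<open>\<Sum>\<sigma>. \<plusminus> df\<^bsub>\<sigma> 1\<^esub> \<otimes> \<dots> \<otimes> df\<^bsub>\<sigma> j\<^esub>\<close> in \<open>CoS\<^sup>j\<close>.  Arguments \<open>(d, f)\<close> are functions \<open>f\<close> of chain degree \<open>d\<close>,
  so that \<open>df\<close> has degree \<open>d + n + 1\<close> in \<open>\<Omega>\<^sup>1\<^bsub>[-n-1]\<^esub>\<close>.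
\<close>

definition symmetrisation :: "(int \<times> 'm) list \<Rightarrow> ('a::one, 'm) tens"
  where "symmetrisation ms =
    (\<Sum>\<sigma> \<in> {\<sigma>. \<sigma> permutes {..<length ms}}. perm_tens \<sigma> (frag_of (1, ms)))"

definition ev :: "('r, 'a::{ring, monoid_mult}) alg \<Rightarrow> int \<Rightarrow> 'a polyvec \<Rightarrow> (int \<times> 'a) list \<Rightarrow> 'a"
  where "ev A n \<phi> fs = \<phi> (length fs)
    (symmetrisation (map (\<lambda>(d, f). (d + n + 1, dd A f)) fs)
       +o tens_sub (gr A) (pol_mod A n) (length fs))"

definition homog_args :: "('r, 'a) alg \<Rightarrow> (int \<times> 'a) list set"
  where "homog_args A = {fs. \<forall>(d, f) \<in> set fs. f \<in> gr A d}"

text \<open>The polyvector of degree \<open>i\<close> with given values as a polyderivation.\<close>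

definition pol_of ::
    "('r, 'a::{ring, monoid_mult}) alg \<Rightarrow> int \<Rightarrow> int \<Rightarrow> ((int \<times> 'a) list \<Rightarrow> 'a) \<Rightarrow> 'a polyvec"
  where "pol_of A n i \<Phi> =
    (THE \<chi>. \<chi> \<in> Pol A n i \<and> (\<forall>fs \<in> homog_args A. ev A n \<chi> fs = \<Phi> fs))"

text \<open>Koszul sign for moving the arguments at the positions in \<open>S\<close> to the front.\<close>

definition shuffle_exp :: "int \<Rightarrow> (int \<times> 'a) list \<Rightarrow> nat set \<Rightarrow> int"
  where "shuffle_exp n fs S =
    (\<Sum>(k, l) \<in> {(k, l). k < l \<and> l < length fs \<and> k \<notin> S \<and> l \<in> S}.
       (fst (fs ! k) + n + 1) * (fst (fs ! l) + n + 1))"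

definition total_degree :: "int \<Rightarrow> (int \<times> 'a) list \<Rightarrow> int"
  where "total_degree n fs = (\<Sum>(d, f) \<leftarrow> fs. d + n + 1)"

text \<open>The algebra \<open>A\<close> sits in \<open>Pol\<close> as the polyvectors of weight 0; \<open>a\<close> has chain degree \<open>i\<close>.\<close>

definition pol_fun :: "('r, 'a::{ring, monoid_mult}) alg \<Rightarrow> int \<Rightarrow> int \<Rightarrow> 'a \<Rightarrow> 'a polyvec"
  where "pol_fun A n i a = pol_of A n (- i) (\<lambda>fs. if fs = [] then a else 0)"

text \<open>
  The product of polyvectors \<open>\<phi>, \<psi>\<close> of cochain degrees \<open>i, j\<close>, dual to the inclusions
  \<open>CoS\<^sup>p\<^sup>+\<^sup>q \<rightarrow> CoS\<^sup>p \<otimes> CoS\<^sup>q\<close>; on symmetrisations this is the shuffle product.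
\<close>

definition pol_mult ::
    "('r, 'a::{ring, monoid_mult}) alg \<Rightarrow> int \<Rightarrow> int \<Rightarrow> 'a polyvec \<Rightarrow> int \<Rightarrow> 'a polyvec \<Rightarrow> 'a polyvec"
  where "pol_mult A n i \<phi> j \<psi> = pol_of A n (i + j)
    (\<lambda>fs. \<Sum>S \<in> Pow {..<length fs}.
       ksgn (shuffle_exp n fs S + j * total_degree n (nths fs S))
         (ev A n \<phi> (nths fs S) * ev A n \<psi> (nths fs (- S))))"

fun pol_prod ::
    "('r, 'a::{ring, monoid_mult}) alg \<Rightarrow> int \<Rightarrow> (int \<times> 'a polyvec) list \<Rightarrow> 'a polyvec"
  where
    "pol_prod A n [] = pol_fun A n 0 1"
  | "pol_prod A n ((i, \<phi>) # xs) = pol_mult A n i \<phi> (sum_list (map fst xs)) (pol_prod A n xs)"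

text \<open>
  The Schouten--Nijenhuis bracket in terms of polyderivations,
  \<open>[\<Phi>, \<Psi>] = \<Phi> \<circ> \<Psi> - \<plusminus> \<Psi> \<circ> \<Phi>\<close>, where \<open>\<Phi> \<circ> \<Psi>\<close> inserts the value of \<open>\<Psi>\<close> as first argument
  of \<open>\<Phi>\<close> and sums over shuffles.  For polyderivations of weight at most 1 it is the
  Lie bracket of derivations and the action of derivations on \<open>A\<close>.
\<close>

definition insertion ::
    "int \<Rightarrow> ((int \<times> 'a) list \<Rightarrow> 'a) \<Rightarrow> int \<Rightarrow> ((int \<times> 'a) list \<Rightarrow> 'a) \<Rightarrow>
      (int \<times> 'a) list \<Rightarrow> 'a::{ring, monoid_mult}"
  where "insertion n \<Phi> j \<Psi> fs = (\<Sum>S \<in> Pow {..<length fs}.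
    ksgn (shuffle_exp n fs S)
      (\<Phi> ((total_degree n (nths fs S) - j, \<Psi> (nths fs S)) # nths fs (- S))))"

definition schouten ::
    "int \<Rightarrow> int \<Rightarrow> ((int \<times> 'a) list \<Rightarrow> 'a) \<Rightarrow> int \<Rightarrow> ((int \<times> 'a) list \<Rightarrow> 'a) \<Rightarrow>
      (int \<times> 'a) list \<Rightarrow> 'a::{ring, monoid_mult}"
  where "schouten n i \<Phi> j \<Psi> fs =
    insertion n \<Phi> j \<Psi> fs - ksgn ((i - n - 1) * (j - n - 1)) (insertion n \<Psi> i \<Phi> fs)"

definition pol_bracket ::
    "('r, 'a::{ring, monoid_mult}) alg \<Rightarrow> int \<Rightarrow> int \<Rightarrow> 'a polyvec \<Rightarrow> int \<Rightarrow> 'a polyvec \<Rightarrow> 'a polyvec"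
  where "pol_bracket A n i \<phi> j \<psi> =
    pol_of A n (i + j - n - 1) (schouten n i (ev A n \<phi>) j (ev A n \<psi>))"

text \<open>
  The derivation \<open>\<delta>\<close> of \<open>A\<close>, of degree \<open>n + 2\<close>.  It is kept as a polyderivation and not as an
  element of \<open>Pol\<close>, because it is \<open>R\<close>-linear only if \<open>R\<close> has zero differential; the operator
  \<open>[\<delta>, -]\<close> preserves \<open>Pol\<close> in any case.
\<close>

definition delta_fun :: "('r, 'a::zero) alg \<Rightarrow> (int \<times> 'a) list \<Rightarrow> 'a"
  where "delta_fun A fs = (case fs of [(d, f)] \<Rightarrow> del A f | _ \<Rightarrow> 0)"

definition delta_bracket ::
    "('r, 'a::{ring, monoid_mult}) alg \<Rightarrow> int \<Rightarrow> int \<Rightarrow> 'a polyvec \<Rightarrow> 'a polyvec"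
  where "delta_bracket A n j \<psi> =
    pol_of A n (j + 1) (schouten n (n + 2) (delta_fun A) j (ev A n \<psi>))"

text \<open>\<open>\<delta>\<^sub>\<pi> = [\<delta> + \<pi>, -]\<close>\<close>

definition delta_pi_bracket ::
    "('r, 'a::{ring, monoid_mult}) alg \<Rightarrow> int \<Rightarrow> 'a polyvec \<Rightarrow> int \<Rightarrow> 'a polyvec \<Rightarrow> 'a polyvec"
  where "delta_pi_bracket A n \<pi> j \<psi> =
    pol_of A n (j + 1) (schouten n (n + 2) (delta_fun A + ev A n \<pi>) j (ev A n \<psi>))"

definition half :: "'b::plus \<Rightarrow> 'b"
  where "half x = (THE y. y + y = x)"

definition kappa :: "('r, 'a::{ring, monoid_mult}) alg \<Rightarrow> int \<Rightarrow> 'a polyvec \<Rightarrow> 'a polyvec"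
  where "kappa A n \<pi> =
    delta_bracket A n (n + 2) \<pi> + half (pol_bracket A n (n + 2) \<pi> (n + 2) \<pi>)"


section \<open>The de Rham complex\<close>

definition dr_mod :: "('r, 'a::{ring, monoid_mult}) alg \<Rightarrow> ('a, ('a \<times> 'a \<Rightarrow>\<^sub>0 int) set) gmod"
  where "dr_mod A = shift 1 (omega A)"

text \<open>\<open>Omega A r m\<close> is the part of \<open>\<Omega>\<^sup>r\<close> of total cochain degree \<open>m\<close>.\<close>

definition Omega :: "('r, 'a::{ring, monoid_mult}) alg \<Rightarrow> nat \<Rightarrow> int \<Rightarrow> 'a kahler_tens set"
  where "Omega A r m = sym_pow (gr A) (dr_mod A) r (- m)"

definition DR :: "('r, 'a::{ring, monoid_mult}) alg \<Rightarrow> int \<Rightarrow> (nat \<Rightarrow> 'a kahler_tens) set"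
  where "DR A m = {\<omega>. \<forall>r. \<omega> r \<in> Omega A r m}"

text \<open>\<open>form A a [(d\<^sub>1, f\<^sub>1), \<dots>]\<close> is \<open>a df\<^sub>1 \<and> \<dots> \<and> df\<^sub>r\<close>, where \<open>f\<^sub>i\<close> has chain degree \<open>d\<^sub>i\<close>.\<close>

definition form :: "('r, 'a::{ring, monoid_mult}) alg \<Rightarrow> 'a \<Rightarrow> (int \<times> 'a) list \<Rightarrow> 'a kahler_tens"
  where "form A a fs = frag_of (a, map (\<lambda>(d, f). (d - 1, dd A f)) fs)
    +o sym_sub (gr A) (dr_mod A) (length fs)"

text \<open>
  The additive map on \<open>\<Omega>\<^sup>r\<close> that sends \<open>a df\<^sub>1 \<and> \<dots> \<and> df\<^sub>r\<close> to \<open>V i a [(d\<^sub>1, f\<^sub>1), \<dots>]\<close>, where \<open>a\<close> has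
  chain degree \<open>i\<close>.  Its values on homogeneous elements are determined by this.
\<close>

definition on_forms ::
    "('r, 'a::{ring, monoid_mult}) alg \<Rightarrow> nat \<Rightarrow> (int \<Rightarrow> 'a \<Rightarrow> (int \<times> 'a) list \<Rightarrow> 'b) \<Rightarrow>
      'a kahler_tens \<Rightarrow> 'b::plus"
  where "on_forms A r V = (SOME g.
    (\<forall>m. \<forall>X \<in> Omega A r m. \<forall>Y \<in> Omega A r m. g (X + Y) = g X + g Y) \<and>
    (\<forall>i. \<forall>a \<in> gr A i. \<forall>fs \<in> homog_args A. length fs = r \<longrightarrow> g (form A a fs) = V i a fs))"

definition d_form :: "('r, 'a::{ring, monoid_mult}) alg \<Rightarrow> nat \<Rightarrow> 'a kahler_tens \<Rightarrow> 'a kahler_tens"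
  where "d_form A r = on_forms A r (\<lambda>i a fs. form A 1 ((i, a) # fs))"

text \<open>
  The contribution of \<open>\<delta>\<close> to the total differential: the derivation with \<open>\<delta>(df) = -d(\<delta>f)\<close>.
\<close>

definition delta_form :: "('r, 'a::{ring, monoid_mult}) alg \<Rightarrow> nat \<Rightarrow> 'a kahler_tens \<Rightarrow> 'a kahler_tens"
  where "delta_form A r = on_forms A r (\<lambda>i a fs. form A (del A a) fs +
    (\<Sum>l < length fs. form A
       (ksgn (1 + i + (\<Sum>(d, f) \<leftarrow> take l fs. d - 1)) a)
       (fs[l := (fst (fs ! l) - 1, del A (snd (fs ! l)))])))"

definition dDR ::
    "('r, 'a::{ring, monoid_mult}) alg \<Rightarrow> (nat \<Rightarrow> 'a kahler_tens) \<Rightarrow> (nat \<Rightarrow> 'a kahler_tens)"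
  where "dDR A \<omega> r = (case r of 0 \<Rightarrow> sym_sub (gr A) (dr_mod A) 0 | Suc s \<Rightarrow> d_form A s (\<omega> s))"

definition DDR ::
    "('r, 'a::{ring, monoid_mult}) alg \<Rightarrow> (nat \<Rightarrow> 'a kahler_tens) \<Rightarrow> (nat \<Rightarrow> 'a kahler_tens)"
  where "DDR A \<omega> r = dDR A \<omega> r + delta_form A r (\<omega> r)"


section \<open>The maps \<open>\<mu>\<close> and \<open>\<nu>\<close>\<close>

text \<open>The factors \<open>a, [\<pi>, f\<^sub>1], \<dots>, [\<pi>, f\<^sub>r]\<close> with their cochain degrees.\<close>

definition mu_factors ::
    "('r, 'a::{ring, monoid_mult}) alg \<Rightarrow> int \<Rightarrow> 'a polyvec \<Rightarrow> int \<Rightarrow> 'a \<Rightarrow> (int \<times> 'a) list \<Rightarrow>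
      (int \<times> 'a polyvec) list"
  where "mu_factors A n \<pi> i a fs = (- i, pol_fun A n i a) #
    map (\<lambda>(d, f). (1 - d, pol_bracket A n (n + 2) \<pi> (- d) (pol_fun A n d f))) fs"

definition mu_form ::
    "('r, 'a::{ring, monoid_mult}) alg \<Rightarrow> int \<Rightarrow> 'a polyvec \<Rightarrow> nat \<Rightarrow> 'a kahler_tens \<Rightarrow> 'a polyvec"
  where "mu_form A n \<pi> r =
    on_forms A r (\<lambda>i a fs. pol_prod A n (mu_factors A n \<pi> i a fs))"

text \<open>
  For \<open>b\<close> of cochain degree \<open>j\<close>, the derivation \<open>\<nu>(-, \<pi>, b)\<close> has degree \<open>j - n - 2\<close>; the sign is
  the one for moving it past \<open>a df\<^sub>1 \<and> \<dots> \<and> df\<^bsub>l-1\<^esub>\<close>.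
\<close>

definition nu_form ::
    "('r, 'a::{ring, monoid_mult}) alg \<Rightarrow> int \<Rightarrow> 'a polyvec \<Rightarrow> int \<Rightarrow> 'a polyvec \<Rightarrow> nat \<Rightarrow>
      'a kahler_tens \<Rightarrow> 'a polyvec"
  where "nu_form A n \<pi> j b r = on_forms A r (\<lambda>i a fs.
    \<Sum>l < length fs. ksgn ((j - n - 2) * (- i + (\<Sum>(d, f) \<leftarrow> take l fs. 1 - d)))
      (pol_prod A n ((mu_factors A n \<pi> i a fs)[Suc l :=
        (case fs ! l of (d, f) \<Rightarrow>
           (j - d - n - 1, pol_bracket A n j b (- d) (pol_fun A n d f)))])))"

text \<open>
  On \<open>DR/F\<^sup>p = \<Omega>\<^sup>0 \<oplus> \<dots> \<oplus> \<Omega>\<^bsub>p-1\<^esub>\<close>; the values are representatives modulo \<open>F\<^sup>p\<close>.  The argument \<open>\<pi>\<close> is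
  a polyvector, not a class modulo \<open>F\<^sup>p\<close>: bracketing with a function lowers the filtration, so
  \<open>[\<pi>, f]\<close> modulo \<open>F\<^sup>p\<close> depends on the representative \<open>\<pi>\<close>.
\<close>

definition mu ::
    "('r, 'a::{ring, monoid_mult}) alg \<Rightarrow> int \<Rightarrow> nat \<Rightarrow> (nat \<Rightarrow> 'a kahler_tens) \<Rightarrow> 'a polyvec \<Rightarrow>
      'a polyvec"
  where "mu A n p \<omega> \<pi> = (\<Sum>r < p. mu_form A n \<pi> r (\<omega> r))"

definition nu ::
    "('r, 'a::{ring, monoid_mult}) alg \<Rightarrow> int \<Rightarrow> nat \<Rightarrow> (nat \<Rightarrow> 'a kahler_tens) \<Rightarrow> 'a polyvec \<Rightarrow>
      int \<Rightarrow> 'a polyvec \<Rightarrow> 'a polyvec"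
  where "nu A n p \<omega> \<pi> j b = (\<Sum>r < p. nu_form A n \<pi> j b r (\<omega> r))"

definition eq_mod_Fil :: "nat \<Rightarrow> 'a::ab_group_add polyvec \<Rightarrow> 'a polyvec \<Rightarrow> bool"
  where "eq_mod_Fil p \<phi> \<psi> \<longleftrightarrow> \<phi> - \<psi> \<in> Fil p"

end

theory Submission
  imports Defs
begin

text \<open>
  A polyvector is determined by its values on symmetrisations of \<open>df\<^sub>1 \<otimes> \<cdots> \<otimes> df\<^sub>r\<close>, and every graded
  symmetric polyderivation that kills \<open>R\<close> arises in this way; so all identities can be checked for
  polyderivations, by induction on the number of arguments.  There \<open>[\<Theta>, -]\<close> is a derivation of the
  shuffle product for every polyderivation \<open>\<Theta>\<close>, in particular for \<open>\<Theta> = \<delta>\<close>.  Applied to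
  \<open>a [\<pi>, f\<^sub>1] \<cdots> [\<pi>, f\<^sub>r]\<close> with \<open>\<Theta> = \<pi>\<close>, the term \<open>[\<pi>, a] [\<pi>, f\<^sub>1] \<cdots> [\<pi>, f\<^sub>r]\<close> is \<open>\<mu>(d\<omega>)\<close>, and the
  terms with \<open>[\<pi>, [\<pi>, f\<^sub>l]] = \<onehalf> [[\<pi>, \<pi>], f\<^sub>l]\<close> make up \<open>\<onehalf> \<nu>(\<omega>, [\<pi>, \<pi>])\<close>.  With \<open>\<Theta> = \<delta>\<close> one uses
  \<open>[\<delta>, [\<pi>, f]] = [[\<delta>, \<pi>], f] - [\<pi>, \<delta> f]\<close> instead.  Modulo \<open>F\<^sup>p\<close> nothing is lost by truncating \<open>\<omega>\<close>,
  because \<open>\<mu>\<close> maps \<open>\<Omega>\<^sup>p\<close> to \<open>F\<^sup>p\<close> for \<open>\<pi> \<in> F\<^sup>2\<close>.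
\<close>

section \<open>Shuffle sums\<close>

text \<open>Two obstacles shape the proof. One is the signs in shuffle sums. Splitting off the first
  argument gives \<open>pmul_Cons\<close> and \<open>insertion_Cons\<close>, which say that
  contraction with a function is a derivation of the product and of the insertion; the inductions on
  arguments then compare a few terms whose signs depend only on the parities of some degrees. The
  other is that \<open>pol_of\<close> and \<open>on_forms\<close> are descriptions, which say
  nothing before existence (and for \<open>pol_of\<close> uniqueness) is proved. Existence rests on
  the universal property of tensor and exterior powers, done once for maps \<open>V\<close> on the
  data of a df_1 ... df_r that respect the relations only modulo a subgroup \<open>H\<close>. With
  \<open>H\<close> trivial this yields polyvectors, \<mu> and \<nu>; with \<open>H\<close> the
  relations of the exterior power it yields d and \<delta> on forms, whose values are cosets and
  thus not elements of a type that is a group. Polyvectors live on invariant tensors, where the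
  symmetriser is multiplication by r!; this is where the rational coefficients enter.\<close>

lemma ksgn_ksgn [simp]: "ksgn a (ksgn b x) = ksgn (a + b) (x::'b::ab_group_add)"
  by (simp add: ksgn_def)

lemma ksgn_zero [simp]: "ksgn a (0::'b::ab_group_add) = 0"
  by (simp add: ksgn_def)

lemma ksgn_0 [simp]: "ksgn 0 x = x"
  by (simp add: ksgn_def)

lemma ksgn_add: "ksgn a (x + y) = ksgn a x + ksgn a (y::'b::ab_group_add)"
  by (simp add: ksgn_def)

lemma ksgn_diff: "ksgn a (x - y) = ksgn a x - ksgn a (y::'b::ab_group_add)"
  by (simp add: ksgn_def)

lemma ksgn_minus: "ksgn a (- x) = - ksgn a (x::'b::ab_group_add)"
  by (simp add: ksgn_def)

lemma ksgn_sum: "ksgn a (\<Sum>i\<in>I. f i) = (\<Sum>i\<in>I. ksgn a (f i :: 'b::ab_group_add))"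
  by (simp add: ksgn_def sum_negf)

lemma ksgn_mult_left: "ksgn a x * y = ksgn a (x * (y::'b::ring))"
  by (simp add: ksgn_def)

lemma ksgn_mult_right: "x * ksgn a y = ksgn a (x * (y::'b::ring))"
  by (simp add: ksgn_def)

lemmas ksgn_mult = ksgn_mult_left ksgn_mult_right

lemma ksgn_apply: "ksgn a f x = ksgn a (f x :: 'b::ab_group_add)"
  by (simp add: ksgn_def)

lemma ksgn_cong: "even a = even b \<Longrightarrow> x = y \<Longrightarrow> ksgn a x = ksgn b y"
  by (simp add: ksgn_def)

lemma ksgn_odd: "odd a \<Longrightarrow> ksgn a x = - x"
  by (simp add: ksgn_def)

lemma ksgn_even: "even a \<Longrightarrow> ksgn a x = x"
  by (simp add: ksgn_def)

lemma total_degree_simps [simp]: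
  "total_degree n [] = 0"
  "total_degree n (x # fs) = fst x + n + 1 + total_degree n fs"
  "total_degree n (fs @ gs) = total_degree n fs + total_degree n gs"
  by (auto simp: total_degree_def split: prod.splits)

lemma homog_args_simps [simp]:
  "[] \<in> homog_args A"
  "x # fs \<in> homog_args A \<longleftrightarrow> snd x \<in> gr A (fst x) \<and> fs \<in> homog_args A"
  "fs @ gs \<in> homog_args A \<longleftrightarrow> fs \<in> homog_args A \<and> gs \<in> homog_args A"
  by (auto simp: homog_args_def split: prod.splits)


text \<open>Subsets are sorted by whether they contain 0. As 0 is the position of the first
  argument, this is what turns a shuffle sum into a recursion over the argument list.\<close>

lemma sum_Pow_Suc:
  "(\<Sum>S \<in> Pow {..<Suc m}. F S) =
    (\<Sum>S \<in> Pow {..<m}. F (insert 0 (Suc ` S))) + (\<Sum>S \<in> Pow {..<m}. F (Suc ` S) :: 'b::ab_group_add)"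
proof -
  have *: "{..<Suc m} = insert 0 (Suc ` {..<m})"
    by (auto simp: image_iff less_Suc_eq_0_disj)
  have inj: "inj_on (image Suc) X" for X
    by (meson inj_Suc inj_on_image_eq_iff inj_onI subset_UNIV inj_image_eq_iff)
  have inj': "inj_on (\<lambda>S. insert 0 (Suc ` S)) X" for X
  proof (rule inj_onI)
    fix S T assume "insert 0 (Suc ` S) = insert 0 (Suc ` T)"
    then have "Suc ` S = Suc ` T" by (auto simp: set_eq_iff image_iff)
    then show "S = T" by (simp add: inj_image_eq_iff)
  qed
  have "Pow {..<Suc m} = (image Suc) ` Pow {..<m} \<union> (\<lambda>S. insert 0 (Suc ` S)) ` Pow {..<m}"
    unfolding * Pow_insert by (simp add: image_Pow_surj[OF refl, symmetric] image_image)
  then show ?thesis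
    by (subst \<open>Pow _ = _\<close>, subst sum.union_disjoint)
      (auto simp: sum.reindex[OF inj] sum.reindex[OF inj'] add.commute)
qed

lemma nths_Cons_insert: "nths (x # fs) (insert 0 (Suc ` S)) = x # nths fs S"
  and nths_Cons_Suc: "nths (x # fs) (Suc ` S) = nths fs S"
  and nths_Cons_insert_compl: "nths (x # fs) (- insert 0 (Suc ` S)) = nths fs (- S)"
  and nths_Cons_Suc_compl: "nths (x # fs) (- (Suc ` S)) = x # nths fs (- S)"
proof -
  have 1: "{j. Suc j \<in> insert 0 (Suc ` S)} = S" "{j. Suc j \<in> Suc ` S} = S"
    "{j. Suc j \<in> - insert 0 (Suc ` S)} = - S" "{j. Suc j \<in> - (Suc ` S)} = - S"
    by auto
  show "nths (x # fs) (insert 0 (Suc ` S)) = x # nths fs S" "nths (x # fs) (Suc ` S) = nths fs S"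
    "nths (x # fs) (- insert 0 (Suc ` S)) = nths fs (- S)"
    "nths (x # fs) (- (Suc ` S)) = x # nths fs (- S)"
    unfolding nths_Cons 1 by auto
qed

lemma total_degree_nths:
  "S \<subseteq> {..<length fs} \<Longrightarrow> total_degree n (nths fs S) = (\<Sum>l\<in>S. fst (fs ! l) + n + 1)"
proof (induction fs arbitrary: S)
  case Nil
  then show ?case by simp
next
  case (Cons x fs)
  define T where "T = {j. Suc j \<in> S}"
  have T: "T \<subseteq> {..<length fs}" "finite T" using Cons.prems finite_subset[of T "{..<length fs}"]
    by (auto simp: T_def)
  have "S = (if 0 \<in> S then insert 0 (Suc ` T) else Suc ` T)"
  proof (rule Set.set_eqI)
    fix k show "k \<in> S \<longleftrightarrow> k \<in> (if 0 \<in> S then insert 0 (Suc ` T) else Suc ` T)"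
      by (cases k) (auto simp: T_def)
  qed
  moreover have "(\<Sum>l\<in>Suc ` T. fst ((x # fs) ! l) + n + 1) = (\<Sum>l\<in>T. fst (fs ! l) + n + 1)"
    by (simp add: sum.reindex)
  moreover have "0 \<notin> Suc ` T" "finite (Suc ` T)" using T by auto
  ultimately show ?case
    using Cons.IH[OF T(1)] sum.insert[of "Suc ` T" 0 "\<lambda>l. fst ((x # fs) ! l) + n + 1"]
      nths_Cons_insert[of x fs T] nths_Cons_Suc[of x fs T]
    by (auto split: if_splits)
qed

text \<open>A selected first argument is already in front, so position 0 occurs in no pair that has
  to be exchanged.\<close>

lemma shuffle_exp_insert: "shuffle_exp n (x # fs) (insert 0 (Suc ` S)) = shuffle_exp n fs S"
proof -
  have eq: "{(k, l). k < l \<and> l < length (x # fs) \<and> k \<notin> insert 0 (Suc ` S) \<and> l \<in> insert 0 (Suc ` S)} =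
    (\<lambda>(k, l). (Suc k, Suc l)) ` {(k, l). k < l \<and> l < length fs \<and> k \<notin> S \<and> l \<in> S}" (is "?X = ?f ` ?Y")
  proof (rule Set.set_eqI)
    fix z show "z \<in> ?X \<longleftrightarrow> z \<in> ?f ` ?Y"
      by (cases z; cases "fst z"; cases "snd z") (force simp: image_iff)+
  qed
  have inj: "inj_on ?f ?Y" by (auto simp: inj_on_def)
  show ?thesis
    unfolding shuffle_exp_def eq sum.reindex[OF inj] by (simp add: case_prod_beta)
qed

text \<open>If the first argument stays behind, every selected argument has to pass it; the pairs
  \<open>?g\<close> contribute its degree times the total degree of the selection.\<close>

lemma shuffle_exp_Suc:
  assumes "S \<subseteq> {..<length fs}"
  shows "shuffle_exp n (x # fs) (Suc ` S) =
    shuffle_exp n fs S + (fst x + n + 1) * total_degree n (nths fs S)"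
proof -
  let ?X = "{(k, l). k < l \<and> l < length (x # fs) \<and> k \<notin> Suc ` S \<and> l \<in> Suc ` S}"
  let ?Y = "{(k, l). k < l \<and> l < length fs \<and> k \<notin> S \<and> l \<in> S}"
  let ?f = "\<lambda>(k, l). (Suc k, Suc l)" and ?g = "\<lambda>l. (0, Suc l)"
  have eq: "?X = ?f ` ?Y \<union> ?g ` S"
  proof (rule Set.set_eqI)
    fix z show "z \<in> ?X \<longleftrightarrow> z \<in> ?f ` ?Y \<union> ?g ` S"
      using assms by (cases z; cases "fst z"; cases "snd z") (force simp: image_iff)+
  qed
  have fin: "finite ?Y" "finite S"
    using finite_subset[OF assms] by (auto intro!: finite_subset[of ?Y "{..<length fs} \<times> {..<length fs}"])
  have inj: "inj_on ?f ?Y" "inj_on ?g S" by (auto simp: inj_on_def)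
  have "?f ` ?Y \<inter> ?g ` S = {}" by auto
  then show ?thesis
    unfolding shuffle_exp_def eq using fin
    by (simp only: sum.union_disjoint finite_imageI sum.reindex[OF inj(1)] sum.reindex[OF inj(2)])
      (simp add: case_prod_beta total_degree_nths[OF assms] sum_distrib_left)
qed

lemma shuffle_exp_Nil [simp]: "shuffle_exp n [] S = 0"
  by (simp add: shuffle_exp_def)

text \<open>By \<open>schouten_cst\<close> this is the bracket with the function x, which explains
  why it behaves as a derivation everywhere below.\<close>

abbreviation (input) contr :: "'x \<Rightarrow> ('x list \<Rightarrow> 'b) \<Rightarrow> 'x list \<Rightarrow> 'b"
  where "contr x \<Phi> \<equiv> (\<lambda>fs. \<Phi> (x # fs))"

text \<open>The formula inside \<open>pol_mult\<close>, for arbitrary functions of argument lists,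
  so that it also applies to polyderivations not yet known to come from polyvectors.\<close>

definition pmul ::
    "int \<Rightarrow> ((int \<times> 'a) list \<Rightarrow> 'a) \<Rightarrow> int \<Rightarrow> ((int \<times> 'a) list \<Rightarrow> 'a) \<Rightarrow>
      (int \<times> 'a) list \<Rightarrow> 'a::{ring, monoid_mult}"
  where "pmul n \<Phi> j \<Psi> fs = (\<Sum>S \<in> Pow {..<length fs}.
    ksgn (shuffle_exp n fs S + j * total_degree n (nths fs S)) (\<Phi> (nths fs S) * \<Psi> (nths fs (- S))))"

lemma pmul_Nil [simp]: "pmul n \<Phi> j \<Psi> [] = \<Phi> [] * \<Psi> []"
  by (simp add: pmul_def)

text \<open>Subsets containing position 0 give the first summand, the others the second. Only the
  first carries a sign: contraction acts from the right and has to pass \<Psi> before it reaches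
  \<Phi>. In the second, lowering \<open>j\<close> by the degree of dx absorbs the rest of the
  shuffle sign.\<close>

lemma pmul_Cons:
  "pmul n \<Phi> j \<Psi> (x # fs) =
    ksgn (j * (fst x + n + 1)) (pmul n (contr x \<Phi>) j \<Psi> fs) +
    pmul n \<Phi> (j - (fst x + n + 1)) (contr x \<Psi>) fs"
proof -
  have "pmul n \<Phi> j \<Psi> (x # fs) =
     (\<Sum>S \<in> Pow {..<length fs}. ksgn (j * (fst x + n + 1)) (
        ksgn (shuffle_exp n fs S + j * total_degree n (nths fs S))
        (\<Phi> (x # nths fs S) * \<Psi> (nths fs (- S))))) +
     (\<Sum>S \<in> Pow {..<length fs}.
        ksgn (shuffle_exp n fs S + (j - (fst x + n + 1)) * total_degree n (nths fs S))
        (\<Phi> (nths fs S) * \<Psi> (x # nths fs (- S))))"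
    unfolding pmul_def list.size add_0_right add_Suc_right sum_Pow_Suc[unfolded Suc_eq_plus1]
      shuffle_exp_insert nths_Cons_insert nths_Cons_insert_compl nths_Cons_Suc nths_Cons_Suc_compl
      sum_Pow_Suc
    by (intro arg_cong2[where f = "(+)"] sum.cong refl)
      (auto simp: shuffle_exp_Suc algebra_simps intro!: ksgn_cong)
  then show ?thesis by (simp add: pmul_def ksgn_sum)
qed

lemma insertion_Nil [simp]: "insertion n \<Phi> j \<Psi> [] = \<Phi> [(- j, \<Psi> [])]"
  by (simp add: insertion_def)

text \<open>The argument x either goes into the inner function or stays with the outer one, where it
  is exchanged with the inserted value by means of the hypothesis. The inserted value has degree
  total degree minus \<open>j\<close>, and the total degree part of the exchange sign cancels
  against the shuffle sign.\<close>

lemma insertion_Cons: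
  assumes "\<And>y ys. \<Phi> (y # x # ys) = ksgn ((fst x + n + 1) * (fst y + n + 1)) (\<Phi> (x # y # ys))"
  shows "insertion n \<Phi> j \<Psi> (x # fs) =
    insertion n \<Phi> (j - (fst x + n + 1)) (contr x \<Psi>) fs +
    ksgn ((fst x + n + 1) * (j - n - 1)) (insertion n (contr x \<Phi>) j \<Psi> fs)"
proof -
  have "insertion n \<Phi> j \<Psi> (x # fs) =
     (\<Sum>S \<in> Pow {..<length fs}. ksgn (shuffle_exp n fs S)
        (\<Phi> ((total_degree n (nths fs S) - (j - (fst x + n + 1)), \<Psi> (x # nths fs S)) # nths fs (- S)))) +
     (\<Sum>S \<in> Pow {..<length fs}. ksgn ((fst x + n + 1) * (j - n - 1))
        (ksgn (shuffle_exp n fs S)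
        (\<Phi> (x # (total_degree n (nths fs S) - j, \<Psi> (nths fs S)) # nths fs (- S)))))"
    unfolding insertion_def list.size add_0_right add_Suc_right sum_Pow_Suc[unfolded Suc_eq_plus1]
      shuffle_exp_insert nths_Cons_insert nths_Cons_insert_compl nths_Cons_Suc nths_Cons_Suc_compl
      sum_Pow_Suc assms
    by (intro arg_cong2[where f = "(+)"] sum.cong refl)
      (auto simp: shuffle_exp_Suc algebra_simps intro!: ksgn_cong)
  then show ?thesis by (simp add: insertion_def ksgn_sum)
qed

section \<open>Polyderivations and their brackets\<close>

text \<open>The homogeneous structure of A with the operations of its type. \<open>gr_div\<close> is
  divisibility by positive integers realised in degree 0; \<open>del_str\<close> is what remains of
  the structure map being a chain map.\<close>

locale graded_algebra =
  fixes A :: "('r, 'a::{ring, monoid_mult}) alg" and n :: int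
  assumes gr_0 [simp, intro]: "0 \<in> gr A i"
    and gr_add [intro]: "x \<in> gr A i \<Longrightarrow> y \<in> gr A i \<Longrightarrow> x + y \<in> gr A i"
    and gr_uminus [intro]: "x \<in> gr A i \<Longrightarrow> - x \<in> gr A i"
    and gr_1 [simp, intro]: "1 \<in> gr A 0"
    and gr_mult [intro]: "x \<in> gr A i \<Longrightarrow> y \<in> gr A j \<Longrightarrow> x * y \<in> gr A (i + j)"
    and gr_comm: "x \<in> gr A i \<Longrightarrow> y \<in> gr A j \<Longrightarrow> x * y = ksgn (i * j) (y * x)"
    and gr_unique: "x \<in> gr A i \<Longrightarrow> x \<in> gr A j \<Longrightarrow> x \<noteq> 0 \<Longrightarrow> i = j"
    and gr_div: "0 < k \<Longrightarrow> \<exists>u \<in> gr A 0. (\<Sum>l<(k::nat). u) = 1"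
    and del_gr: "x \<in> gr A i \<Longrightarrow> del A x \<in> gr A (i - 1)"
    and del_add: "del A (x + y) = del A x + del A y"
    and del_mult: "x \<in> gr A i \<Longrightarrow> del A (x * y) = del A x * y + ksgn i (x * del A y)"
    and del_str: "\<exists>r'. del A (str A r) = str A r'"
begin

lemma gr_diff [intro]: "x \<in> gr A i \<Longrightarrow> y \<in> gr A i \<Longrightarrow> x - y \<in> gr A i"
  using gr_add[of x i "- y"] gr_uminus[of y i] by simp

lemma gr_ksgn [intro]: "x \<in> gr A i \<Longrightarrow> ksgn e x \<in> gr A i"
  by (auto simp: ksgn_def)

text \<open>The support condition makes equality of polyderivations the same as equality of
  functions. Additivity and the Leibniz rule are imposed in the first slot only; the exchange rule
  carries them to the others. The number \<open>i - n - 1\<close> is the degree of \<Phi> in the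
  shifted Lie algebra.\<close>

definition pder :: "int \<Rightarrow> ((int \<times> 'a) list \<Rightarrow> 'a) \<Rightarrow> bool"
  where "pder i \<Phi> \<longleftrightarrow>
    (\<forall>fs. fs \<notin> homog_args A \<longrightarrow> \<Phi> fs = 0) \<and>
    (\<forall>fs \<in> homog_args A. \<Phi> fs \<in> gr A (total_degree n fs - i)) \<and>
    (\<forall>d f g fs. f \<in> gr A d \<longrightarrow> g \<in> gr A d \<longrightarrow>
      \<Phi> ((d, f + g) # fs) = \<Phi> ((d, f) # fs) + \<Phi> ((d, g) # fs)) \<and>
    (\<forall>p q f g fs. f \<in> gr A p \<longrightarrow> g \<in> gr A q \<longrightarrow> \<Phi> ((p + q, f * g) # fs) =
      ksgn ((i - n - 1) * p) (f * \<Phi> ((q, g) # fs)) +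
      ksgn (p * q + (i - n - 1) * q) (g * \<Phi> ((p, f) # fs))) \<and>
    (\<forall>xs x y ys. \<Phi> (xs @ x # y # ys) =
      ksgn ((fst x + n + 1) * (fst y + n + 1)) (\<Phi> (xs @ y # x # ys)))"

text \<open>Kept apart from \<open>pder\<close> because \<delta> is a polyderivation that need not
  kill R; brackets with \<delta> are dealt with in \<open>Rlin_schouten_dfun\<close>.\<close>

definition Rlin :: "((int \<times> 'a) list \<Rightarrow> 'a) \<Rightarrow> bool"
  where "Rlin \<Phi> \<longleftrightarrow> (\<forall>d r fs. str A r \<in> gr A d \<longrightarrow> \<Phi> ((d, str A r) # fs) = 0)"

lemma pderI:
  assumes "\<And>fs. fs \<notin> homog_args A \<Longrightarrow> \<Phi> fs = 0"
    and "\<And>fs. fs \<in> homog_args A \<Longrightarrow> \<Phi> fs \<in> gr A (total_degree n fs - i)"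
    and "\<And>d f g fs. f \<in> gr A d \<Longrightarrow> g \<in> gr A d \<Longrightarrow>
      \<Phi> ((d, f + g) # fs) = \<Phi> ((d, f) # fs) + \<Phi> ((d, g) # fs)"
    and "\<And>p q f g fs. f \<in> gr A p \<Longrightarrow> g \<in> gr A q \<Longrightarrow> \<Phi> ((p + q, f * g) # fs) =
      ksgn ((i - n - 1) * p) (f * \<Phi> ((q, g) # fs)) +
      ksgn (p * q + (i - n - 1) * q) (g * \<Phi> ((p, f) # fs))"
    and "\<And>xs x y ys. \<Phi> (xs @ x # y # ys) =
      ksgn ((fst x + n + 1) * (fst y + n + 1)) (\<Phi> (xs @ y # x # ys))"
  shows "pder i \<Phi>"
  unfolding pder_def using assms by blast

lemma pder_supp: "pder i \<Phi> \<Longrightarrow> fs \<notin> homog_args A \<Longrightarrow> \<Phi> fs = 0"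
  by (simp add: pder_def)

lemma pder_gr: "pder i \<Phi> \<Longrightarrow> \<Phi> fs \<in> gr A (total_degree n fs - i)"
  by (cases "fs \<in> homog_args A") (auto simp: pder_def)

lemmas pder_add_arg =
  pder_def[THEN iffD1, THEN conjunct2, THEN conjunct2, THEN conjunct1, rule_format]

lemmas pder_mult_arg =
  pder_def[THEN iffD1, THEN conjunct2, THEN conjunct2, THEN conjunct2, THEN conjunct1, rule_format]

lemmas pder_swap =
  pder_def[THEN iffD1, THEN conjunct2, THEN conjunct2, THEN conjunct2, THEN conjunct2, rule_format]

lemma pder_swap0: "pder i \<Phi> \<Longrightarrow> \<Phi> (x # y # ys) =
      ksgn ((fst x + n + 1) * (fst y + n + 1)) (\<Phi> (y # x # ys))"
  using pder_swap[of i \<Phi> "[]" x y ys] by simp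

lemma pder_zero_arg: "pder i \<Phi> \<Longrightarrow> \<Phi> ((d, 0) # fs) = 0"
  using pder_add_arg[of i \<Phi> 0 d 0 fs] by simp

lemma pder_uminus_arg: "pder i \<Phi> \<Longrightarrow> f \<in> gr A d \<Longrightarrow> \<Phi> ((d, - f) # fs) = - \<Phi> ((d, f) # fs)"
  using pder_add_arg[of i \<Phi> f d "- f" fs] pder_zero_arg[of i \<Phi> d fs] gr_uminus[of f d]
  by (simp add: eq_neg_iff_add_eq_0 add.commute)

lemma pder_ksgn_arg: "pder i \<Phi> \<Longrightarrow> f \<in> gr A d \<Longrightarrow> \<Phi> ((d, ksgn e f) # fs) = ksgn e (\<Phi> ((d, f) # fs))"
  by (simp add: ksgn_def pder_uminus_arg)

lemma pder_0 [simp]: "pder i 0"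
  by (rule pderI) auto

lemma pder_add:
  assumes "pder i \<Phi>" "pder i \<Psi>"
  shows "pder i (\<Phi> + \<Psi>)"
proof (rule pderI)
  fix xs x y ys
  show "(\<Phi> + \<Psi>) (xs @ x # y # ys) =
      ksgn ((fst x + n + 1) * (fst y + n + 1)) ((\<Phi> + \<Psi>) (xs @ y # x # ys))"
    using pder_swap[OF assms(1), of xs x y ys] pder_swap[OF assms(2), of xs x y ys]
    by (simp add: ksgn_add)
qed (use pder_gr[OF assms(1)] pder_gr[OF assms(2)] in
  \<open>auto simp: pder_supp[OF assms(1)] pder_supp[OF assms(2)] pder_add_arg[OF assms(1)]
    pder_add_arg[OF assms(2)] pder_mult_arg[OF assms(1)] pder_mult_arg[OF assms(2)] ksgn_add distrib_left\<close>)

lemma pder_ksgn: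
  assumes "pder i \<Phi>"
  shows "pder i (ksgn e \<Phi>)"
proof (rule pderI)
  fix xs x y ys
  show "ksgn e \<Phi> (xs @ x # y # ys) =
      ksgn ((fst x + n + 1) * (fst y + n + 1)) (ksgn e \<Phi> (xs @ y # x # ys))"
    using pder_swap[OF assms, of xs x y ys] by (simp add: ksgn_apply add.commute)
qed (use pder_gr[OF assms] in
  \<open>auto simp: pder_supp[OF assms] pder_add_arg[OF assms] pder_mult_arg[OF assms] ksgn_apply ksgn_add ksgn_mult add.commute\<close>)

lemma pder_cong_degree: "pder i \<Phi> \<Longrightarrow> i = j \<Longrightarrow> pder j \<Phi>"
  by simp

lemma pder_scale:
  assumes "c \<in> gr A p" "pder i \<Phi>"
  shows "pder (i - p) (\<lambda>fs. c * \<Phi> fs)"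
proof (rule pderI)
  fix p' q f g fs assume fg: "f \<in> gr A p'" "g \<in> gr A q"
  have 1: "c * (f * x) = ksgn (p * p') (f * (c * x))" for x
    using gr_comm[OF assms(1) fg(1)] by (simp add: mult.assoc[symmetric] ksgn_mult)
  have 2: "c * (g * x) = ksgn (p * q) (g * (c * x))" for x
    using gr_comm[OF assms(1) fg(2)] by (simp add: mult.assoc[symmetric] ksgn_mult)
  show "c * \<Phi> ((p' + q, f * g) # fs) =
      ksgn ((i - p - n - 1) * p') (f * (c * \<Phi> ((q, g) # fs))) +
      ksgn (p' * q + (i - p - n - 1) * q) (g * (c * \<Phi> ((p', f) # fs)))"
    using pder_mult_arg[OF assms(2) fg] by (auto simp: distrib_left ksgn_mult 1 2 intro!: arg_cong2[where f = "(+)"] ksgn_cong)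
next
  fix fs assume "fs \<in> homog_args A"
  then show "c * \<Phi> fs \<in> gr A (total_degree n fs - (i - p))"
    using gr_mult[OF assms(1) pder_gr[OF assms(2)], of fs] by (simp add: algebra_simps)
next
  fix xs x y ys
  show "c * \<Phi> (xs @ x # y # ys) =
      ksgn ((fst x + n + 1) * (fst y + n + 1)) (c * \<Phi> (xs @ y # x # ys))"
    using pder_swap[OF assms(2), of xs x y ys] by (simp add: ksgn_mult)
qed (auto simp: pder_supp[OF assms(2)] pder_add_arg[OF assms(2)] distrib_left)

text \<open>The first slot of \<open>contr x \<Phi>\<close> is the second slot of \<Phi>, so all
  rules are read off after exchanging x with that argument. For x not homogeneous the contraction is
  zero.\<close>

lemma pder_contr:
  assumes "pder i \<Phi>"
  shows "pder (i - fst x - n - 1) (contr x \<Phi>)"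
proof (cases "snd x \<in> gr A (fst x)")
  case False
  then have "contr x \<Phi> = 0" using pder_supp[OF assms] by (auto simp: fun_eq_iff)
  then show ?thesis by simp
next
  case True
  have swap: "\<Phi> (x # y # fs) = ksgn ((fst x + n + 1) * (fst y + n + 1)) (\<Phi> (y # x # fs))" for y fs
    by (rule pder_swap0[OF assms])
  show ?thesis
  proof (rule pderI)
    fix fs assume "fs \<in> homog_args A"
    then show "\<Phi> (x # fs) \<in> gr A (total_degree n fs - (i - fst x - n - 1))"
      using pder_gr[OF assms, of "x # fs"] by (simp add: algebra_simps)
  next
    fix p q f g fs assume fg: "f \<in> gr A p" "g \<in> gr A q"
    show "\<Phi> (x # (p + q, f * g) # fs) =
      ksgn ((i - fst x - n - 1 - n - 1) * p) (f * \<Phi> (x # (q, g) # fs)) +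
      ksgn (p * q + (i - fst x - n - 1 - n - 1) * q) (g * \<Phi> (x # (p, f) # fs))"
      unfolding swap
      using pder_mult_arg[OF assms fg] by (auto simp: ksgn_add ksgn_mult intro!: arg_cong2[where f = "(+)"] ksgn_cong)
  next
    fix xs u v ys
    show "\<Phi> (x # xs @ u # v # ys) =
      ksgn ((fst u + n + 1) * (fst v + n + 1)) (\<Phi> (x # xs @ v # u # ys))"
      using pder_swap[OF assms, of "x # xs" u v ys] by simp
  qed (use assms True in \<open>auto simp: swap ksgn_add pder_add_arg[OF assms] pder_supp[OF assms]\<close>)
qed

lemma contr_add_arg: "pder i \<Phi> \<Longrightarrow> f \<in> gr A d \<Longrightarrow> g \<in> gr A d \<Longrightarrow>
    contr (d, f + g) \<Phi> = contr (d, f) \<Phi> + contr (d, g) \<Phi>"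
  by (auto simp: fun_eq_iff pder_add_arg)

lemma contr_mult_arg: "pder i \<Phi> \<Longrightarrow> f \<in> gr A p \<Longrightarrow> g \<in> gr A q \<Longrightarrow> contr (p + q, f * g) \<Phi> =
      ksgn ((i - n - 1) * p) (\<lambda>fs. f * \<Phi> ((q, g) # fs)) +
      ksgn (p * q + (i - n - 1) * q) (\<lambda>fs. g * \<Phi> ((p, f) # fs))"
  by (auto simp: fun_eq_iff pder_mult_arg ksgn_apply)

lemma contr_swap: "pder i \<Phi> \<Longrightarrow> contr y (contr x \<Phi>) =
   ksgn ((fst x + n + 1) * (fst y + n + 1)) (contr x (contr y \<Phi>))"
  by (auto simp: fun_eq_iff ksgn_apply pder_swap0[of i \<Phi> x y])

lemma contr_nonhomog: "pder i \<Phi> \<Longrightarrow> snd x \<notin> gr A (fst x) \<Longrightarrow> contr x \<Phi> = 0"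
  by (auto simp: fun_eq_iff pder_supp)

end

section \<open>Bilinearity and commutativity of the shuffle product\<close>

lemma pmul_add_left: "pmul n (\<Phi> + \<Phi>') j \<Psi> = pmul n \<Phi> j \<Psi> + pmul n \<Phi>' j \<Psi>"
  by (auto simp: fun_eq_iff pmul_def sum.distrib ksgn_add algebra_simps)

lemma pmul_add_right: "pmul n \<Phi> j (\<Psi> + \<Psi>') = pmul n \<Phi> j \<Psi> + pmul n \<Phi> j \<Psi>'"
  by (auto simp: fun_eq_iff pmul_def sum.distrib ksgn_add algebra_simps)

lemma pmul_ksgn_left: "pmul n (ksgn e \<Phi>) j \<Psi> = ksgn e (pmul n \<Phi> j \<Psi>)"
  by (auto simp: fun_eq_iff pmul_def ksgn_sum ksgn_apply ksgn_mult add.commute intro!: sum.cong)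

lemma pmul_ksgn_right: "pmul n \<Phi> j (ksgn e \<Psi>) = ksgn e (pmul n \<Phi> j \<Psi>)"
  by (auto simp: fun_eq_iff pmul_def ksgn_sum ksgn_apply ksgn_mult add.commute intro!: sum.cong)

lemma pmul_0_left [simp]: "pmul n 0 j \<Psi> = 0"
  and pmul_0_right [simp]: "pmul n \<Phi> j 0 = 0"
  by (auto simp: fun_eq_iff pmul_def)

lemma pmul_scale_left: "pmul n (\<lambda>fs. c * \<Phi> fs) j \<Psi> = (\<lambda>fs. c * pmul n \<Phi> j \<Psi> fs)"
  by (auto simp: fun_eq_iff pmul_def sum_distrib_left ksgn_mult mult.assoc)

lemma contr_pmul: "contr x (pmul n \<Phi> j \<Psi>) =
    ksgn (j * (fst x + n + 1)) (pmul n (contr x \<Phi>) j \<Psi>) +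
    pmul n \<Phi> (j - fst x - n - 1) (contr x \<Psi>)"
  by (auto simp: fun_eq_iff pmul_Cons ksgn_apply algebra_simps)

lemma contr_ksgn: "contr x (ksgn e \<Phi>) = ksgn e (contr x (\<Phi> :: _ \<Rightarrow> 'b::ab_group_add))"
  by (auto simp: fun_eq_iff ksgn_apply)

lemma contr_plus: "contr x (\<Phi> + \<Psi>) = contr x \<Phi> + contr x (\<Psi> :: _ \<Rightarrow> 'b::ab_group_add)"
  by (auto simp: fun_eq_iff)

lemma contr_minus: "contr x (\<Phi> - \<Psi>) = contr x \<Phi> - contr x (\<Psi> :: _ \<Rightarrow> 'b::ab_group_add)"
  by (auto simp: fun_eq_iff)

lemma contr_0 [simp]: "contr x 0 = (0 :: _ \<Rightarrow> 'b::ab_group_add)"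
  by (auto simp: fun_eq_iff)

context graded_algebra
begin

text \<open>The scalar has to pass the values of \<Phi>, of degree total degree minus
  \<open>i\<close>; the total degree part of this sign is cancelled by lowering the degree of the
  right factor to \<open>j - p\<close>.\<close>

lemma pmul_scale_right:
  assumes "c \<in> gr A p" "pder i \<Phi>"
  shows "pmul n \<Phi> (j - p) (\<lambda>fs. c * \<Psi> fs) = ksgn (i * p) (\<lambda>fs. c * pmul n \<Phi> j \<Psi> fs)"
proof -
  have "\<Phi> fs * (c * x) = ksgn (p * (total_degree n fs - i)) (c * (\<Phi> fs * x))" for fs x
    using gr_comm[OF pder_gr[OF assms(2)] assms(1), of fs]
    by (simp add: mult.assoc[symmetric] ksgn_mult mult.commute)
  then show ?thesis
    by (auto simp: fun_eq_iff ksgn_apply pmul_def sum_distrib_left ksgn_mult ksgn_sum intro!: sum.cong ksgn_cong)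
qed

lemma pmul_comm:
  assumes "pder i \<Phi>" "pder j \<Psi>"
  shows "pmul n \<Phi> j \<Psi> = ksgn (i * j) (pmul n \<Psi> i \<Phi>)"
proof
  fix fs show "pmul n \<Phi> j \<Psi> fs = ksgn (i * j) (pmul n \<Psi> i \<Phi>) fs"
    using assms
  proof (induction fs arbitrary: \<Phi> \<Psi> i j)
    case Nil
    then show ?case
      using gr_comm[OF pder_gr pder_gr, of i \<Phi> j \<Psi> "[]" "[]"] by (simp add: ksgn_apply)
  next
    case (Cons x fs)
    show ?case
      using Cons.IH[OF pder_contr[OF Cons.prems(1)] Cons.prems(2), of x]
        Cons.IH[OF Cons.prems(1) pder_contr[OF Cons.prems(2)], of x]
      by (auto simp: ksgn_apply pmul_Cons ksgn_add algebra_simps intro!: arg_cong2[where f = "(+)"] ksgn_cong)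
  qed
qed

end

definition cst :: "'a \<Rightarrow> 'x list \<Rightarrow> 'a::zero"
  where "cst a = (\<lambda>fs. if fs = [] then a else 0)"

lemma cst_simps [simp]: "cst a [] = a" "cst a (x # fs) = 0"
  by (auto simp: cst_def)

section \<open>Insertion and the Schouten bracket\<close>

lemma insertion_add_left: "insertion n (\<Phi> + \<Phi>') j \<Psi> = insertion n \<Phi> j \<Psi> + insertion n \<Phi>' j \<Psi>"
  by (auto simp: fun_eq_iff insertion_def sum.distrib ksgn_add)

lemma insertion_ksgn_left: "insertion n (ksgn e \<Phi>) j \<Psi> = ksgn e (insertion n \<Phi> j \<Psi>)"
  by (auto simp: fun_eq_iff insertion_def ksgn_sum ksgn_apply add.commute)

lemma insertion_0_left [simp]: "insertion n 0 j \<Psi> = 0"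
  by (auto simp: fun_eq_iff insertion_def)

lemma schouten_antisym:
  "schouten n i \<Phi> j \<Psi> = - ksgn ((i - n - 1) * (j - n - 1)) (schouten n j \<Psi> i \<Phi>)"
  by (auto simp: fun_eq_iff schouten_def ksgn_apply ksgn_def)

context graded_algebra
begin

lemma insertion_add_right:
  assumes "pder i \<Phi>" "pder j \<Psi>" "pder j \<Psi>'"
  shows "insertion n \<Phi> j (\<Psi> + \<Psi>') = insertion n \<Phi> j \<Psi> + insertion n \<Phi> j \<Psi>'"
  by (auto simp: fun_eq_iff insertion_def pder_add_arg[OF assms(1) pder_gr[OF assms(2)] pder_gr[OF assms(3)]]
      sum.distrib ksgn_add)

lemma insertion_ksgn_right:
  assumes "pder i \<Phi>" "pder j \<Psi>"
  shows "insertion n \<Phi> j (ksgn e \<Psi>) = ksgn e (insertion n \<Phi> j \<Psi>)"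
  by (auto simp: fun_eq_iff insertion_def ksgn_apply pder_ksgn_arg[OF assms(1) pder_gr[OF assms(2)]]
      ksgn_sum add.commute)

lemma insertion_0_right:
  assumes "pder i \<Phi>"
  shows "insertion n \<Phi> j 0 = 0"
  by (auto simp: fun_eq_iff insertion_def pder_zero_arg[OF assms])

lemma contr_insertion:
  assumes "pder i \<Phi>"
  shows "contr x (insertion n \<Phi> j \<Psi>) = insertion n \<Phi> (j - fst x - n - 1) (contr x \<Psi>) +
    ksgn ((fst x + n + 1) * (j - n - 1)) (insertion n (contr x \<Phi>) j \<Psi>)"
  by (rule ext, subst insertion_Cons)
    (auto simp: pder_swap0[OF assms, of _ x] ksgn_apply mult.commute algebra_simps)

lemma schouten_add_right:
  assumes "pder i \<Phi>" "pder j \<Psi>" "pder j \<Psi>'"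
  shows "schouten n i \<Phi> j (\<Psi> + \<Psi>') = schouten n i \<Phi> j \<Psi> + schouten n i \<Phi> j \<Psi>'"
  using insertion_add_right[OF assms] insertion_add_left[of n \<Psi> \<Psi>' i \<Phi>]
  by (auto simp: fun_eq_iff schouten_def ksgn_add)

lemma schouten_add_left:
  assumes "pder i \<Phi>" "pder i \<Phi>'" "pder j \<Psi>"
  shows "schouten n i (\<Phi> + \<Phi>') j \<Psi> = schouten n i \<Phi> j \<Psi> + schouten n i \<Phi>' j \<Psi>"
  using insertion_add_right[OF assms(3,1,2)] insertion_add_left[of n \<Phi> \<Phi>' j \<Psi>]
  by (auto simp: fun_eq_iff schouten_def ksgn_add)

lemma schouten_ksgn_right:
  assumes "pder i \<Phi>" "pder j \<Psi>"
  shows "schouten n i \<Phi> j (ksgn e \<Psi>) = ksgn e (schouten n i \<Phi> j \<Psi>)"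
  using insertion_ksgn_right[OF assms, of e] insertion_ksgn_left[of n e \<Psi> i \<Phi>]
  by (auto simp: fun_eq_iff schouten_def ksgn_diff ksgn_apply add.commute)

lemma schouten_ksgn_left:
  assumes "pder i \<Phi>" "pder j \<Psi>"
  shows "schouten n i (ksgn e \<Phi>) j \<Psi> = ksgn e (schouten n i \<Phi> j \<Psi>)"
  using insertion_ksgn_right[OF assms(2,1), of e] insertion_ksgn_left[of n e \<Phi> j \<Psi>]
  by (auto simp: fun_eq_iff schouten_def ksgn_diff ksgn_apply add.commute)

lemma schouten_0 [simp]:
  assumes "pder i \<Phi>"
  shows "schouten n i \<Phi> j 0 = 0" "schouten n j 0 i \<Phi> = 0"
  using insertion_0_right[OF assms] by (auto simp: fun_eq_iff schouten_def)

text \<open>Both insertions split in the same way, so the bracket does. Since contraction is the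
  bracket with a function, this is the graded Jacobi identity with a function as third entry. It
  replaces the definition of the bracket in the inductions below, except on the empty argument
  list.\<close>

lemma contr_schouten:
  assumes "pder i \<Phi>" "pder j \<Psi>"
  shows "contr x (schouten n i \<Phi> j \<Psi>) = schouten n i \<Phi> (j - fst x - n - 1) (contr x \<Psi>) +
    ksgn ((fst x + n + 1) * (j - n - 1)) (schouten n (i - fst x - n - 1) (contr x \<Phi>) j \<Psi>)"
proof -
  define \<epsilon> where "\<epsilon> = fst x + n + 1"
  have eps: "i - fst x - n - 1 = i - \<epsilon>" "j - fst x - n - 1 = j - \<epsilon>" by (simp_all add: \<epsilon>_def)
  have *: "schouten n i \<Phi> j \<Psi> = insertion n \<Phi> j \<Psi> - ksgn ((i - n - 1) * (j - n - 1)) (insertion n \<Psi> i \<Phi>)"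
    for i j \<Phi> \<Psi> by (auto simp: fun_eq_iff schouten_def ksgn_apply)
  show ?thesis
    unfolding * contr_minus contr_ksgn contr_insertion[OF assms(1)] contr_insertion[OF assms(2)]
      ksgn_add ksgn_diff ksgn_ksgn eps \<epsilon>_def[symmetric]
    by (cases "even i"; cases "even j"; cases "even n"; cases "even \<epsilon>"; simp add: ksgn_def)
qed

lemma pder_cst:
  assumes "a \<in> gr A d"
  shows "pder (- d) (cst a)"
  by (rule pderI) (use assms in \<open>auto simp: cst_def\<close>)

text \<open>Contraction kills \<open>cst f\<close>, so in each step only the contraction of \<Phi>
  survives, and its sign is exactly the one for exchanging the first two arguments.\<close>

lemma schouten_cst:
  assumes "pder i \<Phi>" "f \<in> gr A d"
  shows "schouten n i \<Phi> (- d) (cst f) = contr (d, f) \<Phi>"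
proof
  fix fs show "schouten n i \<Phi> (- d) (cst f) fs = \<Phi> ((d, f) # fs)"
    using assms(1)
  proof (induction fs arbitrary: i \<Phi>)
    case Nil
    then show ?case by (simp add: schouten_def)
  next
    case (Cons x fs)
    have "schouten n i \<Phi> (- d) (cst f) (x # fs) =
       ksgn ((fst x + n + 1) * (- d - n - 1)) (\<Phi> (x # (d, f) # fs))"
      using Cons.IH[OF pder_contr[OF Cons.prems]] schouten_0(1)[OF Cons.prems]
        contr_schouten[OF Cons.prems pder_cst[OF assms(2)], THEN fun_cong, of x fs]
      by (simp add: ksgn_apply zero_fun_def)
    also have "\<dots> = \<Phi> ((d, f) # x # fs)"
      by (subst pder_swap0[OF Cons.prems]) (simp, rule ksgn_even, auto)
    finally show ?case .
  qed
qed

lemma pmul_supp: "pder i \<Phi> \<Longrightarrow> pder j \<Psi> \<Longrightarrow> fs \<notin> homog_args A \<Longrightarrow> pmul n \<Phi> j \<Psi> fs = 0"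
proof (induction fs arbitrary: i j \<Phi> \<Psi>)
  case Nil
  then show ?case by simp
next
  case (Cons x fs)
  show ?case
  proof (cases "snd x \<in> gr A (fst x)")
    case True
    then have "fs \<notin> homog_args A" using Cons.prems by simp
    then show ?thesis
      using Cons.IH[OF pder_contr[OF Cons.prems(1)] Cons.prems(2), of x]
        Cons.IH[OF Cons.prems(1) pder_contr[OF Cons.prems(2)], of x] by (simp add: pmul_Cons diff_diff_eq add.assoc)
  next
    case False
    then show ?thesis using contr_nonhomog[OF Cons.prems(1)] contr_nonhomog[OF Cons.prems(2)]
      by (simp add: pmul_Cons)
  qed
qed

lemma pmul_gr: "pder i \<Phi> \<Longrightarrow> pder j \<Psi> \<Longrightarrow> pmul n \<Phi> j \<Psi> fs \<in> gr A (total_degree n fs - (i + j))"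
proof (induction fs arbitrary: i j \<Phi> \<Psi>)
  case Nil
  then show ?case using gr_mult[OF pder_gr[of i \<Phi> "[]"] pder_gr[of j \<Psi> "[]"]] by simp
next
  case (Cons x fs)
  show ?case
    using Cons.IH[OF pder_contr[OF Cons.prems(1)] Cons.prems(2), of x]
      Cons.IH[OF Cons.prems(1) pder_contr[OF Cons.prems(2)], of x]
    by (auto simp: pmul_Cons algebra_simps)
qed

text \<open>Only exchanging the first two arguments is a computation: the double contractions of the
  factors are related by \<open>contr_swap\<close>, and the mixed terms change places. An exchange
  further inside is reduced to this by contracting the leading arguments.\<close>

lemma pmul_swap: "pder i \<Phi> \<Longrightarrow> pder j \<Psi> \<Longrightarrow> pmul n \<Phi> j \<Psi> (xs @ x # y # ys) =
      ksgn ((fst x + n + 1) * (fst y + n + 1)) (pmul n \<Phi> j \<Psi> (xs @ y # x # ys))"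
proof (induction xs arbitrary: i j \<Phi> \<Psi>)
  case Nil
  define \<epsilon> \<epsilon>' where "\<epsilon> = fst x + n + 1" and "\<epsilon>' = fst y + n + 1"
  have eps: "fst x + n + 1 = \<epsilon>" "fst y + n + 1 = \<epsilon>'" by (simp_all add: \<epsilon>_def \<epsilon>'_def)
  have eq: "j - \<epsilon> - \<epsilon>' = j - \<epsilon>' - \<epsilon>" by simp
  show ?case
    unfolding append_Nil pmul_Cons contr_swap[OF Nil(1), of y x] contr_swap[OF Nil(2), of y x] eps
      pmul_ksgn_left pmul_ksgn_right ksgn_apply eq
    by (cases "even j"; cases "even \<epsilon>'"; cases "even \<epsilon>"; simp add: ksgn_def)
next
  case (Cons z zs)
  show ?case
    using Cons.IH[OF pder_contr[OF Cons.prems(1)] Cons.prems(2), of z]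
      Cons.IH[OF Cons.prems(1) pder_contr[OF Cons.prems(2)], of z]
    by (simp add: pmul_Cons ksgn_add diff_diff_eq add.assoc) (simp add: add.commute)
qed

lemma pder_pmul:
  assumes "pder i \<Phi>" "pder j \<Psi>"
  shows "pder (i + j) (pmul n \<Phi> j \<Psi>)"
proof (rule pderI)
  fix d f g fs assume "f \<in> gr A d" "g \<in> gr A d"
  then show "pmul n \<Phi> j \<Psi> ((d, f + g) # fs) = pmul n \<Phi> j \<Psi> ((d, f) # fs) + pmul n \<Phi> j \<Psi> ((d, g) # fs)"
    by (simp add: pmul_Cons contr_add_arg[OF assms(1)] contr_add_arg[OF assms(2)]
        pmul_add_left pmul_add_right ksgn_add)
next
  fix p q f g fs assume fg: "f \<in> gr A p" "g \<in> gr A q"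
  have eq: "j - (p + q + n + 1) = j - (q + n + 1) - p" "j - (q + n + 1) - p = j - (p + n + 1) - q" by simp_all
  show "pmul n \<Phi> j \<Psi> ((p + q, f * g) # fs) =
    ksgn ((i + j - n - 1) * p) (f * pmul n \<Phi> j \<Psi> ((q, g) # fs)) +
    ksgn (p * q + (i + j - n - 1) * q) (g * pmul n \<Phi> j \<Psi> ((p, f) # fs))"
    unfolding pmul_Cons contr_mult_arg[OF assms(1) fg] contr_mult_arg[OF assms(2) fg] fst_conv
      pmul_add_left pmul_add_right pmul_ksgn_left pmul_ksgn_right pmul_scale_left
    \<comment> \<open>The equations \<open>eq\<close> rewrite the degree of the contracted right
      factor so that first f and then g can be moved out of it.\<close>
    unfolding eq(1) pmul_scale_right[OF fg(1) assms(1)]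
    unfolding eq(2) pmul_scale_right[OF fg(2) assms(1)]
    by (cases "even i"; cases "even j"; cases "even p"; cases "even q"; cases "even n";
        simp add: ksgn_def distrib_left algebra_simps)
qed (use assms in \<open>auto simp: pmul_supp intro: pmul_gr pmul_swap\<close>)

text \<open>Products are bracketed to the right throughout, so this is the form in which
  neighbouring factors are exchanged. In the induction step, 1, 2 and 3 differ in which of the three
  factors is contracted.\<close>

lemma pmul_left_comm:
  assumes "pder i \<Phi>" "pder j \<Psi>" "pder k X"
  shows "pmul n \<Phi> (j + k) (pmul n \<Psi> k X) = ksgn (i * j) (pmul n \<Psi> (i + k) (pmul n \<Phi> k X))"
proof
  fix fs show "pmul n \<Phi> (j + k) (pmul n \<Psi> k X) fs = ksgn (i * j) (pmul n \<Psi> (i + k) (pmul n \<Phi> k X)) fs"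
    using assms
  proof (induction fs arbitrary: i j k \<Phi> \<Psi> X)
    case Nil
    have "\<Phi> [] * \<Psi> [] = ksgn (i * j) (\<Psi> [] * \<Phi> [])"
      using gr_comm[OF pder_gr[OF Nil(1), of "[]"] pder_gr[OF Nil(2), of "[]"]] by simp
    then show ?case by (simp add: ksgn_apply mult.assoc[symmetric] ksgn_mult)
  next
    case (Cons x fs)
    define \<epsilon> where "\<epsilon> = fst x + n + 1"
    have eps: "fst x + n + 1 = \<epsilon>" "m - fst x - n - 1 = m - \<epsilon>" for m by (simp_all add: \<epsilon>_def)
    have d: "pder (i - \<epsilon>) (contr x \<Phi>)" "pder (j - \<epsilon>) (contr x \<Psi>)" "pder (k - \<epsilon>) (contr x X)"
      using Cons.prems[THEN pder_contr, of x] by (simp_all add: \<epsilon>_def algebra_simps)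
    have 1: "pmul n (contr x \<Phi>) (j + k) (pmul n \<Psi> k X) fs = ksgn ((i - \<epsilon>) * j) (pmul n \<Psi> (i + k - \<epsilon>) (pmul n (contr x \<Phi>) k X) fs)"
      using Cons.IH[OF d(1) Cons.prems(2,3)] by (simp add: ksgn_apply algebra_simps)
    have 2: "pmul n \<Phi> (j + k - \<epsilon>) (pmul n (contr x \<Psi>) k X) fs = ksgn (i * (j - \<epsilon>)) (pmul n (contr x \<Psi>) (i + k) (pmul n \<Phi> k X) fs)"
      using Cons.IH[OF Cons.prems(1) d(2) Cons.prems(3)] by (simp add: ksgn_apply algebra_simps)
    have 3: "pmul n \<Phi> (j + k - \<epsilon>) (pmul n \<Psi> (k - \<epsilon>) (contr x X)) fs = ksgn (i * j) (pmul n \<Psi> (i + k - \<epsilon>) (pmul n \<Phi> (k - \<epsilon>) (contr x X)) fs)"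
      using Cons.IH[OF Cons.prems(1,2) d(3)] by (simp add: ksgn_apply algebra_simps)
    show ?case
      unfolding ksgn_apply pmul_Cons[of n \<Phi> "j + k" "pmul n \<Psi> k X" x fs]
        pmul_Cons[of n \<Psi> "i + k" "pmul n \<Phi> k X" x fs] eps contr_pmul pmul_add_right pmul_ksgn_right plus_fun_apply
        1 2 3
      by (cases "even i"; cases "even j"; cases "even k"; cases "even \<epsilon>"; simp add: ksgn_def)
  qed
qed

lemma pmul_cst: "pmul n (cst f) j \<Psi> = (\<lambda>fs. f * \<Psi> fs)"
proof
  fix fs show "pmul n (cst f) j \<Psi> fs = f * \<Psi> fs"
    by (induction fs arbitrary: j \<Psi>) (auto simp: pmul_Cons pmul_0_left[unfolded zero_fun_def])
qed

text \<open>On the empty list this is the Leibniz rule of \<Theta> for the product of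
  \<open>\<Phi> []\<close> and \<open>\<Psi> []\<close>. In the step both sides become sums over
  which of \<Theta>, \<Phi>, \<Psi> is contracted, and these three groups agree by
  induction.\<close>

lemma schouten_pmul:
  assumes "pder k \<Theta>" "pder i \<Phi>" "pder j \<Psi>"
  shows "schouten n k \<Theta> (i + j) (pmul n \<Phi> j \<Psi>) =
    pmul n (schouten n k \<Theta> i \<Phi>) j \<Psi> +
    ksgn ((k - n - 1) * i) (pmul n \<Phi> (k + j - n - 1) (schouten n k \<Theta> j \<Psi>))"
proof
  fix fs
  show "schouten n k \<Theta> (i + j) (pmul n \<Phi> j \<Psi>) fs = (pmul n (schouten n k \<Theta> i \<Phi>) j \<Psi> +
    ksgn ((k - n - 1) * i) (pmul n \<Phi> (k + j - n - 1) (schouten n k \<Theta> j \<Psi>))) fs"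
    using assms(1-3)
  proof (induction fs arbitrary: k i j \<Theta> \<Phi> \<Psi>)
    case Nil
    have 1: "\<Psi> [] * \<Theta> [(- i, \<Phi> [])] = ksgn (j * (n + 1 - i - k)) (\<Theta> [(- i, \<Phi> [])] * \<Psi> [])"
      using gr_comm[OF pder_gr[OF Nil(3), of "[]"] pder_gr[OF Nil(1), of "[(- i, \<Phi> [])]"]]
      by (auto intro!: ksgn_cong)
    have 2: "\<Theta> [(- i - j, \<Phi> [] * \<Psi> [])] = ksgn ((k - n - 1) * i) (\<Phi> [] * \<Theta> [(- j, \<Psi> [])]) +
        \<Theta> [(- i, \<Phi> [])] * \<Psi> []"
      using pder_mult_arg[OF Nil(1), of "\<Phi> []" "- i" "\<Psi> []" "- j" "[]"]
        pder_gr[OF Nil(2), of "[]"] pder_gr[OF Nil(3), of "[]"]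
      by (auto simp: 1 intro!: arg_cong2[where f = "(+)"] ksgn_cong ksgn_even)
    show ?case
      by (simp add: schouten_def 2 ksgn_apply pmul_Cons ksgn_add ksgn_diff ksgn_mult
        left_diff_distrib right_diff_distrib)
        (auto simp: ksgn_def)
  next
    case (Cons x fs)
    define \<epsilon> where "\<epsilon> = fst x + n + 1"
    have eps: "m - fst x - n - 1 = m - \<epsilon>" "fst x + n + 1 = \<epsilon>" for m by (simp_all add: \<epsilon>_def)
    have d: "pder (k - \<epsilon>) (contr x \<Theta>)" "pder (i - \<epsilon>) (contr x \<Phi>)" "pder (j - \<epsilon>) (contr x \<Psi>)"
      using Cons.prems[THEN pder_contr, of x] by (simp_all add: \<epsilon>_def algebra_simps)
    have eq: "i + j - \<epsilon> = (i - \<epsilon>) + j" "i + j - \<epsilon> = i + (j - \<epsilon>)"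
      "k + (j - \<epsilon>) - n - 1 = k + j - n - 1 - \<epsilon>" "k - \<epsilon> + j - n - 1 = k + j - n - 1 - \<epsilon>" by simp_all
    have p: "pder (i + j - \<epsilon>) (pmul n (contr x \<Phi>) j \<Psi>)" "pder (i + j - \<epsilon>) (pmul n \<Phi> (j - \<epsilon>) (contr x \<Psi>))"
      using pder_pmul[OF d(2) Cons.prems(3)] pder_pmul[OF Cons.prems(2) d(3)] unfolding eq(1)[symmetric] eq(2)[symmetric] .
    have L: "schouten n k \<Theta> (i + j) (pmul n \<Phi> j \<Psi>) (x # fs) =
      ksgn (j * \<epsilon>) (schouten n k \<Theta> (i - \<epsilon> + j) (pmul n (contr x \<Phi>) j \<Psi>) fs)
      + schouten n k \<Theta> (i + (j - \<epsilon>)) (pmul n \<Phi> (j - \<epsilon>) (contr x \<Psi>)) fs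
      + ksgn (\<epsilon> * (i + j - n - 1)) (schouten n (k - \<epsilon>) (contr x \<Theta>) (i + j) (pmul n \<Phi> j \<Psi>) fs)"
      using contr_schouten[OF Cons.prems(1) pder_pmul[OF Cons.prems(2,3)], THEN fun_cong, of x fs]
      by (simp add: contr_pmul eps schouten_add_right[OF Cons.prems(1) pder_ksgn[OF p(1)] p(2)]
        schouten_ksgn_right[OF Cons.prems(1) p(1)] ksgn_apply eq(1,2)[symmetric])
    show ?case
      unfolding L Cons.IH[OF Cons.prems(1) d(2) Cons.prems(3)] Cons.IH[OF Cons.prems(1,2) d(3)]
        Cons.IH[OF d(1) Cons.prems(2,3)]
      unfolding plus_fun_apply pmul_Cons ksgn_apply eps eq(3,4)
        contr_schouten[OF Cons.prems(1,2)] contr_schouten[OF Cons.prems(1,3)]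
        pmul_add_left pmul_add_right pmul_ksgn_left pmul_ksgn_right ksgn_add ksgn_ksgn
      by (cases "even k"; cases "even i"; cases "even j"; cases "even n"; cases "even \<epsilon>";
        simp add: ksgn_def)
  qed
qed

text \<open>Scaling by f is the product with \<open>cst f\<close>, and the bracket with
  \<open>cst f\<close> is a contraction. The first summand measures the failure of the bracket to be
  linear over A.\<close>

lemma schouten_scale_right:
  assumes "pder i \<Phi>" "pder j \<Psi>" "f \<in> gr A p"
  shows "schouten n i \<Phi> (j - p) (\<lambda>fs. f * \<Psi> fs) =
    pmul n (contr (p, f) \<Phi>) j \<Psi> + ksgn ((i - n - 1) * p) (\<lambda>fs. f * schouten n i \<Phi> j \<Psi> fs)"
proof -
  have "schouten n i \<Phi> (- p + j) (pmul n (cst f) j \<Psi>) = pmul n (contr (p, f) \<Phi>) j \<Psi> +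
      ksgn ((i - n - 1) * p) (pmul n (cst f) (i + j - n - 1) (schouten n i \<Phi> j \<Psi>))"
    unfolding schouten_pmul[OF assms(1) pder_cst[OF assms(3)] assms(2)] schouten_cst[OF assms(1,3)]
    by (rule arg_cong2[where f = "(+)"], rule refl, rule ksgn_cong) auto
  then show ?thesis by (simp add: pmul_cst)
qed

lemma schouten_scale_left:
  assumes "pder i \<Phi>" "pder j \<Psi>" "f \<in> gr A p"
  shows "schouten n (i - p) (\<lambda>fs. f * \<Phi> fs) j \<Psi> =
    (\<lambda>fs. f * schouten n i \<Phi> j \<Psi> fs) -
    ksgn ((i - p - n - 1) * (j - n - 1)) (pmul n (contr (p, f) \<Psi>) i \<Phi>)"
  unfolding schouten_antisym[of n "i - p" _ j] schouten_scale_right[OF assms(2,1,3)]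
    schouten_antisym[of n i \<Phi> j]
  by (cases "even i"; cases "even j"; cases "even n"; cases "even p")
    (simp_all add: ksgn_def fun_eq_iff)

lemma schouten_supp: "pder i \<Phi> \<Longrightarrow> pder j \<Psi> \<Longrightarrow> fs \<notin> homog_args A \<Longrightarrow> schouten n i \<Phi> j \<Psi> fs = 0"
proof (induction fs arbitrary: i j \<Phi> \<Psi>)
  case Nil
  then show ?case by simp
next
  case (Cons x fs)
  note c = contr_schouten[OF Cons.prems(1,2), THEN fun_cong, of x fs]
  show ?case
  proof (cases "snd x \<in> gr A (fst x)")
    case True
    then have "fs \<notin> homog_args A" using Cons.prems by simp
    then show ?thesis
      using c Cons.IH[OF pder_contr[OF Cons.prems(1)] Cons.prems(2), of x]
        Cons.IH[OF Cons.prems(1) pder_contr[OF Cons.prems(2)], of x] by (simp add: ksgn_apply)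
  next
    case False
    then show ?thesis
      using c contr_nonhomog[OF Cons.prems(1)] contr_nonhomog[OF Cons.prems(2)]
        schouten_0(1)[OF Cons.prems(1)] schouten_0(2)[OF Cons.prems(2)] by (simp add: ksgn_apply)
  qed
qed

lemma schouten_gr: "pder i \<Phi> \<Longrightarrow> pder j \<Psi> \<Longrightarrow>
    schouten n i \<Phi> j \<Psi> fs \<in> gr A (total_degree n fs - (i + j - n - 1))"
proof (induction fs arbitrary: i j \<Phi> \<Psi>)
  case Nil
  then show ?case
    using pder_gr[of i \<Phi> "[(- j, \<Psi> [])]"] pder_gr[of j \<Psi> "[(- i, \<Phi> [])]"]
    by (auto simp: schouten_def algebra_simps)
next
  case (Cons x fs)
  note c = contr_schouten[OF Cons.prems(1,2), THEN fun_cong, of x fs]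
  show ?case
    using c Cons.IH[OF pder_contr[OF Cons.prems(1)] Cons.prems(2), of x]
      Cons.IH[OF Cons.prems(1) pder_contr[OF Cons.prems(2)], of x]
    by (auto simp: ksgn_apply algebra_simps)
qed

lemma schouten_swap: "pder i \<Phi> \<Longrightarrow> pder j \<Psi> \<Longrightarrow> schouten n i \<Phi> j \<Psi> (xs @ x # y # ys) =
      ksgn ((fst x + n + 1) * (fst y + n + 1)) (schouten n i \<Phi> j \<Psi> (xs @ y # x # ys))"
proof (induction xs arbitrary: i j \<Phi> \<Psi>)
  case Nil
  define \<epsilon> \<epsilon>' where "\<epsilon> = fst x + n + 1" and "\<epsilon>' = fst y + n + 1"
  have eps: "fst x + n + 1 = \<epsilon>" "fst y + n + 1 = \<epsilon>'" "m - fst x - n - 1 = m - \<epsilon>"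
    "m - fst y - n - 1 = m - \<epsilon>'" for m
    by (simp_all add: \<epsilon>_def \<epsilon>'_def)
  have eq: "m - \<epsilon> - \<epsilon>' = m - \<epsilon>' - \<epsilon>" for m by simp
  \<comment> \<open>The four ways of distributing two contractions over the two entries of the
    bracket.\<close>
  have c: "contr y (contr x (schouten n i \<Phi> j \<Psi>)) =
    (schouten n i \<Phi> (j - fst x - n - 1 - fst y - n - 1) (contr y (contr x \<Psi>)) +
     ksgn ((fst y + n + 1) * (j - fst x - n - 1 - n - 1))
        (schouten n (i - fst y - n - 1) (contr y \<Phi>) (j - fst x - n - 1) (contr x \<Psi>))) +
    ksgn ((fst x + n + 1) * (j - n - 1))
     (schouten n (i - fst x - n - 1) (contr x \<Phi>) (j - fst y - n - 1) (contr y \<Psi>) +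
      ksgn ((fst y + n + 1) * (j - n - 1))
       (schouten n (i - fst x - n - 1 - fst y - n - 1) (contr y (contr x \<Phi>)) j \<Psi>))" (is "?L = ?R") for x y
  proof
    fix fs
    show "?L fs = ?R fs"
      using contr_schouten[OF Nil(1) Nil(2), of x, THEN fun_cong, of "y # fs"]
        contr_schouten[OF Nil(1) pder_contr[OF Nil(2), of x], of y, THEN fun_cong, of fs]
        contr_schouten[OF pder_contr[OF Nil(1), of x] Nil(2), of y, THEN fun_cong, of fs]
      by (simp add: ksgn_apply)
  qed
  have "pder (j - \<epsilon>' - \<epsilon>) (contr y (contr x \<Psi>))" "pder (i - \<epsilon>' - \<epsilon>) (contr y (contr x \<Phi>))"
    using pder_contr[OF pder_contr[OF Nil(1), of x], of y] pder_contr[OF pder_contr[OF Nil(2), of x], of y]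
    by (simp_all add: eps eq)
  then have "contr y (contr x (schouten n i \<Phi> j \<Psi>)) =
    ksgn (\<epsilon> * \<epsilon>') (contr x (contr y (schouten n i \<Phi> j \<Psi>)))"
    unfolding c contr_swap[OF Nil(1), of y x] contr_swap[OF Nil(2), of y x] eps eq
    by (simp only: schouten_ksgn_right[OF Nil(1)] schouten_ksgn_left[OF _ Nil(2)])
      (cases "even j"; cases "even \<epsilon>'"; cases "even \<epsilon>"; cases "even n"; simp add: ksgn_def)
  from fun_cong[OF this, of ys] show ?case by (simp add: eps ksgn_apply)
next
  case (Cons z zs)
  note c = contr_schouten[OF Cons.prems(1,2), THEN fun_cong, of z]
  show ?case
    using c[of "zs @ x # y # ys"] c[of "zs @ y # x # ys"]
      Cons.IH[OF pder_contr[OF Cons.prems(1)] Cons.prems(2), of z]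
      Cons.IH[OF Cons.prems(1) pder_contr[OF Cons.prems(2)], of z]
    by (simp add: ksgn_apply ksgn_add add.commute)
qed

text \<open>The Leibniz rule holds for the bracket and in general not for the insertions. Scaling
  produces mixed products, the contraction of \<Phi> by f times that of \<Psi> by g and the same
  with f and g exchanged; each occurs twice, in e1 and e4 and in e2 and e3, with opposite signs once
  \<open>pmul_comm\<close> has put the factors in the same order.\<close>

lemma pder_schouten:
  assumes "pder i \<Phi>" "pder j \<Psi>"
  shows "pder (i + j - n - 1) (schouten n i \<Phi> j \<Psi>)"
proof (rule pderI)
  note c = contr_schouten[OF assms, THEN fun_cong]
  fix d f g fs assume "f \<in> gr A d" "g \<in> gr A d"
  then show "schouten n i \<Phi> j \<Psi> ((d, f + g) # fs) = schouten n i \<Phi> j \<Psi> ((d, f) # fs) + schouten n i \<Phi> j \<Psi> ((d, g) # fs)"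
    using pder_contr[OF assms(1), of "(d, f)"] pder_contr[OF assms(1), of "(d, g)"]
      pder_contr[OF assms(2), of "(d, f)"] pder_contr[OF assms(2), of "(d, g)"]
    by (simp add: c contr_add_arg[OF assms(1)] contr_add_arg[OF assms(2)]
        schouten_add_left[OF _ _ assms(2)] schouten_add_right[OF assms(1)] ksgn_add)
next
  note c = contr_schouten[OF assms, THEN fun_cong]
  fix p q f g fs assume fg: "f \<in> gr A p" "g \<in> gr A q"
  have eq: "m - (p + q) - n - 1 = (m - q - n - 1) - p" "m - (p + q) - n - 1 = (m - p - n - 1) - q" for m
    by simp_all
  have d: "pder (i - p - n - 1) (contr (p, f) \<Phi>)" "pder (j - p - n - 1) (contr (p, f) \<Psi>)"
     "pder (i - q - n - 1) (contr (q, g) \<Phi>)" "pder (j - q - n - 1) (contr (q, g) \<Psi>)"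
    using pder_contr[OF assms(1), of "(p, f)"] pder_contr[OF assms(2), of "(p, f)"]
      pder_contr[OF assms(1), of "(q, g)"] pder_contr[OF assms(2), of "(q, g)"] by simp_all
  have s: "pder (i - (p + q) - n - 1) (\<lambda>fs. f * contr (q, g) \<Phi> fs)"
    "pder (j - (p + q) - n - 1) (\<lambda>fs. f * contr (q, g) \<Psi> fs)"
    unfolding eq(1) using pder_scale[OF fg(1) d(3)] pder_scale[OF fg(1) d(4)] .
  have t: "pder (i - (p + q) - n - 1) (\<lambda>fs. g * contr (p, f) \<Phi> fs)"
    "pder (j - (p + q) - n - 1) (\<lambda>fs. g * contr (p, f) \<Psi> fs)"
    unfolding eq(2) using pder_scale[OF fg(2) d(1)] pder_scale[OF fg(2) d(2)] .
  have e1: "schouten n i \<Phi> (j - (p + q) - n - 1) (\<lambda>fs. f * contr (q, g) \<Psi> fs) =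
      pmul n (contr (p, f) \<Phi>) (j - q - n - 1) (contr (q, g) \<Psi>) +
      ksgn ((i - n - 1) * p) (\<lambda>fs. f * schouten n i \<Phi> (j - q - n - 1) (contr (q, g) \<Psi>) fs)"
    unfolding eq(1) by (rule schouten_scale_right[OF assms(1) d(4) fg(1)])
  have e2: "schouten n i \<Phi> (j - (p + q) - n - 1) (\<lambda>fs. g * contr (p, f) \<Psi> fs) =
      pmul n (contr (q, g) \<Phi>) (j - p - n - 1) (contr (p, f) \<Psi>) +
      ksgn ((i - n - 1) * q) (\<lambda>fs. g * schouten n i \<Phi> (j - p - n - 1) (contr (p, f) \<Psi>) fs)"
    unfolding eq(2) by (rule schouten_scale_right[OF assms(1) d(2) fg(2)])
  have e3: "schouten n (i - (p + q) - n - 1) (\<lambda>fs. f * contr (q, g) \<Phi> fs) j \<Psi> =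
     (\<lambda>fs. f * schouten n (i - q - n - 1) (contr (q, g) \<Phi>) j \<Psi> fs) -
      ksgn ((i - (p + q) - n - 1 - n - 1) * (j - n - 1))
        (ksgn ((i - q - n - 1) * (j - p - n - 1))
          (pmul n (contr (q, g) \<Phi>) (j - p - n - 1) (contr (p, f) \<Psi>)))"
    unfolding eq(1) using schouten_scale_left[OF d(3) assms(2) fg(1)] pmul_comm[OF d(2) d(3)]
    by (simp add: mult.commute)
  have e4: "schouten n (i - (p + q) - n - 1) (\<lambda>fs. g * contr (p, f) \<Phi> fs) j \<Psi> =
     (\<lambda>fs. g * schouten n (i - p - n - 1) (contr (p, f) \<Phi>) j \<Psi> fs) -
      ksgn ((i - (p + q) - n - 1 - n - 1) * (j - n - 1))
        (ksgn ((i - p - n - 1) * (j - q - n - 1))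
          (pmul n (contr (p, f) \<Phi>) (j - q - n - 1) (contr (q, g) \<Psi>)))"
    unfolding eq(2) using schouten_scale_left[OF d(1) assms(2) fg(2)] pmul_comm[OF d(4) d(1)]
    by (simp add: mult.commute)
  show "schouten n i \<Phi> j \<Psi> ((p + q, f * g) # fs) =
    ksgn ((i + j - n - 1 - n - 1) * p) (f * schouten n i \<Phi> j \<Psi> ((q, g) # fs)) +
    ksgn (p * q + (i + j - n - 1 - n - 1) * q) (g * schouten n i \<Phi> j \<Psi> ((p, f) # fs))"
    unfolding c contr_mult_arg[OF assms(1) fg] contr_mult_arg[OF assms(2) fg] fst_conv
      schouten_add_right[OF assms(1) pder_ksgn[OF s(2)] pder_ksgn[OF t(2)]]
      schouten_add_left[OF pder_ksgn[OF s(1)] pder_ksgn[OF t(1)] assms(2)]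
      schouten_ksgn_right[OF assms(1) s(2)] schouten_ksgn_right[OF assms(1) t(2)]
      schouten_ksgn_left[OF s(1) assms(2)] schouten_ksgn_left[OF t(1) assms(2)]
      e1 e2 e3 e4
    by (cases "even i"; cases "even j"; cases "even p"; cases "even q"; cases "even n";
        simp add: ksgn_def distrib_left right_diff_distrib)
qed (use assms in \<open>auto simp: schouten_supp intro: schouten_gr schouten_swap\<close>)

end

section \<open>Products of the brackets [\<pi>, f_l] and derivations acting on them\<close>

fun PP :: "int \<Rightarrow> (int \<times> ((int \<times> 'a) list \<Rightarrow> 'a::{ring, monoid_mult})) list \<Rightarrow> (int \<times> 'a) list \<Rightarrow> 'a"
  where
    "PP n [] = cst 1"
  | "PP n ((i, \<Phi>) # xs) = pmul n \<Phi> (sum_list (map fst xs)) (PP n xs)"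

text \<open>At once the total cochain degree of df_1 ... df_r and the degree of [\<pi>, f_1] ...
  [\<pi>, f_r], because \<pi> has degree n + 2.\<close>

definition cdeg :: "(int \<times> 'a) list \<Rightarrow> int"
  where "cdeg fs = (\<Sum>(d, f)\<leftarrow>fs. 1 - d)"

lemma cdeg_simps [simp]:
  "cdeg [] = 0"
  "cdeg (x # fs) = 1 - fst x + cdeg fs"
  "cdeg (fs @ gs) = cdeg fs + cdeg gs"
  by (auto simp: cdeg_def split: prod.splits)

text \<open>The polyderivation underlying \<mu>(df_1 ... df_r), made recursive in the arguments;
  \<open>PP_Pr\<close> relates it to the list of factors.\<close>

fun Pr :: "int \<Rightarrow> ((int \<times> 'a) list \<Rightarrow> 'a::{ring, monoid_mult}) \<Rightarrow> (int \<times> 'a) list \<Rightarrow> (int \<times> 'a) list \<Rightarrow> 'a"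
  where
    "Pr n \<pi> [] = cst 1"
  | "Pr n \<pi> (x # fs) = pmul n (contr x \<pi>) (cdeg fs) (Pr n \<pi> fs)"

text \<open>\<open>\<Sum>\<^sub>l \<plusminus> [\<pi>, f\<^sub>1] \<cdots> c f\<^sub>l \<cdots> [\<pi>, f\<^sub>r]\<close>, the extension of \<open>c\<close> to a derivation of degree 1.\<close>

fun Rep :: "int \<Rightarrow> ((int \<times> 'a) list \<Rightarrow> 'a::{ring, monoid_mult}) \<Rightarrow>
    (int \<times> 'a \<Rightarrow> (int \<times> 'a) list \<Rightarrow> 'a) \<Rightarrow> (int \<times> 'a) list \<Rightarrow> (int \<times> 'a) list \<Rightarrow> 'a"
  where
    "Rep n \<pi> c [] = 0"
  | "Rep n \<pi> c (x # fs) = pmul n (c x) (cdeg fs) (Pr n \<pi> fs) +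
      ksgn (1 - fst x) (pmul n (contr x \<pi>) (cdeg fs + 1) (Rep n \<pi> c fs))"

lemma sum_list_cdeg: "sum_list (map fst (map (\<lambda>x. (1 - fst x, \<phi> x)) fs)) = cdeg fs"
  by (induction fs) auto

lemma PP_Pr: "PP n (map (\<lambda>x. (1 - fst x, contr x \<pi>)) fs) = Pr n \<pi> fs"
  by (induction fs) (simp_all add: sum_list_cdeg del: map_map)

lemma sum_list_cdeg_update:
  "l < length fs \<Longrightarrow>
    sum_list (map fst ((map (\<lambda>x. (1 - fst x, \<phi> x)) fs)[l := (2 - fst (fs ! l), \<psi>)])) = cdeg fs + 1"
  by (induction fs arbitrary: l) (auto simp: sum_list_cdeg simp del: map_map split: nat.splits)

lemma pmul_sum_right: "pmul n \<Phi> j (\<Sum>l\<in>L. \<Psi> l) = (\<Sum>l\<in>L. pmul n \<Phi> j (\<Psi> l))"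
  by (induction L rule: infinite_finite_induct)
    (simp_all only: sum.infinite sum.empty sum.insert pmul_0_right pmul_add_right not_False_eq_True)

text \<open>Connects the recursion with the definition of \<nu>, where the l-th factor of a list is
  overwritten. The degree \<open>2 - fst (fs ! l)\<close> is that of the old factor plus 1, the
  degree of the derivation.\<close>

lemma Rep_eq_sum:
  "Rep n \<pi> c fs = (\<Sum>l<length fs. ksgn (cdeg (take l fs))
    (PP n ((map (\<lambda>x. (1 - fst x, contr x \<pi>)) fs)[l := (2 - fst (fs ! l), c (fs ! l))])))"
proof (induction fs)
  case Nil
  then show ?case by simp
next
  case (Cons x fs)
  have "ksgn (1 - fst x) (pmul n (contr x \<pi>) (cdeg fs + 1) (Rep n \<pi> c fs)) =
    (\<Sum>l<length fs. ksgn (cdeg (take (Suc l) (x # fs)))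
    (PP n ((map (\<lambda>x. (1 - fst x, contr x \<pi>)) (x # fs))[Suc l := (2 - fst ((x # fs) ! Suc l), c ((x # fs) ! Suc l))])))"
    unfolding Cons.IH pmul_sum_right ksgn_sum
    by (intro sum.cong refl) (simp add: sum_list_cdeg_update pmul_ksgn_right del: map_map)
  then show ?case
    by (simp add: sum.lessThan_Suc_shift PP_Pr sum_list_cdeg del: sum.lessThan_Suc map_map)
qed

lemma Rep_add: "Rep n \<pi> (\<lambda>x. c x + c' x) fs = Rep n \<pi> c fs + Rep n \<pi> c' fs"
  by (induction fs)
    (simp_all only: Rep.simps add_0_left pmul_add_left pmul_add_right ksgn_add ac_simps)

lemma Rep_cong: "(\<And>x. x \<in> set fs \<Longrightarrow> c x = c' x) \<Longrightarrow> Rep n \<pi> c fs = Rep n \<pi> c' fs"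
  by (induction fs) auto

context graded_algebra
begin

lemma Rlin_0 [simp]: "Rlin 0"
  by (simp add: Rlin_def)

lemma Rlin_cst [simp]: "Rlin (cst a)"
  by (simp add: Rlin_def)

lemma Rlin_add: "Rlin \<Phi> \<Longrightarrow> Rlin \<Psi> \<Longrightarrow> Rlin (\<Phi> + \<Psi>)"
  by (simp add: Rlin_def)

lemma Rlin_ksgn: "Rlin \<Phi> \<Longrightarrow> Rlin (ksgn e \<Phi>)"
  by (simp add: Rlin_def ksgn_apply)

lemma Rlin_scale: "Rlin \<Phi> \<Longrightarrow> Rlin (\<lambda>fs. c * \<Phi> fs)"
  by (simp add: Rlin_def)

lemma Rlin_contr0: "Rlin \<Phi> \<Longrightarrow> str A r \<in> gr A d \<Longrightarrow> contr (d, str A r) \<Phi> = 0"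
  by (auto simp: Rlin_def fun_eq_iff)

lemma Rlin_pmul: "Rlin \<Phi> \<Longrightarrow> Rlin \<Psi> \<Longrightarrow> Rlin (pmul n \<Phi> j \<Psi>)"
  unfolding Rlin_def[of "pmul n \<Phi> j \<Psi>"] 
  by (auto simp: pmul_Cons Rlin_contr0 pmul_0_left[unfolded zero_fun_def] pmul_0_right[unfolded zero_fun_def])

lemma Rlin_contr:
  assumes "pder i \<Phi>" "Rlin \<Phi>"
  shows "Rlin (contr x \<Phi>)"
  using assms(2) unfolding Rlin_def by (auto simp: pder_swap0[OF assms(1), of x])

lemma Rlin_schouten:
  assumes "pder i \<Phi>" "Rlin \<Phi>" "pder j \<Psi>" "Rlin \<Psi>"
  shows "Rlin (schouten n i \<Phi> j \<Psi>)"
  unfolding Rlin_def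
  by (auto simp: contr_schouten[OF assms(1,3), THEN fun_cong] Rlin_contr0[OF assms(2)] Rlin_contr0[OF assms(4)]
      schouten_0(1)[OF assms(1)] schouten_0(2)[OF assms(3)])

text \<open>\<open>delta_fun\<close> has a value whatever degree its argument is labelled with;
  cutting it off gives a polyderivation in the sense of \<open>pder\<close> that agrees with it on
  homogeneous arguments.\<close>

definition dfun :: "(int \<times> 'a) list \<Rightarrow> 'a"
  where "dfun fs = (if fs \<in> homog_args A then delta_fun A fs else 0)"

lemma dfun_simps [simp]: "dfun [] = 0" "dfun (x # y # fs) = 0" "f \<in> gr A d \<Longrightarrow> dfun [(d, f)] = del A f"
  by (auto simp: dfun_def delta_fun_def split: list.splits)

lemma pder_dfun: "pder (n + 2) dfun"
proof (rule pderI)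
  fix d f g fs assume "f \<in> gr A d" "g \<in> gr A d"
  then show "dfun ((d, f + g) # fs) = dfun ((d, f) # fs) + dfun ((d, g) # fs)"
    by (cases fs) (auto simp: del_add gr_add)
next
  fix p q f g fs assume fg: "f \<in> gr A p" "g \<in> gr A q"
  have "del A f * g = ksgn ((p - 1) * q) (g * del A f)" using gr_comm[OF del_gr[OF fg(1)] fg(2)] .
  then show "dfun ((p + q, f * g) # fs) = ksgn ((n + 2 - n - 1) * p) (f * dfun ((q, g) # fs)) +
       ksgn (p * q + (n + 2 - n - 1) * q) (g * dfun ((p, f) # fs))"
    using fg by (cases fs) (auto simp: del_mult gr_mult intro!: arg_cong2[where f = "(+)"] ksgn_cong)
next
  fix fs assume "fs \<in> homog_args A"
  then show "dfun fs \<in> gr A (total_degree n fs - (n + 2))"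
    by (cases fs rule: remdups_adj.cases) (auto dest: del_gr)
next
  fix xs x y ys show "dfun (xs @ x # y # ys) = ksgn ((fst x + n + 1) * (fst y + n + 1)) (dfun (xs @ y # x # ys))"
  proof -
    have *: "delta_fun A (xs @ x # y # ys) = 0" for x y
      by (cases xs) (auto simp: delta_fun_def split: list.splits)
    show ?thesis by (simp add: dfun_def *)
  qed
qed (simp add: dfun_def)

lemma contr_dfun: "f \<in> gr A d \<Longrightarrow> contr (d, f) dfun = cst (del A f)"
  by (rule ext, rename_tac fs, case_tac fs) auto

lemma schouten_cst_left:
  assumes "pder j \<Psi>" "f \<in> gr A d"
  shows "schouten n (- d) (cst f) j \<Psi> = - ksgn ((d + n + 1) * (j - n - 1)) (contr (d, f) \<Psi>)"
  unfolding schouten_antisym[of n "- d"] schouten_cst[OF assms]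
  by (rule arg_cong[where f = uminus], rule ksgn_cong) auto

text \<open>The contraction of \<delta> by f is the constant \<delta> f, whose bracket with \<Psi>
  is again a contraction; the two signs combine to that of \<open>j - n - 1\<close>.\<close>

lemma contr_schouten_dfun:
  assumes "pder j \<Psi>" "f \<in> gr A d"
  shows "contr (d, f) (schouten n (n + 2) dfun j \<Psi>) =
    schouten n (n + 2) dfun (j - d - n - 1) (contr (d, f) \<Psi>) -
    ksgn (j - n - 1) (contr (d - 1, del A f) \<Psi>)"
proof -
  have eq: "n + 2 - d - n - 1 = - (d - 1)" by simp
  have "ksgn ((d + n + 1) * (j - n - 1)) (- ksgn ((d - 1 + n + 1) * (j - n - 1)) X) = - ksgn (j - n - 1) X"
    for X :: "(int \<times> 'a) list \<Rightarrow> 'a"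
    by (auto simp: ksgn_def)
  then show ?thesis
    unfolding contr_schouten[OF pder_dfun assms(1), of "(d, f)"] fst_conv eq contr_dfun[OF assms(2)]
      schouten_cst_left[OF assms(1) del_gr[OF assms(2)]] by simp
qed

text \<open>For r in R the element \<delta> r need not vanish, but it lies in the image of R again
  by \<open>del_str\<close>, so \<Psi> kills it. Thus both terms of
  \<open>contr_schouten_dfun\<close> are zero.\<close>

lemma Rlin_schouten_dfun:
  assumes "pder j \<Psi>" "Rlin \<Psi>"
  shows "Rlin (schouten n (n + 2) dfun j \<Psi>)"
  unfolding Rlin_def
proof (intro allI impI)
  fix d r fs assume r: "str A r \<in> gr A d"
  obtain r' where r': "del A (str A r) = str A r'" using del_str by blast
  then have "str A r' \<in> gr A (d - 1)" using del_gr[OF r] by simp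
  then show "schouten n (n + 2) dfun j \<Psi> ((d, str A r) # fs) = 0"
    using contr_schouten_dfun[OF assms(1) r, THEN fun_cong, of fs]
    by (simp add: r' Rlin_contr0[OF assms(2)] r schouten_0(1)[OF pder_dfun] ksgn_def)
qed

lemma pder_contr':
  assumes "pder (n + 2) \<pi>"
  shows "pder (1 - fst x) (contr x \<pi>)"
  using pder_contr[OF assms, of x] by simp

lemma pder_Pr:
  assumes "pder (n + 2) \<pi>"
  shows "pder (cdeg fs) (Pr n \<pi> fs)"
  using pder_cst[of 1 0] by (induction fs) (auto intro!: pder_pmul pder_contr'[OF assms])

lemma Rlin_Pr:
  assumes "pder (n + 2) \<pi>" "Rlin \<pi>"
  shows "Rlin (Pr n \<pi> fs)"
  by (induction fs) (auto intro!: Rlin_pmul Rlin_contr[OF assms])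

lemma pder_Rep:
  assumes "pder (n + 2) \<pi>" "\<And>x. x \<in> set fs \<Longrightarrow> pder (2 - fst x) (c x)"
  shows "pder (cdeg fs + 1) (Rep n \<pi> c fs)"
  using assms(2)
proof (induction fs)
  case (Cons x fs)
  have "pder (2 - fst x + cdeg fs) (pmul n (c x) (cdeg fs) (Pr n \<pi> fs))"
    using Cons.prems by (intro pder_pmul pder_Pr assms(1)) simp
  moreover have "pder (1 - fst x + (cdeg fs + 1)) (pmul n (contr x \<pi>) (cdeg fs + 1) (Rep n \<pi> c fs))"
    using Cons by (intro pder_pmul pder_contr'[OF assms(1)]) (metis list.set_intros(2))
  then have "pder (2 - fst x + cdeg fs) (pmul n (contr x \<pi>) (cdeg fs + 1) (Rep n \<pi> c fs))"
    by (rule pder_cong_degree) simp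
  ultimately have "pder (2 - fst x + cdeg fs) (Rep n \<pi> c (x # fs))"
    unfolding Rep.simps by (intro pder_add pder_ksgn)
  then show ?case by (rule pder_cong_degree) simp
qed simp

lemma Rlin_Rep:
  assumes "pder (n + 2) \<pi>" "Rlin \<pi>" "\<And>x. x \<in> set fs \<Longrightarrow> Rlin (c x)"
  shows "Rlin (Rep n \<pi> c fs)"
  using assms(3)
  by (induction fs) (auto intro!: Rlin_pmul Rlin_add Rlin_ksgn Rlin_contr[OF assms(1,2)] Rlin_Pr[OF assms(1,2)])

lemma Pr_swap:
  assumes "pder (n + 2) \<pi>"
  shows "Pr n \<pi> (xs @ x # y # ys) = ksgn ((1 - fst x) * (1 - fst y)) (Pr n \<pi> (xs @ y # x # ys))"
proof (induction xs)
  case Nil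
  show ?case
    using pmul_left_comm[OF pder_contr'[OF assms, of x] pder_contr'[OF assms, of y] pder_Pr[OF assms, of ys]]
    by simp
next
  case (Cons z xs)
  then show ?case by (simp add: pmul_ksgn_right algebra_simps)
qed

text \<open>The terms are matched by the factor that is modified: that of x, that of y, or one in
  \<open>ys\<close>. For each, two neighbouring factors are exchanged, with degree
  \<open>u + 1\<close> or \<open>v + 1\<close> for a modified one; the change of sign this causes is
  that of the derivation passing one factor more or less.\<close>

lemma Rep_swap:
  assumes "pder (n + 2) \<pi>" "\<And>x. pder (2 - fst x) (c x)"
  shows "Rep n \<pi> c (xs @ x # y # ys) = ksgn ((1 - fst x) * (1 - fst y)) (Rep n \<pi> c (xs @ y # x # ys))"
proof (induction xs)
  case Nil
  define u v k where "u = 1 - fst x" and "v = 1 - fst y" and "k = cdeg ys"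
  have e: "1 - fst x = u" "1 - fst y = v" "cdeg ys = k" by (simp_all add: u_def v_def k_def)
  note d = pder_contr'[OF assms(1), of x, unfolded e] pder_contr'[OF assms(1), of y, unfolded e]
    pder_Pr[OF assms(1), of ys, unfolded e] pder_Rep[OF assms(1) assms(2), of ys, unfolded e]
  have cx: "pder (u + 1) (c x)" "pder (v + 1) (c y)" using assms(2)[of x] assms(2)[of y] by (simp_all add: u_def v_def)
  note l = pmul_left_comm[OF cx(1) d(2,3)] pmul_left_comm[OF d(1) cx(2) d(3)] pmul_left_comm[OF d(1,2,4)]
  show ?case
  proof
    fix gs
    show "Rep n \<pi> c ([] @ x # y # ys) gs = ksgn ((1 - fst x) * (1 - fst y)) (Rep n \<pi> c ([] @ y # x # ys)) gs"
      using l[THEN fun_cong, of gs] add.commute[of 1 k] add.commute[of 1 u] add.commute[of 1 v]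
      by (simp add: e pmul_add_right pmul_ksgn_right ksgn_add ksgn_apply add.assoc add.left_commute[of 1])
        (cases "even u"; cases "even v"; simp add: ksgn_def)
  qed
next
  case (Cons z xs)
  have "cdeg (xs @ y # x # ys) = cdeg (xs @ x # y # ys)" by simp
  then show ?case
    unfolding append_Cons Rep.simps Cons Pr_swap[OF assms(1), of xs x y ys] pmul_ksgn_right ksgn_add ksgn_ksgn
    by (simp only: add.commute)
qed

lemma Pr_add_arg:
  assumes "pder (n + 2) \<pi>" "f \<in> gr A d" "g \<in> gr A d"
  shows "Pr n \<pi> ((d, f + g) # fs) = Pr n \<pi> ((d, f) # fs) + Pr n \<pi> ((d, g) # fs)"
  by (simp add: contr_add_arg[OF assms] pmul_add_left)

lemma Pr_mult_arg:
  assumes "pder (n + 2) \<pi>" "f \<in> gr A p" "g \<in> gr A q"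
  shows "Pr n \<pi> ((p + q, f * g) # fs) = ksgn p (\<lambda>gs. f * Pr n \<pi> ((q, g) # fs) gs) +
    ksgn (p * q + q) (\<lambda>gs. g * Pr n \<pi> ((p, f) # fs) gs)"
  by (simp add: contr_mult_arg[OF assms] pmul_add_left pmul_ksgn_left pmul_scale_left)

lemma Rep_add_arg:
  assumes "pder (n + 2) \<pi>" "f \<in> gr A d" "g \<in> gr A d" "c (d, f + g) = c (d, f) + c (d, g)"
  shows "Rep n \<pi> c ((d, f + g) # fs) = Rep n \<pi> c ((d, f) # fs) + Rep n \<pi> c ((d, g) # fs)"
  by (simp add: assms(4) contr_add_arg[OF assms(1-3)] pmul_add_left ksgn_add)

lemma scale_ksgn: "(\<lambda>gs. f * ksgn e \<Phi> gs) = ksgn e (\<lambda>gs. (f::'b::ring) * \<Phi> gs)"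
  by (rule ext) (simp only: ksgn_apply ksgn_mult)

lemma Rep_mult_arg:
  assumes "pder (n + 2) \<pi>" "f \<in> gr A p" "g \<in> gr A q"
    and "c (p + q, f * g) = (\<lambda>gs. f * c (q, g) gs) + ksgn (p * q) (\<lambda>gs. g * c (p, f) gs)"
  shows "Rep n \<pi> c ((p + q, f * g) # fs) = (\<lambda>gs. f * Rep n \<pi> c ((q, g) # fs) gs) +
    ksgn (p * q) (\<lambda>gs. g * Rep n \<pi> c ((p, f) # fs) gs)"
proof -
  have *: "(\<lambda>gs. f * (\<Phi> + \<Psi>) gs) = (\<lambda>gs. f * \<Phi> gs) + (\<lambda>gs. f * \<Psi> gs)" for f :: 'a and \<Phi> \<Psi> :: "(int \<times> 'a) list \<Rightarrow> 'a"
    by (auto simp: distrib_left)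
  show ?thesis
    unfolding Rep.simps assms(4) contr_mult_arg[OF assms(1-3)] pmul_add_left pmul_ksgn_left pmul_scale_left
      fst_conv * scale_ksgn ksgn_add ksgn_ksgn
    by (cases "even p"; cases "even q"; simp add: ksgn_def algebra_simps)
qed

lemma schouten_Pr:
  assumes "pder (n + 2) \<Theta>" "pder (n + 2) \<pi>"
  shows "schouten n (n + 2) \<Theta> (cdeg fs) (Pr n \<pi> fs) =
    Rep n \<pi> (\<lambda>x. schouten n (n + 2) \<Theta> (1 - fst x) (contr x \<pi>)) fs"
proof (induction fs)
  case Nil
  \<comment> \<open>A derivation kills 1, because 1 = 1 * 1.\<close>
  have "\<Theta> ((0, 1) # gs) = 0" for gs
    using pder_mult_arg[OF assms(1), of 1 0 1 0 gs] by simp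
  then show ?case using schouten_cst[OF assms(1), of 1 0] by (simp add: zero_fun_def)
next
  case (Cons x fs)
  then show ?case
    using schouten_pmul[OF assms(1) pder_contr'[OF assms(2), of x] pder_Pr[OF assms(2), of fs]]
    by (simp add: add.commute)
qed

text \<open>\<pi> is odd in the shifted grading, so after \<open>schouten_antisym\<close> the two
  terms of \<open>contr_schouten\<close> have the same sign. The double is left as a sum; it is
  cancelled later by \<open>double_eqD\<close>.\<close>

lemma contr_schouten_self:
  assumes "pder (n + 2) \<pi>"
  shows "contr x (schouten n (n + 2) \<pi> (n + 2) \<pi>) =
    schouten n (n + 2) \<pi> (1 - fst x) (contr x \<pi>) + schouten n (n + 2) \<pi> (1 - fst x) (contr x \<pi>)"
  using contr_schouten[OF assms assms, of x] schouten_antisym[of n "1 - fst x" "contr x \<pi>" "n + 2" \<pi>]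
  by (simp add: diff_add_eq) (auto simp: ksgn_def)

end

section \<open>Additive and multi-additive extension from free abelian groups\<close>

definition zmul :: "int \<Rightarrow> 'b \<Rightarrow> 'b::ab_group_add"
  where "zmul k b = ((+) b ^^ nat k) 0 - ((+) b ^^ nat (- k)) 0"

lemma funpow_add_zero: "((+) b ^^ (p + q)) 0 = ((+) b ^^ p) 0 + ((+) b ^^ q) (0::'b::ab_group_add)"
  by (induction p) (auto simp: add.assoc)

lemma zmul_eq: "k = int p - int q \<Longrightarrow> zmul k b = ((+) b ^^ p) 0 - ((+) b ^^ q) 0"
proof -
  assume "k = int p - int q"
  then have "nat k + q = nat (- k) + p" by simp
  then have "((+) b ^^ nat k) 0 + ((+) b ^^ q) 0 = ((+) b ^^ nat (- k)) 0 + ((+) b ^^ p) 0"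
    by (simp only: funpow_add_zero[symmetric])
  then show ?thesis
    by (simp add: zmul_def algebra_simps)
qed

lemma zmul_diff: "zmul (k - l) b = zmul k b - zmul l b"
proof -
  have "k - l = int (nat k + nat (- l)) - int (nat (- k) + nat l)" by simp
  from zmul_eq[OF this, of b] show ?thesis unfolding zmul_def funpow_add_zero by (simp add: algebra_simps)
qed

lemma zmul_0 [simp]: "zmul 0 b = 0"
  by (simp add: zmul_def)

lemma zmul_1 [simp]: "zmul 1 b = b"
  by (simp add: zmul_def)

lemma zmul_diff_right: "zmul k (b - c) = zmul k b - zmul k c"
proof -
  have "((+) (b - c) ^^ m) 0 = ((+) b ^^ m) 0 - ((+) c ^^ m) 0" for m
    by (induction m) auto
  then show ?thesis by (simp add: zmul_def)
qed

text \<open>The homomorphism out of the free abelian group on the generators that is determined by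
  f, with \<open>zmul\<close> as the integer action on an arbitrary abelian group.\<close>

definition fext :: "('k \<Rightarrow> 'b::ab_group_add) \<Rightarrow> ('k \<Rightarrow>\<^sub>0 int) \<Rightarrow> 'b"
  where "fext f x = (\<Sum>k \<in> Poly_Mapping.keys x. zmul (poly_mapping.lookup x k) (f k))"

lemma fext_superset:
  "finite K \<Longrightarrow> Poly_Mapping.keys x \<subseteq> K \<Longrightarrow> fext f x = (\<Sum>k \<in> K. zmul (poly_mapping.lookup x k) (f k))"
  unfolding fext_def by (rule sum.mono_neutral_left) (auto simp: in_keys_iff)

lemma fext_diff: "fext f (x - y) = fext f x - fext f y"
proof -
  let ?K = "Poly_Mapping.keys x \<union> Poly_Mapping.keys y"
  have "Poly_Mapping.keys (x - y) \<subseteq> ?K" by (rule keys_diff)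
  then show ?thesis
    by (simp add: fext_superset[of ?K] lookup_minus zmul_diff sum_subtractf)
qed

lemma fext_of [simp]: "fext f (frag_of k) = f k"
  by (simp add: fext_def)

lemma fext_0 [simp]: "fext f 0 = 0"
  by (simp add: fext_def)

lemma fext_minus: "fext f (- x) = - fext f x"
  using fext_diff[of f 0 x] by simp

lemma fext_diff_fun: "fext (\<lambda>k. f k - g k) x = fext f x - fext g x"
  by (simp add: fext_def zmul_diff_right sum_subtractf)

text \<open>The map on lists of formal sums that is induced, slot after slot, by a map on lists of
  generators; it plays the part of the universal property of tensor products over the
  integers.\<close>

fun mext :: "('k list \<Rightarrow> 'b::ab_group_add) \<Rightarrow> ('k \<Rightarrow>\<^sub>0 int) list \<Rightarrow> 'b"
  where
    "mext u [] = u []"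
  | "mext u (y # ys) = fext (\<lambda>g. mext (\<lambda>gs. u (g # gs)) ys) y"

lemma mext_of: "mext u (map frag_of gs) = u gs"
  by (induction gs arbitrary: u) auto

text \<open>Stated for differences to match \<open>group_closure\<close>, which is generated under
  subtraction; sums, negatives and 0 are covered.\<close>

definition madd :: "nat \<Rightarrow> ('g::ab_group_add list \<Rightarrow> 'b::ab_group_add) \<Rightarrow> bool"
  where "madd r D \<longleftrightarrow> (\<forall>l i y z. length l = r \<longrightarrow> i < r \<longrightarrow> D (l[i := y - z]) = D (l[i := y]) - D (l[i := z]))"

lemma mext_madd: "madd r (mext u)"
proof -
  have "i < length l \<Longrightarrow> mext u (l[i := y - z]) = mext u (l[i := y]) - mext u (l[i := z])" for l i y z
    by (induction l arbitrary: i u) (auto simp: fext_diff fext_diff_fun split: nat.splits)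
  then show ?thesis by (auto simp: madd_def)
qed

lemma madd_app: "madd r D \<Longrightarrow> length (pre @ y # post) = r \<Longrightarrow>
    D (pre @ (y - z) # post) = D (pre @ y # post) - D (pre @ z # post)"
  unfolding madd_def by (drule spec[of _ "pre @ y # post"], drule spec[of _ "length pre"]) auto

lemma madd_diff: "madd r D \<Longrightarrow> madd r D' \<Longrightarrow> madd r (\<lambda>l. D l - D' l)"
  by (auto simp: madd_def)

lemma madd_ksgn: "madd r D \<Longrightarrow> madd r (\<lambda>l. ksgn e (D l))"
  by (auto simp: madd_def ksgn_diff)

text \<open>Makes a test such as D(l) minus D(l with one slot acted on by a scalar) additive in
  every slot, so that the identity it expresses can be checked on generators.\<close>

lemma madd_update:
  assumes "madd r D" "\<And>y z. T (y - z) = T y - T z"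
  shows "madd r (\<lambda>l. D (l[k := T (l ! k)]))"
  unfolding madd_def
proof (intro allI impI)
  fix l :: "'a list" and i y z assume l: "length l = r" "i < r"
  show "D (l[i := y - z, k := T (l[i := y - z] ! k)]) =
    D (l[i := y, k := T (l[i := y] ! k)]) - D (l[i := z, k := T (l[i := z] ! k)])"
  proof (cases "i = k")
    case True
    then show ?thesis using l assms by (simp add: madd_def)
  next
    case False
    then have "l[i := w, k := T (l[i := w] ! k)] = (l[k := T (l ! k)])[i := w]" for w
      by (simp add: list_update_swap)
    then show ?thesis using l assms(1) by (simp add: madd_def)
  qed
qed

lemma permute_list_update:
  assumes "\<sigma> permutes {..<length l}" "i < length l"
  shows "permute_list \<sigma> (l[i := y]) = (permute_list \<sigma> l)[inv_into UNIV \<sigma> i := y]"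
proof (rule nth_equalityI)
  fix j assume "j < length (permute_list \<sigma> (l[i := y]))"
  then have j: "j < length l" by simp
  have "\<sigma> j = i \<longleftrightarrow> j = inv_into UNIV \<sigma> i" using permutes_inv_eq[OF assms(1), of i j] by auto
  moreover have "\<sigma> j < length l" using permutes_in_image[OF assms(1)] j by auto
  ultimately show "permute_list \<sigma> (l[i := y]) ! j = (permute_list \<sigma> l)[inv_into UNIV \<sigma> i := y] ! j"
    using assms j by (auto simp: permute_list_nth nth_list_update)
qed auto

lemma madd_permute:
  assumes "madd r D" "\<sigma> permutes {..<r}"
  shows "madd r (\<lambda>l. D (permute_list \<sigma> l))"
  unfolding madd_def
proof (intro allI impI)
  fix l :: "'a list" and i y z assume l: "length l = r" "i < r"
  have "inv_into UNIV \<sigma> i < r" using permutes_in_image[OF permutes_inv[OF assms(2)]] l by auto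
  then show "D (permute_list \<sigma> (l[i := y - z])) = D (permute_list \<sigma> (l[i := y])) - D (permute_list \<sigma> (l[i := z]))"
    using assms l by (simp add: permute_list_update madd_def)
qed

text \<open>Quotients are handled as congruences \<open>x - y \<in> H\<close>. The subgroup is a set
  and not built into a type, since the relations it stands for depend on A.\<close>

definition subgrp :: "'b::ab_group_add set \<Rightarrow> bool"
  where "subgrp H \<longleftrightarrow> 0 \<in> H \<and> (\<forall>x \<in> H. \<forall>y \<in> H. x - y \<in> H)"

lemma subgrp_closure [simp]: "subgrp (group_closure S)"
  by (auto simp: subgrp_def group_closure.diff)

lemma subgrp_0 [simp]: "subgrp {0}"
  by (simp add: subgrp_def)

lemma subgrp_zero: "subgrp H \<Longrightarrow> 0 \<in> H"
  by (simp add: subgrp_def)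

lemma subgrp_diff: "subgrp H \<Longrightarrow> x \<in> H \<Longrightarrow> y \<in> H \<Longrightarrow> x - y \<in> H"
  by (simp add: subgrp_def)

lemma subgrp_minus: "subgrp H \<Longrightarrow> x \<in> H \<Longrightarrow> - x \<in> H"
  using subgrp_diff[of H 0 x] subgrp_zero[of H] by simp

lemma subgrp_add: "subgrp H \<Longrightarrow> x \<in> H \<Longrightarrow> y \<in> H \<Longrightarrow> x + y \<in> H"
  using subgrp_diff[of H x "- y"] subgrp_minus[of H y] by simp

lemma subgrp_ksgn: "subgrp H \<Longrightarrow> x \<in> H \<Longrightarrow> ksgn e x \<in> H"
  by (simp add: ksgn_def subgrp_minus)

lemma subgrp_ksgn_iff: "subgrp H \<Longrightarrow> ksgn e x \<in> H \<longleftrightarrow> x \<in> H"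
  using subgrp_minus[of H x] subgrp_minus[of H "- x"] by (auto simp: ksgn_def)

lemma subgrp_sum: "subgrp H \<Longrightarrow> (\<And>l. l \<in> L \<Longrightarrow> f l \<in> H) \<Longrightarrow> (\<Sum>l\<in>L. f l) \<in> H"
  by (induction L rule: infinite_finite_induct) (auto simp: subgrp_zero subgrp_add)

lemma subgrp_cong_sym: "subgrp H \<Longrightarrow> x - y \<in> H \<Longrightarrow> y - x \<in> H"
  using subgrp_minus[of H "x - y"] by simp

lemma subgrp_cong_trans: "subgrp H \<Longrightarrow> x - y \<in> H \<Longrightarrow> y - z \<in> H \<Longrightarrow> x - z \<in> H"
  using subgrp_add[of H "x - y" "y - z"] by simp

lemma subgrp_cong_mem: "subgrp H \<Longrightarrow> x - y \<in> H \<Longrightarrow> x \<in> H \<longleftrightarrow> y \<in> H"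
  using subgrp_add[of H "x - y" y] subgrp_diff[of H x "x - y"] by auto

lemma group_closure_induct_subgrp:
  assumes "x \<in> group_closure S" "subgrp H" "\<And>s. s \<in> S \<Longrightarrow> \<phi> s \<in> H" "\<And>x y. \<phi> (x - y) = \<phi> x - \<phi> y"
  shows "\<phi> x \<in> H"
  using assms(1)
proof induction
  case (base s)
  have "\<phi> 0 = 0" using assms(4)[of 0 0] by simp
  then show ?case using base assms(2,3) by (auto simp: subgrp_zero)
next
  case (diff s t)
  then show ?case using assms(2,4) by (simp add: subgrp_diff)
qed

text \<open>Slot by slot: for fixed generators in front the map is additive in the remaining slots,
  and the elements sent into H by one slot form a subgroup.\<close>

lemma madd_closure:
  fixes D :: "'g::ab_group_add list \<Rightarrow> 'b::ab_group_add"
  assumes "madd r D" "subgrp H" "list_all2 (\<lambda>y X. y \<in> group_closure X) ys Xs" "length Xs = r"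
    and "\<And>zs. list_all2 (\<in>) zs Xs \<Longrightarrow> D zs \<in> H"
  shows "D ys \<in> H"
  using assms(1,3-5)
proof (induction Xs arbitrary: D ys r)
  case Nil
  then show ?case by simp
next
  case (Cons X Xs)
  obtain y ys' where ys: "ys = y # ys'" "y \<in> group_closure X" "list_all2 (\<lambda>y X. y \<in> group_closure X) ys' Xs"
    using Cons.prems(2) by (auto simp: list_all2_Cons2)
  have len: "length ys' = length Xs" using list_all2_lengthD[OF ys(3)] .
  have "D (z # ys') \<in> H" if z: "z \<in> X" for z
  proof (rule Cons.IH[of "length Xs" "\<lambda>l. D (z # l)" ys'])
    show "madd (length Xs) (contr z D)"
      unfolding madd_def
    proof (intro allI impI)
      fix l :: "'g list" and i u v assume l: "length l = length Xs" "i < length Xs"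
      have "D ((z # l)[Suc i := u - v]) = D ((z # l)[Suc i := u]) - D ((z # l)[Suc i := v])"
        using Cons.prems(1)[unfolded madd_def, rule_format, of "z # l" "Suc i" u v] Cons.prems(3) l by simp
      then show "D (z # l[i := u - v]) = D (z # l[i := u]) - D (z # l[i := v])" by simp
    qed
    show "D (z # zs) \<in> H" if "list_all2 (\<in>) zs Xs" for zs
      using that z by (intro Cons.prems(4)) auto
  qed (use ys in auto)
  then show ?case
    unfolding ys(1)
    by (rule group_closure_induct_subgrp[OF ys(2) assms(2), of "\<lambda>y. D (y # ys')"])
      (use madd_app[OF Cons.prems(1), of "[]" _ ys'] Cons.prems(3) len in auto)
qed

section \<open>Multilinear forms on generators\<close>

lemma ksgn_cong_diff: "even (a - b) \<Longrightarrow> x = y \<Longrightarrow> ksgn a x = ksgn b y"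
  by (rule ksgn_cong) auto

text \<open>The degree of df_1 \<otimes> ... \<otimes> df_r when df is placed in degree deg f - s.
  The shift is 1 for differential forms and - n - 1 for polyvectors.\<close>

definition sdeg :: "int \<Rightarrow> (int \<times> 'a) list \<Rightarrow> int"
  where "sdeg s fs = (\<Sum>(d, f)\<leftarrow>fs. d - s)"

lemma sdeg_simps [simp]:
  "sdeg s [] = 0"
  "sdeg s (x # fs) = fst x - s + sdeg s fs"
  "sdeg s (fs @ gs) = sdeg s fs + sdeg s gs"
  by (auto simp: sdeg_def split: prod.splits)

text \<open>
  In the lists below, a quadruple \<open>(p, b, q, f)\<close> stands for the form \<open>b df\<close> with \<open>b\<close> of degree \<open>p\<close>
  and \<open>f\<close> of degree \<open>q\<close>; the sign is the one for moving all coefficients to the front.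
\<close>

fun coeff_deg :: "(int \<times> 'a \<times> int \<times> 'a) list \<Rightarrow> int"
  where "coeff_deg [] = 0" | "coeff_deg ((p, b, q, f) # qs) = p + coeff_deg qs"

fun coeff_prod :: "(int \<times> 'a \<times> int \<times> 'a) list \<Rightarrow> 'a::{ring, monoid_mult}"
  where "coeff_prod [] = 1" | "coeff_prod ((p, b, q, f) # qs) = b * coeff_prod qs"

fun form_deg :: "int \<Rightarrow> (int \<times> 'a \<times> int \<times> 'a) list \<Rightarrow> int"
  where "form_deg s [] = 0" | "form_deg s ((p, b, q, f) # qs) = p + q - s + form_deg s qs"

text \<open>\<open>s * p\<close> is the sign of \<open>shift\<close> for a coefficient of degree p;
  \<open>(q - s) * coeff_deg qs\<close> comes from the coefficients further right passing
  df.\<close>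

fun coeff_exp :: "int \<Rightarrow> (int \<times> 'a \<times> int \<times> 'a) list \<Rightarrow> int"
  where "coeff_exp s [] = 0"
  | "coeff_exp s ((p, b, q, f) # qs) = s * p + (q - s) * coeff_deg qs + coeff_exp s qs"

abbreviation "diff_args \<equiv> map (\<lambda>(p, b, q, f). (q, f))"
abbreviation "forget_deg \<equiv> map (\<lambda>(p, b, q, f). (b, f))"

lemma coeff_deg_append [simp]: "coeff_deg (xs @ ys) = coeff_deg xs + coeff_deg ys"
  by (induction xs) auto

lemma coeff_prod_append [simp]: "coeff_prod (xs @ ys) = coeff_prod xs * coeff_prod ys"
  by (induction xs) (auto simp: mult.assoc)

lemma form_deg_append [simp]: "form_deg s (xs @ ys) = form_deg s xs + form_deg s ys"
  by (induction xs) auto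

lemma coeff_exp_append [simp]:
  "coeff_exp s (xs @ ys) = coeff_exp s xs + (form_deg s xs - coeff_deg xs) * coeff_deg ys + coeff_exp s ys"
  by (induction xs) (auto simp: algebra_simps)

text \<open>What V has to be on a \<otimes> b_1 df_1 \<otimes> ... \<otimes> b_r df_r, although V
  itself only knows a single coefficient in front.\<close>

definition expand :: "int \<Rightarrow> (int \<Rightarrow> 'a::{ring, monoid_mult} \<Rightarrow> (int \<times> 'a) list \<Rightarrow> 'b) \<Rightarrow> int \<Rightarrow> 'a \<Rightarrow>
    (int \<times> 'a \<times> int \<times> 'a) list \<Rightarrow> 'b::ab_group_add"
  where "expand s V k a qs = ksgn (coeff_exp s qs)
    (V (k + coeff_deg qs) (a * coeff_prod qs) (diff_args qs))"

context graded_algebra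
begin

definition hom_quads :: "(int \<times> 'a \<times> int \<times> 'a) list \<Rightarrow> bool"
  where "hom_quads qs \<longleftrightarrow> (\<forall>(p, b, q, f) \<in> set qs. b \<in> gr A p \<and> f \<in> gr A q)"

lemma hom_quads_simps [simp]:
  "hom_quads []"
  "hom_quads ((p, b, q, f) # qs) \<longleftrightarrow> b \<in> gr A p \<and> f \<in> gr A q \<and> hom_quads qs"
  "hom_quads (qs @ qs') \<longleftrightarrow> hom_quads qs \<and> hom_quads qs'"
  by (auto simp: hom_quads_def ball_Un)

lemma hom_quads_args: "hom_quads qs \<Longrightarrow> diff_args qs \<in> homog_args A"
  by (induction qs) auto

lemma hom_quads_prod: "hom_quads qs \<Longrightarrow> coeff_prod qs \<in> gr A (coeff_deg qs)"
  by (induction qs) auto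

lemma gr_left_comm: "x \<in> gr A i \<Longrightarrow> y \<in> gr A j \<Longrightarrow> x * (y * z) = ksgn (i * j) (y * (x * z))"
  by (simp add: mult.assoc[symmetric] gr_comm[of x i y j] ksgn_mult)

text \<open>A form \<open>V\<close> on \<open>a df\<^sub>1 \<cdots> df\<^sub>r\<close> modulo \<open>H\<close>, where \<open>df\<close> is in degree \<open>deg f - s\<close>.\<close>

definition mform :: "int \<Rightarrow> nat \<Rightarrow> 'b::ab_group_add set \<Rightarrow> (int \<Rightarrow> 'a \<Rightarrow> (int \<times> 'a) list \<Rightarrow> 'b) \<Rightarrow> bool"
  where "mform s r H V \<longleftrightarrow> subgrp H \<and>
    (\<forall>i a b fs. a \<in> gr A i \<longrightarrow> b \<in> gr A i \<longrightarrow> fs \<in> homog_args A \<longrightarrow> length fs = r \<longrightarrow>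
      V i (a + b) fs - V i a fs - V i b fs \<in> H) \<and>
    (\<forall>i a d f g fs. a \<in> gr A i \<longrightarrow> f \<in> gr A d \<longrightarrow> g \<in> gr A d \<longrightarrow> fs \<in> homog_args A \<longrightarrow>
      Suc (length fs) = r \<longrightarrow>
      V i a ((d, f + g) # fs) - V i a ((d, f) # fs) - V i a ((d, g) # fs) \<in> H) \<and>
    (\<forall>i a p q f g fs. a \<in> gr A i \<longrightarrow> f \<in> gr A p \<longrightarrow> g \<in> gr A q \<longrightarrow> fs \<in> homog_args A \<longrightarrow>
      Suc (length fs) = r \<longrightarrow>
      V i a ((p + q, f * g) # fs) - ksgn (s * p) (V (i + p) (a * f) ((q, g) # fs)) -
        ksgn (p * q + s * q) (V (i + q) (a * g) ((p, f) # fs)) \<in> H) \<and>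
    (\<forall>i a d c fs. a \<in> gr A i \<longrightarrow> str A c \<in> gr A d \<longrightarrow> fs \<in> homog_args A \<longrightarrow>
      Suc (length fs) = r \<longrightarrow> V i a ((d, str A c) # fs) \<in> H) \<and>
    (\<forall>i a xs x y ys. a \<in> gr A i \<longrightarrow> xs @ x # y # ys \<in> homog_args A \<longrightarrow> length (xs @ x # y # ys) = r \<longrightarrow>
      V i a (xs @ x # y # ys) - ksgn ((fst x - s) * (fst y - s)) (V i a (xs @ y # x # ys)) \<in> H)"

lemmas mform_subgrp = mform_def[THEN iffD1, THEN conjunct1]
lemmas mform_add_coeff = mform_def[THEN iffD1, THEN conjunct2, THEN conjunct1, rule_format]
lemmas mform_add_arg = mform_def[THEN iffD1, THEN conjunct2, THEN conjunct2, THEN conjunct1, rule_format]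
lemmas mform_mult_arg =
  mform_def[THEN iffD1, THEN conjunct2, THEN conjunct2, THEN conjunct2, THEN conjunct1, rule_format]
lemmas mform_str_arg = mform_def[THEN iffD1, THEN conjunct2, THEN conjunct2, THEN conjunct2,
    THEN conjunct2, THEN conjunct1, rule_format]
lemmas mform_swap = mform_def[THEN iffD1, THEN conjunct2, THEN conjunct2, THEN conjunct2,
    THEN conjunct2, THEN conjunct2, rule_format]

lemma mformI:
  assumes "subgrp H"
    and "\<And>i a b fs. a \<in> gr A i \<Longrightarrow> b \<in> gr A i \<Longrightarrow> fs \<in> homog_args A \<Longrightarrow> length fs = r \<Longrightarrow>
      V i (a + b) fs - V i a fs - V i b fs \<in> H"
    and "\<And>i a d f g fs. a \<in> gr A i \<Longrightarrow> f \<in> gr A d \<Longrightarrow> g \<in> gr A d \<Longrightarrow> fs \<in> homog_args A \<Longrightarrow>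
      Suc (length fs) = r \<Longrightarrow>
      V i a ((d, f + g) # fs) - V i a ((d, f) # fs) - V i a ((d, g) # fs) \<in> H"
    and "\<And>i a p q f g fs. a \<in> gr A i \<Longrightarrow> f \<in> gr A p \<Longrightarrow> g \<in> gr A q \<Longrightarrow> fs \<in> homog_args A \<Longrightarrow>
      Suc (length fs) = r \<Longrightarrow>
      V i a ((p + q, f * g) # fs) - ksgn (s * p) (V (i + p) (a * f) ((q, g) # fs)) -
        ksgn (p * q + s * q) (V (i + q) (a * g) ((p, f) # fs)) \<in> H"
    and "\<And>i a d c fs. a \<in> gr A i \<Longrightarrow> str A c \<in> gr A d \<Longrightarrow> fs \<in> homog_args A \<Longrightarrow>
      Suc (length fs) = r \<Longrightarrow> V i a ((d, str A c) # fs) \<in> H"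
    and "\<And>i a xs x y ys. a \<in> gr A i \<Longrightarrow> xs @ x # y # ys \<in> homog_args A \<Longrightarrow>
      length (xs @ x # y # ys) = r \<Longrightarrow>
      V i a (xs @ x # y # ys) - ksgn ((fst x - s) * (fst y - s)) (V i a (xs @ y # x # ys)) \<in> H"
  shows "mform s r H V"
  unfolding mform_def using assms(1)
  by (intro conjI allI impI) (rule assms; assumption)+

text \<open>Iterated adjacent exchange. The relations of \<open>mform\<close> concern the first
  slot, so other slots are brought there first.\<close>

lemma mform_move:
  assumes V: "mform s r H V" and "a \<in> gr A i"
  shows "us @ pre @ x # ys \<in> homog_args A \<Longrightarrow> length (us @ pre @ x # ys) = r \<Longrightarrow>
    V i a (us @ pre @ x # ys) - ksgn ((fst x - s) * sdeg s pre) (V i a (us @ x # pre @ ys)) \<in> H"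
proof (induction pre arbitrary: us)
  case Nil
  then show ?case by (simp add: subgrp_zero[OF mform_subgrp[OF V]])
next
  case (Cons z pre)
  note H = mform_subgrp[OF V]
  have 1: "V i a (us @ (z # pre) @ x # ys) - ksgn ((fst x - s) * sdeg s pre) (V i a (us @ z # x # pre @ ys)) \<in> H"
    using Cons.IH[of "us @ [z]"] Cons.prems by simp
  have "V i a (us @ z # x # pre @ ys) - ksgn ((fst z - s) * (fst x - s)) (V i a (us @ x # z # pre @ ys)) \<in> H"
    using Cons.prems by (intro mform_swap[OF V assms(2)]) auto
  from subgrp_ksgn[OF H this, of "(fst x - s) * sdeg s pre"]
  have "ksgn ((fst x - s) * sdeg s pre) (V i a (us @ z # x # pre @ ys)) -
      ksgn ((fst x - s) * sdeg s (z # pre)) (V i a (us @ x # z # pre @ ys)) \<in> H"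
    by (simp add: ksgn_diff algebra_simps)
  from subgrp_cong_trans[OF H 1 this] show ?case by simp
qed

lemma mform_zero_coeff:
  assumes V: "mform s r H V" and "fs \<in> homog_args A" "length fs = r"
  shows "V i 0 fs \<in> H"
  using mform_add_coeff[OF V, of 0 i 0 fs] assms subgrp_minus[OF mform_subgrp[OF V]] by fastforce

lemma mform_ksgn_coeff:
  assumes V: "mform s r H V" and "a \<in> gr A k" "fs \<in> homog_args A" "length fs = r"
  shows "V k (ksgn e a) fs - ksgn e (V k a fs) \<in> H"
proof (cases "even e")
  case True
  then show ?thesis by (simp add: ksgn_even subgrp_zero[OF mform_subgrp[OF V]])
next
  case False
  note H = mform_subgrp[OF V]
  have "V k (a + - a) fs - V k a fs - V k (- a) fs \<in> H"
    using assms by (intro mform_add_coeff[OF V]) auto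
  then have "- V k a fs - V k (- a) fs \<in> H"
    using subgrp_diff[OF H _ mform_zero_coeff[OF V assms(3,4), of k]] by fastforce
  from subgrp_minus[OF H this] show ?thesis
    using False by (simp add: ksgn_odd algebra_simps)
qed

lemma mform_zero_arg:
  assumes V: "mform s r H V" and "a \<in> gr A i" "pre @ post \<in> homog_args A" "Suc (length (pre @ post)) = r"
  shows "V i a (pre @ (d, 0) # post) \<in> H"
proof -
  note H = mform_subgrp[OF V]
  have "V i a ((d, 0) # pre @ post) \<in> H"
    using mform_add_arg[OF V assms(2), of 0 d 0 "pre @ post"] assms subgrp_minus[OF H] by fastforce
  then show ?thesis
    using mform_move[OF V assms(2), of "[]" pre "(d, 0)" post] assms
    by (simp add: subgrp_cong_mem[OF H] subgrp_ksgn_iff[OF H])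
qed

context
  fixes s r H and V :: "int \<Rightarrow> 'a \<Rightarrow> (int \<times> 'a) list \<Rightarrow> 'b::ab_group_add"
  assumes V: "mform s r H V"
begin

lemmas H = mform_subgrp[OF V]

lemma expand_add_coeff:
  assumes "a \<in> gr A k" "b \<in> gr A k" "hom_quads qs" "length qs = r"
  shows "expand s V k (a + b) qs - expand s V k a qs - expand s V k b qs \<in> H"
proof -
  have "V (k + coeff_deg qs) (a * coeff_prod qs + b * coeff_prod qs) (diff_args qs) -
     V (k + coeff_deg qs) (a * coeff_prod qs) (diff_args qs) -
     V (k + coeff_deg qs) (b * coeff_prod qs) (diff_args qs) \<in> H"
    using assms hom_quads_prod[OF assms(3)] hom_quads_args[OF assms(3)]
    by (intro mform_add_coeff[OF V]) auto
  from subgrp_ksgn[OF H this, of "coeff_exp s qs"] show ?thesis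
    by (simp add: expand_def distrib_right ksgn_diff)
qed

text \<open>The sign is a product over three exchanges: b with b', df with df', and coefficients
  with differentials. The last one is the difference of the two values of
  \<open>coeff_exp\<close>.\<close>

lemma expand_swap:
  assumes "a \<in> gr A k" "hom_quads (pre @ (p, b, q, f) # (p', b', q', f') # post)"
    "length (pre @ (p, b, q, f) # (p', b', q', f') # post) = r"
  shows "expand s V k a (pre @ (p, b, q, f) # (p', b', q', f') # post) -
    ksgn ((p + q - s) * (p' + q' - s)) (expand s V k a (pre @ (p', b', q', f') # (p, b, q, f) # post)) \<in> H"
proof -
  let ?l = "pre @ (p, b, q, f) # (p', b', q', f') # post"
  let ?l' = "pre @ (p', b', q', f') # (p, b, q, f) # post"
  have bb: "b \<in> gr A p" "b' \<in> gr A p'" using assms(2) by auto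
  let ?c = "k + coeff_deg ?l"
  have h: "hom_quads ?l'" using assms(2) by auto
  have P: "coeff_prod ?l = ksgn (p * p') (coeff_prod ?l')"
    by (simp add: gr_left_comm[OF bb] ksgn_mult)
  have mem: "a * coeff_prod ?l' \<in> gr A ?c"
    using gr_mult[OF assms(1) hom_quads_prod[OF h]] by (simp add: algebra_simps)
  have lenr: "length (diff_args ?l) = r" using assms(3) by simp
  have 1: "V ?c (a * coeff_prod ?l) (diff_args ?l) -
      ksgn (p * p') (V ?c (a * coeff_prod ?l') (diff_args ?l)) \<in> H"
    unfolding P ksgn_mult_right by (rule mform_ksgn_coeff[OF V mem hom_quads_args[OF assms(2)] lenr])
  have "V ?c (a * coeff_prod ?l') (diff_args ?l) -
     ksgn ((q - s) * (q' - s)) (V ?c (a * coeff_prod ?l') (diff_args ?l')) \<in> H"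
    using mform_swap[OF V mem, of "diff_args pre" "(q, f)" "(q', f')" "diff_args post"]
      hom_quads_args[OF assms(2)] assms(3) by simp
  from subgrp_ksgn[OF H this, of "p * p'"]
  have "ksgn (p * p') (V ?c (a * coeff_prod ?l') (diff_args ?l)) -
     ksgn (p * p' + (q - s) * (q' - s)) (V ?c (a * coeff_prod ?l') (diff_args ?l')) \<in> H"
    by (simp add: ksgn_diff)
  from subgrp_ksgn[OF H subgrp_cong_trans[OF H 1 this], of "coeff_exp s ?l"]
  have "expand s V k a ?l - ksgn (coeff_exp s ?l + (p * p' + (q - s) * (q' - s)))
      (V ?c (a * coeff_prod ?l') (diff_args ?l')) \<in> H"
    by (simp only: ksgn_diff ksgn_ksgn expand_def)
  moreover have "ksgn (coeff_exp s ?l + (p * p' + (q - s) * (q' - s))) X =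
      ksgn ((p + q - s) * (p' + q' - s)) (ksgn (coeff_exp s ?l') X)" for X :: 'b
    unfolding ksgn_ksgn by (rule ksgn_cong_diff) (simp_all add: algebra_simps)
  moreover have "?c = k + coeff_deg ?l'" by simp
  ultimately show ?thesis by (simp only: expand_def)
qed

text \<open>An entry with b = 0 or f = 0 may be labelled with any degree. That its value lies in H
  under every labelling makes the choice of degrees in \<open>U_eq\<close> harmless.\<close>

lemma expand_zero:
  assumes "a \<in> gr A k" "hom_quads qs" "length qs = r" "\<exists>(p, b, q, f) \<in> set qs. b = 0 \<or> f = 0"
  shows "expand s V k a qs \<in> H"
proof -
  obtain p b q f where x: "(p, b, q, f) \<in> set qs" "b = 0 \<or> f = 0" using assms(4) by auto
  obtain pre post where qs: "qs = pre @ (p, b, q, f) # post" using split_list[OF x(1)] by auto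
  have "V (k + coeff_deg qs) (a * coeff_prod qs) (diff_args qs) \<in> H"
    using x(2)
  proof
    assume "b = 0"
    then have "coeff_prod qs = 0" by (simp add: qs)
    then show ?thesis using mform_zero_coeff[OF V hom_quads_args[OF assms(2)]] assms(3) by simp
  next
    assume "f = 0"
    then show ?thesis
      using mform_zero_arg[OF V gr_mult[OF assms(1) hom_quads_prod[OF assms(2)]], of "diff_args pre" "diff_args post" q]
        hom_quads_args[OF assms(2)] assms(3) by (simp add: qs)
  qed
  then show ?thesis by (simp add: expand_def subgrp_ksgn[OF H])
qed

lemma expand_zero_coeff:
  assumes "hom_quads qs" "length qs = r"
  shows "expand s V k 0 qs \<in> H"
  using mform_zero_coeff[OF V hom_quads_args[OF assms(1)]] assms(2)
  by (simp add: expand_def subgrp_ksgn[OF H])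

text \<open>On its way to the front, c passes the shift, which gives \<open>s * e\<close>, and
  everything in \<open>pre\<close>, of total degree \<open>form_deg s pre\<close>.\<close>

lemma expand_pull:
  assumes "a \<in> gr A k" "c \<in> gr A e" "hom_quads (pre @ (p, b, q, f) # post)"
    "length (pre @ (p, b, q, f) # post) = r"
  shows "expand s V k a (pre @ (e + p, c * b, q, f) # post) -
    ksgn (s * e + e * form_deg s pre) (expand s V (k + e) (a * c) (pre @ (p, b, q, f) # post)) \<in> H"
proof -
  let ?l = "pre @ (p, b, q, f) # post"
  let ?c = "k + e + coeff_deg ?l"
  have h: "hom_quads pre" using assms(3) by auto
  have mem: "a * c * coeff_prod ?l \<in> gr A ?c"
    using gr_mult[OF gr_mult[OF assms(1,2)] hom_quads_prod[OF assms(3)]] .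
  have "coeff_prod pre * (c * x) = ksgn (e * coeff_deg pre) (c * (coeff_prod pre * x))" for x
    using gr_left_comm[OF hom_quads_prod[OF h] assms(2)] by (simp add: mult.commute)
  then have eq: "a * coeff_prod (pre @ (e + p, c * b, q, f) # post) =
      ksgn (e * coeff_deg pre) (a * c * coeff_prod ?l)"
    by (simp add: mult.assoc ksgn_mult)
  have "V ?c (ksgn (e * coeff_deg pre) (a * c * coeff_prod ?l)) (diff_args ?l) -
      ksgn (e * coeff_deg pre) (V ?c (a * c * coeff_prod ?l) (diff_args ?l)) \<in> H"
    using mform_ksgn_coeff[OF V mem hom_quads_args[OF assms(3)]] assms(4) by simp
  from subgrp_ksgn[OF H this, of "coeff_exp s (pre @ (e + p, c * b, q, f) # post)"]
  have "expand s V k a (pre @ (e + p, c * b, q, f) # post) -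
      ksgn (coeff_exp s (pre @ (e + p, c * b, q, f) # post) + e * coeff_deg pre)
        (V ?c (a * c * coeff_prod ?l) (diff_args ?l)) \<in> H"
    by (simp only: expand_def eq ksgn_diff ksgn_ksgn) (simp add: algebra_simps)
  moreover have "ksgn (coeff_exp s (pre @ (e + p, c * b, q, f) # post) + e * coeff_deg pre) X =
      ksgn (s * e + e * form_deg s pre) (ksgn (coeff_exp s ?l) X)" for X :: 'b
    unfolding ksgn_ksgn by (rule ksgn_cong_diff) (simp_all add: algebra_simps)
  ultimately show ?thesis by (simp only: expand_def)
qed

end

end

text \<open>Additivity and the Leibniz rule are relations with three terms, and bringing a slot to
  the front gives all three the same sign \<open>e\<close>.\<close>

lemma subgrp_cong3:
  assumes "subgrp H" "x - ksgn e x' \<in> H" "y - ksgn e y' \<in> H" "z - ksgn e z' \<in> H" "x' - y' - z' \<in> H"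
  shows "x - y - z \<in> H"
proof -
  have "x - y - z = (x - ksgn e x') - (y - ksgn e y') - (z - ksgn e z') + ksgn e (x' - y' - z')"
    by (simp add: ksgn_diff)
  then show ?thesis using assms by (simp only: subgrp_add subgrp_diff subgrp_ksgn)
qed

lemma permute_list_adjacent:
  "permute_list (transpose (length xs) (Suc (length xs))) (xs @ x # y # ys) = xs @ y # x # ys"
proof (rule nth_equalityI)
  let ?\<tau> = "transpose (length xs) (Suc (length xs))"
  have p: "?\<tau> permutes {..<length (xs @ x # y # ys)}" by (rule permutes_swap_id) auto
  fix i assume "i < length (permute_list ?\<tau> (xs @ x # y # ys))"
  then have i: "i < length (xs @ x # y # ys)" by simp
  show "permute_list ?\<tau> (xs @ x # y # ys) ! i = (xs @ y # x # ys) ! i"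
    unfolding permute_list_nth[OF p i]
    by (auto simp: transpose_def nth_append nth_Cons' )
qed simp

context graded_algebra
begin

context
  fixes s r H and V :: "int \<Rightarrow> 'a \<Rightarrow> (int \<times> 'a) list \<Rightarrow> 'b::ab_group_add"
  assumes V: "mform s r H V"
begin

lemma expand_ksgn_coeff:
  assumes "a \<in> gr A k" "hom_quads qs" "length qs = r"
  shows "expand s V k (ksgn e a) qs - ksgn e (expand s V k a qs) \<in> H"
proof -
  have "V (k + coeff_deg qs) (ksgn e (a * coeff_prod qs)) (diff_args qs) -
      ksgn e (V (k + coeff_deg qs) (a * coeff_prod qs) (diff_args qs)) \<in> H"
    using assms by (intro mform_ksgn_coeff[OF V] hom_quads_args gr_mult hom_quads_prod) auto
  from subgrp_ksgn[OF mform_subgrp[OF V] this, of "coeff_exp s qs"] show ?thesis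
    by (simp add: expand_def ksgn_mult ksgn_diff add.commute)
qed

lemma expand_pull_ksgn:
  assumes "a \<in> gr A k" "c \<in> gr A e" "hom_quads (pre @ (p, b, q, f) # post)"
    "length (pre @ (p, b, q, f) # post) = r"
  shows "expand s V k a (pre @ (e + p, ksgn u c * b, q, f) # post) -
    ksgn (u + s * e + e * form_deg s pre) (expand s V (k + e) (a * c) (pre @ (p, b, q, f) # post)) \<in> H"
proof -
  have 1: "expand s V k a (pre @ (e + p, ksgn u c * b, q, f) # post) -
    ksgn (s * e + e * form_deg s pre) (expand s V (k + e) (a * ksgn u c) (pre @ (p, b, q, f) # post)) \<in> H"
    using assms by (intro expand_pull[OF V]) auto
  have "expand s V (k + e) (ksgn u (a * c)) (pre @ (p, b, q, f) # post) -
      ksgn u (expand s V (k + e) (a * c) (pre @ (p, b, q, f) # post)) \<in> H"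
    using assms by (intro expand_ksgn_coeff gr_mult) auto
  from subgrp_ksgn[OF mform_subgrp[OF V] this, of "s * e + e * form_deg s pre"]
  have "ksgn (s * e + e * form_deg s pre) (expand s V (k + e) (a * ksgn u c) (pre @ (p, b, q, f) # post)) -
      ksgn (u + s * e + e * form_deg s pre) (expand s V (k + e) (a * c) (pre @ (p, b, q, f) # post)) \<in> H"
    by (simp add: ksgn_diff ksgn_mult add_ac)
  from subgrp_cong_trans[OF mform_subgrp[OF V] 1 this] show ?thesis .
qed

lemma expand_move:
  assumes "a \<in> gr A k"
  shows "hom_quads (us @ pre @ (p, b, q, f) # ys) \<Longrightarrow> length (us @ pre @ (p, b, q, f) # ys) = r \<Longrightarrow>
    expand s V k a (us @ pre @ (p, b, q, f) # ys) -
    ksgn ((p + q - s) * form_deg s pre) (expand s V k a (us @ (p, b, q, f) # pre @ ys)) \<in> H"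
proof (induction pre arbitrary: us)
  case Nil
  then show ?case by (simp add: subgrp_zero[OF mform_subgrp[OF V]])
next
  case (Cons z pre)
  note H = mform_subgrp[OF V]
  obtain p' b' q' f' where z: "z = (p', b', q', f')" by (cases z)
  let ?x = "(p, b, q, f)"
  have 1: "expand s V k a (us @ (z # pre) @ ?x # ys) -
      ksgn ((p + q - s) * form_deg s pre) (expand s V k a (us @ z # ?x # pre @ ys)) \<in> H"
    using Cons.IH[of "us @ [z]"] Cons.prems by simp
  have "expand s V k a (us @ z # ?x # pre @ ys) -
      ksgn ((p' + q' - s) * (p + q - s)) (expand s V k a (us @ ?x # z # pre @ ys)) \<in> H"
    using Cons.prems assms unfolding z by (intro expand_swap[OF V]) auto
  from subgrp_ksgn[OF H this, of "(p + q - s) * form_deg s pre"]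
  have "ksgn ((p + q - s) * form_deg s pre) (expand s V k a (us @ z # ?x # pre @ ys)) -
      ksgn ((p + q - s) * form_deg s (z # pre)) (expand s V k a (us @ ?x # z # pre @ ys)) \<in> H"
    by (simp add: z ksgn_diff algebra_simps)
  from subgrp_cong_trans[OF H 1 this] show ?case by simp
qed

lemma expand_add_left:
  assumes "a \<in> gr A k" "b \<in> gr A p" "b' \<in> gr A p" "f \<in> gr A q" "hom_quads (pre @ post)"
    "Suc (length (pre @ post)) = r"
  shows "expand s V k a (pre @ (p, b + b', q, f) # post) - expand s V k a (pre @ (p, b, q, f) # post) -
    expand s V k a (pre @ (p, b', q, f) # post) \<in> H"
proof -
  let ?l = "\<lambda>b. pre @ (p, b, q, f) # post"
  have h: "hom_quads (?l b)" "hom_quads (?l b')" using assms by auto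
  have "V (k + coeff_deg (?l b)) (a * coeff_prod (?l b) + a * coeff_prod (?l b')) (diff_args (?l b)) -
    V (k + coeff_deg (?l b)) (a * coeff_prod (?l b)) (diff_args (?l b)) -
    V (k + coeff_deg (?l b)) (a * coeff_prod (?l b')) (diff_args (?l b)) \<in> H"
    using assms(6) gr_mult[OF assms(1) hom_quads_prod[OF h(1)]] gr_mult[OF assms(1) hom_quads_prod[OF h(2)]]
    by (intro mform_add_coeff[OF V] hom_quads_args[OF h(1)]) auto
  from subgrp_ksgn[OF mform_subgrp[OF V] this, of "coeff_exp s (?l b)"] show ?thesis
    by (simp add: expand_def ksgn_diff distrib_left distrib_right)
qed

lemma expand_add_right:
  assumes "a \<in> gr A k" "b \<in> gr A p" "f \<in> gr A q" "f' \<in> gr A q" "hom_quads (pre @ post)"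
    "Suc (length (pre @ post)) = r"
  shows "expand s V k a (pre @ (p, b, q, f + f') # post) - expand s V k a (pre @ (p, b, q, f) # post) -
    expand s V k a (pre @ (p, b, q, f') # post) \<in> H"
proof (rule subgrp_cong3[OF mform_subgrp[OF V]])
  let ?l = "\<lambda>f. (p, b, q, f) # pre @ post"
  have m: "expand s V k a (pre @ (p, b, q, f) # post) -
    ksgn ((p + q - s) * form_deg s pre) (expand s V k a (?l f)) \<in> H" if "f \<in> gr A q" for f
    using expand_move[OF assms(1), of "[]" pre p b q f post] assms that by simp
  show "expand s V k a (pre @ (p, b, q, f + f') # post) -
    ksgn ((p + q - s) * form_deg s pre) (expand s V k a (?l (f + f'))) \<in> H"
    using assms by (intro m) auto
  show "expand s V k a (pre @ (p, b, q, f) # post) -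
    ksgn ((p + q - s) * form_deg s pre) (expand s V k a (?l f)) \<in> H"
    using assms by (intro m) auto
  show "expand s V k a (pre @ (p, b, q, f') # post) -
    ksgn ((p + q - s) * form_deg s pre) (expand s V k a (?l f')) \<in> H"
    using assms by (intro m) auto
  have h: "hom_quads (?l f)" using assms by simp
  have "V (k + coeff_deg (?l f)) (a * coeff_prod (?l f)) ((q, f + f') # diff_args (pre @ post)) -
    V (k + coeff_deg (?l f)) (a * coeff_prod (?l f)) ((q, f) # diff_args (pre @ post)) -
    V (k + coeff_deg (?l f)) (a * coeff_prod (?l f)) ((q, f') # diff_args (pre @ post)) \<in> H"
    using assms gr_mult[OF assms(1) hom_quads_prod[OF h]]
    by (intro mform_add_arg[OF V] hom_quads_args) auto
  from subgrp_ksgn[OF mform_subgrp[OF V] this, of "coeff_exp s (?l f)"]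
  show "expand s V k a (?l (f + f')) - expand s V k a (?l f) - expand s V k a (?l f') \<in> H"
    by (simp add: expand_def ksgn_diff)
qed

text \<open>The three entries have the same total degree, so they are brought to the front with the
  common sign \<open>?e\<close>, and there the rule for V applies. It puts f and g behind the
  coefficients of the remaining entries; 2 and 3 move them back to their place beside b.\<close>

lemma expand_mult:
  assumes "a \<in> gr A k" "b \<in> gr A p" "f \<in> gr A q" "g \<in> gr A q'" "hom_quads (pre @ post)"
    "Suc (length (pre @ post)) = r"
  shows "expand s V k a (pre @ (p, b, q + q', f * g) # post) - expand s V k a (pre @ (p + q, b * f, q', g) # post) -
    expand s V k a (pre @ (p + q', ksgn (q * q') (b * g), q, f) # post) \<in> H"
proof (rule subgrp_cong3[OF mform_subgrp[OF V]])
  note H = mform_subgrp[OF V]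
  let ?e = "(p + q + q' - s) * form_deg s pre"
  have e: "p + (q + q') - s = p + q + q' - s" "p + q' + q - s = p + q + q' - s" by simp_all
  show "expand s V k a (pre @ (p, b, q + q', f * g) # post) -
    ksgn ?e (expand s V k a ((p, b, q + q', f * g) # pre @ post)) \<in> H"
    using expand_move[OF assms(1), of "[]" pre p b "q + q'" "f * g" post] assms unfolding e(1) by auto
  show "expand s V k a (pre @ (p + q, b * f, q', g) # post) -
    ksgn ?e (expand s V k a ((p + q, b * f, q', g) # pre @ post)) \<in> H"
    using expand_move[OF assms(1), of "[]" pre "p + q" "b * f" q' g post] assms by auto
  show "expand s V k a (pre @ (p + q', ksgn (q * q') (b * g), q, f) # post) -
    ksgn ?e (expand s V k a ((p + q', ksgn (q * q') (b * g), q, f) # pre @ post)) \<in> H"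
    using expand_move[OF assms(1), of "[]" pre "p + q'" "ksgn (q * q') (b * g)" q f post] assms
    unfolding e(2) by auto
  let ?R = "pre @ post"
  let ?x = "a * (b * coeff_prod ?R)" and ?B = "coeff_deg ?R" and ?fs = "diff_args ?R"
  let ?k = "k + (p + ?B)"
  let ?E = "s * p + (q + q' - s) * ?B + coeff_exp s ?R"
  have R: "coeff_prod ?R \<in> gr A ?B" by (rule hom_quads_prod[OF assms(5)])
  have fs: "?fs \<in> homog_args A" "Suc (length ?fs) = r" using hom_quads_args[OF assms(5)] assms(6) by auto
  have x: "?x \<in> gr A ?k" using assms R by auto
  have 1: "V ?k ?x ((q + q', f * g) # ?fs) - ksgn (s * q) (V (?k + q) (?x * f) ((q', g) # ?fs)) -
        ksgn (q * q' + s * q') (V (?k + q') (?x * g) ((q, f) # ?fs)) \<in> H"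
    using x assms(3,4) fs by (intro mform_mult_arg[OF V])
  have Rf: "coeff_prod ?R * h = ksgn (q * ?B) (h * coeff_prod ?R)" if "h \<in> gr A q" for h q
    using gr_comm[OF R that] by (simp add: mult.commute)
  have 2: "V (?k + q) (?x * f) ((q', g) # ?fs) -
     ksgn (q * ?B) (V (?k + q) (a * (b * f * coeff_prod ?R)) ((q', g) # ?fs)) \<in> H"
  proof -
    have "a * (b * f * coeff_prod ?R) \<in> gr A (?k + q)"
      using gr_mult[OF assms(1) gr_mult[OF gr_mult[OF assms(2,3)] R]] by (simp add: algebra_simps)
    then have "V (?k + q) (ksgn (q * ?B) (a * (b * f * coeff_prod ?R))) ((q', g) # ?fs) -
      ksgn (q * ?B) (V (?k + q) (a * (b * f * coeff_prod ?R)) ((q', g) # ?fs)) \<in> H"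
      using fs assms(4) by (intro mform_ksgn_coeff[OF V]) auto
    then show ?thesis by (simp only: mult.assoc Rf[OF assms(3)] ksgn_mult)
  qed
  have 3: "V (?k + q') (?x * g) ((q, f) # ?fs) -
     ksgn (q' * ?B + q * q') (V (?k + q') (a * (ksgn (q * q') (b * g) * coeff_prod ?R)) ((q, f) # ?fs)) \<in> H"
  proof -
    have "a * (ksgn (q * q') (b * g) * coeff_prod ?R) \<in> gr A (?k + q')"
      using gr_mult[OF assms(1) gr_mult[OF gr_ksgn[OF gr_mult[OF assms(2,4)]] R]] by (simp add: algebra_simps)
    then have "V (?k + q') (ksgn (q' * ?B + q * q') (a * (ksgn (q * q') (b * g) * coeff_prod ?R))) ((q, f) # ?fs) -
      ksgn (q' * ?B + q * q') (V (?k + q') (a * (ksgn (q * q') (b * g) * coeff_prod ?R)) ((q, f) # ?fs)) \<in> H"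
      using fs assms(3) by (intro mform_ksgn_coeff[OF V]) auto
    moreover have "ksgn (q' * ?B + q * q') (a * (ksgn (q * q') (b * g) * coeff_prod ?R)) = ?x * g"
      by (simp only: mult.assoc Rf[OF assms(4)] ksgn_mult ksgn_ksgn) (rule ksgn_cong_diff, simp_all add: algebra_simps)
    ultimately show ?thesis by simp
  qed
  have "V ?k ?x ((q + q', f * g) # ?fs) - ksgn (s * q + q * ?B) (V (?k + q) (a * (b * f * coeff_prod ?R)) ((q', g) # ?fs)) -
        ksgn (q * q' + s * q' + (q' * ?B + q * q')) (V (?k + q') (a * (ksgn (q * q') (b * g) * coeff_prod ?R)) ((q, f) # ?fs)) \<in> H"
    using subgrp_add[OF H subgrp_add[OF H 1 subgrp_ksgn[OF H 2, of "s * q"]] subgrp_ksgn[OF H 3, of "q * q' + s * q'"]]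
    by (simp add: ksgn_diff)
  from subgrp_ksgn[OF H this, of ?E]
  have *: "ksgn ?E (V ?k ?x ((q + q', f * g) # ?fs)) -
      ksgn (?E + (s * q + q * ?B)) (V (?k + q) (a * (b * f * coeff_prod ?R)) ((q', g) # ?fs)) -
      ksgn (?E + (q * q' + s * q' + (q' * ?B + q * q')))
        (V (?k + q') (a * (ksgn (q * q') (b * g) * coeff_prod ?R)) ((q, f) # ?fs)) \<in> H"
    by (simp add: ksgn_diff)
  have s2: "ksgn (?E + (s * q + q * ?B)) X = ksgn (s * (p + q) + (q' - s) * ?B + coeff_exp s ?R) X" for X :: 'b
    by (rule ksgn_cong_diff) (simp_all add: algebra_simps)
  have s3: "ksgn (?E + (q * q' + s * q' + (q' * ?B + q * q'))) X =
     ksgn (s * (p + q') + (q - s) * ?B + coeff_exp s ?R) X" for X :: 'b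
    by (rule ksgn_cong_diff) (simp_all add: algebra_simps)
  have k: "?k + q = k + (p + q + ?B)" "?k + q' = k + (p + q' + ?B)" by simp_all
  show "expand s V k a ((p, b, q + q', f * g) # ?R) - expand s V k a ((p + q, b * f, q', g) # ?R) -
    expand s V k a ((p + q', ksgn (q * q') (b * g), q, f) # ?R) \<in> H"
    using *[unfolded s2 s3 k]
    by (simp only: expand_def coeff_exp.simps coeff_deg.simps coeff_prod.simps list.map prod.case)
qed

lemma expand_str:
  assumes "a \<in> gr A k" "b \<in> gr A p" "str A c \<in> gr A q" "hom_quads (pre @ post)"
    "Suc (length (pre @ post)) = r"
  shows "expand s V k a (pre @ (p, b, q, str A c) # post) \<in> H"
proof -
  note H = mform_subgrp[OF V]
  let ?l = "(p, b, q, str A c) # pre @ post"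
  have h: "hom_quads ?l" using assms by simp
  have "V (k + coeff_deg ?l) (a * coeff_prod ?l) ((q, str A c) # diff_args (pre @ post)) \<in> H"
    using assms gr_mult[OF assms(1) hom_quads_prod[OF h]]
    by (intro mform_str_arg[OF V] hom_quads_args) auto
  then have "expand s V k a ?l \<in> H" by (simp add: expand_def subgrp_ksgn[OF H])
  then show ?thesis
    using expand_move[OF assms(1), of "[]" pre p b q "str A c" post] assms
    by (simp add: subgrp_cong_mem[OF H] subgrp_ksgn_iff[OF H])
qed

end

end

section \<open>Cosets of subgroups generated by relations\<close>

lemma closure_add: "x \<in> group_closure S \<Longrightarrow> y \<in> group_closure S \<Longrightarrow> x + y \<in> group_closure (S :: 'b::ab_group_add set)"
  by (rule group_closure_add)

lemma coset_self: "x \<in> x +o group_closure (S :: 'b::ab_group_add set)"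
  by (auto simp: elt_set_plus_def intro: exI[of _ 0])

lemma coset_eq_iff: "x +o group_closure S = y +o group_closure S \<longleftrightarrow> x - y \<in> group_closure (S :: 'b::ab_group_add set)"
proof
  assume "x +o group_closure S = y +o group_closure S"
  then show "x - y \<in> group_closure S" using coset_self[of x S] set_plus_imp_minus by metis
next
  assume a: "x - y \<in> group_closure S"
  have sub: "u +o group_closure S \<subseteq> v +o group_closure S" if "u - v \<in> group_closure S" for u v
  proof
    fix z assume "z \<in> u +o group_closure S"
    then have "z - u \<in> group_closure S" by (rule set_plus_imp_minus)
    from closure_add[OF this that] show "z \<in> v +o group_closure S"
      by (intro set_minus_imp_plus) simp
  qed
  have "y - x \<in> group_closure S" using a group_closure_minus_iff[of "x - y" S] by simp
  with sub a show "x +o group_closure S = y +o group_closure S" by blast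
qed

lemma coset_add: "(x +o group_closure S) + (y +o group_closure S) = (x + y) +o group_closure (S :: 'b::ab_group_add set)"
proof -
  have "group_closure S + group_closure S = group_closure S"
    using set_zero_plus2[of "group_closure S" "group_closure S"]
    by (auto simp: set_plus_def closure_add)
  then show ?thesis by (simp add: set_plus_rearrange)
qed

text \<open>\<open>mact\<close> and \<open>tens_act\<close> are defined as an image plus the
  relations: the image of a coset may be smaller than a coset, and adding the relations fills it
  up.\<close>

lemma coset_image:
  assumes "\<And>x y. \<phi> (x - y) = \<phi> x - \<phi> y" "\<And>x. x \<in> S \<Longrightarrow> \<phi> x \<in> group_closure S"
  shows "\<phi> ` (y +o group_closure S) + group_closure S = \<phi> y +o group_closure (S :: 'b::ab_group_add set)"
proof -
  have z: "\<phi> z \<in> group_closure S" if "z \<in> group_closure S" for z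
    by (rule group_closure_induct_subgrp[OF that]) (use assms in auto)
  have 0: "\<phi> 0 = 0" using assms(1)[of 0 0] by simp
  have add: "\<phi> (u + v) = \<phi> u + \<phi> v" for u v using assms(1)[of u "- v"] assms(1)[of 0 v] by (simp add: 0)
  show ?thesis
  proof (intro Set.set_eqI iffI)
    fix x assume "x \<in> \<phi> ` (y +o group_closure S) + group_closure S"
    then obtain u v where uv: "x = \<phi> (y + u) + v" "u \<in> group_closure S" "v \<in> group_closure S"
      by (auto simp: set_plus_def elt_set_plus_def)
    then show "x \<in> \<phi> y +o group_closure S"
      using closure_add[OF z[OF uv(2)] uv(3)] by (auto simp: add elt_set_plus_def add.assoc)
  next
    fix x assume "x \<in> \<phi> y +o group_closure S"
    then obtain v where "x = \<phi> y + v" "v \<in> group_closure S" by (auto simp: elt_set_plus_def)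
    then show "x \<in> \<phi> ` (y +o group_closure S) + group_closure S"
      using coset_self[of y S] by (auto simp: set_plus_def)
  qed
qed

section \<open>Extending multilinear forms to Kaehler differentials\<close>

definition cact :: "'a::times \<Rightarrow> ('a \<times> 'a \<Rightarrow>\<^sub>0 int) \<Rightarrow> ('a \<times> 'a \<Rightarrow>\<^sub>0 int)"
  where "cact c = frag_extend (\<lambda>(a, f). frag_of (c * a, f))"

lemma cact_diff: "cact c (y - z) = cact c y - cact c z"
  by (simp add: cact_def frag_extend_diff)

lemma cact_of [simp]: "cact c (frag_of (a, f)) = frag_of (c * a, f)"
  by (simp add: cact_def)

context graded_algebra
begin

definition omega_gens :: "int \<Rightarrow> ('a \<times> 'a \<Rightarrow>\<^sub>0 int) set"
  where "omega_gens m = {frag_of (a, f) | a f i j. a \<in> gr A i \<and> f \<in> gr A j \<and> i + j = m}"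

abbreviation omega_pre :: "int \<Rightarrow> ('a \<times> 'a \<Rightarrow>\<^sub>0 int) set"
  where "omega_pre m \<equiv> group_closure (omega_gens m)"

lemma omega_gensI: "a \<in> gr A i \<Longrightarrow> f \<in> gr A j \<Longrightarrow> i + j = m \<Longrightarrow> frag_of (a, f) \<in> omega_gens m"
  unfolding omega_gens_def by blast

lemma mpart_omega: "mpart (omega A) m = (\<lambda>x. x +o omega_sub A) ` omega_pre m"
  by (simp add: omega_def omega_gens_def)

lemma cact_omega_rel: "z \<in> omega_rel A \<Longrightarrow> c \<in> gr A e \<Longrightarrow> cact c z \<in> omega_rel A"
proof (induction rule: omega_rel.induct)
  case (1 a i b f j)
  then show ?case using omega_rel.intros(1)[of "c * a" A "e + i" "c * b" f j] by (auto simp: cact_diff distrib_left)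
next
  case (2 a i f j g)
  then show ?case using omega_rel.intros(2)[of "c * a" A "e + i" f j g] by (auto simp: cact_diff)
next
  case (3 a i f j g k)
  then show ?case using omega_rel.intros(3)[of "c * a" A "e + i" f j g k]
    by (auto simp: cact_diff mult.assoc ksgn_mult)
next
  case (4 a i r j)
  then show ?case using omega_rel.intros(4)[of "c * a" A "e + i" r j] by auto
qed

lemma cact_omega_pre: "c \<in> gr A e \<Longrightarrow> y \<in> omega_pre m \<Longrightarrow> cact c y \<in> omega_pre (e + m)"
proof (rule group_closure_induct_subgrp[of y "omega_gens m"])
  fix s assume "c \<in> gr A e" "s \<in> omega_gens m"
  then obtain a f i j where "s = frag_of (a, f)" "a \<in> gr A i" "f \<in> gr A j" "i + j = m"
    by (auto simp: omega_gens_def)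
  then show "cact c s \<in> omega_pre (e + m)"
    using gr_mult[OF \<open>c \<in> gr A e\<close>, of a i]
    by (intro group_closure.base insertI2) (auto intro: omega_gensI[of _ "e + i" _ j])
qed (auto simp: cact_diff)

lemma mact_omega: "c \<in> gr A e \<Longrightarrow> mact (omega A) e c (y +o omega_sub A) = cact c y +o omega_sub A"
  using coset_image[of "cact c" "omega_rel A" y]
  by (simp add: omega_def cact_def[symmetric] cact_diff cact_omega_rel group_closure.base)

abbreviation smod :: "int \<Rightarrow> ('a, ('a \<times> 'a \<Rightarrow>\<^sub>0 int) set) gmod"
  where "smod s \<equiv> shift s (omega A)"

lemma mpart_smod: "mpart (smod s) d = mpart (omega A) (s + d)"
  by (simp add: shift_def)

lemma mact_smod: "c \<in> gr A e \<Longrightarrow>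
    mact (smod s) e c (y +o omega_sub A) = cact (ksgn (s * e) c) y +o omega_sub A"
  by (simp add: shift_def mact_omega gr_ksgn)

text \<open>A symbol (b, f) does not record the degrees of b and f, but the sign in
  \<open>expand\<close> depends on them. For nonzero homogeneous elements the choice is forced by
  \<open>gr_unique\<close>.\<close>

definition dgr :: "'a \<Rightarrow> int"
  where "dgr x = (SOME i. x \<in> gr A i)"

lemma dgr_gr: "x \<in> gr A i \<Longrightarrow> x \<in> gr A (dgr x)"
  unfolding dgr_def by (rule someI)

lemma dgr_eq: "x \<in> gr A i \<Longrightarrow> x \<noteq> 0 \<Longrightarrow> dgr x = i"
  using gr_unique dgr_gr by blast

definition with_deg :: "('a \<times> 'a) list \<Rightarrow> (int \<times> 'a \<times> int \<times> 'a) list"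
  where "with_deg gs = map (\<lambda>(b, f). (dgr b, b, dgr f, f)) gs"

definition U :: "int \<Rightarrow> (int \<Rightarrow> 'a \<Rightarrow> (int \<times> 'a) list \<Rightarrow> 'b) \<Rightarrow> int \<Rightarrow> 'a \<Rightarrow> ('a \<times> 'a) list \<Rightarrow> 'b::ab_group_add"
  where "U s V k a gs = expand s V k a (with_deg gs)"

text \<open>\<open>is_rep s ms ys\<close>: the \<open>ys\<close> are representatives of the homogeneous differentials \<open>ms\<close>.\<close>

definition is_rep :: "int \<Rightarrow> (int \<times> ('a \<times> 'a \<Rightarrow>\<^sub>0 int) set) list \<Rightarrow> ('a \<times> 'a \<Rightarrow>\<^sub>0 int) list \<Rightarrow> bool"
  where "is_rep s = list_all2 (\<lambda>(d, x) y. y \<in> omega_pre (s + d) \<and> x = y +o omega_sub A)"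

definition rep :: "int \<Rightarrow> int \<times> ('a \<times> 'a \<Rightarrow>\<^sub>0 int) set \<Rightarrow> ('a \<times> 'a \<Rightarrow>\<^sub>0 int)"
  where "rep s = (\<lambda>(d, x). SOME y. y \<in> omega_pre (s + d) \<and> x = y +o omega_sub A)"

lemma rep:
  assumes "x \<in> mpart (smod s) d"
  shows "rep s (d, x) \<in> omega_pre (s + d)" "x = rep s (d, x) +o omega_sub A"
proof -
  have "\<exists>y. y \<in> omega_pre (s + d) \<and> x = y +o omega_sub A"
    using assms by (auto simp: mpart_smod mpart_omega)
  from someI_ex[OF this] show "rep s (d, x) \<in> omega_pre (s + d)" "x = rep s (d, x) +o omega_sub A"
    by (simp_all add: rep_def)
qed

lemma is_rep_rep: "ms \<in> factors (smod s) r \<Longrightarrow> is_rep s ms (map (rep s) ms)"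
  unfolding is_rep_def list_all2_map2
  by (rule list.rel_refl_strong) (use rep in \<open>force simp: factors_def\<close>)

text \<open>The induced value on a \<otimes> x_1 \<otimes> ... \<otimes> x_r, where the x_l are
  cosets: representatives are chosen and expanded multi-additively. Independence of the choices
  modulo H is \<open>Fgen_rep\<close>.\<close>

definition Fgen :: "int \<Rightarrow> (int \<Rightarrow> 'a \<Rightarrow> (int \<times> 'a) list \<Rightarrow> 'b) \<Rightarrow>
    'a \<times> (int \<times> ('a \<times> 'a \<Rightarrow>\<^sub>0 int) set) list \<Rightarrow> 'b::ab_group_add"
  where "Fgen s V = (\<lambda>(a, ms). mext (U s V (dgr a) a) (map (rep s) ms))"

lemma quads_exist:
  assumes "\<forall>y \<in> set zs. \<exists>m. y \<in> omega_gens m"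
  shows "\<exists>qs. hom_quads qs \<and> zs = map frag_of (forget_deg qs)"
  using assms
proof (induction zs)
  case Nil
  then show ?case by (intro exI[of _ "[]"]) simp
next
  case (Cons z zs)
  then obtain qs where "hom_quads qs" "zs = map frag_of (forget_deg qs)" by auto
  moreover obtain a f i j where "z = frag_of (a, f)" "a \<in> gr A i" "f \<in> gr A j"
    using Cons.prems by (auto simp: omega_gens_def)
  ultimately show ?case by (intro exI[of _ "(i, a, j, f) # qs"]) auto
qed

lemma quads_exist_deg:
  assumes "list_all2 (\<in>) zs (map (\<lambda>(d, x). omega_gens (s + d)) ms)"
  shows "\<exists>qs. hom_quads qs \<and> zs = map frag_of (forget_deg qs) \<and>
    list_all2 (\<lambda>(p, b, q, f) (d, x). p + q - s = d) qs ms"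
  using assms
proof (induction ms arbitrary: zs)
  case Nil
  then show ?case by (intro exI[of _ "[]"]) simp
next
  case (Cons m ms)
  then obtain z zs' where z: "zs = z # zs'" "z \<in> omega_gens (s + fst m)"
     "list_all2 (\<in>) zs' (map (\<lambda>(d, x). omega_gens (s + d)) ms)"
    by (auto simp: list_all2_Cons2 split: prod.splits)
  obtain qs where "hom_quads qs" "zs' = map frag_of (forget_deg qs)"
    "list_all2 (\<lambda>(p, b, q, f) (d, x). p + q - s = d) qs ms" using Cons.IH[OF z(3)] by auto
  moreover obtain a f i j where "z = frag_of (a, f)" "a \<in> gr A i" "f \<in> gr A j" "i + j = s + fst m"
    using z(2) by (auto simp: omega_gens_def)
  ultimately show ?case
    using z(1) by (intro exI[of _ "(i, a, j, f) # qs"]) (auto split: prod.splits)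
qed

context
  fixes s r H and V :: "int \<Rightarrow> 'a \<Rightarrow> (int \<times> 'a) list \<Rightarrow> 'b::ab_group_add"
  assumes V: "mform s r H V"
begin

text \<open>The degrees found by \<open>dgr\<close> are the given ones unless some entry is 0, and
  then both values lie in H by \<open>expand_zero\<close>.\<close>

lemma U_eq:
  assumes "a \<in> gr A k" "hom_quads qs" "length qs = r"
  shows "U s V k a (forget_deg qs) - expand s V k a qs \<in> H"
proof (cases "\<exists>(p, b, q, f) \<in> set qs. b = 0 \<or> f = 0")
  case False
  then have "\<forall>x \<in> set qs. (case x of (p, b, q, f) \<Rightarrow> (dgr b, b, dgr f, f)) = x"
    using assms(2) dgr_eq by (fastforce simp: hom_quads_def)
  then have "with_deg (forget_deg qs) = qs"
    by (auto simp: with_deg_def case_prod_unfold intro!: map_idI)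
  then show ?thesis by (simp add: U_def subgrp_zero[OF mform_subgrp[OF V]])
next
  case True
  then obtain p b q f where *: "(p, b, q, f) \<in> set qs" "b = 0 \<or> f = 0" by blast
  have "hom_quads (with_deg (forget_deg qs))"
    using assms(2) dgr_gr by (fastforce simp: hom_quads_def with_deg_def)
  moreover have "(dgr b, b, dgr f, f) \<in> set (with_deg (forget_deg qs))"
    using *(1) by (force simp: with_deg_def)
  then have "\<exists>(p, b, q, f) \<in> set (with_deg (forget_deg qs)). b = 0 \<or> f = 0" using *(2) by blast
  ultimately have "expand s V k a (with_deg (forget_deg qs)) \<in> H"
    using assms(1,3) by (intro expand_zero[OF V]) (auto simp: with_deg_def)
  then show ?thesis
    using expand_zero[OF V assms True] by (simp add: U_def subgrp_diff[OF mform_subgrp[OF V]])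
qed

lemma U_rel3:
  assumes "a \<in> gr A k" "hom_quads x" "hom_quads y" "hom_quads z" "length x = r" "length y = r" "length z = r"
    "expand s V k a x - expand s V k a y - expand s V k a z \<in> H"
  shows "U s V k a (forget_deg x) - U s V k a (forget_deg y) - U s V k a (forget_deg z) \<in> H"
  by (rule subgrp_cong3[OF mform_subgrp[OF V], of _ 0 "expand s V k a x" _ "expand s V k a y" _
        "expand s V k a z"]) (use assms U_eq in auto)

text \<open>The core of well-definedness. Multi-additivity reduces the claim to a single relation in
  one slot and single symbols in all others, and the four kinds of relation in
  \<open>omega_rel\<close> are answered by \<open>expand_add_left\<close>,
  \<open>expand_add_right\<close>, \<open>expand_mult\<close> and \<open>expand_str\<close>.\<close>

lemma mext_kill:
  assumes a: "a \<in> gr A k" and pre: "\<forall>y \<in> set pre. \<exists>m. y \<in> omega_pre m"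
    and post: "\<forall>y \<in> set post. \<exists>m. y \<in> omega_pre m"
    and z: "z \<in> omega_sub A" and len: "Suc (length (pre @ post)) = r"
  shows "mext (U s V k a) (pre @ z # post) \<in> H"
proof -
  note H = mform_subgrp[OF V]
  \<comment> \<open>Every slot is homogeneous of some degree; fixing one makes the generating set a
    function of the slot, as the list of sets in \<open>madd_closure\<close> requires.\<close>
  let ?X = "\<lambda>y. omega_gens (SOME m. y \<in> omega_pre m)"
  have X: "y \<in> group_closure (?X y)" if "\<exists>m. y \<in> omega_pre m" for y
    using someI_ex[OF that] .
  show ?thesis
  proof (rule madd_closure[OF mext_madd H, of _ "map ?X pre @ omega_rel A # map ?X post"])
    show "list_all2 (\<lambda>y X. y \<in> group_closure X) (pre @ z # post) (map ?X pre @ omega_rel A # map ?X post)"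
      using pre post z X by (auto intro!: list_all2_appendI simp: list_all2_map2 intro!: list.rel_refl_strong)
    show "length (map ?X pre @ omega_rel A # map ?X post) = r" using len by simp
    fix zs assume "list_all2 (\<in>) zs (map ?X pre @ omega_rel A # map ?X post)"
    then obtain zs1 w zs2 where zs: "zs = zs1 @ w # zs2" "list_all2 (\<in>) zs1 (map ?X pre)"
      "w \<in> omega_rel A" "list_all2 (\<in>) zs2 (map ?X post)"
      by (auto simp: list_all2_append2 list_all2_Cons2)
    have "\<forall>y \<in> set zs1. \<exists>m. y \<in> omega_gens m" "\<forall>y \<in> set zs2. \<exists>m. y \<in> omega_gens m"
      using zs(2,4) by (fastforce simp: list_all2_conv_all_nth in_set_conv_nth)+
    then obtain P Q where P: "hom_quads P" "zs1 = map frag_of (forget_deg P)"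
      and Q: "hom_quads Q" "zs2 = map frag_of (forget_deg Q)" using quads_exist by metis
    have lenPQ: "Suc (length (P @ Q)) = r"
      using zs P(2) Q(2) len by (auto dest!: list_all2_lengthD)
    have PQ: "hom_quads (P @ Q)" using P Q by simp
    have one: "mext (U s V k a) (zs1 @ frag_of (b, f) # zs2) = U s V k a (forget_deg (P @ (p, b, q, f) # Q))" for b f p q
      using mext_of[of "U s V k a" "forget_deg (P @ (p, b, q, f) # Q)"] by (simp add: P Q)
    have three: "mext (U s V k a) (zs1 @ (x - y - y') # zs2) = mext (U s V k a) (zs1 @ x # zs2) -
       mext (U s V k a) (zs1 @ y # zs2) - mext (U s V k a) (zs1 @ y' # zs2)" for x y y'
      using lenPQ P(2) Q(2) madd_app[OF mext_madd, of zs1 "x - y" zs2 r "U s V k a" y'] madd_app[OF mext_madd, of zs1 x zs2 r "U s V k a" y] by simp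
    have "mext (U s V k a) (zs1 @ w # zs2) \<in> H"
      using zs(3)
    proof cases
      case (1 b i b' f j)
      then show ?thesis
        unfolding 1(1) three one[of _ _ i j] using lenPQ PQ P(1) Q(1)
        by (intro U_rel3[OF a] expand_add_left[OF V a]) auto
    next
      case (2 b i f j g)
      then show ?thesis
        unfolding 2(1) three one[of _ _ i j] using lenPQ PQ P(1) Q(1)
        by (intro U_rel3[OF a] expand_add_right[OF V a]) auto
    next
      case (3 b i f j g l)
      show ?thesis
        unfolding 3(1) three one[of b "f * g" i "j + l"] one[of "b * f" g "i + j" l]
          one[of "ksgn (j * l) (b * g)" f "i + l" j] using 3 lenPQ PQ P(1) Q(1)
        by (intro U_rel3[OF a] expand_mult[OF V a]) auto
    next
      case (4 b i c j)
      have "expand s V k a (P @ (i, b, j, str A c) # Q) \<in> H"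
        using 4 lenPQ PQ by (intro expand_str[OF V a]) auto
      moreover have "U s V k a (forget_deg (P @ (i, b, j, str A c) # Q)) - expand s V k a (P @ (i, b, j, str A c) # Q) \<in> H"
        using 4 lenPQ P(1) Q(1) by (intro U_eq[OF a]) auto
      ultimately show ?thesis unfolding 4(1) one[of _ _ i j] using subgrp_cong_mem[OF H] by blast
    qed
    then show "mext (U s V k a) zs \<in> H" by (simp only: zs(1))
  qed
qed

lemma mext_indep:
  assumes a: "a \<in> gr A k" and "is_rep s ms ys" "is_rep s ms ys'" "length ms = r"
  shows "mext (U s V k a) ys - mext (U s V k a) ys' \<in> H"
proof -
  note H = mform_subgrp[OF V]
  \<comment> \<open>The prefix \<open>us\<close> holds the slots that already have their new
    representatives, so that consecutive lists differ in one slot only.\<close>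
  have "mext (U s V k a) (us @ ys) - mext (U s V k a) (us @ ys') \<in> H"
    if "is_rep s ms ys" "is_rep s ms ys'" "\<forall>y \<in> set us. \<exists>m. y \<in> omega_pre m" "length us + length ms = r" for us ys ys' ms
    using that
  proof (induction ms arbitrary: us ys ys')
    case Nil
    then show ?case by (simp add: is_rep_def subgrp_zero[OF H])
  next
    case (Cons m ms)
    obtain d x where m: "m = (d, x)" by (cases m)
    obtain y zs where y: "ys = y # zs" "y \<in> omega_pre (s + d)" "x = y +o omega_sub A" "is_rep s ms zs"
      using Cons.prems(1) by (auto simp: is_rep_def list_all2_Cons1 m)
    obtain y' zs' where y': "ys' = y' # zs'" "y' \<in> omega_pre (s + d)" "x = y' +o omega_sub A" "is_rep s ms zs'"
      using Cons.prems(2) by (auto simp: is_rep_def list_all2_Cons1 m)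
    have len: "length zs = length ms" using y(4) by (auto simp: is_rep_def dest: list_all2_lengthD)
    have zs: "\<forall>y \<in> set zs. \<exists>m. y \<in> omega_pre m"
      using y(4) by (fastforce simp: is_rep_def list_all2_conv_all_nth in_set_conv_nth)
    have "y - y' \<in> omega_sub A" using y(3) y'(3) coset_eq_iff by blast
    from mext_kill[OF a Cons.prems(3) zs this]
    have "mext (U s V k a) (us @ (y - y') # zs) \<in> H" using Cons.prems(4) len by simp
    then have 1: "mext (U s V k a) (us @ y # zs) - mext (U s V k a) (us @ y' # zs) \<in> H"
      using madd_app[OF mext_madd, of us y zs r "U s V k a" y'] Cons.prems(4) len by simp
    have "mext (U s V k a) ((us @ [y']) @ zs) - mext (U s V k a) ((us @ [y']) @ zs') \<in> H"
      using Cons.prems y'(2) by (intro Cons.IH y(4) y'(4)) auto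
    with 1 show ?case unfolding y(1) y'(1) using subgrp_cong_trans[OF H 1] by simp
  qed
  from this[of ms ys ys' "[]"] assms show ?thesis by simp
qed

lemma mext_closure:
  assumes "madd r D" "is_rep s ms ys" "length ms = r"
    "\<And>qs. hom_quads qs \<Longrightarrow> length qs = r \<Longrightarrow> list_all2 (\<lambda>(p, b, q, f) (d, x). p + q - s = d) qs ms \<Longrightarrow>
      D (map frag_of (forget_deg qs)) \<in> H"
  shows "D ys \<in> H"
proof (rule madd_closure[OF assms(1) mform_subgrp[OF V], of _ "map (\<lambda>(d, x). omega_gens (s + d)) ms"])
  show "list_all2 (\<lambda>y X. y \<in> group_closure X) ys (map (\<lambda>(d, x). omega_gens (s + d)) ms)"
    using assms(2) by (auto simp: is_rep_def list_all2_conv_all_nth split: prod.splits)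
  fix zs assume "list_all2 (\<in>) zs (map (\<lambda>(d, x). omega_gens (s + d)) ms)"
  then show "D zs \<in> H"
    using quads_exist_deg[of zs s ms] assms(3,4) by (metis list_all2_lengthD)
qed (use assms in auto)

lemma Fgen_rep:
  assumes "a \<in> gr A k" "is_rep s ms ys" "length ms = r" "ms \<in> factors (smod s) r"
  shows "Fgen s V (a, ms) - mext (U s V k a) ys \<in> H"
proof (cases "a = 0")
  case False
  then show ?thesis
    using mext_indep[OF assms(1) is_rep_rep[OF assms(4)] assms(2,3)] dgr_eq[OF assms(1)]
    by (simp add: Fgen_def)
next
  case True
  \<comment> \<open>For a = 0 the degree \<open>dgr a\<close> may differ from k, but the values for
    both degrees lie in H.\<close>
  have "mext (U s V k 0) ys \<in> H" if "is_rep s ms ys" for k ys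
  proof (rule mext_closure[OF mext_madd that assms(3)])
    fix qs assume qs: "hom_quads qs" "length qs = r"
    show "mext (U s V k 0) (map frag_of (forget_deg qs)) \<in> H"
      unfolding mext_of using U_eq[OF gr_0 qs, of k] expand_zero_coeff[OF V qs, of k]
      by (simp add: subgrp_cong_mem[OF mform_subgrp[OF V]])
  qed
  then show ?thesis
    using True is_rep_rep[OF assms(4)] assms(2)
    by (simp add: Fgen_def subgrp_diff[OF mform_subgrp[OF V]])
qed

end

end

section \<open>Compatibility of the extension with tensor and symmetric relations\<close>

lemma factors_append:
  "xs @ ys \<in> factors M r \<longleftrightarrow> xs \<in> factors M (length xs) \<and> ys \<in> factors M (length ys) \<and> length xs + length ys = r"
  by (auto simp: factors_def)

lemma factors_Cons:
  "(d, x) # ys \<in> factors M r \<longleftrightarrow> x \<in> mpart M d \<and> ys \<in> factors M (length ys) \<and> Suc (length ys) = r"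
  by (auto simp: factors_def)

lemma factors_length: "ms \<in> factors M r \<Longrightarrow> length ms = r"
  by (simp add: factors_def)

context graded_algebra
begin

lemma is_rep_append: "is_rep s xs us \<Longrightarrow> is_rep s ys vs \<Longrightarrow> is_rep s (xs @ ys) (us @ vs)"
  unfolding is_rep_def by (rule list_all2_appendI)

lemma is_rep_Cons: "is_rep s ((d, x) # ms) (y # ys) \<longleftrightarrow>
    y \<in> omega_pre (s + d) \<and> x = y +o omega_sub A \<and> is_rep s ms ys"
  by (auto simp: is_rep_def)

lemma is_rep_factors: "is_rep s ms ys \<Longrightarrow> length ms = r \<Longrightarrow> ms \<in> factors (smod s) r"
  by (fastforce simp: is_rep_def factors_def mpart_smod mpart_omega list_all2_conv_all_nth in_set_conv_nth)

lemma mpart_smodE: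
  assumes "x \<in> mpart (smod s) d"
  obtains y where "y \<in> omega_pre (s + d)" "x = y +o omega_sub A"
  using assms by (auto simp: mpart_smod mpart_omega)

context
  fixes s r H and V :: "int \<Rightarrow> 'a \<Rightarrow> (int \<times> 'a) list \<Rightarrow> 'b::ab_group_add"
  assumes V: "mform s r H V"
begin

lemma Fgen_cong:
  assumes "a \<in> gr A k" "is_rep s ms ys" "length ms = r"
  shows "Fgen s V (a, ms) - mext (U s V k a) ys \<in> H"
  using Fgen_rep[OF V assms is_rep_factors[OF assms(2,3)]] .

lemma U_cong2:
  assumes "a \<in> gr A k" "hom_quads qs" "length qs = r" "a' \<in> gr A k'" "hom_quads qs'" "length qs' = r"
    "expand s V k a qs - ksgn e (expand s V k' a' qs') \<in> H"
  shows "U s V k a (forget_deg qs) - ksgn e (U s V k' a' (forget_deg qs')) \<in> H"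
proof -
  note H = mform_subgrp[OF V]
  have "ksgn e (expand s V k' a' qs') - ksgn e (U s V k' a' (forget_deg qs')) \<in> H"
    using subgrp_ksgn[OF H subgrp_cong_sym[OF H U_eq[OF V assms(4-6)]], of e] by (simp add: ksgn_diff)
  from subgrp_cong_trans[OF H subgrp_cong_trans[OF H U_eq[OF V assms(1-3)] assms(7)] this]
  show ?thesis .
qed

lemma Fgen_add_coeff:
  assumes "a \<in> gr A k" "b \<in> gr A k" "ms \<in> factors (smod s) r"
  shows "Fgen s V (a + b, ms) - Fgen s V (a, ms) - Fgen s V (b, ms) \<in> H"
proof -
  note H = mform_subgrp[OF V]
  let ?ys = "map (rep s) ms"
  have ys: "is_rep s ms ?ys" "length ms = r" using is_rep_rep factors_length assms(3) by auto
  have "mext (U s V k (a + b)) ?ys - mext (U s V k a) ?ys - mext (U s V k b) ?ys \<in> H"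
  proof (rule mext_closure[OF V _ ys])
    fix qs assume qs: "hom_quads qs" "length qs = r"
    show "mext (U s V k (a + b)) (map frag_of (forget_deg qs)) -
        mext (U s V k a) (map frag_of (forget_deg qs)) - mext (U s V k b) (map frag_of (forget_deg qs)) \<in> H"
      unfolding mext_of
      by (rule subgrp_cong3[OF H, of _ 0 "expand s V k (a + b) qs" _ "expand s V k a qs" _ "expand s V k b qs"])
        (use assms(1,2) qs U_eq[OF V _ qs] expand_add_coeff[OF V assms(1,2) qs] in auto)
  qed (intro madd_diff mext_madd)
  then show ?thesis
    by (rule subgrp_cong3[OF H, where e = 0, rotated -1])
      (use assms(1,2) ys in \<open>auto intro!: Fgen_cong gr_add\<close>)
qed

lemma Fgen_add_arg:
  assumes "a \<in> gr A k" "x \<in> mpart (smod s) d" "y \<in> mpart (smod s) d" "xs @ [(d, x)] @ ys \<in> factors (smod s) r"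
  shows "Fgen s V (a, xs @ [(d, x + y)] @ ys) - Fgen s V (a, xs @ [(d, x)] @ ys) -
      Fgen s V (a, xs @ [(d, y)] @ ys) \<in> H"
proof -
  note H = mform_subgrp[OF V]
  obtain u v where u: "u \<in> omega_pre (s + d)" "x = u +o omega_sub A"
    and v: "v \<in> omega_pre (s + d)" "y = v +o omega_sub A" using assms(2,3) by (metis mpart_smodE)
  have f: "xs \<in> factors (smod s) (length xs)" "ys \<in> factors (smod s) (length ys)" "Suc (length xs + length ys) = r"
    using assms(4) by (auto simp: factors_append factors_Cons)
  let ?X = "map (rep s) xs" and ?Y = "map (rep s) ys"
  have r: "is_rep s (xs @ [(d, w +o omega_sub A)] @ ys) (?X @ w # ?Y)" if "w \<in> omega_pre (s + d)" for w
    using that is_rep_rep[OF f(1)] is_rep_rep[OF f(2)] by (intro is_rep_append) (auto simp: is_rep_Cons)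
  have add: "mext (U s V k a) (?X @ (u + v) # ?Y) - mext (U s V k a) (?X @ u # ?Y) - mext (U s V k a) (?X @ v # ?Y) = 0"
    using f(3) madd_app[OF mext_madd, of ?X "u + v" ?Y r "U s V k a" v] by simp
  have xy: "x + y = (u + v) +o omega_sub A" by (simp add: u v coset_add)
  show ?thesis
    by (rule subgrp_cong3[OF H, of _ 0 "mext (U s V k a) (?X @ (u + v) # ?Y)" _ "mext (U s V k a) (?X @ u # ?Y)"
          _ "mext (U s V k a) (?X @ v # ?Y)"], unfold add xy ksgn_0, unfold u(2) v(2))
      (use assms(1) f(3) subgrp_zero[OF H] r u(1) v(1) closure_add[OF u(1) v(1)] in \<open>auto intro!: Fgen_cong\<close>)
qed

lemma Fgen_scalar:
  assumes "a \<in> gr A k" "c \<in> gr A e" "(d, x) # ys \<in> factors (smod s) r"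
  shows "Fgen s V (a * c, (d, x) # ys) - Fgen s V (a, (e + d, mact (smod s) e c x) # ys) \<in> H"
proof -
  note H = mform_subgrp[OF V]
  have f: "x \<in> mpart (smod s) d" "ys \<in> factors (smod s) (length ys)" "Suc (length ys) = r"
    using assms(3) by (auto simp: factors_Cons)
  obtain u where u: "u \<in> omega_pre (s + d)" "x = u +o omega_sub A" using f(1) by (metis mpart_smodE)
  \<comment> \<open>By \<open>mact_smod\<close>, c acts on representatives through
    \<open>?c\<close>, with the sign of the shift.\<close>
  let ?Y = "map (rep s) ys" and ?c = "ksgn (s * e) c"
  have c: "?c \<in> gr A e" using assms(2) by auto
  have r1: "is_rep s ((d, x) # ys) (u # ?Y)" using u is_rep_rep[OF f(2)] by (simp add: is_rep_Cons)
  have r2: "is_rep s ((e + d, mact (smod s) e c x) # ys) (cact ?c u # ?Y)"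
    using cact_omega_pre[OF c u(1)] is_rep_rep[OF f(2)]
    by (simp add: is_rep_Cons u(2) mact_smod[OF assms(2)] algebra_simps)
  \<comment> \<open>The scalar action is written as an update of slot 0, so that \<open>?D\<close>
    is additive in every slot and may be tested on symbols.\<close>
  let ?D = "\<lambda>l. mext (U s V (k + e) (a * c)) l - mext (U s V k a) (l[0 := cact ?c (l ! 0)])"
  have "?D (u # ?Y) \<in> H"
  proof (rule mext_closure[OF V _ r1])
    show "madd r ?D" by (intro madd_diff madd_update mext_madd cact_diff)
    fix qs assume qs: "hom_quads qs" "length qs = r" "list_all2 (\<lambda>(p, b, q, f) (d, x). p + q - s = d) qs ((d, x) # ys)"
    obtain p b q f qs' where q: "qs = (p, b, q, f) # qs'" using qs(2) f(3) by (cases qs) auto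
    have "U s V k a (forget_deg ((e + p, ?c * b, q, f) # qs')) - ksgn 0 (U s V (k + e) (a * c) (forget_deg qs)) \<in> H"
    proof (rule U_cong2)
      show "expand s V k a ((e + p, ?c * b, q, f) # qs') - ksgn 0 (expand s V (k + e) (a * c) qs) \<in> H"
        using expand_pull_ksgn[OF V assms(1,2), of "[]" p b q f qs' "s * e"] qs q
        by (simp add: ksgn_even)
    qed (use assms qs q c in auto)
    from subgrp_cong_sym[OF H this]
    have "mext (U s V (k + e) (a * c)) (map frag_of (forget_deg qs)) -
        mext (U s V k a) (map frag_of (forget_deg ((e + p, ?c * b, q, f) # qs'))) \<in> H"
      by (simp only: mext_of ksgn_0)
    then show "?D (map frag_of (forget_deg qs)) \<in> H" by (simp add: q)
  qed (use f in auto)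
  then have "mext (U s V (k + e) (a * c)) (u # ?Y) - mext (U s V k a) (cact ?c u # ?Y) \<in> H" by simp
  from subgrp_cong_trans[OF H Fgen_cong[OF gr_mult[OF assms(1,2)] r1] this]
  have "Fgen s V (a * c, (d, x) # ys) - mext (U s V k a) (cact ?c u # ?Y) \<in> H" using f by simp
  from subgrp_cong_trans[OF H this subgrp_cong_sym[OF H Fgen_cong[OF assms(1) r2]]]
  show ?thesis using f by simp
qed

text \<open>Both sides are compared with the expansion in which c stands in front. From the right
  slot it has to pass one factor more, of degree d, and \<open>ksgn (d * e)\<close> on the left
  compensates for that.\<close>

lemma Fgen_balanced:
  assumes "a \<in> gr A k" "c \<in> gr A e" "xs @ [(d, x), (d', y)] @ ys \<in> factors (smod s) r"
  shows "Fgen s V (a, xs @ [(d + e, mact (smod s) e (ksgn (d * e) c) x), (d', y)] @ ys) -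
    Fgen s V (a, xs @ [(d, x), (e + d', mact (smod s) e c y)] @ ys) \<in> H"
proof -
  note H = mform_subgrp[OF V]
  have f: "x \<in> mpart (smod s) d" "y \<in> mpart (smod s) d'" "xs \<in> factors (smod s) (length xs)"
    "ys \<in> factors (smod s) (length ys)" "Suc (Suc (length xs + length ys)) = r"
    using assms(3) by (auto simp: factors_append factors_Cons)
  obtain u v where u: "u \<in> omega_pre (s + d)" "x = u +o omega_sub A"
    and v: "v \<in> omega_pre (s + d')" "y = v +o omega_sub A" using f(1,2) by (metis mpart_smodE)
  let ?X = "map (rep s) xs" and ?Y = "map (rep s) ys" and ?n = "length xs"
  let ?c = "ksgn (s * e) c" and ?c' = "ksgn (s * e + d * e) c"
  have c: "?c \<in> gr A e" "?c' \<in> gr A e" using assms(2) by auto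
  have dc: "ksgn (d * e) c \<in> gr A e" using assms(2) by auto
  have r0: "is_rep s (xs @ [(d, x), (d', y)] @ ys) (?X @ u # v # ?Y)"
    using u v is_rep_rep[OF f(3)] is_rep_rep[OF f(4)] by (intro is_rep_append) (auto simp: is_rep_Cons)
  have r1: "is_rep s (xs @ [(d + e, mact (smod s) e (ksgn (d * e) c) x), (d', y)] @ ys) (?X @ cact ?c' u # v # ?Y)"
    using u v is_rep_rep[OF f(3)] is_rep_rep[OF f(4)] cact_omega_pre[OF c(2) u(1)]
    by (intro is_rep_append) (auto simp: is_rep_Cons mact_smod[OF dc] algebra_simps)
  have r2: "is_rep s (xs @ [(d, x), (e + d', mact (smod s) e c y)] @ ys) (?X @ u # cact ?c v # ?Y)"
    using u v is_rep_rep[OF f(3)] is_rep_rep[OF f(4)] cact_omega_pre[OF c(1) v(1)]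
    by (intro is_rep_append) (auto simp: is_rep_Cons mact_smod[OF assms(2)] algebra_simps)
  let ?D = "\<lambda>l. mext (U s V k a) (l[?n := cact ?c' (l ! ?n)]) - mext (U s V k a) (l[Suc ?n := cact ?c (l ! Suc ?n)])"
  have "?D (?X @ u # v # ?Y) \<in> H"
  proof (rule mext_closure[OF V _ r0])
    show "madd r ?D" by (intro madd_diff madd_update mext_madd cact_diff)
    fix qs assume qs: "hom_quads qs" "length qs = r"
      "list_all2 (\<lambda>(p, b, q, f) (d, x). p + q - s = d) qs (xs @ [(d, x), (d', y)] @ ys)"
    obtain P p b q f p' b' q' f' Q where q: "qs = P @ (p, b, q, f) # (p', b', q', f') # Q" "length P = ?n"
      "p + q - s = d"
      using qs(3) by (fastforce simp: list_all2_append2 list_all2_Cons2 dest: list_all2_lengthD)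
    have "expand s V k a (P @ (e + p, ?c' * b, q, f) # (p', b', q', f') # Q) -
      ksgn (s * e + d * e + s * e + e * form_deg s P) (expand s V (k + e) (a * c) qs) \<in> H"
      unfolding q(1) using qs q by (intro expand_pull_ksgn[OF V assms(1,2)]) auto
    moreover have "expand s V k a ((P @ [(p, b, q, f)]) @ (e + p', ?c * b', q', f') # Q) -
      ksgn (s * e + s * e + e * form_deg s (P @ [(p, b, q, f)])) (expand s V (k + e) (a * c) ((P @ [(p, b, q, f)]) @ (p', b', q', f') # Q)) \<in> H"
      using qs q by (intro expand_pull_ksgn[OF V assms(1,2)]) auto
    moreover have "ksgn (s * e + s * e + e * form_deg s (P @ [(p, b, q, f)])) (expand s V (k + e) (a * c) qs) =
      ksgn (s * e + d * e + s * e + e * form_deg s P) (expand s V (k + e) (a * c) qs)"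
      by (rule ksgn_cong_diff) (simp_all add: q(3)[symmetric] algebra_simps)
    ultimately have "expand s V k a (P @ (e + p, ?c' * b, q, f) # (p', b', q', f') # Q) -
       ksgn 0 (expand s V k a (P @ (p, b, q, f) # (e + p', ?c * b', q', f') # Q)) \<in> H"
      using subgrp_cong_trans[OF H] subgrp_cong_sym[OF H] q(1) by (smt (verit) append.assoc append_Cons append_Nil ksgn_0)
    from U_cong2[OF assms(1) _ _ assms(1) _ _ this]
    have "U s V k a (forget_deg (P @ (e + p, ?c' * b, q, f) # (p', b', q', f') # Q)) -
       U s V k a (forget_deg (P @ (p, b, q, f) # (e + p', ?c * b', q', f') # Q)) \<in> H"
      using qs q c by auto
    then have "mext (U s V k a) (map frag_of (forget_deg (P @ (e + p, ?c' * b, q, f) # (p', b', q', f') # Q))) -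
       mext (U s V k a) (map frag_of (forget_deg (P @ (p, b, q, f) # (e + p', ?c * b', q', f') # Q))) \<in> H"
      by (simp only: mext_of)
    then show "?D (map frag_of (forget_deg qs)) \<in> H"
      by (simp add: q(1) q(2)[symmetric] nth_append list_update_append)
  qed (use f in auto)
  then have "mext (U s V k a) (?X @ cact ?c' u # v # ?Y) - mext (U s V k a) (?X @ u # cact ?c v # ?Y) \<in> H"
    by (simp add: nth_append list_update_append)
  from subgrp_cong_trans[OF H Fgen_cong[OF assms(1) r1] this]
  have "Fgen s V (a, xs @ [(d + e, mact (smod s) e (ksgn (d * e) c) x), (d', y)] @ ys) - mext (U s V k a) (?X @ u # cact ?c v # ?Y) \<in> H"
    using f by simp
  from subgrp_cong_trans[OF H this subgrp_cong_sym[OF H Fgen_cong[OF assms(1) r2]]]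
  show ?thesis using f by simp
qed

lemma Fgen_swap:
  assumes "a \<in> gr A k" "xs @ [(d, x), (d', y)] @ ys \<in> factors (smod s) r"
  shows "Fgen s V (a, xs @ [(d, x), (d', y)] @ ys) -
    ksgn (d * d') (Fgen s V (a, xs @ [(d', y), (d, x)] @ ys)) \<in> H"
proof -
  note H = mform_subgrp[OF V]
  have f: "x \<in> mpart (smod s) d" "y \<in> mpart (smod s) d'" "xs \<in> factors (smod s) (length xs)"
    "ys \<in> factors (smod s) (length ys)" "Suc (Suc (length xs + length ys)) = r"
    using assms(2) by (auto simp: factors_append factors_Cons)
  obtain u v where u: "u \<in> omega_pre (s + d)" "x = u +o omega_sub A"
    and v: "v \<in> omega_pre (s + d')" "y = v +o omega_sub A" using f(1,2) by (metis mpart_smodE)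
  let ?X = "map (rep s) xs" and ?Y = "map (rep s) ys" and ?n = "length xs"
  have r0: "is_rep s (xs @ [(d, x), (d', y)] @ ys) (?X @ u # v # ?Y)"
    using u v is_rep_rep[OF f(3)] is_rep_rep[OF f(4)] by (intro is_rep_append) (auto simp: is_rep_Cons)
  have r1: "is_rep s (xs @ [(d', y), (d, x)] @ ys) (?X @ v # u # ?Y)"
    using u v is_rep_rep[OF f(3)] is_rep_rep[OF f(4)] by (intro is_rep_append) (auto simp: is_rep_Cons)
  let ?\<tau> = "transpose ?n (Suc ?n)"
  have \<tau>: "?\<tau> permutes {..<r}" using f(5) by (intro permutes_swap_id) auto
  let ?D = "\<lambda>l. mext (U s V k a) l - ksgn (d * d') (mext (U s V k a) (permute_list ?\<tau> l))"
  have "?D (?X @ u # v # ?Y) \<in> H"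
  proof (rule mext_closure[OF V _ r0])
    show "madd r ?D" by (intro madd_diff madd_ksgn madd_permute[OF _ \<tau>] mext_madd)
    fix qs assume qs: "hom_quads qs" "length qs = r"
      "list_all2 (\<lambda>(p, b, q, f) (d, x). p + q - s = d) qs (xs @ [(d, x), (d', y)] @ ys)"
    obtain P p b q f p' b' q' f' Q where q: "qs = P @ (p, b, q, f) # (p', b', q', f') # Q" "length P = ?n"
      "p + q - s = d" "p' + q' - s = d'"
      using qs(3) by (fastforce simp: list_all2_append2 list_all2_Cons2 dest: list_all2_lengthD)
    have "expand s V k a (P @ (p, b, q, f) # (p', b', q', f') # Q) -
      ksgn ((p + q - s) * (p' + q' - s)) (expand s V k a (P @ (p', b', q', f') # (p, b, q, f) # Q)) \<in> H"
      using qs q by (intro expand_swap[OF V assms(1)]) auto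
    from U_cong2[OF assms(1) _ _ assms(1) _ _ this]
    have *: "U s V k a (forget_deg qs) -
      ksgn (d * d') (U s V k a (forget_deg (P @ (p', b', q', f') # (p, b, q, f) # Q))) \<in> H"
      using qs q by auto
    have "permute_list ?\<tau> (map frag_of (forget_deg qs)) =
       map frag_of (forget_deg (P @ (p', b', q', f') # (p, b, q, f) # Q))"
      unfolding q(1) using permute_list_adjacent[of "map frag_of (forget_deg P)"] q(2) by simp
    then show "?D (map frag_of (forget_deg qs)) \<in> H"
      using * by (simp only: mext_of)
  qed (use f in auto)
  then have "mext (U s V k a) (?X @ u # v # ?Y) - ksgn (d * d') (mext (U s V k a) (?X @ v # u # ?Y)) \<in> H"
    using permute_list_adjacent[of ?X u v ?Y] by simp
  from subgrp_cong_trans[OF H Fgen_cong[OF assms(1) r0] this]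
  have 1: "Fgen s V (a, xs @ [(d, x), (d', y)] @ ys) - ksgn (d * d') (mext (U s V k a) (?X @ v # u # ?Y)) \<in> H"
    using f by simp
  have "Fgen s V (a, xs @ [(d', y), (d, x)] @ ys) - mext (U s V k a) (?X @ v # u # ?Y) \<in> H"
    using f by (intro Fgen_cong[OF assms(1) r1]) simp
  from subgrp_cong_trans[OF H 1 subgrp_ksgn[OF H subgrp_cong_sym[OF H this], of "d * d'", unfolded ksgn_diff]]
  show ?thesis .
qed

text \<open>Every clause of \<open>tens_rel\<close> and \<open>sym_rel\<close> is matched by one of
  the preceding lemmas, so the extension descends to the symmetric power.\<close>

lemma fext_Fgen_sym_sub:
  assumes "x \<in> sym_sub (gr A) (smod s) r"
  shows "fext (Fgen s V) x \<in> H"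
proof (rule group_closure_induct_subgrp[OF assms mform_subgrp[OF V] _ fext_diff])
  note H = mform_subgrp[OF V]
  fix z assume "z \<in> sym_rel (gr A) (smod s) r"
  then consider "z \<in> tens_rel (gr A) (smod s) r" | a i xs d x d' y ys where
    "z = frag_of (a, xs @ [(d, x), (d', y)] @ ys) - ksgn (d * d') (frag_of (a, xs @ [(d', y), (d, x)] @ ys))"
    "a \<in> gr A i" "xs @ [(d, x), (d', y)] @ ys \<in> factors (smod s) r"
    unfolding sym_rel_def by blast
  then show "fext (Fgen s V) z \<in> H"
  proof cases
    case 1
    then show ?thesis
      by cases (simp_all only: fext_diff fext_of, auto intro: Fgen_add_coeff Fgen_add_arg[simplified]
        Fgen_scalar Fgen_balanced[simplified])
  next
    case 2
    have "fext (Fgen s V) (ksgn e w) = ksgn e (fext (Fgen s V) w)" for e w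
      by (simp add: ksgn_def fext_minus)
    then show ?thesis using Fgen_swap[OF 2(2,3)] by (simp only: 2(1) fext_diff fext_of)
  qed
qed

lemma fext_Fgen_dd:
  assumes "a \<in> gr A k" "fs \<in> homog_args A" "length fs = r"
  shows "fext (Fgen s V) (frag_of (a, map (\<lambda>(d, f). (d - s, dd A f)) fs)) - V k a fs \<in> H"
proof -
  note H = mform_subgrp[OF V]
  let ?qs = "map (\<lambda>(d, f). (0 :: int, 1 :: 'a, d, f)) fs"
  have "is_rep s (map (\<lambda>(d, f). (d - s, dd A f)) fs) (map frag_of (forget_deg ?qs))"
    using assms(2)
    by (induction fs) (auto simp: is_rep_def is_rep_Cons dd_def intro!: group_closure.base insertI2 omega_gensI[of 1 0])
  from Fgen_cong[OF assms(1) this]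
  have 1: "Fgen s V (a, map (\<lambda>(d, f). (d - s, dd A f)) fs) - U s V k a (forget_deg ?qs) \<in> H"
    using assms(3) by (simp only: mext_of) simp
  have q: "hom_quads ?qs" "coeff_exp s ?qs = 0" "coeff_deg ?qs = 0" "coeff_prod ?qs = 1" "diff_args ?qs = fs"
    using assms(2) by (induction fs) auto
  have "expand s V k a ?qs = V k a fs" unfolding expand_def q(2-5) by simp
  then have "U s V k a (forget_deg ?qs) - V k a fs \<in> H"
    using U_eq[OF V assms(1) q(1)] assms(3) by (simp del: map_map)
  from subgrp_cong_trans[OF H 1 this] show ?thesis by simp
qed

end

end

section \<open>Symmetrisation\<close>

definition inv_pairs :: "nat \<Rightarrow> (nat \<times> nat) set"
  where "inv_pairs m = {(k, l). k < l \<and> l < m}"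

lemma finite_inv_pairs [simp]: "finite (inv_pairs m)"
  by (rule finite_subset[of _ "{..<m} \<times> {..<m}"]) (auto simp: inv_pairs_def)

text \<open>With all pairs as index set and summands that may vanish, the index set does not depend
  on \<sigma>, which permits reindexing by another permutation.\<close>

lemma perm_exp_altdef: "perm_exp \<sigma> ds =
    (\<Sum>(k, l) \<in> inv_pairs (length ds). if \<sigma> l < \<sigma> k then ds ! \<sigma> k * ds ! \<sigma> l else 0)"
proof -
  have "{(k, l). k < l \<and> l < length ds \<and> \<sigma> l < \<sigma> k} =
     {z \<in> inv_pairs (length ds). case z of (k, l) \<Rightarrow> \<sigma> l < \<sigma> k}"
    by (auto simp: inv_pairs_def)
  then show ?thesis
    unfolding perm_exp_def by (simp add: sum.inter_filter case_prod_unfold)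
qed

text \<open>Pairs k < l stand for sets with two elements, on which g acts; \<open>min\<close> and
  \<open>max\<close> restore the order.\<close>

lemma inv_pairs_reindex:
  assumes "g permutes {..<m}"
  shows "bij_betw (\<lambda>(k, l). (min (g k) (g l), max (g k) (g l))) (inv_pairs m) (inv_pairs m)"
proof -
  let ?h = "\<lambda>(k, l). (min (g k) (g l), max (g k) (g l))"
  have inj: "g k = g l \<longleftrightarrow> k = l" for k l using permutes_inj[OF assms] by (auto dest: injD)
  have bound: "g k < m" if "k < m" for k using permutes_in_image[OF assms, of k] that by auto
  have 1: "inj_on ?h (inv_pairs m)"
    by (auto simp: inj_on_def inv_pairs_def min_def max_def inj split: if_splits)
  have "?h ` inv_pairs m \<subseteq> inv_pairs m"
    using bound inj by (fastforce simp: inv_pairs_def min_def max_def nat_less_le)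
  with 1 have "?h ` inv_pairs m = inv_pairs m" by (intro endo_inj_surj) auto
  with 1 show ?thesis by (simp add: bij_betw_def)
qed

text \<open>A pair is inverted by \<open>f \<circ> g\<close> iff it is inverted by exactly one of \<open>g\<close> and (after \<open>g\<close>) \<open>f\<close>.\<close>

lemma perm_exp_compose:
  assumes f: "f permutes {..<length ds}" and g: "g permutes {..<length ds}"
  shows "even (perm_exp (f \<circ> g) ds - (perm_exp f ds + perm_exp g (permute_list f ds)))"
proof -
  let ?P = "inv_pairs (length ds)"
  let ?w = "\<lambda>k l. ds ! f (g k) * ds ! f (g l)"
  have finj: "f k = f l \<longleftrightarrow> k = l" and ginj: "g k = g l \<longleftrightarrow> k = l" for k l
    using permutes_inj[OF f] permutes_inj[OF g] by (auto dest: injD)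
  have bound: "g k < length ds" if "k < length ds" for k using permutes_in_image[OF g, of k] that by auto
  have "perm_exp f ds = (\<Sum>(k, l) \<in> ?P. if f (max (g k) (g l)) < f (min (g k) (g l)) then ?w k l else 0)"
    unfolding perm_exp_altdef
    by (subst sum.reindex_bij_betw[OF inv_pairs_reindex[OF g], symmetric])
      (auto intro!: sum.cong simp: min_def max_def mult.commute)
  moreover have "perm_exp g (permute_list f ds) = (\<Sum>(k, l) \<in> ?P. if g l < g k then ?w k l else 0)"
    unfolding perm_exp_altdef length_permute_list
    by (intro sum.cong refl) (auto simp: inv_pairs_def permute_list_nth[OF f] bound)
  ultimately have "perm_exp (f \<circ> g) ds - (perm_exp f ds + perm_exp g (permute_list f ds)) =
    (\<Sum>(k, l) \<in> ?P. (if f (g l) < f (g k) then ?w k l else 0) -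
      ((if f (max (g k) (g l)) < f (min (g k) (g l)) then ?w k l else 0) + (if g l < g k then ?w k l else 0)))"
    by (simp add: perm_exp_altdef sum_subtractf sum.distrib case_prod_unfold cong: if_cong)
  also have "even \<dots>"
  proof (rule dvd_sum, clarify)
    fix k l assume "(k, l) \<in> ?P"
    then have "k \<noteq> l" by (auto simp: inv_pairs_def)
    then have "g k \<noteq> g l" "f (g k) \<noteq> f (g l)" by (auto simp: finj ginj)
    then show "even ((if f (g l) < f (g k) then ?w k l else 0) -
      ((if f (max (g k) (g l)) < f (min (g k) (g l)) then ?w k l else 0) + (if g l < g k then ?w k l else 0)))"
      by (auto simp: min_def max_def)
  qed
  finally show ?thesis .
qed

lemma perm_exp_id [simp]: "perm_exp id ds = 0"
  unfolding perm_exp_altdef by (rule sum.neutral) (auto simp: inv_pairs_def)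

lemma perm_exp_adjacent:
  assumes "Suc m < length ds"
  shows "perm_exp (transpose m (Suc m)) ds = ds ! m * ds ! Suc m"
proof -
  have "{(k, l). k < l \<and> l < length ds \<and> transpose m (Suc m) l < transpose m (Suc m) k} = {(m, Suc m)}"
    using assms by (auto simp: transpose_def split: if_splits)
  then show ?thesis by (simp add: perm_exp_def mult.commute)
qed

text \<open>Koszul signs are easily computed for neighbouring factors only. Conjugation reaches the
  remaining transpositions, and these generate all permutations.\<close>

lemma permutes_adjacent_induct:
  assumes "\<sigma> permutes {..<m}" and "P id"
    and comp: "\<And>f g. f permutes {..<m} \<Longrightarrow> g permutes {..<m} \<Longrightarrow> P f \<Longrightarrow> P g \<Longrightarrow> P (f \<circ> g)"
    and adj: "\<And>k. Suc k < m \<Longrightarrow> P (transpose k (Suc k))"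
  shows "P \<sigma>"
proof -
  have less: "P (transpose a b)" if "a < b" "b < m" for a b
    using that
  proof (induction b)
    case 0
    then show ?case by simp
  next
    case (Suc b)
    show ?case
    proof (cases "a = b")
      case True
      then show ?thesis using adj Suc.prems by simp
    next
      case False
      have p: "transpose b (Suc b) permutes {..<m}" "transpose a b permutes {..<m}"
        using Suc.prems False by (auto intro!: permutes_swap_id)
      \<comment> \<open>Conjugation with the transposition of b and b + 1 moves the end point b to b
        + 1.\<close>
      have eq: "transpose a (Suc b) = transpose b (Suc b) \<circ> transpose a b \<circ> transpose b (Suc b)"
        using Suc.prems False by (auto simp: fun_eq_iff transpose_def)
      have "P (transpose a b)" using Suc False by auto
      then have "P (transpose b (Suc b) \<circ> transpose a b)"
        using comp[OF p] adj[of b] Suc.prems by blast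
      then show ?thesis
        unfolding eq using comp[OF permutes_compose[OF p(2,1)] p(1)] adj[of b] Suc.prems by blast
    qed
  qed
  have transp: "P (transpose a b)" if "a < m" "b < m" "a \<noteq> b" for a b
    using less[of a b] less[of b a] that by (cases "a < b") (auto simp: transpose_commute)
  show ?thesis
    using assms(1) finite_lessThan[of m]
  proof (induction rule: permutes_induct)
    case id
    show ?case by (rule assms(2))
  next
    case (swap a b p)
    then show ?case by (intro comp transp permutes_swap_id) auto
  qed
qed

section \<open>The signed action of permutations on tensors\<close>

lemma perm_tens_diff: "perm_tens \<sigma> (x - y) = perm_tens \<sigma> x - perm_tens \<sigma> y"
  by (simp add: perm_tens_def frag_extend_diff)

lemma perm_tens_add: "perm_tens \<sigma> (x + y) = perm_tens \<sigma> x + perm_tens \<sigma> y"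
  by (simp add: perm_tens_def frag_extend_add)

lemma perm_tens_0 [simp]: "perm_tens \<sigma> 0 = 0"
  by (simp add: perm_tens_def)

lemma perm_tens_ksgn: "perm_tens \<sigma> (ksgn e x) = ksgn e (perm_tens \<sigma> x)"
  by (simp add: ksgn_def perm_tens_def frag_extend_minus)

lemma perm_tens_of: "perm_tens \<sigma> (frag_of (a, ms)) =
    ksgn (perm_exp \<sigma> (map fst ms)) (frag_of (a, permute_list \<sigma> ms))"
  by (simp add: perm_tens_def)

text \<open>\<open>permute_list\<close> is meaningful only for permutations of the actual positions,
  so the composition law requires a fixed number of factors.\<close>

definition tens_len :: "nat \<Rightarrow> ('a, 'm) tens set"
  where "tens_len m = group_closure {frag_of (a, ms) | a ms. length ms = m}"

lemma tens_lenI: "length ms = m \<Longrightarrow> frag_of (a, ms) \<in> tens_len m"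
  unfolding tens_len_def by (rule group_closure.base) auto

lemma subgrp_tens_len [simp]: "subgrp (tens_len m)"
  by (simp add: tens_len_def)

lemma tens_len_induct:
  assumes "x \<in> tens_len m" "\<And>a ms. length ms = m \<Longrightarrow> \<phi> (frag_of (a, ms)) = (0 :: 'b::ab_group_add)"
    and "\<And>x y. \<phi> (x - y) = \<phi> x - \<phi> y"
  shows "\<phi> x = 0"
  using group_closure_induct_subgrp[OF assms(1)[unfolded tens_len_def] subgrp_0, of \<phi>] assms(2,3) by auto

text \<open>Permuting the entries of a list is a right action, hence the reversed order; the signs
  agree by \<open>perm_exp_compose\<close>.\<close>

lemma perm_tens_compose:
  assumes "x \<in> tens_len m" "f permutes {..<m}" "g permutes {..<m}"
  shows "perm_tens (f \<circ> g) x = perm_tens g (perm_tens f x)"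
proof -
  have "perm_tens (f \<circ> g) x - perm_tens g (perm_tens f x) = 0"
  proof (rule tens_len_induct[OF assms(1)])
    fix a :: 'a and ms :: "(int \<times> 'b) list" assume ms: "length ms = m"
    have "even (perm_exp (f \<circ> g) (map fst ms) - (perm_exp f (map fst ms) + perm_exp g (map fst (permute_list f ms))))"
      using perm_exp_compose[of f "map fst ms" g] assms(2,3) ms by (simp add: permute_list_map)
    then show "perm_tens (f \<circ> g) (frag_of (a, ms)) - perm_tens g (perm_tens f (frag_of (a, ms))) = 0"
      using assms(3) ms by (simp add: perm_tens_of perm_tens_ksgn permute_list_compose) (rule ksgn_cong_diff, auto)
  qed (simp add: perm_tens_diff)
  then show ?thesis by simp
qed

lemma perm_tens_id [simp]: "perm_tens id x = x"
proof -
  have *: "(\<lambda>(a, ms). ksgn (perm_exp id (map fst ms)) (frag_of (a, permute_list id ms))) = frag_of"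
    by (auto simp: fun_eq_iff)
  show ?thesis unfolding perm_tens_def * by (rule frag_expansion[symmetric])
qed

lemma factors_permute:
  assumes "ms \<in> factors M m" "\<sigma> permutes {..<m}"
  shows "permute_list \<sigma> ms \<in> factors M m"
  using assms by (auto simp: factors_def)

lemma sum_list_permute:
  "\<sigma> permutes {..<length ds} \<Longrightarrow> sum_list (permute_list \<sigma> ds) = (sum_list ds :: int)"
  by (metis mset_permute_list sum_mset_sum_list)

lemma tens_pre_len: "x \<in> tens_pre G M m d \<Longrightarrow> x \<in> tens_len m"
  unfolding tens_pre_def
  by (erule group_closure_induct_subgrp[where \<phi> = "\<lambda>x. x"]) (auto intro: tens_lenI simp: factors_def)

lemma tens_preI: "a \<in> G i \<Longrightarrow> ms \<in> factors M m \<Longrightarrow> i + sum_list (map fst ms) = d \<Longrightarrow>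
    frag_of (a, ms) \<in> tens_pre G M m d"
  unfolding tens_pre_def by (rule group_closure.base) blast

lemma perm_tens_pre:
  assumes "\<sigma> permutes {..<m}" "x \<in> tens_pre G M m d"
  shows "perm_tens \<sigma> x \<in> tens_pre G M m d"
  using assms(2) unfolding tens_pre_def
proof (rule group_closure_induct_subgrp)
  fix s assume "s \<in> {frag_of (a, ms) | a ms i. a \<in> G i \<and> ms \<in> factors M m \<and> i + sum_list (map fst ms) = d}"
  then obtain a ms i where s: "s = frag_of (a, ms)" "a \<in> G i" "ms \<in> factors M m" "i + sum_list (map fst ms) = d"
    by blast
  have "sum_list (map fst (permute_list \<sigma> ms)) = sum_list (map fst ms)"
    using assms(1) s(3) sum_list_permute[of \<sigma> "map fst ms"] by (simp add: factors_length permute_list_map)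
  then have "frag_of (a, permute_list \<sigma> ms) \<in> tens_pre G M m d"
    using s factors_permute[OF s(3) assms(1)] by (intro tens_preI) auto
  then show "perm_tens \<sigma> s \<in> group_closure
     {frag_of (a, ms) | a ms i. a \<in> G i \<and> ms \<in> factors M m \<and> i + sum_list (map fst ms) = d}"
    unfolding s(1) perm_tens_of tens_pre_def by (intro subgrp_ksgn) auto
qed (auto simp: perm_tens_diff)

lemma tens_sub_len: "x \<in> tens_sub G M m \<Longrightarrow> x \<in> tens_len m"
proof (erule group_closure_induct_subgrp[where \<phi> = "\<lambda>x. x"])
  fix z assume "z \<in> tens_rel G M m"
  then show "z \<in> tens_len m"
    by cases (auto intro!: subgrp_diff tens_lenI simp: factors_def)
qed auto

lemma tens_sub_sym_sub: "x \<in> tens_sub G M m \<Longrightarrow> x \<in> sym_sub G M m"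
  by (erule group_closure_induct_subgrp[where \<phi> = "\<lambda>x. x"])
    (auto simp: sym_rel_def intro: group_closure.base)

lemma perm_exp_of_adjacent:
  "perm_exp (transpose (length xs) (Suc (length xs))) (map fst (xs @ (d, x) # (d', y) # ys)) = d * d'"
  by (subst perm_exp_adjacent) (auto simp: nth_append)

lemma split_adjacent:
  assumes "Suc k < length ms"
  obtains xs x y ys where "ms = xs @ x # y # ys" "length xs = k"
proof
  show "ms = take k ms @ ms ! k # ms ! Suc k # drop (Suc (Suc k)) ms"
    using assms by (simp add: Cons_nth_drop_Suc)
qed (use assms in simp)

text \<open>For neighbouring transpositions and one symbol this is a generator of
  \<open>sym_rel\<close> up to sign. Along a composition the congruences are chained, since
  \<open>perm_tens\<close> preserves \<open>tens_pre\<close>.\<close>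

lemma perm_tens_sym_sub:
  assumes "\<sigma> permutes {..<m}" "x \<in> tens_pre G M m d"
  shows "perm_tens \<sigma> x - x \<in> sym_sub G M m"
proof -
  have "\<forall>x \<in> tens_pre G M m d. perm_tens \<sigma> x - x \<in> sym_sub G M m"
    using assms(1)
  proof (rule permutes_adjacent_induct[where P = "\<lambda>\<sigma>. \<forall>x \<in> tens_pre G M m d. perm_tens \<sigma> x - x \<in> sym_sub G M m"])
    fix f g assume fg: "f permutes {..<m}" "g permutes {..<m}"
      "\<forall>x \<in> tens_pre G M m d. perm_tens f x - x \<in> sym_sub G M m"
      "\<forall>x \<in> tens_pre G M m d. perm_tens g x - x \<in> sym_sub G M m"
    show "\<forall>x \<in> tens_pre G M m d. perm_tens (f \<circ> g) x - x \<in> sym_sub G M m"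
    proof
      fix x assume x: "x \<in> tens_pre G M m d"
      have "perm_tens g (perm_tens f x) - perm_tens f x \<in> sym_sub G M m"
        using fg perm_tens_pre[OF fg(1) x] by blast
      from subgrp_cong_trans[OF subgrp_closure this] fg(3) x
      show "perm_tens (f \<circ> g) x - x \<in> sym_sub G M m"
        by (simp add: perm_tens_compose[OF tens_pre_len[OF x] fg(1,2)])
    qed
  next
    fix k assume k: "Suc k < m"
    show "\<forall>x \<in> tens_pre G M m d. perm_tens (transpose k (Suc k)) x - x \<in> sym_sub G M m"
    proof
      fix x assume "x \<in> tens_pre G M m d"
      then show "perm_tens (transpose k (Suc k)) x - x \<in> sym_sub G M m"
        unfolding tens_pre_def
      proof (rule group_closure_induct_subgrp)
        fix z assume "z \<in> {frag_of (a, ms) | a ms i. a \<in> G i \<and> ms \<in> factors M m \<and> i + sum_list (map fst ms) = d}"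
        then obtain a ms i where z: "z = frag_of (a, ms)" "a \<in> G i" "ms \<in> factors M m" by blast
        obtain xs u v ys where ms: "ms = xs @ u # v # ys" "length xs = k"
          using split_adjacent k factors_length[OF z(3)] by metis
        obtain e u' e' v' where uv: "u = (e, u')" "v = (e', v')" by (cases u, cases v)
        have "perm_tens (transpose k (Suc k)) z = ksgn (e * e') (frag_of (a, xs @ (e', v') # (e, u') # ys))"
          unfolding z(1) ms(1) uv perm_tens_of ms(2)[symmetric] permute_list_adjacent perm_exp_of_adjacent ..
        moreover have "z - ksgn (e * e') (frag_of (a, xs @ (e', v') # (e, u') # ys)) \<in> sym_rel G M m"
          using z ms(1) unfolding sym_rel_def uv by (intro UnI2 CollectI exI[of _ a] exI[of _ i] exI[of _ xs]
            exI[of _ e] exI[of _ u'] exI[of _ e'] exI[of _ v'] exI[of _ ys]) auto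
        ultimately show "perm_tens (transpose k (Suc k)) z - z \<in> sym_sub G M m"
          by (intro subgrp_cong_sym[OF subgrp_closure, of z]) (simp add: group_closure.base)
      qed (auto simp: perm_tens_diff)
    qed
  qed (auto simp: perm_tens_id)
  then show ?thesis using assms(2) by blast
qed

section \<open>The symmetriser\<close>

definition Sym :: "nat \<Rightarrow> ('a, 'm) tens \<Rightarrow> ('a, 'm) tens"
  where "Sym m x = (\<Sum>\<sigma> \<in> {\<sigma>. \<sigma> permutes {..<m}}. perm_tens \<sigma> x)"

lemma Sym_diff: "Sym m (x - y) = Sym m x - Sym m y"
  by (simp add: Sym_def perm_tens_diff sum_subtractf)

lemma symmetrisation_Sym: "symmetrisation ms = Sym (length ms) (frag_of (1, ms))"
  by (simp add: symmetrisation_def Sym_def)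

lemma perm_tens_sum: "perm_tens \<sigma> (\<Sum>i\<in>I. f i) = (\<Sum>i\<in>I. perm_tens \<sigma> (f i))"
  by (induction I rule: infinite_finite_induct) (auto simp: perm_tens_add)

lemma perm_tens_Sym:
  assumes "x \<in> tens_len m" "\<sigma> permutes {..<m}"
  shows "perm_tens \<sigma> (Sym m x) = Sym m x"
proof -
  have "perm_tens \<sigma> (Sym m x) = (\<Sum>\<tau> \<in> {\<tau>. \<tau> permutes {..<m}}. perm_tens (\<tau> \<circ> \<sigma>) x)"
    unfolding Sym_def perm_tens_sum using assms by (intro sum.cong) (auto simp: perm_tens_compose)
  then show ?thesis unfolding Sym_def by (simp add: sum_permutations_compose_right[OF assms(2), of "\<lambda>\<tau>. perm_tens \<tau> x"])
qed

lemma Sym_perm_tens: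
  assumes "x \<in> tens_len m" "\<sigma> permutes {..<m}"
  shows "Sym m (perm_tens \<sigma> x) = Sym m x"
proof -
  have "Sym m (perm_tens \<sigma> x) = (\<Sum>\<tau> \<in> {\<tau>. \<tau> permutes {..<m}}. perm_tens (\<sigma> \<circ> \<tau>) x)"
    unfolding Sym_def using assms by (intro sum.cong) (auto simp: perm_tens_compose)
  then show ?thesis unfolding Sym_def by (simp add: setum_permutations_compose_left[OF assms(2), of "\<lambda>\<tau>. perm_tens \<tau> x"])
qed

definition tact :: "'a::times \<Rightarrow> ('a, 'm) tens \<Rightarrow> ('a, 'm) tens"
  where "tact c = frag_extend (\<lambda>(a, ms). frag_of (c * a, ms))"

lemma tact_of [simp]: "tact c (frag_of (a, ms)) = frag_of (c * a, ms)"
  by (simp add: tact_def)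

lemma tact_diff: "tact c (x - y) = tact c x - tact c y"
  by (simp add: tact_def frag_extend_diff)

lemma tact_ksgn: "tact c (ksgn e x) = ksgn e (tact c x)"
  by (simp add: tact_def ksgn_def frag_extend_minus)

lemma tact_sum: "tact c (\<Sum>i\<in>I. f i) = (\<Sum>i\<in>I. tact c (f i))"
  by (induction I rule: infinite_finite_induct) (auto simp: tact_def frag_extend_add)

lemma tact_perm_tens:
  assumes "x \<in> tens_len m"
  shows "tact c (perm_tens \<sigma> x) = perm_tens \<sigma> (tact c x)"
proof -
  have "tact c (perm_tens \<sigma> x) - perm_tens \<sigma> (tact c x) = 0"
    by (rule tens_len_induct[OF assms]) (auto simp: perm_tens_of tact_ksgn tact_diff perm_tens_diff)
  then show ?thesis by simp
qed

lemma tact_Sym: "x \<in> tens_len m \<Longrightarrow> tact c (Sym m x) = Sym m (tact c x)"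
  by (simp add: Sym_def tact_sum tact_perm_tens)

text \<open>A scalar of degree e is moved from the front into factor j, either before or after u and
  v are exchanged. If j is one of the exchanged factors, its degree has grown by e; this changes the
  exchange sign by the same amount as the way from the front to j changes.\<close>

lemma adjacent_parity:
  fixes A B :: "int list"
  assumes "j < length (A @ u # v # B)" "\<tau> = transpose (length A) (Suc (length A))"
  shows "even (u * v + e * sum_list (take (\<tau> j) (A @ v # u # B)) -
    (e * sum_list (take j (A @ u # v # B)) +
      perm_exp \<tau> ((A @ u # v # B)[j := e + (A @ u # v # B) ! j])))"
proof -
  have E: "perm_exp \<tau> (A' @ u' # v' # B') = u' * v'" if "length A' = length A" for A' u' v' B'
    unfolding assms(2) using that by (subst perm_exp_adjacent) (auto simp: nth_append)
  have t: "\<tau> (length A) = Suc (length A)" "\<tau> (Suc (length A)) = length A"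
    "j \<noteq> length A \<Longrightarrow> j \<noteq> Suc (length A) \<Longrightarrow> \<tau> j = j"
    by (auto simp: assms(2) transpose_def)
  consider "j < length A" | "j = length A" | "j = Suc (length A)" | "Suc (Suc (length A)) \<le> j" by linarith
  then show ?thesis
  proof cases
    case 1
    then show ?thesis by (simp add: t list_update_append E)
  next
    case 2
    then show ?thesis by (simp add: t list_update_append E algebra_simps)
  next
    case 3
    then show ?thesis by (simp add: t list_update_append nth_append E algebra_simps)
  next
    case 4
    have "\<tau> j = j" using 4 by (intro t(3)) auto
    moreover obtain k where "j = Suc (Suc (length A + k))" using le_Suc_ex[OF 4] by auto
    ultimately show ?thesis by (simp add: list_update_append nth_append E algebra_simps)
  qed
qed

context graded_algebra
begin

section \<open>Stability of the tensor relations under permutations\<close>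

lemma mact_mpart:
  assumes "c \<in> gr A e" "x \<in> mpart (smod s) d"
  shows "mact (smod s) e c x \<in> mpart (smod s) (e + d)"
proof -
  obtain y where y: "y \<in> omega_pre (s + d)" "x = y +o omega_sub A" using mpart_smodE[OF assms(2)] .
  have "cact (ksgn (s * e) c) y \<in> omega_pre (s + (e + d))"
    using cact_omega_pre[OF gr_ksgn[OF assms(1)] y(1)] by (simp add: algebra_simps)
  then show ?thesis by (auto simp: y(2) mact_smod[OF assms(1)] mpart_smod mpart_omega)
qed

abbreviation tsub :: "int \<Rightarrow> nat \<Rightarrow> ('a, ('a \<times> 'a \<Rightarrow>\<^sub>0 int) set) tens set"
  where "tsub s r \<equiv> tens_sub (gr A) (smod s) r"

lemma tens_zero_coeff: "ms \<in> factors (smod s) r \<Longrightarrow> frag_of (0, ms) \<in> tsub s r"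
  using group_closure.base[OF insertI2, OF tens_rel.intros(1)[of 0 "gr A" 0 0 ms "smod s" r]]
    group_closure_minus_iff[of "frag_of (0, ms)"] by simp

lemma tens_ksgn_coeff:
  assumes "a \<in> gr A i" "ms \<in> factors (smod s) r"
  shows "frag_of (ksgn u a, ms) - ksgn u (frag_of (a, ms)) \<in> tsub s r"
proof (cases "even u")
  case True
  then show ?thesis by (simp add: ksgn_even)
next
  case False
  have "frag_of (a + - a, ms) - frag_of (a, ms) - frag_of (- a, ms) \<in> tsub s r"
    by (intro group_closure.base insertI2 tens_rel.intros(1)[of _ _ i]) (use assms in auto)
  from subgrp_diff[OF subgrp_closure tens_zero_coeff[OF assms(2)] this]
  show ?thesis using False by (simp add: ksgn_odd add.commute)
qed

text \<open>\<open>tens_rel\<close> moves a scalar from the front into the first factor only. From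
  there the balancing relation hands it on, at the price of \<open>d' * e\<close> for each factor
  passed; hence the induction from the right end of \<open>xs\<close>.\<close>

lemma tens_scalar_at:
  assumes "c \<in> gr A e"
  shows "a \<in> gr A i \<Longrightarrow> xs @ (d, x) # ys \<in> factors (smod s) r \<Longrightarrow>
    frag_of (a * c, xs @ (d, x) # ys) -
    ksgn (e * sum_list (map fst xs)) (frag_of (a, xs @ (e + d, mact (smod s) e c x) # ys)) \<in> tsub s r"
  using assms
proof (induction xs arbitrary: c d x ys rule: rev_induct)
  case Nil
  then show ?case by (auto intro!: group_closure.base tens_rel.intros(3))
next
  case (snoc z xs)
  obtain d' y where z: "z = (d', y)" by (cases z)
  let ?c = "ksgn (d' * e) c"
  note T = subgrp_cong_trans[OF subgrp_closure]
  have c: "?c \<in> gr A e" using snoc.prems(3) by auto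
  have 1: "frag_of (a * ?c, xs @ (d', y) # (d, x) # ys) -
    ksgn (e * sum_list (map fst xs)) (frag_of (a, xs @ (e + d', mact (smod s) e ?c y) # (d, x) # ys)) \<in> tsub s r"
    using snoc.IH[OF snoc.prems(1) _ c, of d' y "(d, x) # ys"] snoc.prems(2) z by simp
  have 2: "frag_of (a, xs @ [(d' + e, mact (smod s) e ?c y), (d, x)] @ ys) -
      frag_of (a, xs @ [(d', y), (e + d, mact (smod s) e c x)] @ ys) \<in> tsub s r"
    using snoc.prems z by (intro group_closure.base insertI2 tens_rel.intros(4)[of a "gr A" i]) auto
  from T[OF 1 subgrp_ksgn[OF subgrp_closure 2, of "e * sum_list (map fst xs)", unfolded ksgn_diff, simplified add.commute[of d' e] append_Cons append_Nil]]
  have 3: "frag_of (a * ?c, xs @ (d', y) # (d, x) # ys) -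
    ksgn (e * sum_list (map fst xs)) (frag_of (a, xs @ (d', y) # (e + d, mact (smod s) e c x) # ys)) \<in> tsub s r"
    by simp
  have "frag_of (ksgn (d' * e) (a * c), xs @ (d', y) # (d, x) # ys) -
      ksgn (d' * e) (frag_of (a * c, xs @ (d', y) # (d, x) # ys)) \<in> tsub s r"
    using snoc.prems z by (intro tens_ksgn_coeff gr_mult) auto
  from T[OF subgrp_cong_sym[OF subgrp_closure this] 3[unfolded ksgn_mult]]
  have "ksgn (d' * e) (frag_of (a * c, xs @ (d', y) # (d, x) # ys)) -
    ksgn (e * sum_list (map fst xs)) (frag_of (a, xs @ (d', y) # (e + d, mact (smod s) e c x) # ys)) \<in> tsub s r" .
  from subgrp_ksgn[OF subgrp_closure this, of "d' * e"]
  show ?case by (simp add: z ksgn_diff ksgn_even algebra_simps)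
qed

lemma tens_scalar_nth:
  assumes "a \<in> gr A i" "c \<in> gr A e" "ms \<in> factors (smod s) r" "j < r"
  shows "frag_of (a * c, ms) - ksgn (e * sum_list (take j (map fst ms)))
    (frag_of (a, ms[j := (e + fst (ms ! j), mact (smod s) e c (snd (ms ! j)))])) \<in> tsub s r"
proof -
  have j: "j < length ms" using assms by (simp add: factors_length)
  show ?thesis
    using tens_scalar_at[OF assms(2,1), of "take j ms" "fst (ms ! j)" "snd (ms ! j)" "drop (Suc j) ms" s r] assms(3)
    by (simp add: id_take_nth_drop[OF j, symmetric] upd_conv_take_nth_drop[OF j] take_map)
qed

text \<open>The generators \<open>tens_rel\<close> are not permuted among themselves, as the scalar
  relation singles out the first factor. The scalar relation at an arbitrary position does better:
  the exchange carries position j to \<open>?\<tau> j\<close>, and the signs match by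
  \<open>adjacent_parity\<close>.\<close>

lemma perm_scalar_nth:
  assumes "a \<in> gr A i" "c \<in> gr A e" "ms \<in> factors (smod s) r" "j < r" "Suc k < r"
  shows "perm_tens (transpose k (Suc k)) (frag_of (a * c, ms) - ksgn (e * sum_list (take j (map fst ms)))
    (frag_of (a, ms[j := (e + fst (ms ! j), mact (smod s) e c (snd (ms ! j)))]))) \<in> tsub s r"
proof -
  let ?\<tau> = "transpose k (Suc k)"
  let ?v = "(e + fst (ms ! j), mact (smod s) e c (snd (ms ! j)))"
  let ?ms = "permute_list ?\<tau> ms"
  have len: "length ms = r" using assms(3) by (rule factors_length)
  have p: "?\<tau> permutes {..<r}" using assms(5) by (intro permutes_swap_id) auto
  have inv: "inv_into UNIV ?\<tau> = ?\<tau>" by (simp add: inv_transpose_eq)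
  have tj: "?\<tau> j < r" using permutes_in_image[OF p, of j] assms(4) by auto
  have nth: "?ms ! ?\<tau> j = ms ! j" using permute_list_nth[of ?\<tau> ms "?\<tau> j"] p len tj by simp
  have upd: "permute_list ?\<tau> (ms[j := ?v]) = ?ms[?\<tau> j := ?v]"
    using permute_list_update[of ?\<tau> ms j ?v] p len assms(4) inv by simp
  obtain xs x y ys where s: "ms = xs @ x # y # ys" "length xs = k"
    using split_adjacent assms(5) len by metis
  have ms': "?ms = xs @ y # x # ys" using permute_list_adjacent[of xs x y ys] s by simp
  have E: "perm_exp ?\<tau> (map fst ms) = fst x * fst y"
    using s assms(5) len by (subst perm_exp_adjacent) (auto simp: nth_append)
  have mapu: "map fst (ms[j := ?v]) = (map fst ms)[j := e + map fst ms ! j]"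
    using len assms(4) by (simp add: map_update)
  have par: "even (fst x * fst y + e * sum_list (take (?\<tau> j) (map fst ?ms)) -
    (e * sum_list (take j (map fst ms)) + perm_exp ?\<tau> (map fst (ms[j := ?v]))))"
  proof -
    have m: "map fst ms = map fst xs @ fst x # fst y # map fst ys"
      "map fst ?ms = map fst xs @ fst y # fst x # map fst ys" unfolding ms' using s by auto
    have "j < length (map fst xs @ fst x # fst y # map fst ys)" "length (map fst xs) = k"
      using s len assms(4) by auto
    then show ?thesis
      unfolding mapu m using adjacent_parity[of j "map fst xs" "fst x" "fst y" "map fst ys" ?\<tau> e] by blast
  qed
  have "frag_of (a * c, ?ms) - ksgn (e * sum_list (take (?\<tau> j) (map fst ?ms)))
    (frag_of (a, ?ms[?\<tau> j := ?v])) \<in> tsub s r"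
    using tens_scalar_nth[OF assms(1,2) factors_permute[OF assms(3) p] tj] by (simp add: nth)
  from subgrp_ksgn[OF subgrp_closure this, of "fst x * fst y"]
  have "ksgn (fst x * fst y) (frag_of (a * c, ?ms)) -
    ksgn (fst x * fst y + e * sum_list (take (?\<tau> j) (map fst ?ms))) (frag_of (a, ?ms[?\<tau> j := ?v])) \<in> tsub s r"
    by (simp add: ksgn_diff)
  moreover have "ksgn (fst x * fst y + e * sum_list (take (?\<tau> j) (map fst ?ms))) X =
    ksgn (e * sum_list (take j (map fst ms)) + perm_exp ?\<tau> (map fst (ms[j := ?v]))) X"
    for X :: "('a, ('a \<times> 'a \<Rightarrow>\<^sub>0 int) set) tens"
    by (rule ksgn_cong_diff[OF par refl])
  ultimately show ?thesis
    by (simp only: perm_tens_diff perm_tens_ksgn perm_tens_of E upd ksgn_ksgn)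
qed

text \<open>Additivity relations go to additivity relations. The other two kinds are combinations of
  scalar relations at fixed positions and of sign changes in the coefficient, which are handled by
  \<open>perm_scalar_nth\<close> and r0.\<close>

lemma perm_adjacent_tens_rel:
  assumes "z \<in> tens_rel (gr A) (smod s) r" "Suc k < r"
  shows "perm_tens (transpose k (Suc k)) z \<in> tsub s r"
proof -
  let ?\<tau> = "transpose k (Suc k)"
  have p: "?\<tau> permutes {..<r}" using assms(2) by (intro permutes_swap_id) auto
  note S = subgrp_closure[of "tens_rel (gr A) (smod s) r"]
  have r0: "perm_tens ?\<tau> (frag_of (ksgn u a, ms) - ksgn u (frag_of (a, ms))) \<in> tsub s r"
    if "a \<in> gr A i" "ms \<in> factors (smod s) r" for u a i ms
  proof -
    have "perm_tens ?\<tau> (frag_of (ksgn u a, ms) - ksgn u (frag_of (a, ms))) =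
      ksgn (perm_exp ?\<tau> (map fst ms)) (frag_of (ksgn u a, permute_list ?\<tau> ms) - ksgn u (frag_of (a, permute_list ?\<tau> ms)))"
      by (simp add: perm_tens_diff perm_tens_ksgn perm_tens_of ksgn_diff add.commute)
    then show ?thesis
      using tens_ksgn_coeff[OF that(1) factors_permute[OF that(2) p], of u] by (simp add: subgrp_ksgn[OF S])
  qed
  show ?thesis
    using assms(1)
  proof cases
    case (1 a i b ms)
    have "perm_tens ?\<tau> z = ksgn (perm_exp ?\<tau> (map fst ms)) (frag_of (a + b, permute_list ?\<tau> ms) -
        frag_of (a, permute_list ?\<tau> ms) - frag_of (b, permute_list ?\<tau> ms))"
      unfolding 1(1) by (simp add: perm_tens_diff perm_tens_of ksgn_diff)
    moreover have "frag_of (a + b, permute_list ?\<tau> ms) -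
        frag_of (a, permute_list ?\<tau> ms) - frag_of (b, permute_list ?\<tau> ms) \<in> tsub s r"
      using 1 factors_permute[OF 1(4) p] by (intro group_closure.base insertI2 tens_rel.intros(1))
    ultimately show ?thesis by (simp add: subgrp_ksgn[OF S])
  next
    case (2 a i x d y xs ys)
    let ?l = "xs @ [(d, x)] @ ys" and ?j = "inv_into UNIV ?\<tau> (length xs)"
    let ?L = "permute_list ?\<tau> ?l"
    have len: "length ?l = r" using factors_length[OF 2(5)] .
    have j: "?j < r" using permutes_in_image[OF permutes_inv[OF p], of "length xs"] len by auto
    have upd: "permute_list ?\<tau> (xs @ [(d, w)] @ ys) = take ?j ?L @ [(d, w)] @ drop (Suc ?j) ?L" for w
    proof -
      have "permute_list ?\<tau> (?l[length xs := (d, w)]) = ?L[?j := (d, w)]"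
        using p len by (intro permute_list_update) auto
      then show ?thesis using j len by (simp add: upd_conv_take_nth_drop)
    qed
    have "perm_tens ?\<tau> z = ksgn (perm_exp ?\<tau> (map fst ?l))
      (frag_of (a, take ?j ?L @ [(d, x + y)] @ drop (Suc ?j) ?L) -
       frag_of (a, take ?j ?L @ [(d, x)] @ drop (Suc ?j) ?L) -
       frag_of (a, take ?j ?L @ [(d, y)] @ drop (Suc ?j) ?L))"
      unfolding 2(1) perm_tens_diff perm_tens_of upd[symmetric] ksgn_diff by simp
    moreover have "take ?j ?L @ [(d, x)] @ drop (Suc ?j) ?L \<in> factors (smod s) r"
      unfolding upd[symmetric] by (rule factors_permute[OF 2(5) p])
    then have "frag_of (a, take ?j ?L @ [(d, x + y)] @ drop (Suc ?j) ?L) -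
       frag_of (a, take ?j ?L @ [(d, x)] @ drop (Suc ?j) ?L) -
       frag_of (a, take ?j ?L @ [(d, y)] @ drop (Suc ?j) ?L) \<in> tsub s r"
      using 2 by (intro group_closure.base insertI2 tens_rel.intros(2))
    ultimately show ?thesis by (simp add: subgrp_ksgn[OF S])
  next
    case (3 a i c e d x ys)
    then show ?thesis
      using perm_scalar_nth[OF 3(2,3,4), of 0 k] assms(2) by simp
  next
    case (4 a i c e xs d x d' y ys)
    let ?ms = "xs @ [(d, x), (d', y)] @ ys" and ?n = "length xs"
    let ?c = "ksgn (d * e) c" and ?S = "e * sum_list (map fst xs)"
    have len: "length ?ms = r" using factors_length[OF 4(4)] .
    have c: "?c \<in> gr A e" using 4(3) by auto
    let ?u = "frag_of (a, xs @ [(d + e, mact (smod s) e ?c x), (d', y)] @ ys)"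
    let ?v = "frag_of (a, xs @ [(d, x), (e + d', mact (smod s) e c y)] @ ys)"
    have r1: "perm_tens ?\<tau> (frag_of (a * ?c, ?ms) - ksgn ?S ?u) \<in> tsub s r"
      using perm_scalar_nth[OF 4(2) c 4(4), of ?n k] assms(2) len
      by (simp add: nth_append list_update_append take_map add.commute)
    have r2: "perm_tens ?\<tau> (frag_of (a * c, ?ms) - ksgn (?S + e * d) ?v) \<in> tsub s r"
      using perm_scalar_nth[OF 4(2,3,4), of "Suc ?n" k] assms(2) len
      by (simp add: nth_append list_update_append take_map distrib_left)
    have r3: "perm_tens ?\<tau> (frag_of (a * ?c, ?ms) - ksgn (d * e) (frag_of (a * c, ?ms))) \<in> tsub s r"
      using r0[OF gr_mult[OF 4(2,3)] 4(4), of "d * e"] by (simp add: ksgn_mult)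
    \<comment> \<open>The balancing relation compares the two ways of moving c from the front into
      one of two neighbouring factors.\<close>
    have "z = ksgn ?S ((frag_of (a * ?c, ?ms) - ksgn (d * e) (frag_of (a * c, ?ms))) -
        (frag_of (a * ?c, ?ms) - ksgn ?S ?u) + ksgn (d * e) (frag_of (a * c, ?ms) - ksgn (?S + e * d) ?v))"
      unfolding 4(1) by (simp add: ksgn_add ksgn_diff ksgn_even)
    then have "perm_tens ?\<tau> z = ksgn ?S (perm_tens ?\<tau> (frag_of (a * ?c, ?ms) - ksgn (d * e) (frag_of (a * c, ?ms))) -
        perm_tens ?\<tau> (frag_of (a * ?c, ?ms) - ksgn ?S ?u) +
        ksgn (d * e) (perm_tens ?\<tau> (frag_of (a * c, ?ms) - ksgn (?S + e * d) ?v)))"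
      by (simp only: perm_tens_ksgn perm_tens_add perm_tens_diff)
    then show ?thesis
      using r1 r2 r3 by (simp only: subgrp_ksgn[OF S] subgrp_add[OF S] subgrp_diff[OF S])
  qed
qed

lemma perm_tens_tsub:
  assumes "\<sigma> permutes {..<r}" "x \<in> tsub s r"
  shows "perm_tens \<sigma> x \<in> tsub s r"
proof -
  have "\<forall>x \<in> tsub s r. perm_tens \<sigma> x \<in> tsub s r"
    using assms(1)
  proof (rule permutes_adjacent_induct[where P = "\<lambda>\<sigma>. \<forall>x \<in> tsub s r. perm_tens \<sigma> x \<in> tsub s r"])
    fix f g assume "f permutes {..<r}" "g permutes {..<r}"
      "\<forall>x \<in> tsub s r. perm_tens f x \<in> tsub s r" "\<forall>x \<in> tsub s r. perm_tens g x \<in> tsub s r"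
    then show "\<forall>x \<in> tsub s r. perm_tens (f \<circ> g) x \<in> tsub s r"
      by (auto simp: perm_tens_compose[OF tens_sub_len])
  next
    fix k assume k: "Suc k < r"
    show "\<forall>x \<in> tsub s r. perm_tens (transpose k (Suc k)) x \<in> tsub s r"
      by (intro ballI, erule group_closure_induct_subgrp)
        (auto simp: perm_tens_diff intro: perm_adjacent_tens_rel[OF _ k])
  qed simp
  then show ?thesis using assms(2) by blast
qed

lemma Sym_tsub: "x \<in> tsub s r \<Longrightarrow> Sym r x \<in> tsub s r"
  unfolding Sym_def by (rule subgrp_sum) (auto intro: perm_tens_tsub)

lemma Sym_cong: "x - y \<in> tsub s r \<Longrightarrow> Sym r x +o tsub s r = Sym r y +o tsub s r"
  using Sym_tsub[of "x - y" s r] by (simp add: coset_eq_iff Sym_diff)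

section \<open>Tensors generated by differentials of functions\<close>

abbreviation dds :: "int \<Rightarrow> (int \<times> 'a) list \<Rightarrow> (int \<times> ('a \<times> 'a \<Rightarrow>\<^sub>0 int) set) list"
  where "dds s \<equiv> map (\<lambda>(d, f). (d - s, dd A f))"

lemma frag_dd_pre: "f \<in> gr A d \<Longrightarrow> frag_of (1, f) \<in> omega_pre d"
  by (intro group_closure.base insertI2 omega_gensI[of 1 0]) auto

lemma dd_mpart: "f \<in> gr A d \<Longrightarrow> dd A f \<in> mpart (smod s) (d - s)"
  using frag_dd_pre[of f d] by (auto simp: dd_def mpart_smod mpart_omega)

lemma dds_factors: "fs \<in> homog_args A \<Longrightarrow> length fs = r \<Longrightarrow> dds s fs \<in> factors (smod s) r"
  using dd_mpart by (fastforce simp: homog_args_def factors_def)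

lemma sum_dds: "sum_list (map fst (dds s fs)) = sdeg s fs"
  by (induction fs) auto

lemma length_dds [simp]: "length (dds s fs) = length fs"
  by simp

lemma tens_add_arg:
  assumes "a \<in> gr A i" "x \<in> mpart (smod s) d" "y \<in> mpart (smod s) d" "xs @ (d, x) # ys \<in> factors (smod s) r"
  shows "frag_of (a, xs @ (d, x + y) # ys) - frag_of (a, xs @ (d, x) # ys) - frag_of (a, xs @ (d, y) # ys) \<in> tsub s r"
  using tens_rel.intros(2)[of a "gr A" i x "smod s" d y xs ys r] assms by (auto intro: group_closure.base)

lemma tens_coset_zero:
  assumes "a \<in> gr A i" "xs @ (d, 0 +o omega_sub A) # ys \<in> factors (smod s) r"
  shows "frag_of (a, xs @ (d, 0 +o omega_sub A) # ys) \<in> tsub s r"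
proof -
  have "0 +o omega_sub A \<in> mpart (smod s) d" using assms(2) by (auto simp: factors_append factors_Cons)
  from tens_add_arg[OF assms(1) this this assms(2)]
  have "- frag_of (a, xs @ (d, 0 +o omega_sub A) # ys) \<in> tsub s r"
    unfolding coset_add by simp
  then show ?thesis by (simp only: group_closure_minus_iff)
qed

lemma tens_coset_diff:
  assumes "a \<in> gr A i" "x \<in> omega_pre (s + d)" "y \<in> omega_pre (s + d)"
    "xs \<in> factors (smod s) (length xs)" "ys \<in> factors (smod s) (length ys)" "Suc (length xs + length ys) = r"
  shows "frag_of (a, xs @ (d, (x - y) +o omega_sub A) # ys) -
    (frag_of (a, xs @ (d, x +o omega_sub A) # ys) - frag_of (a, xs @ (d, y +o omega_sub A) # ys)) \<in> tsub s r"
proof -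
  have m: "(x - y) +o omega_sub A \<in> mpart (smod s) d" "y +o omega_sub A \<in> mpart (smod s) d"
    using assms(2,3) by (auto simp: mpart_smod mpart_omega intro: group_closure.diff)
  have "frag_of (a, xs @ (d, ((x - y) +o omega_sub A) + (y +o omega_sub A)) # ys) -
    frag_of (a, xs @ (d, (x - y) +o omega_sub A) # ys) - frag_of (a, xs @ (d, y +o omega_sub A) # ys) \<in> tsub s r"
    using assms m by (intro tens_add_arg[OF assms(1)]) (auto simp: factors_append factors_Cons)
  from subgrp_cong_sym[OF subgrp_closure this[unfolded coset_add diff_diff_eq]]
  show ?thesis by (simp add: algebra_simps)
qed

text \<open>The df generate the Kaehler differentials over A, and coefficients inside the factors
  move to the front by \<open>tens_scalar_at\<close>. The result is an induction principle over
  formal tensors, for predicates compatible with differences and with congruence modulo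
  \<open>tsub\<close>.\<close>

lemma tens_span:
  assumes x: "x \<in> tens_pre (gr A) (smod s) r m"
    and gens: "\<And>k a fs. a \<in> gr A k \<Longrightarrow> fs \<in> homog_args A \<Longrightarrow> length fs = r \<Longrightarrow> k + sdeg s fs = m \<Longrightarrow>
      Q (frag_of (a, dds s fs))"
    and Q0: "Q 0" and Qd: "\<And>x y. Q x \<Longrightarrow> Q y \<Longrightarrow> Q (x - y)"
    and Qc: "\<And>x y. x \<in> tens_pre (gr A) (smod s) r m \<Longrightarrow> Q y \<Longrightarrow> x - y \<in> tsub s r \<Longrightarrow> Q x"
  shows "Q x"
proof -
  have Qk: "Q (ksgn e x)" if "Q x" for e x
    using that Qd[OF Q0 that] by (simp add: ksgn_def)
  \<comment> \<open>\<open>fs\<close> are the factors already brought into the form df, with their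
    former coefficients absorbed in \<open>a\<close>; \<open>ms\<close> are the factors still to be
    treated.\<close>
  have main: "Q (frag_of (a, dds s fs @ ms))"
    if "fs \<in> homog_args A" "ms \<in> factors (smod s) (length ms)" "length fs + length ms = r" "a \<in> gr A k"
      "k + sdeg s fs + sum_list (map fst ms) = m" for fs ms a k
    using that
  proof (induction ms arbitrary: fs a k)
    case Nil
    then show ?case using gens[of a k fs] by simp
  next
    case (Cons z ms)
    obtain d x where z: "z = (d, x)" by (cases z)
    have f: "x \<in> mpart (smod s) d" "ms \<in> factors (smod s) (length ms)"
      using Cons.prems(2) by (auto simp: z factors_Cons)
    have fs: "dds s fs \<in> factors (smod s) (length fs)" using dds_factors Cons.prems(1) by blast
    obtain y where y: "y \<in> omega_pre (s + d)" "x = y +o omega_sub A" using mpart_smodE[OF f(1)] .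
    have pre: "frag_of (a, dds s fs @ (d, w +o omega_sub A) # ms) \<in> tens_pre (gr A) (smod s) r m"
      "dds s fs @ (d, w +o omega_sub A) # ms \<in> factors (smod s) r"
      if "w \<in> omega_pre (s + d)" for w
    proof -
      have "w +o omega_sub A \<in> mpart (smod s) d" using that by (auto simp: mpart_smod mpart_omega)
      then show 2: "dds s fs @ (d, w +o omega_sub A) # ms \<in> factors (smod s) r"
        using Cons.prems(3) f(2) fs by (auto simp: factors_append factors_Cons)
      have "k + sum_list (map fst (dds s fs @ (d, w +o omega_sub A) # ms)) = m"
        using Cons.prems(5) by (simp add: z sum_dds del: map_map)
      then show "frag_of (a, dds s fs @ (d, w +o omega_sub A) # ms) \<in> tens_pre (gr A) (smod s) r m"
        by (rule tens_preI[where G = "gr A", OF Cons.prems(4) 2])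
    qed
    \<comment> \<open>Membership is carried along, because \<open>pre\<close> and
      \<open>tens_coset_diff\<close> ask for it when y is a difference.\<close>
    have "y \<in> omega_pre (s + d) \<and> Q (frag_of (a, dds s fs @ (d, y +o omega_sub A) # ms))"
      using y(1)
    proof (induction rule: group_closure.induct)
      case (base w)
      show ?case
      proof (cases "w = 0")
        case True
        have 0: "0 \<in> omega_pre (s + d)" by simp
        have "frag_of (a, dds s fs @ (d, 0 +o omega_sub A) # ms) \<in> tsub s r"
          by (rule tens_coset_zero[OF Cons.prems(4) pre(2)[OF 0]])
        then show ?thesis using Qc[OF pre(1)[OF 0] Q0] True by simp
      next
        case False
        then have w: "w \<in> omega_pre (s + d)" using base by (auto intro: group_closure.base)
        obtain b g p q where bg: "w = frag_of (b, g)" "b \<in> gr A p" "g \<in> gr A q" "p + q = s + d"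
          using base False by (auto simp: omega_gens_def)
        let ?c = "ksgn (s * p) b"
        have c: "?c \<in> gr A p" using bg(2) by auto
        have "mact (smod s) p ?c (dd A g) = w +o omega_sub A"
          by (simp add: dd_def mact_smod[OF c] bg(1) ksgn_even)
        moreover have "dds s fs @ (q - s, dd A g) # ms \<in> factors (smod s) r"
          using Cons.prems(3) f(2) fs dd_mpart[OF bg(3)] by (auto simp: factors_append factors_Cons)
        moreover have "p + (q - s) = d" using bg(4) by simp
        ultimately have 1: "frag_of (a * ?c, dds s fs @ (q - s, dd A g) # ms) -
          ksgn (p * sum_list (map fst (dds s fs))) (frag_of (a, dds s fs @ (d, w +o omega_sub A) # ms)) \<in> tsub s r"
          using tens_scalar_at[OF c Cons.prems(4), of "dds s fs" "q - s" "dd A g" ms s r] by simp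
        have "Q (frag_of (a * ?c, dds s (fs @ [(q, g)]) @ ms))"
          using Cons.prems f(2) bg c by (intro Cons.IH[of _ _ "k + p"]) (auto simp: z)
        then have 2: "Q (ksgn (p * sum_list (map fst (dds s fs))) (frag_of (a * ?c, dds s fs @ (q - s, dd A g) # ms)))"
          by (intro Qk) simp
        have "frag_of (a, dds s fs @ (d, w +o omega_sub A) # ms) -
          ksgn (p * sum_list (map fst (dds s fs))) (frag_of (a * ?c, dds s fs @ (q - s, dd A g) # ms)) \<in> tsub s r"
          using subgrp_ksgn[OF subgrp_closure subgrp_cong_sym[OF subgrp_closure 1], of "p * sum_list (map fst (dds s fs))"]
          by (simp add: ksgn_diff ksgn_even del: map_map)
        from Qc[OF pre(1)[OF w] 2 this] w show ?thesis by blast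
      qed
    next
      case (diff u v)
      then have uv: "u \<in> omega_pre (s + d)" "v \<in> omega_pre (s + d)" by auto
      have "u - v \<in> omega_pre (s + d)" using uv by (rule group_closure.diff)
      moreover have "frag_of (a, dds s fs @ (d, (u - v) +o omega_sub A) # ms) -
        (frag_of (a, dds s fs @ (d, u +o omega_sub A) # ms) - frag_of (a, dds s fs @ (d, v +o omega_sub A) # ms)) \<in> tsub s r"
        using Cons.prems(3) f(2) fs by (intro tens_coset_diff[OF Cons.prems(4) uv]) auto
      ultimately show ?case
        using Qc[OF pre(1)] Qd diff by blast
    qed
    then show ?case by (simp add: z y(2))
  qed
  have "x \<in> tens_pre (gr A) (smod s) r m \<and> Q x"
    using x unfolding tens_pre_def
  proof (induction rule: group_closure.induct)
    case (base w)
    then show ?case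
    proof (cases "w = 0")
      case False
      then obtain a ms i where "w = frag_of (a, ms)" "a \<in> gr A i" "ms \<in> factors (smod s) r" "i + sum_list (map fst ms) = m"
        using base by blast
      then show ?thesis using main[of "[]" ms a i] base by (auto simp: factors_length intro: group_closure.base)
    qed (simp add: Q0)
  next
    case (diff u v)
    then show ?case by (auto intro: Qd group_closure.diff)
  qed
  then show ?thesis ..
qed

lemma tens_dd_add:
  assumes "a \<in> gr A i" "f \<in> gr A d" "g \<in> gr A d" "xs @ ys \<in> factors (smod s) (length (xs @ ys))" "Suc (length (xs @ ys)) = r"
  shows "frag_of (a, xs @ (d - s, dd A (f + g)) # ys) - frag_of (a, xs @ (d - s, dd A f) # ys) -
    frag_of (a, xs @ (d - s, dd A g) # ys) \<in> tsub s r"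
proof -
  have "frag_of (1, f + g) - frag_of (1, f) - frag_of (1, g) \<in> omega_sub A"
    using omega_rel.intros(2)[of 1 A 0 f d g] assms by (auto intro: group_closure.base)
  then have "dd A (f + g) = dd A f + dd A g"
    by (simp add: dd_def coset_add coset_eq_iff diff_diff_eq)
  then show ?thesis
    using tens_add_arg[OF assms(1) dd_mpart[OF assms(2)] dd_mpart[OF assms(3)], where xs = xs and ys = ys and r = r] assms
    by (simp add: factors_append factors_Cons dd_mpart)
qed

text \<open>In the shifted module a scalar acts with an extra sign. \<open>?c\<close> and
  \<open>?c'\<close> are chosen to cancel it, so that d(fg) is the sum of \<open>?x\<close> and
  \<open>?y\<close>; the signs reappear when the scalars are moved into the coefficient.\<close>

lemma tens_dd_mult:
  assumes "a \<in> gr A i" "f \<in> gr A p" "g \<in> gr A q" "ys \<in> factors (smod s) (length ys)" "Suc (length ys) = r"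
  shows "frag_of (a, (p + q - s, dd A (f * g)) # ys) - ksgn (s * p) (frag_of (a * f, (q - s, dd A g) # ys)) -
    ksgn (p * q + s * q) (frag_of (a * g, (p - s, dd A f) # ys)) \<in> tsub s r"
proof -
  note S = subgrp_closure[of "tens_rel (gr A) (smod s) r"]
  let ?c = "ksgn (s * p) f" and ?c' = "ksgn (s * q + p * q) g"
  have c: "?c \<in> gr A p" "?c' \<in> gr A q" using assms(2,3) by auto
  let ?x = "mact (smod s) p ?c (dd A g)" and ?y = "mact (smod s) q ?c' (dd A f)"
  have "frag_of (1, f * g) - frag_of (1 * f, g) - frag_of (ksgn (p * q) (1 * g), f) \<in> omega_sub A"
    using omega_rel.intros(3)[of 1 A 0 f p g q] assms by (auto intro: group_closure.base)
  then have dd: "dd A (f * g) = ?x + ?y"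
    by (simp add: dd_def mact_smod[OF c(1)] mact_smod[OF c(2)] coset_add coset_eq_iff ksgn_even diff_diff_eq)
      (simp add: ksgn_def)
  have x: "?x \<in> mpart (smod s) (p + q - s)" using mact_mpart[OF c(1) dd_mpart[OF assms(3)], of s] by (simp add: algebra_simps)
  have y: "?y \<in> mpart (smod s) (p + q - s)" using mact_mpart[OF c(2) dd_mpart[OF assms(2)], of s] by (simp add: algebra_simps)
  have 0: "frag_of (a, (p + q - s, ?x + ?y) # ys) - frag_of (a, (p + q - s, ?x) # ys) - frag_of (a, (p + q - s, ?y) # ys) \<in> tsub s r"
    using tens_add_arg[OF assms(1) x y, where xs = "[]" and ys = ys and r = r] x assms(4,5) by (simp add: factors_Cons)
  have 1: "frag_of (a * ?c, (q - s, dd A g) # ys) - frag_of (a, (p + q - s, ?x) # ys) \<in> tsub s r"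
    using tens_scalar_at[OF c(1) assms(1), of "[]" "q - s" "dd A g" ys s r] dd_mpart[OF assms(3)] assms(4,5)
    by (simp add: factors_Cons algebra_simps)
  have 2: "frag_of (a * ?c', (p - s, dd A f) # ys) - frag_of (a, (p + q - s, ?y) # ys) \<in> tsub s r"
    using tens_scalar_at[OF c(2) assms(1), of "[]" "p - s" "dd A f" ys s r] dd_mpart[OF assms(2)] assms(4,5)
    by (simp add: factors_Cons algebra_simps)
  have 3: "frag_of (a * ?c, (q - s, dd A g) # ys) - ksgn (s * p) (frag_of (a * f, (q - s, dd A g) # ys)) \<in> tsub s r"
    unfolding ksgn_mult_right using assms dd_mpart[OF assms(3)]
    by (intro tens_ksgn_coeff gr_mult) (auto simp: factors_Cons)
  have 4: "frag_of (a * ?c', (p - s, dd A f) # ys) - ksgn (s * q + p * q) (frag_of (a * g, (p - s, dd A f) # ys)) \<in> tsub s r"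
    unfolding ksgn_mult_right using assms dd_mpart[OF assms(2)]
    by (intro tens_ksgn_coeff gr_mult) (auto simp: factors_Cons)
  have "frag_of (a, (p + q - s, ?x + ?y) # ys) - ksgn (s * p) (frag_of (a * f, (q - s, dd A g) # ys)) -
    ksgn (s * q + p * q) (frag_of (a * g, (p - s, dd A f) # ys)) \<in> tsub s r"
    using subgrp_add[OF S subgrp_add[OF S 0 subgrp_diff[OF S 3 1]] subgrp_diff[OF S 4 2]] by (simp add: algebra_simps)
  then show ?thesis by (simp add: dd add.commute)
qed

lemma tens_dd_str:
  assumes "a \<in> gr A i" "str A c \<in> gr A d" "ys \<in> factors (smod s) (length ys)" "Suc (length ys) = r"
  shows "frag_of (a, (d - s, dd A (str A c)) # ys) \<in> tsub s r"
proof -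
  have "frag_of (1, str A c) \<in> omega_sub A"
    using omega_rel.intros(4)[of 1 A 0 c d] assms by (auto intro: group_closure.base)
  then have dd: "dd A (str A c) = 0 +o omega_sub A" unfolding dd_def coset_eq_iff by simp
  show ?thesis
    using tens_coset_zero[OF assms(1), of "[]" "d - s" ys s r] dd_mpart[OF assms(2), of s] assms(3,4)
    unfolding dd by (simp add: factors_Cons)
qed

end

section \<open>Polyvectors as polyderivations\<close>

context graded_algebra
begin

lemma tact_tens_rel: "z \<in> tens_rel (gr A) M r \<Longrightarrow> c \<in> gr A e \<Longrightarrow> tact c z \<in> tens_rel (gr A) M r"
proof (induction rule: tens_rel.induct)
  case (1 a i b ms)
  then show ?case using tens_rel.intros(1)[of "c * a" "gr A" "e + i" "c * b" ms M r]
    by (auto simp: tact_diff distrib_left)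
next
  case (2 a i x d y xs ys)
  then show ?case using tens_rel.intros(2)[of "c * a" "gr A" "e + i" x M d y xs ys r] by (auto simp: tact_diff)
next
  case (3 a i c' e' d x ys)
  then show ?case using tens_rel.intros(3)[of "c * a" "gr A" "e + i" c' e' d x ys M r]
    by (auto simp: tact_diff mult.assoc)
next
  case (4 a i c' e' xs d x d' y ys)
  then show ?case using tens_rel.intros(4)[of "c * a" "gr A" "e + i" c' e' xs d x d' y ys M r]
    by (auto simp: tact_diff)
qed

lemma tens_act_coset:
  "c \<in> gr A e \<Longrightarrow> tens_act (gr A) M r c (x +o tens_sub (gr A) M r) = tact c x +o tens_sub (gr A) M r"
  using coset_image[of "tact c" "tens_rel (gr A) M r" x]
  by (simp add: tens_act_def tact_def[symmetric] tact_diff tact_tens_rel group_closure.base)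

lemma tact_tens_pre:
  assumes "c \<in> gr A e" "x \<in> tens_pre (gr A) M r m"
  shows "tact c x \<in> tens_pre (gr A) M r (e + m)"
  using assms(2) unfolding tens_pre_def[of _ _ _ m]
proof (rule group_closure_induct_subgrp)
  fix z assume "z \<in> {frag_of (a, ms) | a ms i. a \<in> gr A i \<and> ms \<in> factors M r \<and> i + sum_list (map fst ms) = m}"
  then obtain a ms i where "z = frag_of (a, ms)" "a \<in> gr A i" "ms \<in> factors M r" "i + sum_list (map fst ms) = m"
    by blast
  then show "tact c z \<in> tens_pre (gr A) M r (e + m)"
    using gr_mult[OF assms(1)] by (auto intro!: tens_preI[where G = "gr A" and i = "e + i"])
qed (auto simp: tact_diff tens_pre_def)

lemma tens_pre_diff: "x \<in> tens_pre G M r m \<Longrightarrow> y \<in> tens_pre G M r m \<Longrightarrow> x - y \<in> tens_pre G M r m"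
  unfolding tens_pre_def by (rule group_closure.diff)

lemma tens_pre_add: "x \<in> tens_pre G M r m \<Longrightarrow> y \<in> tens_pre G M r m \<Longrightarrow> x + y \<in> tens_pre G M r m"
  unfolding tens_pre_def by (rule closure_add)

lemma tens_pre_ksgn: "x \<in> tens_pre G M r m \<Longrightarrow> ksgn e x \<in> tens_pre G M r m"
  unfolding tens_pre_def by (rule subgrp_ksgn) auto

lemma tens_pre_0 [simp]: "0 \<in> tens_pre G M r m"
  by (simp add: tens_pre_def)

lemma subgrp_tens_pre [simp]: "subgrp (tens_pre G M r m)"
  by (simp add: tens_pre_def)

lemma Sym_tens_pre: "x \<in> tens_pre G M r m \<Longrightarrow> Sym r x \<in> tens_pre G M r m"
  unfolding Sym_def by (rule subgrp_sum) (auto intro: perm_tens_pre)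

section \<open>Invariant tensors and the values of polyvectors on them\<close>

lemma perm_tens_coset:
  assumes "\<sigma> permutes {..<r}" "perm_tens \<sigma> x - x \<in> tsub s r"
  shows "perm_tens \<sigma> ` (x +o tsub s r) \<subseteq> x +o tsub s r"
proof
  fix z assume "z \<in> perm_tens \<sigma> ` (x +o tsub s r)"
  then obtain w where w: "z = perm_tens \<sigma> (x + w)" "w \<in> tsub s r" by (auto simp: elt_set_plus_def)
  have "z - x = (perm_tens \<sigma> x - x) + perm_tens \<sigma> w" by (simp add: w perm_tens_add)
  then show "z \<in> x +o tsub s r"
    using closure_add[OF assms(2) perm_tens_tsub[OF assms(1) w(2)]] by (intro set_minus_imp_plus) (simp only: \<open>z - x = _\<close>)
qed

lemma CoS_Sym: "x \<in> tens_pre (gr A) (smod s) r m \<Longrightarrow> Sym r x +o tsub s r \<in> CoS (gr A) (smod s) r m"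
  unfolding CoS_def tens_pow_def
  by (auto intro!: Sym_tens_pre perm_tens_coset[THEN subsetD] simp: perm_tens_Sym[OF tens_pre_len])

lemma CoS_E:
  assumes "t \<in> CoS (gr A) (smod s) r m"
  obtains x where "x \<in> tens_pre (gr A) (smod s) r m" "t = x +o tsub s r"
    "\<And>\<sigma>. \<sigma> permutes {..<r} \<Longrightarrow> perm_tens \<sigma> x - x \<in> tsub s r"
proof -
  obtain x where x: "x \<in> tens_pre (gr A) (smod s) r m" "t = x +o tsub s r"
    using assms by (auto simp: CoS_def tens_pow_def)
  have "perm_tens \<sigma> x - x \<in> tsub s r" if "\<sigma> permutes {..<r}" for \<sigma>
    using assms that coset_self[of x "tens_rel (gr A) (smod s) r"]
    by (intro set_plus_imp_minus) (auto simp: CoS_def x(2))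
  with x show ?thesis by (rule that)
qed

lemma CoS_I:
  assumes "x \<in> tens_pre (gr A) (smod s) r m" "\<And>\<sigma>. \<sigma> permutes {..<r} \<Longrightarrow> perm_tens \<sigma> x - x \<in> tsub s r"
  shows "x +o tsub s r \<in> CoS (gr A) (smod s) r m"
  using assms perm_tens_coset by (auto simp: CoS_def tens_pow_def)

lemma pol_mod_smod: "pol_mod A n = smod (- n - 1)"
  by (simp add: pol_mod_def)

text \<open>A polyvector composed with the symmetriser. Unlike \<open>\<phi> r\<close> it makes
  sense on all homogeneous tensors and not only on invariant ones, so that \<open>tens_span\<close>
  applies to it.\<close>

definition symval :: "'a polyvec \<Rightarrow> nat \<Rightarrow> ('a, ('a \<times> 'a \<Rightarrow>\<^sub>0 int) set) tens \<Rightarrow> 'a"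
  where "symval \<phi> r x = \<phi> r (Sym r x +o tsub (- n - 1) r)"

abbreviation ppre :: "nat \<Rightarrow> int \<Rightarrow> ('a, ('a \<times> 'a \<Rightarrow>\<^sub>0 int) set) tens set"
  where "ppre r m \<equiv> tens_pre (gr A) (smod (- n - 1)) r m"

lemma ev_symval: "ev A n \<phi> fs = symval \<phi> (length fs) (frag_of (1, dds (- n - 1) fs))"
proof -
  have eq: "map (\<lambda>(d, f). (d + n + 1, dd A f)) fs = dds (- n - 1) fs" by (rule map_cong) auto
  show ?thesis by (simp only: eq ev_def symval_def symmetrisation_Sym pol_mod_smod length_map)
qed

lemma Pol_iff: "\<phi> \<in> Pol A n i \<longleftrightarrow> (\<forall>j.
    (\<forall>t. t \<notin> (\<Union>m. CoS (gr A) (smod (- n - 1)) j m) \<longrightarrow> \<phi> j t = 0) \<and>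
    (\<forall>m. \<forall>t \<in> CoS (gr A) (smod (- n - 1)) j m.
       \<phi> j t \<in> gr A (m - i) \<and>
       (\<forall>u \<in> CoS (gr A) (smod (- n - 1)) j m. \<phi> j (t + u) = \<phi> j t + \<phi> j u) \<and>
       (\<forall>e. \<forall>c \<in> gr A e.
          \<phi> j (tens_act (gr A) (smod (- n - 1)) j c t) = ksgn (i * e) (c * \<phi> j t))))"
  by (simp add: Pol_def pol_mod_smod)

lemma dds_pre: "a \<in> gr A k \<Longrightarrow> fs \<in> homog_args A \<Longrightarrow> frag_of (a, dds (- n - 1) fs) \<in> ppre (length fs) (k + total_degree n fs)"
proof (intro tens_preI[where G = "gr A"] dds_factors)
  show "fs \<in> homog_args A \<Longrightarrow> k + sum_list (map fst (dds (- n - 1) fs)) = k + total_degree n fs"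
    by (induction fs) auto
qed auto

context
  fixes \<phi> i assumes P: "\<phi> \<in> Pol A n i"
begin

lemma Pol_gr: "t \<in> CoS (gr A) (smod (- n - 1)) r m \<Longrightarrow> \<phi> r t \<in> gr A (m - i)"
  using P unfolding Pol_iff by blast

lemma Pol_add: "t \<in> CoS (gr A) (smod (- n - 1)) r m \<Longrightarrow> u \<in> CoS (gr A) (smod (- n - 1)) r m \<Longrightarrow>
    \<phi> r (t + u) = \<phi> r t + \<phi> r u"
  using P unfolding Pol_iff by blast

lemma Pol_act: "t \<in> CoS (gr A) (smod (- n - 1)) r m \<Longrightarrow> c \<in> gr A e \<Longrightarrow>
    \<phi> r (tens_act (gr A) (smod (- n - 1)) r c t) = ksgn (i * e) (c * \<phi> r t)"
  using P unfolding Pol_iff by blast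

lemma Pol_off: "t \<notin> (\<Union>m. CoS (gr A) (smod (- n - 1)) r m) \<Longrightarrow> \<phi> r t = 0"
  using P unfolding Pol_iff by blast

lemma symval_gr: "x \<in> ppre r m \<Longrightarrow> symval \<phi> r x \<in> gr A (m - i)"
  unfolding symval_def by (intro Pol_gr CoS_Sym)

lemma symval_add: "x \<in> ppre r m \<Longrightarrow> y \<in> ppre r m \<Longrightarrow> symval \<phi> r (x + y) = symval \<phi> r x + symval \<phi> r y"
  using Pol_add[OF CoS_Sym CoS_Sym, of x r m y] Sym_diff[of r "x + y" y]
  by (simp add: symval_def coset_add diff_eq_eq)

lemma symval_diff: "x \<in> ppre r m \<Longrightarrow> y \<in> ppre r m \<Longrightarrow> symval \<phi> r (x - y) = symval \<phi> r x - symval \<phi> r y"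
  using symval_add[of "x - y" r m y] by (simp add: tens_pre_diff)

lemma symval_0 [simp]: "symval \<phi> r 0 = 0"
  using symval_diff[of 0 r 0 0] by simp

lemma symval_ksgn: "x \<in> ppre r m \<Longrightarrow> symval \<phi> r (ksgn e x) = ksgn e (symval \<phi> r x)"
  using symval_diff[of 0 r m x] by (simp add: ksgn_def)

lemma symval_cong: "x - y \<in> tsub (- n - 1) r \<Longrightarrow> symval \<phi> r x = symval \<phi> r y"
  unfolding symval_def by (simp add: Sym_cong)

lemma symval_act:
  assumes "x \<in> ppre r m" "c \<in> gr A e"
  shows "symval \<phi> r (tact c x) = ksgn (i * e) (c * symval \<phi> r x)"
  using Pol_act[OF CoS_Sym[OF assms(1)] assms(2)]
  by (simp add: symval_def tens_act_coset[OF assms(2)] tact_Sym[OF tens_pre_len[OF assms(1)]])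

lemma symval_perm: "x \<in> ppre r m \<Longrightarrow> \<sigma> permutes {..<r} \<Longrightarrow> symval \<phi> r (perm_tens \<sigma> x) = symval \<phi> r x"
  unfolding symval_def by (simp add: Sym_perm_tens[OF tens_pre_len])

lemma symval_dds:
  assumes "a \<in> gr A k" "fs \<in> homog_args A"
  shows "symval \<phi> (length fs) (frag_of (a, dds (- n - 1) fs)) = ksgn (i * k) (a * ev A n \<phi> fs)"
  using symval_act[OF dds_pre[of 1 0 fs] assms(1)] assms(2) by (simp add: ev_symval)

lemma symval_dds_cong3:
  assumes "x \<in> ppre r m" "y \<in> ppre r m" "z \<in> ppre r m" "x - y - z \<in> tsub (- n - 1) r"
  shows "symval \<phi> r x = symval \<phi> r y + symval \<phi> r z"
  using symval_cong[of x "y + z" r] assms symval_add[of y r m z] by (simp add: diff_diff_eq)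

end

text \<open>\<open>ev\<close> cut off outside homogeneous arguments, so that \<open>pder\<close>
  holds and equal polyderivations are equal functions.\<close>

definition nev :: "'a polyvec \<Rightarrow> (int \<times> 'a) list \<Rightarrow> 'a"
  where "nev \<phi> fs = (if fs \<in> homog_args A then ev A n \<phi> fs else 0)"

lemma dds_pre_eq:
  assumes "a \<in> gr A k" "fs \<in> homog_args A" "length fs = r" "k + total_degree n fs = m"
  shows "frag_of (a, dds (- n - 1) fs) \<in> ppre r m"
  using dds_pre[OF assms(1,2)] assms(3,4) by simp

text \<open>Every rule is a relation between tensors of differentials: \<open>tens_dd_add\<close>,
  \<open>tens_dd_mult\<close>, or an adjacent permutation, under which the symmetriser is invariant.
  \<open>symval\<close> turns it into an equation in A.\<close>

lemma pder_nev:
  assumes P: "\<phi> \<in> Pol A n i"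
  shows "pder i (nev \<phi>)"
proof (rule pderI)
  fix fs assume "fs \<in> homog_args A"
  then show "nev \<phi> fs \<in> gr A (total_degree n fs - i)"
    using symval_gr[OF P dds_pre[of 1 0 fs]] by (simp add: nev_def ev_symval)
next
  fix d f g fs assume fg: "f \<in> gr A d" "g \<in> gr A d"
  show "nev \<phi> ((d, f + g) # fs) = nev \<phi> ((d, f) # fs) + nev \<phi> ((d, g) # fs)"
  proof (cases "fs \<in> homog_args A")
    case True
    let ?m = "d + n + 1 + total_degree n fs" and ?r = "Suc (length fs)"
    have "frag_of (1, dds (- n - 1) ((d, f + g) # fs)) - frag_of (1, dds (- n - 1) ((d, f) # fs)) -
      frag_of (1, dds (- n - 1) ((d, g) # fs)) \<in> tsub (- n - 1) ?r"
      using tens_dd_add[OF gr_1 fg, where xs = "[]" and ys = "dds (- n - 1) fs" and s = "- n - 1" and r = ?r] dds_factors[OF True] by simp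
    moreover have "frag_of (1, dds (- n - 1) ((d, h) # fs)) \<in> ppre ?r ?m" if "h \<in> gr A d" for h
      using that True by (intro dds_pre_eq[of 1 0]) auto
    ultimately show ?thesis
      using symval_dds_cong3[OF P, of _ ?r ?m] fg True by (simp add: nev_def ev_symval gr_add del: list.map)
  qed (simp add: nev_def)
next
  fix p q f g fs assume fg: "f \<in> gr A p" "g \<in> gr A q"
  show "nev \<phi> ((p + q, f * g) # fs) =
    ksgn ((i - n - 1) * p) (f * nev \<phi> ((q, g) # fs)) +
    ksgn (p * q + (i - n - 1) * q) (g * nev \<phi> ((p, f) # fs))"
  proof (cases "fs \<in> homog_args A")
    case True
    let ?m = "p + q + n + 1 + total_degree n fs" and ?r = "Suc (length fs)"
    let ?x = "frag_of (1, dds (- n - 1) ((p + q, f * g) # fs))"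
    let ?y = "frag_of (f, dds (- n - 1) ((q, g) # fs))" and ?z = "frag_of (g, dds (- n - 1) ((p, f) # fs))"
    have 1: "?x - ksgn ((- n - 1) * p) ?y - ksgn (p * q + (- n - 1) * q) ?z \<in> tsub (- n - 1) ?r"
      using tens_dd_mult[OF gr_1 fg, of "dds (- n - 1) fs" "- n - 1" ?r] dds_factors[OF True] by simp
    have pre: "?x \<in> ppre ?r ?m" "?y \<in> ppre ?r ?m" "?z \<in> ppre ?r ?m"
      using fg True gr_mult[OF fg]
      by (auto intro!: dds_pre_eq[of 1 0 "(p + q, f * g) # fs"] dds_pre_eq[of f p "(q, g) # fs"]
          dds_pre_eq[of g q "(p, f) # fs"] simp del: list.map)
    have "symval \<phi> ?r ?x = ksgn ((- n - 1) * p) (symval \<phi> ?r ?y) + ksgn (p * q + (- n - 1) * q) (symval \<phi> ?r ?z)"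
      using symval_dds_cong3[OF P pre(1) tens_pre_ksgn[OF pre(2)] tens_pre_ksgn[OF pre(3)] 1]
        symval_ksgn[OF P pre(2)] symval_ksgn[OF P pre(3)] by simp
    moreover have "symval \<phi> ?r ?y = ksgn (i * p) (f * ev A n \<phi> ((q, g) # fs))"
      using symval_dds[OF P fg(1), of "(q, g) # fs"] fg True by simp
    moreover have "symval \<phi> ?r ?z = ksgn (i * q) (g * ev A n \<phi> ((p, f) # fs))"
      using symval_dds[OF P fg(2), of "(p, f) # fs"] fg True by simp
    moreover have "symval \<phi> ?r ?x = ev A n \<phi> ((p + q, f * g) # fs)" by (simp add: ev_symval)
    \<comment> \<open>The shift contributes \<open>- n - 1\<close> and the linearity of \<phi> over
      A contributes i; together they give the exponent \<open>i - n - 1\<close> of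
      \<open>pder\<close>.\<close>
    ultimately have "ev A n \<phi> ((p + q, f * g) # fs) =
      ksgn ((- n - 1) * p + i * p) (f * ev A n \<phi> ((q, g) # fs)) +
      ksgn (p * q + (- n - 1) * q + i * q) (g * ev A n \<phi> ((p, f) # fs))"
      by (simp only: ksgn_ksgn)
    also have "\<dots> = ksgn ((i - n - 1) * p) (f * ev A n \<phi> ((q, g) # fs)) +
      ksgn (p * q + (i - n - 1) * q) (g * ev A n \<phi> ((p, f) # fs))"
      by (intro arg_cong2[where f = "(+)"] ksgn_cong_diff refl) (simp_all add: algebra_simps)
    finally show ?thesis using fg True gr_mult[OF fg] by (simp add: nev_def)
  qed (simp add: nev_def)
next
  fix xs x y ys
  show "nev \<phi> (xs @ x # y # ys) =
      ksgn ((fst x + n + 1) * (fst y + n + 1)) (nev \<phi> (xs @ y # x # ys))"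
  proof (cases "xs @ x # y # ys \<in> homog_args A")
    case True
    let ?l = "xs @ x # y # ys" and ?l' = "xs @ y # x # ys"
    let ?\<tau> = "transpose (length xs) (Suc (length xs))"
    have h: "?l' \<in> homog_args A" using True by auto
    have p: "?\<tau> permutes {..<length ?l}" by (intro permutes_swap_id) auto
    have E: "perm_tens ?\<tau> (frag_of (1, dds (- n - 1) ?l)) =
        ksgn ((fst x + n + 1) * (fst y + n + 1)) (frag_of (1, dds (- n - 1) ?l'))"
      using permute_list_adjacent[of "dds (- n - 1) xs"] perm_exp_of_adjacent[of "dds (- n - 1) xs"]
      by (simp add: perm_tens_of case_prod_unfold algebra_simps del: map_map)
    have "ev A n \<phi> ?l = symval \<phi> (length ?l) (perm_tens ?\<tau> (frag_of (1, dds (- n - 1) ?l)))"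
      by (simp only: ev_symval symval_perm[OF P dds_pre[OF gr_1 True] p])
    also have "\<dots> = symval \<phi> (length ?l) (ksgn ((fst x + n + 1) * (fst y + n + 1)) (frag_of (1, dds (- n - 1) ?l')))"
      by (simp only: E)
    also have "\<dots> = ksgn ((fst x + n + 1) * (fst y + n + 1)) (ev A n \<phi> ?l')"
      using symval_ksgn[OF P dds_pre[OF gr_1 h]] by (simp add: ev_symval)
    finally show ?thesis using True h by (simp add: nev_def)
  next
    case False
    then show ?thesis by (auto simp: nev_def)
  qed
qed (simp add: nev_def)

lemma Rlin_nev:
  assumes P: "\<phi> \<in> Pol A n i"
  shows "Rlin (nev \<phi>)"
  unfolding Rlin_def
proof (intro allI impI)
  fix d r fs assume r: "str A r \<in> gr A d"
  show "nev \<phi> ((d, str A r) # fs) = 0"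
  proof (cases "fs \<in> homog_args A")
    case True
    have "frag_of (1, dds (- n - 1) ((d, str A r) # fs)) - 0 \<in> tsub (- n - 1) (Suc (length fs))"
      using tens_dd_str[OF gr_1 r, of "dds (- n - 1) fs" "- n - 1" "Suc (length fs)"] dds_factors[OF True] by simp
    from symval_cong[OF P this] show ?thesis by (simp add: nev_def ev_symval symval_0[OF P])
  qed (simp add: nev_def)
qed

text \<open>The witness is 1/r!. The factor r! appears as a sum over permutations, because this is
  how the symmetriser produces it.\<close>

lemma gr_div_perms: "\<exists>u \<in> gr A 0. (\<Sum>\<sigma> \<in> {\<sigma>. \<sigma> permutes {..<r::nat}}. u) = 1"
proof -
  have fin: "finite {\<sigma>. \<sigma> permutes {..<r}}" by (rule finite_permutations) simp
  have "card {\<sigma>. \<sigma> permutes {..<r}} = fact r" by (rule card_permutations) auto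
  then have "0 < card {\<sigma>. \<sigma> permutes {..<r}}" by simp
  then obtain u where u: "u \<in> gr A 0" "(\<Sum>l<card {\<sigma>. \<sigma> permutes {..<r}}. u) = 1" using gr_div by blast
  obtain h where "bij_betw h {..<card {\<sigma>. \<sigma> permutes {..<r}}} {\<sigma>. \<sigma> permutes {..<r}}"
    using ex_bij_betw_nat_finite[OF fin] by (auto simp: atLeast0LessThan)
  from sum.reindex_bij_betw[OF this, of "\<lambda>_. u"] u show ?thesis by auto
qed

lemma sum_perms_cancel:
  assumes "(\<Sum>\<sigma> \<in> {\<sigma>. \<sigma> permutes {..<r::nat}}. x) = (\<Sum>\<sigma> \<in> {\<sigma>. \<sigma> permutes {..<r}}. y)"
  shows "x = (y :: 'a)"
proof -
  obtain u where u: "(\<Sum>\<sigma> \<in> {\<sigma>. \<sigma> permutes {..<r}}. u) = (1::'a)" using gr_div_perms by blast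
  have "z = u * (\<Sum>\<sigma> \<in> {\<sigma>. \<sigma> permutes {..<r}}. z)" for z :: 'a
    using sum_distrib_right[of "\<lambda>_. u" "{\<sigma>. \<sigma> permutes {..<r}}" z] u by (simp add: sum_distrib_left)
  then show ?thesis using assms by metis
qed

text \<open>On an invariant tensor each summand of the symmetriser is congruent to x, so that
  \<open>symval\<close> is r! times the value of \<phi>.\<close>

lemma symval_invariant:
  assumes P: "\<phi> \<in> Pol A n i" and x: "x \<in> ppre r m"
    and inv: "\<And>\<sigma>. \<sigma> permutes {..<r} \<Longrightarrow> perm_tens \<sigma> x - x \<in> tsub (- n - 1) r"
  shows "symval \<phi> r x = (\<Sum>\<sigma> \<in> {\<sigma>. \<sigma> permutes {..<r}}. \<phi> r (x +o tsub (- n - 1) r))"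
proof -
  let ?S = "{\<sigma>. \<sigma> permutes {..<r}}"
  have C: "x +o tsub (- n - 1) r \<in> CoS (gr A) (smod (- n - 1)) r m" by (rule CoS_I[OF x inv])
  have C0: "0 +o tsub (- n - 1) r \<in> CoS (gr A) (smod (- n - 1)) r m" by (rule CoS_I) auto
  have z: "\<phi> r (0 +o tsub (- n - 1) r) = 0"
    using Pol_add[OF P C0 C0] by (simp only: coset_add add_0_left) simp
  \<comment> \<open>\<phi> is additive only on invariant classes, so the invariance of the partial
    sums is proved along with their value.\<close>
  have "(\<Sum>\<sigma>\<in>T. x) +o tsub (- n - 1) r \<in> CoS (gr A) (smod (- n - 1)) r m \<and>
     \<phi> r ((\<Sum>\<sigma>\<in>T. x) +o tsub (- n - 1) r) = (\<Sum>\<sigma>\<in>T. \<phi> r (x +o tsub (- n - 1) r))" for T :: "(nat \<Rightarrow> nat) set"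
  proof (induction T rule: infinite_finite_induct)
    case (insert \<tau> F)
    have "x + (\<Sum>\<sigma>\<in>F. x) \<in> ppre r m"
      by (rule tens_pre_add[OF x subgrp_sum[OF subgrp_tens_pre x]])
    moreover have "perm_tens \<sigma> (x + (\<Sum>\<sigma>\<in>F. x)) - (x + (\<Sum>\<sigma>\<in>F. x)) \<in> tsub (- n - 1) r" if "\<sigma> permutes {..<r}" for \<sigma>
    proof -
      have "perm_tens \<sigma> (x + (\<Sum>\<sigma>\<in>F. x)) - (x + (\<Sum>\<sigma>\<in>F. x)) =
        (perm_tens \<sigma> x - x) + (\<Sum>_\<in>F. perm_tens \<sigma> x - x)"
        by (simp add: perm_tens_add perm_tens_sum sum_subtractf)
      also have "\<dots> \<in> tsub (- n - 1) r"
        by (intro closure_add inv that subgrp_sum subgrp_closure)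
      finally show ?thesis .
    qed
    ultimately have "(x + (\<Sum>\<sigma>\<in>F. x)) +o tsub (- n - 1) r \<in> CoS (gr A) (smod (- n - 1)) r m"
      by (rule CoS_I)
    then show ?case
      using insert Pol_add[OF P C, of "(\<Sum>\<sigma>\<in>F. x) +o tsub (- n - 1) r"] by (simp add: coset_add)
  qed (use C0 z in \<open>simp_all only: sum.infinite sum.empty simp_thms\<close>)
  moreover have "Sym r x - (\<Sum>\<sigma>\<in>?S. x) \<in> tsub (- n - 1) r"
    unfolding Sym_def sum_subtractf[symmetric] by (rule subgrp_sum) (auto intro: inv)
  then have "Sym r x +o tsub (- n - 1) r = (\<Sum>\<sigma>\<in>?S. x) +o tsub (- n - 1) r" by (simp add: coset_eq_iff)
  ultimately show ?thesis by (simp add: symval_def)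
qed

text \<open>By \<open>tens_span\<close>, \<open>symval\<close> is determined by its values on
  tensors of differentials, and those are given by \<open>nev\<close>. This fixes r! times the
  values on invariant tensors, and r! can be cancelled.\<close>

lemma Pol_eqI:
  assumes P: "\<phi> \<in> Pol A n i" and Q: "\<psi> \<in> Pol A n i" and eq: "nev \<phi> = nev \<psi>"
  shows "\<phi> = \<psi>"
proof (rule ext, rule ext)
  fix r t show "\<phi> r t = \<psi> r t"
  proof (cases "t \<in> (\<Union>m. CoS (gr A) (smod (- n - 1)) r m)")
    case False
    then show ?thesis using Pol_off[OF P] Pol_off[OF Q] by simp
  next
    case True
    then obtain m where "t \<in> CoS (gr A) (smod (- n - 1)) r m" by blast
    then obtain x where x: "x \<in> ppre r m" "t = x +o tsub (- n - 1) r"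
      "\<And>\<sigma>. \<sigma> permutes {..<r} \<Longrightarrow> perm_tens \<sigma> x - x \<in> tsub (- n - 1) r" using CoS_E by metis
    have "x \<in> ppre r m \<and> symval \<phi> r x = symval \<psi> r x"
      using x(1)
    proof (rule tens_span)
      fix k a fs assume a: "a \<in> gr A k" "fs \<in> homog_args A" "length fs = r" "k + sdeg (- n - 1) fs = m"
      have "ev A n \<phi> fs = ev A n \<psi> fs" using fun_cong[OF eq, of fs] a(2) by (simp add: nev_def)
      moreover have "sdeg (- n - 1) fs = total_degree n fs" by (induction fs) auto
      ultimately show "frag_of (a, dds (- n - 1) fs) \<in> ppre r m \<and>
         symval \<phi> r (frag_of (a, dds (- n - 1) fs)) = symval \<psi> r (frag_of (a, dds (- n - 1) fs))"
        using symval_dds[OF P a(1,2)] symval_dds[OF Q a(1,2)] dds_pre_eq[OF a(1-3)] a(3,4) by simp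
    next
      fix x y assume "x \<in> ppre r m \<and> symval \<phi> r x = symval \<psi> r x" "y \<in> ppre r m \<and> symval \<phi> r y = symval \<psi> r y"
      then show "x - y \<in> ppre r m \<and> symval \<phi> r (x - y) = symval \<psi> r (x - y)"
        using symval_diff[OF P, of x r m y] symval_diff[OF Q, of x r m y] by (simp add: tens_pre_diff)
    next
      fix x y assume "x \<in> ppre r m" "y \<in> ppre r m \<and> symval \<phi> r y = symval \<psi> r y" "x - y \<in> tsub (- n - 1) r"
      then show "x \<in> ppre r m \<and> symval \<phi> r x = symval \<psi> r x"
        using symval_cong[OF P, of x y r] symval_cong[OF Q, of x y r] by simp
    qed (simp add: symval_0[OF P] symval_0[OF Q])
    moreover have "symval \<phi> r x = (\<Sum>\<sigma> \<in> {\<sigma>. \<sigma> permutes {..<r}}. \<phi> r t)"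
      unfolding x(2) by (rule symval_invariant[OF P x(1,3)])
    moreover have "symval \<psi> r x = (\<Sum>\<sigma> \<in> {\<sigma>. \<sigma> permutes {..<r}}. \<psi> r t)"
      unfolding x(2) by (rule symval_invariant[OF Q x(1,3)])
    ultimately have "(\<Sum>\<sigma> \<in> {\<sigma>. \<sigma> permutes {..<r}}. \<phi> r t) = (\<Sum>\<sigma> \<in> {\<sigma>. \<sigma> permutes {..<r}}. \<psi> r t)"
      by simp
    then show ?thesis by (rule sum_perms_cancel)
  qed
qed

text \<open>The universal property of the symmetric power of differentials. F stays on formal sums
  and respects relations modulo H; the passage to classes is left to the applications.\<close>

lemma mform_extend:
  assumes "mform s r H V"
  shows "\<exists>F. (\<forall>x y. F (x - y) = F x - F y) \<and> (\<forall>x \<in> sym_sub (gr A) (smod s) r. F x \<in> H) \<and>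
    (\<forall>k a fs. a \<in> gr A k \<longrightarrow> fs \<in> homog_args A \<longrightarrow> length fs = r \<longrightarrow>
      F (frag_of (a, dds s fs)) - V k a fs \<in> H)"
  using fext_diff fext_Fgen_sym_sub[OF assms] fext_Fgen_dd[OF assms]
  by (intro exI[of _ "fext (Fgen s V)"]) blast

text \<open>\<open>i * k\<close> is the sign of a coefficient of degree k leaving the argument of a
  map of degree i. With it the Leibniz rule of \<open>pder\<close> becomes that of
  \<open>mform\<close> for the shift - n - 1.\<close>

lemma mform_pder:
  assumes \<Phi>: "pder i \<Phi>" "Rlin \<Phi>"
  shows "mform (- n - 1) r {0} (\<lambda>k a fs. ksgn (i * k) (a * \<Phi> fs))"
proof (rule mformI)
  fix k a p q f g fs
  assume a: "a \<in> gr A k" and fg: "f \<in> gr A p" "g \<in> gr A q"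
  have "ksgn (i * k) (a * \<Phi> ((p + q, f * g) # fs)) =
    ksgn (i * k + (i - n - 1) * p) (a * f * \<Phi> ((q, g) # fs)) +
    ksgn (i * k + (p * q + (i - n - 1) * q)) (a * g * \<Phi> ((p, f) # fs))"
    unfolding pder_mult_arg[OF \<Phi>(1) fg] by (simp add: distrib_left ksgn_mult ksgn_add mult.assoc)
  also have "\<dots> = ksgn ((- n - 1) * p + i * (k + p)) (a * f * \<Phi> ((q, g) # fs)) +
    ksgn (p * q + (- n - 1) * q + i * (k + q)) (a * g * \<Phi> ((p, f) # fs))"
    by (intro arg_cong2[where f = "(+)"] ksgn_cong_diff refl) (simp_all add: algebra_simps)
  finally show "ksgn (i * k) (a * \<Phi> ((p + q, f * g) # fs)) -
        ksgn ((- n - 1) * p) (ksgn (i * (k + p)) (a * f * \<Phi> ((q, g) # fs))) -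
        ksgn (p * q + (- n - 1) * q) (ksgn (i * (k + q)) (a * g * \<Phi> ((p, f) # fs))) \<in> {0}"
    by simp
next
  fix k a xs x y ys
  show "ksgn (i * k) (a * \<Phi> (xs @ x # y # ys)) - ksgn ((fst x - (- n - 1)) * (fst y - (- n - 1)))
     (ksgn (i * k) (a * \<Phi> (xs @ y # x # ys))) \<in> {0}"
    unfolding pder_swap[OF \<Phi>(1), of xs x y] by (simp add: ksgn_mult algebra_simps)
qed (use \<Phi>(2) in \<open>auto simp: pder_add_arg[OF \<Phi>(1)] distrib_left distrib_right ksgn_add Rlin_def\<close>)

lemma sdeg_total_degree: "sdeg (- n - 1) fs = total_degree n fs"
  by (induction fs) auto

text \<open>The map F induced on all tensors is invariant under permutations, so on a symmetrisation
  it is r! times what it is on the original tensor. Division by r! and restriction to invariant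
  tensors give the polyvector.\<close>

lemma Pol_lift:
  assumes \<Phi>: "pder i \<Phi>" "Rlin \<Phi>"
  obtains \<chi> where "\<chi> \<in> Pol A n i" "nev \<chi> = \<Phi>"
proof -
  let ?s = "- n - 1"
  have "\<exists>F. (\<forall>x y. F (x - y) = F x - F y) \<and> (\<forall>x \<in> sym_sub (gr A) (smod ?s) r. F x = 0) \<and>
    (\<forall>k a fs. a \<in> gr A k \<longrightarrow> fs \<in> homog_args A \<longrightarrow> length fs = r \<longrightarrow>
      F (frag_of (a, dds ?s fs)) = ksgn (i * k) (a * \<Phi> fs))" for r
    using mform_extend[OF mform_pder[OF \<Phi>, of r]] by simp
  then have "\<forall>r. \<exists>F. (\<forall>x y. F (x - y) = F x - F y) \<and> (\<forall>x \<in> sym_sub (gr A) (smod ?s) r. F x = 0) \<and>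
    (\<forall>k a fs. a \<in> gr A k \<longrightarrow> fs \<in> homog_args A \<longrightarrow> length fs = r \<longrightarrow>
      F (frag_of (a, dds ?s fs)) = ksgn (i * k) (a * \<Phi> fs))" by blast
  from choice[OF this] obtain F where F': "\<forall>r. (\<forall>x y. F r (x - y) = F r x - F r y) \<and>
    (\<forall>x \<in> sym_sub (gr A) (smod ?s) r. F r x = 0) \<and>
    (\<forall>k a fs. a \<in> gr A k \<longrightarrow> fs \<in> homog_args A \<longrightarrow> length fs = r \<longrightarrow>
      F r (frag_of (a, dds ?s fs)) = ksgn (i * k) (a * \<Phi> fs))" by blast
  have F: "\<And>r x y. F r (x - y) = F r x - F r y"
    "\<And>r x. x \<in> sym_sub (gr A) (smod ?s) r \<Longrightarrow> F r x = 0"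
    "\<And>r k a fs. a \<in> gr A k \<Longrightarrow> fs \<in> homog_args A \<Longrightarrow> length fs = r \<Longrightarrow>
      F r (frag_of (a, dds ?s fs)) = ksgn (i * k) (a * \<Phi> fs)" using F' by blast+
  have F0: "F r 0 = 0" for r using F(1)[of r 0 0] by simp
  have Fadd: "F r (x + y) = F r x + F r y" for r x y using F(1)[of r "x + y" y] by simp
  have Fsub: "F r x = F r y" if "x - y \<in> tsub ?s r" for r x y
    using F(2)[OF tens_sub_sym_sub[OF that]] F(1)[of r x y] by simp
  have Fperm: "F r (perm_tens \<sigma> x) = F r x" if "\<sigma> permutes {..<r}" "x \<in> ppre r m" for r \<sigma> x m
    using F(2)[OF perm_tens_sym_sub[OF that]] F(1)[of r "perm_tens \<sigma> x" x] by simp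
  have Fgr: "F r x \<in> gr A (m - i)" if "x \<in> ppre r m" for r x m
    using that
  proof (rule tens_span)
    fix k a fs assume a: "a \<in> gr A k" "fs \<in> homog_args A" "length fs = r" "k + sdeg ?s fs = m"
    have "a * \<Phi> fs \<in> gr A (m - i)"
      using gr_mult[OF a(1) pder_gr[OF \<Phi>(1), of fs]] a(4) by (simp add: sdeg_total_degree algebra_simps)
    then show "F r (frag_of (a, dds ?s fs)) \<in> gr A (m - i)" by (simp add: F(3)[OF a(1-3)] gr_ksgn)
  next
    fix x y assume "F r y \<in> gr A (m - i)" "x - y \<in> tsub ?s r"
    then show "F r x \<in> gr A (m - i)" using Fsub[of x y r] by simp
  qed (auto simp: F(1) F0)
  have Ftact: "F r (tact c x) = ksgn (i * e) (c * F r x)" if c: "c \<in> gr A e" and x: "x \<in> ppre r m" for r c e x m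
    using x
  proof (rule tens_span)
    fix k a fs assume a: "a \<in> gr A k" "fs \<in> homog_args A" "length fs = r"
    show "F r (tact c (frag_of (a, dds ?s fs))) = ksgn (i * e) (c * F r (frag_of (a, dds ?s fs)))"
      by (simp add: F(3)[OF a] F(3)[OF gr_mult[OF c a(1)] a(2,3)] ksgn_mult mult.assoc distrib_left)
  next
    fix x y assume "F r (tact c y) = ksgn (i * e) (c * F r y)" and xy: "x - y \<in> tsub ?s r"
    moreover have "tact c x - tact c y \<in> tsub ?s r"
      unfolding tact_diff[symmetric] using xy
      by (rule group_closure_induct_subgrp) (auto simp: tact_diff intro: group_closure.base tact_tens_rel[OF _ c])
    ultimately show "F r (tact c x) = ksgn (i * e) (c * F r x)" using Fsub[of x y r] Fsub[of "tact c x" "tact c y" r] by simp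
  next
    show "F r (tact c 0) = ksgn (i * e) (c * F r 0)" by (simp add: F0 tact_def)
  qed (simp add: F(1) tact_diff ksgn_diff right_diff_distrib)
  obtain u where u: "\<And>r. u r \<in> gr A 0" "\<And>r. (\<Sum>\<sigma> \<in> {\<sigma>. \<sigma> permutes {..<r::nat}}. u r) = 1"
  proof -
    have "\<forall>r. \<exists>u. u \<in> gr A 0 \<and> (\<Sum>\<sigma> \<in> {\<sigma>. \<sigma> permutes {..<r::nat}}. u) = 1"
      using gr_div_perms by blast
    from choice[OF this] that show ?thesis by blast
  qed
  \<comment> \<open>\<open>u r\<close> is 1/r!. The choice of a representative of t does not matter,
    since F vanishes on the relations.\<close>
  define \<chi> where "\<chi> = (\<lambda>r t. if t \<in> (\<Union>m. CoS (gr A) (smod ?s) r m) then u r * F r (SOME x. x \<in> t) else 0)"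
  have chi: "\<chi> r (x +o tsub ?s r) = u r * F r x" if "x +o tsub ?s r \<in> CoS (gr A) (smod ?s) r m" for r x m
  proof -
    have "(SOME y. y \<in> x +o tsub ?s r) \<in> x +o tsub ?s r" by (rule someI) (rule coset_self)
    then have "F r (SOME y. y \<in> x +o tsub ?s r) = F r x" by (intro Fsub set_plus_imp_minus)
    then show ?thesis using that by (auto simp: \<chi>_def)
  qed
  have CoS_add: "(x + y) +o tsub ?s r \<in> CoS (gr A) (smod ?s) r m"
    if "x \<in> ppre r m" "y \<in> ppre r m" "\<And>\<sigma>. \<sigma> permutes {..<r} \<Longrightarrow> perm_tens \<sigma> x - x \<in> tsub ?s r"
      "\<And>\<sigma>. \<sigma> permutes {..<r} \<Longrightarrow> perm_tens \<sigma> y - y \<in> tsub ?s r" for x y r m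
  proof (rule CoS_I[OF tens_pre_add[OF that(1,2)]])
    fix \<sigma> assume "\<sigma> permutes {..<r}"
    from closure_add[OF that(3,4)[OF this]] show "perm_tens \<sigma> (x + y) - (x + y) \<in> tsub ?s r"
      by (simp add: perm_tens_add algebra_simps)
  qed
  have "\<chi> \<in> Pol A n i"
    unfolding Pol_iff
  proof (intro allI conjI ballI impI)
    fix r t assume "t \<notin> (\<Union>m. CoS (gr A) (smod ?s) r m)"
    then show "\<chi> r t = 0" by (simp add: \<chi>_def)
  next
    fix r m t assume t: "t \<in> CoS (gr A) (smod ?s) r m"
    obtain x where x: "x \<in> ppre r m" "t = x +o tsub ?s r"
      "\<And>\<sigma>. \<sigma> permutes {..<r} \<Longrightarrow> perm_tens \<sigma> x - x \<in> tsub ?s r" using CoS_E[OF t] by blast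
    have ct: "\<chi> r t = u r * F r x" using chi t x(2) by simp
    show "\<chi> r t \<in> gr A (m - i)" using gr_mult[OF u(1) Fgr[OF x(1)], of r] by (simp add: ct)
    fix w assume w: "w \<in> CoS (gr A) (smod ?s) r m"
    obtain y where y: "y \<in> ppre r m" "w = y +o tsub ?s r"
      "\<And>\<sigma>. \<sigma> permutes {..<r} \<Longrightarrow> perm_tens \<sigma> y - y \<in> tsub ?s r" using CoS_E[OF w] by blast
    have "\<chi> r w = u r * F r y" using chi w y(2) by simp
    moreover have "\<chi> r (t + w) = u r * F r (x + y)"
      unfolding x(2) y(2) coset_add by (rule chi[OF CoS_add[OF x(1) y(1) x(3) y(3)]])
    ultimately show "\<chi> r (t + w) = \<chi> r t + \<chi> r w" by (simp add: ct Fadd distrib_left)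
  next
    fix r m t e c assume t: "t \<in> CoS (gr A) (smod ?s) r m" and c: "c \<in> gr A e"
    obtain x where x: "x \<in> ppre r m" "t = x +o tsub ?s r"
      "\<And>\<sigma>. \<sigma> permutes {..<r} \<Longrightarrow> perm_tens \<sigma> x - x \<in> tsub ?s r" using CoS_E[OF t] by blast
    have ct: "\<chi> r t = u r * F r x" using chi t x(2) by simp
    have "tact c x +o tsub ?s r \<in> CoS (gr A) (smod ?s) r (e + m)"
    proof (rule CoS_I[OF tact_tens_pre[OF c x(1)]])
      fix \<sigma> assume "\<sigma> permutes {..<r}"
      from x(3)[OF this] have "tact c (perm_tens \<sigma> x - x) \<in> tsub ?s r"
        by (rule group_closure_induct_subgrp) (auto simp: tact_diff intro: group_closure.base tact_tens_rel[OF _ c])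
      then show "perm_tens \<sigma> (tact c x) - tact c x \<in> tsub ?s r"
        by (simp add: tact_diff tact_perm_tens[OF tens_pre_len[OF x(1)]])
    qed
    from chi[OF this] have "\<chi> r (tens_act (gr A) (smod ?s) r c t) = u r * F r (tact c x)"
      by (simp add: x(2) tens_act_coset[OF c])
    also have "\<dots> = ksgn (i * e) (c * \<chi> r t)"
      using gr_left_comm[OF u(1) c, of r] by (simp add: Ftact[OF c x(1)] ct ksgn_mult)
    finally show "\<chi> r (tens_act (gr A) (smod ?s) r c t) = ksgn (i * e) (c * \<chi> r t)" .
  qed
  moreover have "nev \<chi> fs = \<Phi> fs" for fs
  proof (cases "fs \<in> homog_args A")
    case True
    let ?r = "length fs" and ?x = "frag_of (1, dds ?s fs)"
    have x: "?x \<in> ppre ?r (total_degree n fs)" using dds_pre[OF gr_1 True] by simp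
    have Fsum: "F ?r (\<Sum>\<sigma>\<in>T. g \<sigma>) = (\<Sum>\<sigma>\<in>T. F ?r (g \<sigma>))" for T :: "(nat \<Rightarrow> nat) set" and g
      by (induction T rule: infinite_finite_induct) (auto simp: F0 Fadd)
    have "F ?r (Sym ?r ?x) = (\<Sum>\<sigma> \<in> {\<sigma>. \<sigma> permutes {..<?r}}. F ?r ?x)"
      unfolding Sym_def Fsum using x by (intro sum.cong refl Fperm) auto
    also have "F ?r ?x = \<Phi> fs" using F(3)[OF gr_1 True refl] by simp
    finally have "symval \<chi> ?r ?x = u ?r * (\<Sum>\<sigma> \<in> {\<sigma>. \<sigma> permutes {..<?r}}. \<Phi> fs)"
      unfolding symval_def using chi[OF CoS_Sym[OF x]] by simp
    also have "\<dots> = (\<Sum>\<sigma> \<in> {\<sigma>. \<sigma> permutes {..<?r}}. u ?r) * \<Phi> fs"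
      unfolding sum_distrib_left sum_distrib_right ..
    finally show ?thesis using True by (simp add: nev_def ev_symval u(2))
  next
    case False
    then show ?thesis using pder_supp[OF \<Phi>(1)] by (simp add: nev_def)
  qed
  ultimately show ?thesis using that by blast
qed

text \<open>Agreement is asked for on homogeneous arguments only, because the explicit formulas for
  products and brackets are not cut off elsewhere.\<close>

lemma pol_of:
  assumes "pder i \<Phi>" "Rlin \<Phi>" "\<And>fs. fs \<in> homog_args A \<Longrightarrow> \<Psi> fs = \<Phi> fs"
  shows "pol_of A n i \<Psi> \<in> Pol A n i" "nev (pol_of A n i \<Psi>) = \<Phi>"
proof -
  have iff: "(\<forall>fs \<in> homog_args A. ev A n \<chi> fs = \<Psi> fs) \<longleftrightarrow> nev \<chi> = \<Phi>" for \<chi>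
    using assms(3) pder_supp[OF assms(1)] by (fastforce simp: nev_def fun_eq_iff)
  obtain \<chi> where \<chi>: "\<chi> \<in> Pol A n i" "nev \<chi> = \<Phi>" using Pol_lift[OF assms(1,2)] .
  have "pol_of A n i \<Psi> = \<chi>"
    unfolding pol_of_def iff by (rule the_equality) (use \<chi> Pol_eqI in auto)
  then show "pol_of A n i \<Psi> \<in> Pol A n i" "nev (pol_of A n i \<Psi>) = \<Phi>" using \<chi> by simp_all
qed

lemma ev_add: "ev A n (\<phi> + \<psi>) fs = ev A n \<phi> fs + ev A n \<psi> fs"
  by (simp add: ev_def)

lemma nev_add: "nev (\<phi> + \<psi>) = nev \<phi> + nev \<psi>"
  by (rule ext) (simp add: nev_def ev_add)

lemma nev_ksgn: "nev (ksgn e \<phi>) = ksgn e (nev \<phi>)"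
  by (rule ext) (simp add: nev_def ev_def ksgn_apply)

lemma nev_0 [simp]: "nev 0 = 0"
  by (rule ext) (simp add: nev_def ev_def)

lemma Pol_add_closed:
  assumes P: "\<phi> \<in> Pol A n i" and Q: "\<psi> \<in> Pol A n i"
  shows "\<phi> + \<psi> \<in> Pol A n i"
  unfolding Pol_iff
  using Pol_off[OF P] Pol_off[OF Q] Pol_gr[OF P] Pol_gr[OF Q] Pol_add[OF P] Pol_add[OF Q] Pol_act[OF P] Pol_act[OF Q]
  by (auto simp: ksgn_add distrib_left algebra_simps intro!: gr_add)

lemma Pol_uminus_closed:
  assumes P: "\<phi> \<in> Pol A n i"
  shows "- \<phi> \<in> Pol A n i"
  unfolding Pol_iff
  using Pol_off[OF P] Pol_gr[OF P] Pol_add[OF P] Pol_act[OF P]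
  by (auto simp: ksgn_minus intro!: gr_uminus)

lemma Pol_ksgn_closed: "\<phi> \<in> Pol A n i \<Longrightarrow> ksgn e \<phi> \<in> Pol A n i"
  by (simp add: ksgn_def Pol_uminus_closed)

lemma Pol_0 [simp]: "0 \<in> Pol A n i"
  unfolding Pol_iff by auto

lemma Pol_sum_closed: "(\<And>l. l \<in> L \<Longrightarrow> \<phi> l \<in> Pol A n i) \<Longrightarrow> (\<Sum>l\<in>L. \<phi> l) \<in> Pol A n i"
  by (induction L rule: infinite_finite_induct) (simp_all only: sum.infinite sum.empty sum.insert Pol_0 Pol_add_closed insert_iff simp_thms)

lemma pol_of_nev:
  assumes "\<phi> \<in> Pol A n i"
  shows "pol_of A n i (nev \<phi>) = \<phi>"
  using pol_of[OF pder_nev[OF assms] Rlin_nev[OF assms] refl] by (intro Pol_eqI[OF _ assms])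

lemma pol_of_add:
  assumes "pder i \<Phi>" "Rlin \<Phi>" "pder i \<Psi>" "Rlin \<Psi>"
  shows "pol_of A n i (\<Phi> + \<Psi>) = pol_of A n i \<Phi> + pol_of A n i \<Psi>"
proof (rule Pol_eqI)
  note 1 = pol_of[OF assms(1,2) refl] and 2 = pol_of[OF assms(3,4) refl]
  note 3 = pol_of[OF pder_add[OF assms(1,3)] Rlin_add[OF assms(2,4)] refl]
  show "pol_of A n i (\<Phi> + \<Psi>) \<in> Pol A n i" by (rule 3)
  show "pol_of A n i \<Phi> + pol_of A n i \<Psi> \<in> Pol A n i" by (intro Pol_add_closed 1 2)
  show "nev (pol_of A n i (\<Phi> + \<Psi>)) = nev (pol_of A n i \<Phi> + pol_of A n i \<Psi>)"
    unfolding nev_add 1(2) 2(2) 3(2) ..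
qed

lemma pol_of_ksgn:
  assumes "pder i \<Phi>" "Rlin \<Phi>"
  shows "pol_of A n i (ksgn e \<Phi>) = ksgn e (pol_of A n i \<Phi>)"
proof (rule Pol_eqI)
  note 1 = pol_of[OF assms refl]
  note 3 = pol_of[OF pder_ksgn[OF assms(1), of e] Rlin_ksgn[OF assms(2), of e] refl]
  show "pol_of A n i (ksgn e \<Phi>) \<in> Pol A n i" by (rule 3)
  show "ksgn e (pol_of A n i \<Phi>) \<in> Pol A n i" by (intro Pol_ksgn_closed 1)
  show "nev (pol_of A n i (ksgn e \<Phi>)) = nev (ksgn e (pol_of A n i \<Phi>))"
    unfolding nev_ksgn 1(2) 3(2) ..
qed

lemma pol_of_0 [simp]: "pol_of A n i 0 = 0"
  using pol_of_nev[OF Pol_0] by simp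

section \<open>Operations on polyvectors in terms of polyderivations\<close>

lemma nths_homog: "fs \<in> homog_args A \<Longrightarrow> nths fs S \<in> homog_args A"
  using set_nths_subset[of fs S] by (auto simp: homog_args_def)

lemma nev_ev: "fs \<in> homog_args A \<Longrightarrow> nev \<phi> fs = ev A n \<phi> fs"
  by (simp add: nev_def)

text \<open>Insertion feeds a value of one function into the other. This value is again homogeneous,
  of the degree it is labelled with, so only homogeneous arguments are ever compared.\<close>

lemma schouten_agree:
  assumes "pder i \<Phi>'" "pder j \<Psi>'" "\<And>fs. fs \<in> homog_args A \<Longrightarrow> \<Phi> fs = \<Phi>' fs"
    "\<And>fs. fs \<in> homog_args A \<Longrightarrow> \<Psi> fs = \<Psi>' fs" and fs: "fs \<in> homog_args A"
  shows "schouten n i \<Phi> j \<Psi> fs = schouten n i \<Phi>' j \<Psi>' fs"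
proof -
  have "insertion n \<Phi> j \<Psi> fs = insertion n \<Phi>' j \<Psi>' fs"
    unfolding insertion_def
    by (intro sum.cong refl) (simp add: assms(4) nths_homog[OF fs] assms(3) pder_gr[OF assms(2)])
  moreover have "insertion n \<Psi> i \<Phi> fs = insertion n \<Psi>' i \<Phi>' fs"
    unfolding insertion_def
    by (intro sum.cong refl) (simp add: assms(4) nths_homog[OF fs] assms(3) pder_gr[OF assms(1)])
  ultimately show ?thesis by (simp add: schouten_def)
qed

lemma pol_mult:
  assumes P: "\<phi> \<in> Pol A n i" and Q: "\<psi> \<in> Pol A n j"
  shows "pol_mult A n i \<phi> j \<psi> \<in> Pol A n (i + j)" "nev (pol_mult A n i \<phi> j \<psi>) = pmul n (nev \<phi>) j (nev \<psi>)"
  unfolding pol_mult_def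
  by (rule pol_of[OF pder_pmul[OF pder_nev[OF P] pder_nev[OF Q]] Rlin_pmul[OF Rlin_nev[OF P] Rlin_nev[OF Q]]],
      auto simp: pmul_def nev_ev nths_homog)+

lemma pol_fun:
  assumes "a \<in> gr A i"
  shows "pol_fun A n i a \<in> Pol A n (- i)" "nev (pol_fun A n i a) = cst a"
  unfolding pol_fun_def by (rule pol_of[OF pder_cst[OF assms] Rlin_cst], simp add: cst_def)+

lemma pol_bracket:
  assumes P: "\<phi> \<in> Pol A n i" and Q: "\<psi> \<in> Pol A n j"
  shows "pol_bracket A n i \<phi> j \<psi> \<in> Pol A n (i + j - n - 1)"
    "nev (pol_bracket A n i \<phi> j \<psi>) = schouten n i (nev \<phi>) j (nev \<psi>)"
  unfolding pol_bracket_def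
  by (rule pol_of[OF pder_schouten[OF pder_nev[OF P] pder_nev[OF Q]]
        Rlin_schouten[OF pder_nev[OF P] Rlin_nev[OF P] pder_nev[OF Q] Rlin_nev[OF Q]]];
      rule schouten_agree[OF pder_nev[OF P] pder_nev[OF Q]]; simp add: nev_ev)+

lemma dfun_delta_fun: "fs \<in> homog_args A \<Longrightarrow> dfun fs = delta_fun A fs"
  by (simp add: dfun_def)

lemma pder_schouten_dfun:
  assumes "pder j \<Psi>"
  shows "pder (j + 1) (schouten n (n + 2) dfun j \<Psi>)"
  using pder_schouten[OF pder_dfun assms] by (simp add: add.commute)

lemma delta_bracket:
  assumes Q: "\<psi> \<in> Pol A n j"
  shows "delta_bracket A n j \<psi> \<in> Pol A n (j + 1)"
    "nev (delta_bracket A n j \<psi>) = schouten n (n + 2) dfun j (nev \<psi>)"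
  unfolding delta_bracket_def
  by (rule pol_of[OF pder_schouten_dfun[OF pder_nev[OF Q]] Rlin_schouten_dfun[OF pder_nev[OF Q] Rlin_nev[OF Q]]];
      rule schouten_agree[OF pder_dfun pder_nev[OF Q]]; simp add: nev_ev dfun_delta_fun)+

lemma delta_pi_bracket:
  assumes P: "\<pi> \<in> Pol A n (n + 2)" and Q: "\<psi> \<in> Pol A n j"
  shows "delta_pi_bracket A n \<pi> j \<psi> = delta_bracket A n j \<psi> + pol_bracket A n (n + 2) \<pi> j \<psi>"
proof -
  let ?d = "schouten n (n + 2) dfun j (nev \<psi>)" and ?p = "schouten n (n + 2) (nev \<pi>) j (nev \<psi>)"
  have d: "pder (j + 1) ?d" "Rlin ?d"
    using pder_schouten_dfun[OF pder_nev[OF Q]] Rlin_schouten_dfun[OF pder_nev[OF Q] Rlin_nev[OF Q]] .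
  have p: "pder (j + 1) ?p" "Rlin ?p"
    using pder_schouten[OF pder_nev[OF P] pder_nev[OF Q]]
      Rlin_schouten[OF pder_nev[OF P] Rlin_nev[OF P] pder_nev[OF Q] Rlin_nev[OF Q]] by (simp_all add: add.commute)
  have eq: "schouten n (n + 2) (delta_fun A + ev A n \<pi>) j (ev A n \<psi>) fs = (?d + ?p) fs" if "fs \<in> homog_args A" for fs
    unfolding schouten_add_left[OF pder_dfun pder_nev[OF P] pder_nev[OF Q], symmetric]
    using that by (intro schouten_agree[OF pder_add[OF pder_dfun pder_nev[OF P]] pder_nev[OF Q]])
      (simp_all add: nev_ev dfun_delta_fun)
  have 1: "delta_pi_bracket A n \<pi> j \<psi> \<in> Pol A n (j + 1)" "nev (delta_pi_bracket A n \<pi> j \<psi>) = ?d + ?p"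
    unfolding delta_pi_bracket_def
    by (rule pol_of[OF pder_add[OF d(1) p(1)] Rlin_add[OF d(2) p(2)] eq], assumption)+
  have 2: "pol_bracket A n (n + 2) \<pi> j \<psi> \<in> Pol A n (j + 1)"
    using pol_bracket(1)[OF P Q] by (simp add: add.commute)
  show ?thesis
    by (rule Pol_eqI[OF 1(1) Pol_add_closed[OF delta_bracket(1)[OF Q] 2]])
      (simp only: 1(2) nev_add delta_bracket(2)[OF Q] pol_bracket(2)[OF P Q])
qed

lemma pol_prod:
  assumes "\<forall>(i, \<phi>) \<in> set xs. \<phi> \<in> Pol A n i"
  shows "pol_prod A n xs \<in> Pol A n (sum_list (map fst xs)) \<and>
    nev (pol_prod A n xs) = PP n (map (\<lambda>(i, \<phi>). (i, nev \<phi>)) xs)"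
  using assms
proof (induction xs)
  case Nil
  show ?case using pol_fun[OF gr_1] by simp
next
  case (Cons x xs)
  obtain i \<phi> where x: "x = (i, \<phi>)" by (cases x)
  have m: "map fst (map (\<lambda>(i, \<phi>). (i, nev \<phi>)) xs) = map fst xs" by auto
  have "\<phi> \<in> Pol A n i" "pol_prod A n xs \<in> Pol A n (sum_list (map fst xs))" using Cons by (auto simp: x)
  from pol_mult[OF this] show ?case using Cons by (simp add: x m del: map_map)
qed

lemma bracket_fun:
  assumes P: "\<pi> \<in> Pol A n j" and f: "f \<in> gr A d"
  shows "pol_bracket A n j \<pi> (- d) (pol_fun A n d f) \<in> Pol A n (j - d - n - 1)"
    "nev (pol_bracket A n j \<pi> (- d) (pol_fun A n d f)) = contr (d, f) (nev \<pi>)"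
  using pol_bracket[OF P pol_fun(1)[OF f]] by (simp_all add: pol_fun(2)[OF f] schouten_cst[OF pder_nev[OF P] f])

lemma mu_factors:
  assumes P: "\<pi> \<in> Pol A n (n + 2)" and a: "a \<in> gr A i" and fs: "fs \<in> homog_args A"
  shows "\<forall>(i, \<phi>) \<in> set (mu_factors A n \<pi> i a fs). \<phi> \<in> Pol A n i"
    "map (\<lambda>(i, \<phi>). (i, nev \<phi>)) (mu_factors A n \<pi> i a fs) =
      (- i, cst a) # map (\<lambda>x. (1 - fst x, contr x (nev \<pi>))) fs"
proof -
  have "pol_bracket A n (n + 2) \<pi> (- d) (pol_fun A n d f) \<in> Pol A n (1 - d)" if "f \<in> gr A d" for d f
    using bracket_fun(1)[OF P that] by (simp add: algebra_simps)
  then show "\<forall>(i, \<phi>) \<in> set (mu_factors A n \<pi> i a fs). \<phi> \<in> Pol A n i"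
    using pol_fun(1)[OF a] fs by (auto simp: mu_factors_def homog_args_def)
  show "map (\<lambda>(i, \<phi>). (i, nev \<phi>)) (mu_factors A n \<pi> i a fs) =
      (- i, cst a) # map (\<lambda>x. (1 - fst x, contr x (nev \<pi>))) fs"
    using fs by (auto simp: mu_factors_def pol_fun(2)[OF a] bracket_fun(2)[OF P] homog_args_def split: prod.splits)
qed

lemma pder_scaled:
  assumes "a \<in> gr A i" "pder j \<Psi>" "Rlin \<Psi>" "k = j - i"
  shows "pder k (\<lambda>gs. a * \<Psi> gs)" "Rlin (\<lambda>gs. a * \<Psi> gs)"
  using pder_scale[OF assms(1,2)] Rlin_scale[OF assms(3)] assms(4) by auto

lemma mu_on_form:
  assumes P: "\<pi> \<in> Pol A n (n + 2)" and a: "a \<in> gr A i" and fs: "fs \<in> homog_args A"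
  shows "pol_prod A n (mu_factors A n \<pi> i a fs) = pol_of A n (cdeg fs - i) (\<lambda>gs. a * Pr n (nev \<pi>) fs gs)"
proof -
  note m = mu_factors[OF P a fs]
  have "sum_list (map fst (mu_factors A n \<pi> i a fs)) = cdeg fs - i"
    by (simp add: mu_factors_def cdeg_def case_prod_unfold comp_def)
  then have 1: "pol_prod A n (mu_factors A n \<pi> i a fs) \<in> Pol A n (cdeg fs - i)"
    "nev (pol_prod A n (mu_factors A n \<pi> i a fs)) = (\<lambda>gs. a * Pr n (nev \<pi>) fs gs)"
    using pol_prod[OF m(1)] unfolding m(2) by (simp_all add: pmul_cst PP_Pr)
  then show ?thesis using pol_of_nev[OF 1(1)] by simp
qed

text \<open>b has degree n + 3 like [\<pi>, \<pi>] and \<kappa>(\<pi>), so \<nu> is an operation of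
  degree 1; passing the coefficient gives \<open>ksgn i\<close>. The index \<open>Suc l\<close>
  belongs to the l-th function because position 0 holds the coefficient.\<close>

lemma nu_on_form:
  assumes P: "\<pi> \<in> Pol A n (n + 2)" and b: "b \<in> Pol A n (n + 3)" and a: "a \<in> gr A i" and fs: "fs \<in> homog_args A"
  shows "(\<Sum>l < length fs. ksgn ((n + 3 - n - 2) * (- i + (\<Sum>(d, f) \<leftarrow> take l fs. 1 - d)))
      (pol_prod A n ((mu_factors A n \<pi> i a fs)[Suc l :=
        (case fs ! l of (d, f) \<Rightarrow>
           (n + 3 - d - n - 1, pol_bracket A n (n + 3) b (- d) (pol_fun A n d f)))]))) =
    pol_of A n (cdeg fs + 1 - i) (ksgn i (\<lambda>gs. a * Rep n (nev \<pi>) (\<lambda>x. contr x (nev b)) fs gs))"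
proof -
  note m = mu_factors[OF P a fs]
  let ?c = "\<lambda>x. contr x (nev b)"
  let ?L = "\<lambda>l. (map (\<lambda>x. (1 - fst x, contr x (nev \<pi>))) fs)[l := (2 - fst (fs ! l), ?c (fs ! l))]"
  let ?u = "\<lambda>l. case fs ! l of (d, f) \<Rightarrow>
           (n + 3 - d - n - 1, pol_bracket A n (n + 3) b (- d) (pol_fun A n d f))"
  have one: "pol_prod A n ((mu_factors A n \<pi> i a fs)[Suc l := ?u l]) \<in> Pol A n (cdeg fs + 1 - i) \<and>
    nev (pol_prod A n ((mu_factors A n \<pi> i a fs)[Suc l := ?u l])) = (\<lambda>gs. a * PP n (?L l) gs)"
    if l: "l < length fs" for l
  proof -
    obtain d f where df: "fs ! l = (d, f)" by (cases "fs ! l")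
    have f: "f \<in> gr A d" using fs nth_mem[OF l] by (auto simp: homog_args_def df)
    have u: "snd (?u l) \<in> Pol A n (fst (?u l))" using bracket_fun(1)[OF b f] by (simp add: df)
    have all: "\<forall>(i, \<phi>) \<in> set ((mu_factors A n \<pi> i a fs)[Suc l := ?u l]). \<phi> \<in> Pol A n i"
    proof
      fix x assume "x \<in> set ((mu_factors A n \<pi> i a fs)[Suc l := ?u l])"
      then have "x = ?u l \<or> x \<in> set (mu_factors A n \<pi> i a fs)"
        using set_update_subset_insert[of "mu_factors A n \<pi> i a fs" "Suc l" "?u l"] by blast
      then show "case x of (i, \<phi>) \<Rightarrow> \<phi> \<in> Pol A n i"
        using m(1) u by (auto simp only: case_prod_unfold)
    qed
    have map: "map (\<lambda>(i, \<phi>). (i, nev \<phi>)) ((mu_factors A n \<pi> i a fs)[Suc l := ?u l]) = (- i, cst a) # ?L l"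
      unfolding map_update m(2) by (simp add: df bracket_fun(2)[OF b f])
    have "map fst ((mu_factors A n \<pi> i a fs)[Suc l := ?u l]) =
       map fst (map (\<lambda>(i, \<phi>). (i, nev \<phi>)) ((mu_factors A n \<pi> i a fs)[Suc l := ?u l]))" by auto
    then have "sum_list (map fst ((mu_factors A n \<pi> i a fs)[Suc l := ?u l])) = cdeg fs + 1 - i"
      unfolding map using sum_list_cdeg_update[OF l, of "\<lambda>x. contr x (nev \<pi>)" "?c (fs ! l)"] by simp
    then show ?thesis using pol_prod[OF all] unfolding map by (simp add: pmul_cst)
  qed
  let ?\<phi> = "\<lambda>l. ksgn ((n + 3 - n - 2) * (- i + (\<Sum>(d, f) \<leftarrow> take l fs. 1 - d)))
      (pol_prod A n ((mu_factors A n \<pi> i a fs)[Suc l := ?u l]))"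
  have mem: "(\<Sum>l<length fs. ?\<phi> l) \<in> Pol A n (cdeg fs + 1 - i)"
    by (intro Pol_sum_closed Pol_ksgn_closed) (use one in auto)
  have nev_sum: "nev (\<Sum>l\<in>L. \<phi> l) = (\<Sum>l\<in>L. nev (\<phi> l))" for L :: "nat set" and \<phi>
    by (induction L rule: infinite_finite_induct) (simp_all only: sum.infinite sum.empty sum.insert nev_0 nev_add not_False_eq_True)
  have "nev (\<Sum>l<length fs. ?\<phi> l) = (\<Sum>l<length fs. ksgn (i + cdeg (take l fs)) (\<lambda>gs. a * PP n (?L l) gs))"
    unfolding nev_sum nev_ksgn
    by (intro sum.cong refl ksgn_cong_diff) (use one in \<open>auto simp: cdeg_def\<close>)
  also have "\<dots> = ksgn i (\<lambda>gs. a * Rep n (nev \<pi>) ?c fs gs)"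
  proof
    fix gs
    have sum_apply: "(\<Sum>l\<in>L. \<Phi> l) gs = (\<Sum>l\<in>L. \<Phi> l gs)" for L :: "nat set" and \<Phi> :: "nat \<Rightarrow> (int \<times> 'a) list \<Rightarrow> 'a"
      by (induction L rule: infinite_finite_induct) auto
    show "(\<Sum>l<length fs. ksgn (i + cdeg (take l fs)) (\<lambda>gs. a * PP n (?L l) gs)) gs = ksgn i (\<lambda>gs. a * Rep n (nev \<pi>) ?c fs gs) gs"
      unfolding Rep_eq_sum sum_apply ksgn_apply sum_distrib_left ksgn_sum
      by (intro sum.cong refl) (simp add: ksgn_mult)
  qed
  finally show ?thesis using pol_of_nev[OF mem] by simp
qed

end

section \<open>Differential forms\<close>

context graded_algebra
begin

text \<open>The tautological example, with the relations of the symmetric power as H. The operators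
  d and \<delta> on forms arise by modifying it.\<close>

lemma mform_universal:
  "mform s r (sym_sub (gr A) (smod s) r) (\<lambda>i a fs. frag_of (a, dds s fs))"
proof (rule mformI)
  fix i a b fs assume a: "a \<in> gr A i" "b \<in> gr A i" "fs \<in> homog_args A" "length fs = r"
  show "frag_of (a + b, dds s fs) - frag_of (a, dds s fs) - frag_of (b, dds s fs) \<in> sym_sub (gr A) (smod s) r"
    by (intro tens_sub_sym_sub group_closure.base insertI2 tens_rel.intros(1)[of _ _ i] dds_factors a)
next
  fix i a d f g fs assume a: "a \<in> gr A i" "f \<in> gr A d" "g \<in> gr A d" "fs \<in> homog_args A" "Suc (length fs) = r"
  show "frag_of (a, dds s ((d, f + g) # fs)) - frag_of (a, dds s ((d, f) # fs)) - frag_of (a, dds s ((d, g) # fs))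
    \<in> sym_sub (gr A) (smod s) r"
    using tens_dd_add[OF a(1-3), where xs = "[]" and ys = "dds s fs" and r = r] a dds_factors[OF a(4) refl, of s]
    by (intro tens_sub_sym_sub) simp
next
  fix i a p q f g fs
  assume a: "a \<in> gr A i" "f \<in> gr A p" "g \<in> gr A q" "fs \<in> homog_args A" "Suc (length fs) = r"
  show "frag_of (a, dds s ((p + q, f * g) # fs)) - ksgn (s * p) (frag_of (a * f, dds s ((q, g) # fs))) -
    ksgn (p * q + s * q) (frag_of (a * g, dds s ((p, f) # fs))) \<in> sym_sub (gr A) (smod s) r"
    using tens_dd_mult[OF a(1-3), where ys = "dds s fs" and r = r] a dds_factors[OF a(4) refl, of s]
    by (intro tens_sub_sym_sub) simp
next
  fix i a d c fs assume a: "a \<in> gr A i" "str A c \<in> gr A d" "fs \<in> homog_args A" "Suc (length fs) = r"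
  show "frag_of (a, dds s ((d, str A c) # fs)) \<in> sym_sub (gr A) (smod s) r"
    using tens_dd_str[OF a(1,2), where ys = "dds s fs" and r = r] a dds_factors[OF a(3) refl, of s]
    by (intro tens_sub_sym_sub) simp
next
  fix i a xs x y ys
  assume a: "a \<in> gr A i" "xs @ x # y # ys \<in> homog_args A" "length (xs @ x # y # ys) = r"
  have "dds s (xs @ x # y # ys) \<in> factors (smod s) r" using dds_factors[OF a(2,3)] .
  then have "frag_of (a, dds s xs @ [(fst x - s, dd A (snd x)), (fst y - s, dd A (snd y))] @ dds s ys) -
    ksgn ((fst x - s) * (fst y - s))
      (frag_of (a, dds s xs @ [(fst y - s, dd A (snd y)), (fst x - s, dd A (snd x))] @ dds s ys)) \<in> sym_rel (gr A) (smod s) r"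
    unfolding sym_rel_def using a(1) by (intro UnI2 CollectI exI conjI refl) (auto simp: case_prod_unfold)
  then show "frag_of (a, dds s (xs @ x # y # ys)) - ksgn ((fst x - s) * (fst y - s)) (frag_of (a, dds s (xs @ y # x # ys)))
     \<in> sym_sub (gr A) (smod s) r"
    by (intro group_closure.base insertI2) (simp add: case_prod_unfold)
qed simp

lemma mform_swap0:
  assumes "mform s r H V" "a \<in> gr A i" "x # y # ys \<in> homog_args A" "length (x # y # ys) = r"
  shows "V i a (x # y # ys) - ksgn ((fst x - s) * (fst y - s)) (V i a (y # x # ys)) \<in> H"
  using mform_swap[OF assms(1,2), of "[]" x y ys] assms(3,4) by simp

text \<open>An identity in any abelian group, decided by parities. Its right side is the combination
  of the congruences h1 to h7 in \<open>mform_d\<close>, whose letters stand for values of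
  V.\<close>

lemma mform_diff_identity:
  fixes A' :: "'z::ab_group_add"
  shows "A' - ksgn p X2 - ksgn (p * q + q) X3 =
    (A' - ksgn ((i - 1) * (p + q - 1)) B) +
    ksgn ((i - 1) * (p + q - 1)) ((B - ksgn p C1 - ksgn (p * q + q) C2) +
      ksgn p (C1 - ksgn ((q - 1) * (i - 1)) E1) + ksgn (p * q + q) (C2 - ksgn ((p - 1) * (i - 1)) E2)) -
    ksgn p (X2 - ksgn i G1 - ksgn (i * p + p) E1) -
    ksgn (p * q + q) ((X3 - ksgn i G2 - ksgn (i * q + q) E2) + ksgn i (G2 - ksgn ((p - 1) * (q - 1)) G1))"
  by (cases "even i"; cases "even p"; cases "even q"; simp add: ksgn_def)

text \<open>In the Leibniz rule da d(fg) is compared with d(af) dg and d(ag) df. Apart from the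
  wanted terms the latter contain a df dg and a dg df, which cancel by the exchange rule.\<close>

lemma mform_d:
  assumes V: "mform 1 (Suc r) H V"
  shows "mform 1 r H (\<lambda>i a fs. V 0 1 ((i, a) # fs))"
proof (rule mformI)
  show H: "subgrp H" by (rule mform_subgrp[OF V])
  have sw: "V 0 1 (x # y # ys) - ksgn ((fst x - 1) * (fst y - 1)) (V 0 1 (y # x # ys)) \<in> H"
    if "x # y # ys \<in> homog_args A" "length (x # y # ys) = Suc r" for x y ys
    using mform_swap0[OF V gr_1 that] .
  fix i a fs assume a: "a \<in> gr A i" and fs: "fs \<in> homog_args A"
  show "V 0 1 ((i, a + b) # fs) - V 0 1 ((i, a) # fs) - V 0 1 ((i, b) # fs) \<in> H"
    if "b \<in> gr A i" "length fs = r" for b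
    using a fs that by (intro mform_add_arg[OF V]) auto
  assume r: "Suc (length fs) = r"
  show "V 0 1 ((i, a) # (d, f + g) # fs) - V 0 1 ((i, a) # (d, f) # fs) - V 0 1 ((i, a) # (d, g) # fs) \<in> H"
    if fg: "f \<in> gr A d" "g \<in> gr A d" for d f g
  proof (rule subgrp_cong3[OF H])
    show "V 0 1 ((d, f + g) # (i, a) # fs) - V 0 1 ((d, f) # (i, a) # fs) - V 0 1 ((d, g) # (i, a) # fs) \<in> H"
      using a fs r fg by (intro mform_add_arg[OF V]) auto
    show "V 0 1 ((i, a) # (d, f + g) # fs) - ksgn ((i - 1) * (d - 1)) (V 0 1 ((d, f + g) # (i, a) # fs)) \<in> H"
      "V 0 1 ((i, a) # (d, f) # fs) - ksgn ((i - 1) * (d - 1)) (V 0 1 ((d, f) # (i, a) # fs)) \<in> H"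
      "V 0 1 ((i, a) # (d, g) # fs) - ksgn ((i - 1) * (d - 1)) (V 0 1 ((d, g) # (i, a) # fs)) \<in> H"
      using sw[of "(i, a)" "(d, f + g)" fs] sw[of "(i, a)" "(d, f)" fs] sw[of "(i, a)" "(d, g)" fs] a fs r fg
      by auto
  qed
  show "V 0 1 ((i, a) # (p + q, f * g) # fs) - ksgn (1 * p) (V 0 1 ((i + p, a * f) # (q, g) # fs)) -
        ksgn (p * q + 1 * q) (V 0 1 ((i + q, a * g) # (p, f) # fs)) \<in> H"
    if fg: "f \<in> gr A p" "g \<in> gr A q" for p q f g
  proof -
    have h1: "V 0 1 ((i, a) # (p + q, f * g) # fs) - ksgn ((i - 1) * (p + q - 1)) (V 0 1 ((p + q, f * g) # (i, a) # fs)) \<in> H"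
      using sw[of "(i, a)" "(p + q, f * g)" fs] a fs r fg by auto
    have h2: "V 0 1 ((p + q, f * g) # (i, a) # fs) - ksgn p (V p f ((q, g) # (i, a) # fs)) -
       ksgn (p * q + q) (V q g ((p, f) # (i, a) # fs)) \<in> H"
      using mform_mult_arg[OF V gr_1 fg, of "(i, a) # fs"] a fs r by simp
    have h3: "V 0 1 ((i + p, a * f) # (q, g) # fs) - ksgn i (V i a ((p, f) # (q, g) # fs)) -
       ksgn (i * p + p) (V p f ((i, a) # (q, g) # fs)) \<in> H"
      using mform_mult_arg[OF V gr_1 a fg(1), of "(q, g) # fs"] fg(2) fs r by simp
    have h4: "V 0 1 ((i + q, a * g) # (p, f) # fs) - ksgn i (V i a ((q, g) # (p, f) # fs)) -
       ksgn (i * q + q) (V q g ((i, a) # (p, f) # fs)) \<in> H"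
      using mform_mult_arg[OF V gr_1 a fg(2), of "(p, f) # fs"] fg(1) fs r by simp
    have h5: "V p f ((q, g) # (i, a) # fs) - ksgn ((q - 1) * (i - 1)) (V p f ((i, a) # (q, g) # fs)) \<in> H"
      using mform_swap0[OF V fg(1), of "(q, g)" "(i, a)" fs] a fs r fg by simp
    have h6: "V q g ((p, f) # (i, a) # fs) - ksgn ((p - 1) * (i - 1)) (V q g ((i, a) # (p, f) # fs)) \<in> H"
      using mform_swap0[OF V fg(2), of "(p, f)" "(i, a)" fs] a fs r fg by simp
    have h7: "V i a ((q, g) # (p, f) # fs) - ksgn ((p - 1) * (q - 1)) (V i a ((p, f) # (q, g) # fs)) \<in> H"
      using mform_swap0[OF V a, of "(q, g)" "(p, f)" fs] fs r fg by (simp add: mult.commute)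
    note CE = subgrp_add[OF H subgrp_add[OF H h2 subgrp_ksgn[OF H h5, of p]] subgrp_ksgn[OF H h6, of "p * q + q"]]
    note GG = subgrp_add[OF H h4 subgrp_ksgn[OF H h7, of i]]
    show ?thesis
      using subgrp_diff[OF H subgrp_diff[OF H subgrp_add[OF H h1 subgrp_ksgn[OF H CE, of "(i - 1) * (p + q - 1)"]]
          subgrp_ksgn[OF H h3, of p]] subgrp_ksgn[OF H GG, of "p * q + q"]]
      unfolding mult_1 mform_diff_identity[symmetric] .
  qed
  show "V 0 1 ((i, a) # (d, str A k) # fs) \<in> H" if k: "str A k \<in> gr A d" for d k
  proof -
    have "V 0 1 ((d, str A k) # (i, a) # fs) \<in> H" using a fs r k by (intro mform_str_arg[OF V]) auto
    then show ?thesis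
      using sw[of "(i, a)" "(d, str A k)" fs] a fs r k by (simp add: subgrp_cong_mem[OF H] subgrp_ksgn_iff[OF H])
  qed
next
  fix i a xs x y ys
  assume a: "a \<in> gr A i" "xs @ x # y # ys \<in> homog_args A" "length (xs @ x # y # ys) = r"
  then show "V 0 1 ((i, a) # xs @ x # y # ys) - ksgn ((fst x - 1) * (fst y - 1)) (V 0 1 ((i, a) # xs @ y # x # ys)) \<in> H"
    using mform_swap[OF V gr_1, of "(i, a) # xs" x y ys] by simp
qed

text \<open>\<open>\<Sum>\<^sub>l \<plusminus> V (f\<^sub>1, \<dots>, \<delta>f\<^sub>l, \<dots>, f\<^sub>r)\<close>, with the arguments already passed collected in \<open>pre\<close>.\<close>

fun dsum :: "((int \<times> 'a) list \<Rightarrow> 'b) \<Rightarrow> int \<Rightarrow> (int \<times> 'a) list \<Rightarrow> (int \<times> 'a) list \<Rightarrow> 'b::ab_group_add"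
  where
    "dsum V e pre [] = 0"
  | "dsum V e pre (x # fs) = ksgn e (V (pre @ (fst x - 1, del A (snd x)) # fs)) + dsum V (e + fst x - 1) (pre @ [x]) fs"

lemma dsum_eq_sum:
  "dsum V e pre fs = (\<Sum>l<length fs. ksgn (e + sdeg 1 (take l fs)) (V (pre @ fs[l := (fst (fs ! l) - 1, del A (snd (fs ! l)))])))"
proof (induction fs arbitrary: e pre)
  case (Cons x fs)
  then show ?case by (simp add: sum.lessThan_Suc_shift algebra_simps del: sum.lessThan_Suc)
qed simp

text \<open>\<delta> acts on arguments behind the first one, so a three-term relation in the first
  argument holds in each summand. That argument sits at the head of the prefix already
  passed.\<close>

lemma dsum_cong3:
  assumes H: "subgrp H"
    and V: "\<And>ls. ls \<in> homog_args A \<Longrightarrow> length ls = m \<Longrightarrow> V1 (x1 # ls) - ksgn u (V2 (x2 # ls)) - ksgn v (V3 (x3 # ls)) \<in> H"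
  shows "pre @ fs \<in> homog_args A \<Longrightarrow> length (pre @ fs) = m \<Longrightarrow>
    dsum V1 e (x1 # pre) fs - ksgn u (dsum V2 e (x2 # pre) fs) - ksgn v (dsum V3 e (x3 # pre) fs) \<in> H"
proof (induction fs arbitrary: e pre)
  case Nil
  then show ?case by (simp add: subgrp_zero[OF H])
next
  case (Cons z fs)
  let ?z = "(fst z - 1, del A (snd z))"
  have "V1 (x1 # pre @ ?z # fs) - ksgn u (V2 (x2 # pre @ ?z # fs)) - ksgn v (V3 (x3 # pre @ ?z # fs)) \<in> H"
    using Cons.prems del_gr by (intro V) auto
  from subgrp_ksgn[OF H this, of e]
  have 1: "ksgn e (V1 (x1 # pre @ ?z # fs)) - ksgn u (ksgn e (V2 (x2 # pre @ ?z # fs))) - ksgn v (ksgn e (V3 (x3 # pre @ ?z # fs))) \<in> H"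
    by (simp add: ksgn_diff add.commute)
  have 2: "dsum V1 (e + fst z - 1) (x1 # pre @ [z]) fs - ksgn u (dsum V2 (e + fst z - 1) (x2 # pre @ [z]) fs) -
    ksgn v (dsum V3 (e + fst z - 1) (x3 # pre @ [z]) fs) \<in> H"
    using Cons.prems by (intro Cons.IH) auto
  have "dsum V1 e (x1 # pre) (z # fs) - ksgn u (dsum V2 e (x2 # pre) (z # fs)) - ksgn v (dsum V3 e (x3 # pre) (z # fs)) =
    (ksgn e (V1 (x1 # pre @ ?z # fs)) - ksgn u (ksgn e (V2 (x2 # pre @ ?z # fs))) - ksgn v (ksgn e (V3 (x3 # pre @ ?z # fs)))) +
    (dsum V1 (e + fst z - 1) (x1 # pre @ [z]) fs - ksgn u (dsum V2 (e + fst z - 1) (x2 # pre @ [z]) fs) -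
    ksgn v (dsum V3 (e + fst z - 1) (x3 # pre @ [z]) fs))"
    by (simp add: ksgn_add)
  then show ?case using subgrp_add[OF H 1 2] by (simp only:)
qed

lemma dsum_mem:
  assumes H: "subgrp H" and V: "\<And>ls. ls \<in> homog_args A \<Longrightarrow> length ls = m \<Longrightarrow> V (x # ls) \<in> H"
    and "pre @ fs \<in> homog_args A" "length (pre @ fs) = m"
  shows "dsum V e (x # pre) fs \<in> H"
proof -
  have 0: "dsum (\<lambda>_. 0) e pre fs = 0" for e pre and fs :: "(int \<times> 'a) list"
    by (induction fs arbitrary: e pre) auto
  show ?thesis
    using dsum_cong3[OF H, of m V x 0 "\<lambda>_. 0" x 0 "\<lambda>_. 0" x pre fs e] assms(2-4) by (simp add: 0)
qed

lemma dsum_pre_swap: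
  assumes H: "subgrp H"
    and V: "\<And>xs ys. xs @ x # y # ys \<in> homog_args A \<Longrightarrow> length (xs @ x # y # ys) = r \<Longrightarrow>
      V (xs @ x # y # ys) - ksgn u (V (xs @ y # x # ys)) \<in> H"
  shows "pre @ x # y # pre' @ fs \<in> homog_args A \<Longrightarrow> length (pre @ x # y # pre' @ fs) = r \<Longrightarrow>
    dsum V e (pre @ x # y # pre') fs - ksgn u (dsum V e (pre @ y # x # pre') fs) \<in> H"
proof (induction fs arbitrary: e pre')
  case Nil
  then show ?case by (simp add: subgrp_zero[OF H])
next
  case (Cons z fs)
  let ?z = "(fst z - 1, del A (snd z))"
  have "V (pre @ x # y # pre' @ ?z # fs) - ksgn u (V (pre @ y # x # pre' @ ?z # fs)) \<in> H"
    using Cons.prems del_gr by (intro V) auto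
  from subgrp_add[OF H subgrp_ksgn[OF H this, of e] Cons.IH[of "pre' @ [z]" "e + fst z - 1"]] Cons.prems
  show ?case by (simp add: ksgn_diff ksgn_add algebra_simps)
qed

text \<open>If \<delta> hits x or y, it lowers that degree by 1 and so changes the exchange sign; it
  also passes one argument more or less than on the other side. Both effects cancel, which is the
  equation D.\<close>

lemma dsum_swap:
  assumes V: "mform 1 r H V" and a: "a \<in> gr A i"
  shows "pre @ xs @ x # y # ys \<in> homog_args A \<Longrightarrow> length (pre @ xs @ x # y # ys) = r \<Longrightarrow>
    dsum (V i a) e pre (xs @ x # y # ys) -
    ksgn ((fst x - 1) * (fst y - 1)) (dsum (V i a) e pre (xs @ y # x # ys)) \<in> H"
proof (induction xs arbitrary: e pre)
  case Nil
  note H = mform_subgrp[OF V]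
  let ?x = "(fst x - 1, del A (snd x))" and ?y = "(fst y - 1, del A (snd y))"
  have 1: "V i a (pre @ ?x # y # ys) - ksgn ((fst x - 1 - 1) * (fst y - 1)) (V i a (pre @ y # ?x # ys)) \<in> H"
    using mform_swap[OF V a, of pre ?x y ys] Nil del_gr by auto
  have 2: "V i a (pre @ x # ?y # ys) - ksgn ((fst x - 1) * (fst y - 1 - 1)) (V i a (pre @ ?y # x # ys)) \<in> H"
    using mform_swap[OF V a, of pre x ?y ys] Nil del_gr by auto
  have 3: "dsum (V i a) (e + fst x - 1 + fst y - 1) (pre @ [x, y]) ys -
      ksgn ((fst x - 1) * (fst y - 1)) (dsum (V i a) (e + fst x - 1 + fst y - 1) (pre @ [y, x]) ys) \<in> H"
    using dsum_pre_swap[OF H, of x y r "V i a" "(fst x - 1) * (fst y - 1)" pre "[]" ys] mform_swap[OF V a] Nil by simp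
  have eq: "dsum (V i a) (e + fst y - 1 + fst x - 1) (pre @ [y, x]) ys = dsum (V i a) (e + fst x - 1 + fst y - 1) (pre @ [y, x]) ys"
    by (simp add: algebra_simps)
  have D: "dsum (V i a) e pre ([] @ x # y # ys) - ksgn ((fst x - 1) * (fst y - 1)) (dsum (V i a) e pre ([] @ y # x # ys)) =
    ksgn e (V i a (pre @ ?x # y # ys) - ksgn ((fst x - 1 - 1) * (fst y - 1)) (V i a (pre @ y # ?x # ys))) +
    ksgn (e + fst x - 1) (V i a (pre @ x # ?y # ys) - ksgn ((fst x - 1) * (fst y - 1 - 1)) (V i a (pre @ ?y # x # ys))) +
    (dsum (V i a) (e + fst x - 1 + fst y - 1) (pre @ [x, y]) ys -
      ksgn ((fst x - 1) * (fst y - 1)) (dsum (V i a) (e + fst x - 1 + fst y - 1) (pre @ [y, x]) ys))"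
    by (simp add: eq) (cases "even e"; cases "even (fst x)"; cases "even (fst y)";
        simp add: ksgn_def add.commute[of "fst y" "fst x"])
  then show ?case
    using subgrp_add[OF H subgrp_add[OF H subgrp_ksgn[OF H 1, of e] subgrp_ksgn[OF H 2, of "e + fst x - 1"]] 3] by (simp only: D)
next
  case (Cons z xs)
  note H = mform_subgrp[OF V]
  let ?z = "(fst z - 1, del A (snd z))"
  have "V i a ((pre @ ?z # xs) @ x # y # ys) - ksgn ((fst x - 1) * (fst y - 1)) (V i a ((pre @ ?z # xs) @ y # x # ys)) \<in> H"
    using Cons.prems del_gr by (intro mform_swap[OF V a]) auto
  from subgrp_add[OF H subgrp_ksgn[OF H this, of e] Cons.IH[of "pre @ [z]" "e + fst z - 1"]] Cons.prems
  show ?case by (simp add: ksgn_diff ksgn_add add.commute add_diff_eq diff_diff_eq)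
qed

lemma mform_ksgn_arg:
  assumes V: "mform s r H V" and "a \<in> gr A i" "f \<in> gr A d" "fs \<in> homog_args A" "Suc (length fs) = r"
  shows "V i a ((d, ksgn e f) # fs) - ksgn e (V i a ((d, f) # fs)) \<in> H"
proof (cases "even e")
  case True
  then show ?thesis by (simp add: ksgn_even subgrp_zero[OF mform_subgrp[OF V]])
next
  case False
  note H = mform_subgrp[OF V]
  have 1: "V i a ((d, f + - f) # fs) - V i a ((d, f) # fs) - V i a ((d, - f) # fs) \<in> H"
    using assms by (intro mform_add_arg[OF V]) auto
  have 0: "V i a ((d, 0) # fs) \<in> H"
    using mform_zero_arg[OF V assms(2), of "[]" fs d] assms by simp
  have D: "V i a ((d, 0) # fs) - (V i a ((d, 0) # fs) - V i a ((d, f) # fs) - V i a ((d, - f) # fs)) \<in> H"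
    using subgrp_diff[OF H 0 1] by (simp only: add.right_inverse)
  have "V i a ((d, ksgn e f) # fs) - ksgn e (V i a ((d, f) # fs)) =
      V i a ((d, 0) # fs) - (V i a ((d, 0) # fs) - V i a ((d, f) # fs) - V i a ((d, - f) # fs))"
    using False by (simp add: ksgn_odd)
  then show ?thesis using D by (simp only:)
qed

text \<open>The combination of the congruences k1 to k10 in \<open>mform_delta\<close>. The terms u1
  and u4, with \<delta> f and \<delta> g in the coefficient, occur both in \<delta>(af),
  \<delta>(ag) and in d(\<delta>(fg)), and cancel.\<close>

lemma mform_delta_identity:
  fixes T1 :: "'z::ab_group_add"
  shows "(T1 + (ksgn (1 + i) x + d0)) - ksgn p (z1 + (ksgn (1 + (i + p)) u3 + d1)) -
      ksgn (p * q + q) (z2 + (ksgn (1 + (i + q)) u2 + d2)) =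
    (T1 - ksgn p b1 - ksgn (p * q + q) c1) +
    ksgn (1 + i) ((x - Y1 - Y2') + (Y2' - ksgn p Y2) +
      (Y1 - ksgn (p - 1) u1 - ksgn ((p - 1) * q + q) u2) +
      ksgn p (Y2 - ksgn p u3 - ksgn (p * (q - 1) + (q - 1)) u4)) +
    (d0 - ksgn p d1 - ksgn (p * q + q) d2) -
    ksgn p ((z1 - b1 - z1') + (z1' - ksgn i u1)) -
    ksgn (p * q + q) ((z2 - c1 - z2') + (z2' - ksgn i u4))"
  by (cases "even i"; cases "even p"; cases "even q"; simp add: ksgn_def)

lemma mform_delta:
  assumes V: "mform 1 r H V"
  shows "mform 1 r H (\<lambda>i a fs. V (i - 1) (del A a) fs + dsum (V i a) (1 + i) [] fs)"
proof (rule mformI)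
  show H: "subgrp H" by (rule mform_subgrp[OF V])
  fix i a fs assume a: "a \<in> gr A i" and fs: "fs \<in> homog_args A"
  note da = del_gr[OF a]
  show "V (i - 1) (del A (a + b)) fs + dsum (V i (a + b)) (1 + i) [] fs -
    (V (i - 1) (del A a) fs + dsum (V i a) (1 + i) [] fs) -
    (V (i - 1) (del A b) fs + dsum (V i b) (1 + i) [] fs) \<in> H" if b: "b \<in> gr A i" "length fs = r" for b
  proof -
    have 1: "V (i - 1) (del A a + del A b) fs - V (i - 1) (del A a) fs - V (i - 1) (del A b) fs \<in> H"
      using da del_gr[OF b(1)] fs b(2) by (intro mform_add_coeff[OF V])
    have 2: "dsum (V i (a + b)) (1 + i) [] fs - dsum (V i a) (1 + i) [] fs - dsum (V i b) (1 + i) [] fs \<in> H"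
    proof -
      have "dsum (V i (a + b)) e [] fs - dsum (V i a) e [] fs - dsum (V i b) e [] fs =
        (\<Sum>l<length fs. ksgn (e + sdeg 1 (take l fs)) (V i (a + b) (fs[l := (fst (fs ! l) - 1, del A (snd (fs ! l)))]) -
          V i a (fs[l := (fst (fs ! l) - 1, del A (snd (fs ! l)))]) - V i b (fs[l := (fst (fs ! l) - 1, del A (snd (fs ! l)))])))" for e
        by (simp add: dsum_eq_sum ksgn_diff sum_subtractf)
      moreover have "fs[l := (fst (fs ! l) - 1, del A (snd (fs ! l)))] \<in> homog_args A" if "l < length fs" for l
      proof -
        have "snd (fs ! l) \<in> gr A (fst (fs ! l))"
          using fs nth_mem[OF that] unfolding homog_args_def by (cases "fs ! l") force
        then show ?thesis using fs del_gr
          by (auto simp: homog_args_def dest!: set_update_subset_insert[THEN subsetD])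
      qed
      ultimately show ?thesis
        using a b by (auto intro!: subgrp_sum[OF H] subgrp_ksgn[OF H] mform_add_coeff[OF V])
    qed
    from subgrp_add[OF H 1 2] show ?thesis by (simp add: del_add algebra_simps)
  qed
  assume r: "Suc (length fs) = r"
  show "V (i - 1) (del A a) ((d, f + g) # fs) + dsum (V i a) (1 + i) [] ((d, f + g) # fs) -
    (V (i - 1) (del A a) ((d, f) # fs) + dsum (V i a) (1 + i) [] ((d, f) # fs)) -
    (V (i - 1) (del A a) ((d, g) # fs) + dsum (V i a) (1 + i) [] ((d, g) # fs)) \<in> H"
    if fg: "f \<in> gr A d" "g \<in> gr A d" for d f g
  proof -
    have 1: "V (i - 1) (del A a) ((d, f + g) # fs) - V (i - 1) (del A a) ((d, f) # fs) - V (i - 1) (del A a) ((d, g) # fs) \<in> H"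
      using da fs r fg by (intro mform_add_arg[OF V])
    have 2: "V i a ((d - 1, del A f + del A g) # fs) - V i a ((d - 1, del A f) # fs) - V i a ((d - 1, del A g) # fs) \<in> H"
      using a fs r fg del_gr by (intro mform_add_arg[OF V]) auto
    have 3: "dsum (V i a) (1 + i + d - 1) ((d, f + g) # []) fs - ksgn 0 (dsum (V i a) (1 + i + d - 1) ((d, f) # []) fs) -
      ksgn 0 (dsum (V i a) (1 + i + d - 1) ((d, g) # []) fs) \<in> H"
      using mform_add_arg[OF V a fg] fs r by (intro dsum_cong3[OF H, of "length fs"]) auto
    from subgrp_add[OF H subgrp_add[OF H 1 subgrp_ksgn[OF H 2, of "1 + i"]] 3] show ?thesis
      by (simp add: del_add ksgn_diff ksgn_add algebra_simps)
  qed
  show "V (i - 1) (del A a) ((p + q, f * g) # fs) + dsum (V i a) (1 + i) [] ((p + q, f * g) # fs) -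
    ksgn (1 * p) (V (i + p - 1) (del A (a * f)) ((q, g) # fs) + dsum (V (i + p) (a * f)) (1 + (i + p)) [] ((q, g) # fs)) -
    ksgn (p * q + 1 * q) (V (i + q - 1) (del A (a * g)) ((p, f) # fs) + dsum (V (i + q) (a * g)) (1 + (i + q)) [] ((p, f) # fs)) \<in> H"
    if fg: "f \<in> gr A p" "g \<in> gr A q" for p q f g
  proof -
    note df = del_gr[OF fg(1)] and dg = del_gr[OF fg(2)]
    have g1: "del A a * f \<in> gr A (i + p - 1)" "a * del A f \<in> gr A (i + p - 1)"
      "del A a * g \<in> gr A (i + q - 1)" "a * del A g \<in> gr A (i + q - 1)"
      "del A f * g \<in> gr A (p + q - 1)" "f * del A g \<in> gr A (p + q - 1)"
      using gr_mult[OF da fg(1)] gr_mult[OF a df] gr_mult[OF da fg(2)] gr_mult[OF a dg] gr_mult[OF df fg(2)] gr_mult[OF fg(1) dg]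
      by (simp_all add: algebra_simps)
    have k1: "V (i - 1) (del A a) ((p + q, f * g) # fs) - ksgn p (V (i + p - 1) (del A a * f) ((q, g) # fs)) -
        ksgn (p * q + q) (V (i + q - 1) (del A a * g) ((p, f) # fs)) \<in> H"
      using mform_mult_arg[OF V da fg fs r] by (simp add: algebra_simps)
    have k2: "V i a ((p + q - 1, del A (f * g)) # fs) - V i a ((p + q - 1, del A f * g) # fs) -
        V i a ((p + q - 1, ksgn p (f * del A g)) # fs) \<in> H"
      unfolding del_mult[OF fg(1)] using a fs r g1 by (intro mform_add_arg[OF V]) auto
    have k3: "V i a ((p + q - 1, ksgn p (f * del A g)) # fs) - ksgn p (V i a ((p + q - 1, f * del A g) # fs)) \<in> H"
      using a fs r g1 by (intro mform_ksgn_arg[OF V]) auto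
    have k4: "V i a ((p + q - 1, del A f * g) # fs) - ksgn (p - 1) (V (i + p - 1) (a * del A f) ((q, g) # fs)) -
        ksgn ((p - 1) * q + q) (V (i + q) (a * g) ((p - 1, del A f) # fs)) \<in> H"
      using mform_mult_arg[OF V a df fg(2) fs r] by (simp add: algebra_simps)
    have k5: "V i a ((p + q - 1, f * del A g) # fs) - ksgn p (V (i + p) (a * f) ((q - 1, del A g) # fs)) -
        ksgn (p * (q - 1) + (q - 1)) (V (i + q - 1) (a * del A g) ((p, f) # fs)) \<in> H"
      using mform_mult_arg[OF V a fg(1) dg fs r] by (simp add: algebra_simps)
    have k6: "dsum (V i a) (1 + i + (p + q) - 1) ((p + q, f * g) # []) fs -
        ksgn p (dsum (V (i + p) (a * f)) (1 + i + (p + q) - 1) ((q, g) # []) fs) -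
        ksgn (p * q + q) (dsum (V (i + q) (a * g)) (1 + i + (p + q) - 1) ((p, f) # []) fs) \<in> H"
      using mform_mult_arg[OF V a fg] fs r by (intro dsum_cong3[OF H, of "length fs"]) auto
    have k7: "V (i + p - 1) (del A (a * f)) ((q, g) # fs) - V (i + p - 1) (del A a * f) ((q, g) # fs) -
        V (i + p - 1) (ksgn i (a * del A f)) ((q, g) # fs) \<in> H"
      unfolding del_mult[OF a] using fs r g1 fg by (intro mform_add_coeff[OF V]) auto
    have k8: "V (i + p - 1) (ksgn i (a * del A f)) ((q, g) # fs) - ksgn i (V (i + p - 1) (a * del A f) ((q, g) # fs)) \<in> H"
      using fs r g1 fg by (intro mform_ksgn_coeff[OF V]) auto
    have k9: "V (i + q - 1) (del A (a * g)) ((p, f) # fs) - V (i + q - 1) (del A a * g) ((p, f) # fs) -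
        V (i + q - 1) (ksgn i (a * del A g)) ((p, f) # fs) \<in> H"
      unfolding del_mult[OF a] using fs r g1 fg by (intro mform_add_coeff[OF V]) auto
    have k10: "V (i + q - 1) (ksgn i (a * del A g)) ((p, f) # fs) - ksgn i (V (i + q - 1) (a * del A g) ((p, f) # fs)) \<in> H"
      using fs r g1 fg by (intro mform_ksgn_coeff[OF V]) auto
    note K = subgrp_ksgn[OF H subgrp_add[OF H subgrp_add[OF H subgrp_add[OF H k2 k3] k4] subgrp_ksgn[OF H k5, of p]], of "1 + i"]
    note L = subgrp_ksgn[OF H subgrp_add[OF H k7 k8], of p]
    note M = subgrp_ksgn[OF H subgrp_add[OF H k9 k10], of "p * q + q"]
    have e: "1 + (i + p) + q - 1 = 1 + i + (p + q) - 1" "1 + (i + q) + p - 1 = 1 + i + (p + q) - 1" by simp_all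
    show ?thesis
      using subgrp_diff[OF H subgrp_diff[OF H subgrp_add[OF H subgrp_add[OF H k1 K] k6] L] M]
      unfolding mform_delta_identity[symmetric] mult_1 dsum.simps fst_conv snd_conv append_Nil e .
  qed
  show "V (i - 1) (del A a) ((d, str A k) # fs) + dsum (V i a) (1 + i) [] ((d, str A k) # fs) \<in> H"
    if k: "str A k \<in> gr A d" for d k
  proof -
    obtain k' where k': "del A (str A k) = str A k'" using del_str by blast
    have "str A k' \<in> gr A (d - 1)" using del_gr[OF k] k' by simp
    then have "V i a ((d - 1, del A (str A k)) # fs) \<in> H"
      unfolding k' using a fs r by (intro mform_str_arg[OF V])
    moreover have "dsum (V i a) (1 + i + d - 1) ((d, str A k) # []) fs \<in> H"
      using mform_str_arg[OF V a k] fs r by (intro dsum_mem[OF H, of "length fs"]) auto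
    ultimately show ?thesis
      using mform_str_arg[OF V da k fs r] by (simp add: subgrp_add[OF H] subgrp_ksgn[OF H])
  qed
next
  note H = mform_subgrp[OF V]
  fix i a xs x y ys assume a: "a \<in> gr A i" "xs @ x # y # ys \<in> homog_args A" "length (xs @ x # y # ys) = r"
  from subgrp_add[OF H mform_swap[OF V del_gr[OF a(1)] a(2,3)] dsum_swap[OF V a(1), where pre = "[]" and e = "1 + i"]] a(2,3)
  show "V (i - 1) (del A a) (xs @ x # y # ys) + dsum (V i a) (1 + i) [] (xs @ x # y # ys) -
    ksgn ((fst x - 1) * (fst y - 1)) (V (i - 1) (del A a) (xs @ y # x # ys) + dsum (V i a) (1 + i) [] (xs @ y # x # ys)) \<in> H"
    by (simp add: ksgn_add algebra_simps)
qed

lemma pol_of_lin: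
  assumes "pder k \<Phi>" "Rlin \<Phi>" "pder k \<Psi>" "Rlin \<Psi>"
  shows "pol_of A n k (ksgn u \<Phi> + ksgn v \<Psi>) = ksgn u (pol_of A n k \<Phi>) + ksgn v (pol_of A n k \<Psi>)"
  using pol_of_add[OF pder_ksgn[OF assms(1), of u] Rlin_ksgn[OF assms(2), of u]
      pder_ksgn[OF assms(3), of v] Rlin_ksgn[OF assms(4), of v]]
  by (simp only: pol_of_ksgn[OF assms(1,2)] pol_of_ksgn[OF assms(3,4)])

text \<open>A criterion shared by \<mu> and \<nu>: \<kappa> is the degree of the operation, 0 with Z
  = \<open>Pr\<close> and 1 with Z = \<open>Rep\<close>, and \<open>\<kappa> * i\<close> is the sign
  of the operation passing the coefficient.\<close>

lemma mform_pol:
  assumes pd: "\<And>fs. pder (cdeg fs + \<kappa>) (Z fs)" and rl: "\<And>fs. Rlin (Z fs)"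
    and sw: "\<And>xs x y ys. Z (xs @ x # y # ys) = ksgn ((1 - fst x) * (1 - fst y)) (Z (xs @ y # x # ys))"
    and ad: "\<And>d f g fs. f \<in> gr A d \<Longrightarrow> g \<in> gr A d \<Longrightarrow> Z ((d, f + g) # fs) = Z ((d, f) # fs) + Z ((d, g) # fs)"
    and mu: "\<And>p q f g fs. f \<in> gr A p \<Longrightarrow> g \<in> gr A q \<Longrightarrow> Z ((p + q, f * g) # fs) =
      ksgn ((1 + \<kappa>) * p) (\<lambda>gs. f * Z ((q, g) # fs) gs) +
      ksgn (p * q + (1 + \<kappa>) * q) (\<lambda>gs. g * Z ((p, f) # fs) gs)"
    and st: "\<And>d c fs. str A c \<in> gr A d \<Longrightarrow> Z ((d, str A c) # fs) = 0"
  shows "mform 1 r {0} (\<lambda>i a fs. pol_of A n (cdeg fs + \<kappa> - i) (ksgn (\<kappa> * i) (\<lambda>gs. a * Z fs gs)))"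
proof (rule mformI)
  define T where "T i a fs = ksgn (\<kappa> * i) (\<lambda>gs. a * Z fs gs)" for i a fs
  have T: "T i a fs gs = ksgn (\<kappa> * i) (a * Z fs gs)" for i a fs gs by (simp add: T_def ksgn_apply)
  have T': "pder k (T i a fs)" "Rlin (T i a fs)" if "a \<in> gr A i" "k = cdeg fs + \<kappa> - i" for i a fs k
    unfolding T_def using that pder_scaled[OF that(1) pd rl, of k fs] by (auto intro!: pder_ksgn Rlin_ksgn)
  \<comment> \<open>Additivity in the coefficient, additivity in an argument and the Leibniz rule
    all say that one value of T is a signed sum of two others.\<close>
  have lin: "pol_of A n k (T i a fs) - ksgn u (pol_of A n k1 (T i1 a1 fs1)) - ksgn v (pol_of A n k2 (T i2 a2 fs2)) \<in> {0}"
    if "a1 \<in> gr A i1" "a2 \<in> gr A i2" "k = cdeg fs1 + \<kappa> - i1" "k = cdeg fs2 + \<kappa> - i2" "k1 = k" "k2 = k"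
      "\<And>gs. T i a fs gs = ksgn u (T i1 a1 fs1 gs) + ksgn v (T i2 a2 fs2 gs)"
    for i i1 i2 a a1 a2 fs fs1 fs2 u v k k1 k2
  proof -
    have "T i a fs = ksgn u (T i1 a1 fs1) + ksgn v (T i2 a2 fs2)"
      by (rule ext) (simp add: that(7) ksgn_apply)
    then show ?thesis
      using pol_of_lin[OF T'[OF that(1,3)] T'[OF that(2,4)], of u v] that(5,6) by simp
  qed
  show "subgrp {0 :: 'a polyvec}" by (simp add: subgrp_def)
  fix i a fs assume a: "a \<in> gr A i"
  show "pol_of A n (cdeg fs + \<kappa> - i) (ksgn (\<kappa> * i) (\<lambda>gs. (a + b) * Z fs gs)) -
      pol_of A n (cdeg fs + \<kappa> - i) (ksgn (\<kappa> * i) (\<lambda>gs. a * Z fs gs)) -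
      pol_of A n (cdeg fs + \<kappa> - i) (ksgn (\<kappa> * i) (\<lambda>gs. b * Z fs gs)) \<in> {0}" if "b \<in> gr A i" for b
    using lin[of a i b i "cdeg fs + \<kappa> - i" fs fs _ _ i "a + b" fs 0 0, unfolded T_def] a that
    by (simp add: ksgn_apply distrib_right ksgn_add)
  show "pol_of A n (cdeg ((d, f + g) # fs) + \<kappa> - i) (ksgn (\<kappa> * i) (\<lambda>gs. a * Z ((d, f + g) # fs) gs)) -
      pol_of A n (cdeg ((d, f) # fs) + \<kappa> - i) (ksgn (\<kappa> * i) (\<lambda>gs. a * Z ((d, f) # fs) gs)) -
      pol_of A n (cdeg ((d, g) # fs) + \<kappa> - i) (ksgn (\<kappa> * i) (\<lambda>gs. a * Z ((d, g) # fs) gs)) \<in> {0}"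
    if "f \<in> gr A d" "g \<in> gr A d" for d f g
  proof -
    have "pol_of A n (cdeg ((d, f + g) # fs) + \<kappa> - i) (T i a ((d, f + g) # fs)) -
      ksgn 0 (pol_of A n (cdeg ((d, f) # fs) + \<kappa> - i) (T i a ((d, f) # fs))) -
      ksgn 0 (pol_of A n (cdeg ((d, g) # fs) + \<kappa> - i) (T i a ((d, g) # fs))) \<in> {0}"
      by (rule lin) (use a that in \<open>auto simp: T ad distrib_left ksgn_add\<close>)
    then show ?thesis by (simp only: T_def ksgn_0)
  qed
  show "pol_of A n (cdeg ((p + q, f * g) # fs) + \<kappa> - i) (ksgn (\<kappa> * i) (\<lambda>gs. a * Z ((p + q, f * g) # fs) gs)) -
      ksgn (1 * p) (pol_of A n (cdeg ((q, g) # fs) + \<kappa> - (i + p)) (ksgn (\<kappa> * (i + p)) (\<lambda>gs. a * f * Z ((q, g) # fs) gs))) -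
      ksgn (p * q + 1 * q) (pol_of A n (cdeg ((p, f) # fs) + \<kappa> - (i + q)) (ksgn (\<kappa> * (i + q)) (\<lambda>gs. a * g * Z ((p, f) # fs) gs))) \<in> {0}"
    if fg: "f \<in> gr A p" "g \<in> gr A q" for p q f g
  proof -
    have "T i a ((p + q, f * g) # fs) gs = ksgn (1 * p) (T (i + p) (a * f) ((q, g) # fs) gs) +
       ksgn (p * q + 1 * q) (T (i + q) (a * g) ((p, f) # fs) gs)" for gs
      unfolding T mu[OF fg] by (simp add: ksgn_apply distrib_left ksgn_add ksgn_mult mult.assoc algebra_simps)
    then show ?thesis
      unfolding T_def[symmetric] by (intro lin) (use a fg in auto)
  qed
  show "pol_of A n (cdeg ((d, str A c) # fs) + \<kappa> - i) (ksgn (\<kappa> * i) (\<lambda>gs. a * Z ((d, str A c) # fs) gs)) \<in> {0}"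
    if "str A c \<in> gr A d" for d c
    using st[OF that, of fs] pol_of_0 by (simp add: zero_fun_def[symmetric])
next
  fix i a xs x y ys assume a: "a \<in> gr A i"
  show "pol_of A n (cdeg (xs @ x # y # ys) + \<kappa> - i) (ksgn (\<kappa> * i) (\<lambda>gs. a * Z (xs @ x # y # ys) gs)) -
      ksgn ((fst x - 1) * (fst y - 1)) (pol_of A n (cdeg (xs @ y # x # ys) + \<kappa> - i) (ksgn (\<kappa> * i) (\<lambda>gs. a * Z (xs @ y # x # ys) gs))) \<in> {0}"
  proof -
    let ?T = "ksgn (\<kappa> * i) (\<lambda>gs. a * Z (xs @ y # x # ys) gs)"
    have 1: "ksgn (\<kappa> * i) (\<lambda>gs. a * Z (xs @ x # y # ys) gs) = ksgn ((fst x - 1) * (fst y - 1)) ?T"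
      unfolding sw[of xs x y] by (rule ext) (simp add: ksgn_apply ksgn_mult algebra_simps)
    have 2: "cdeg (xs @ x # y # ys) = cdeg (xs @ y # x # ys)" by simp
    have "pder (cdeg (xs @ y # x # ys) + \<kappa> - i) ?T" "Rlin ?T"
      using pder_scaled[OF a pd rl refl, of "xs @ y # x # ys"] by (auto intro!: pder_ksgn Rlin_ksgn)
    from pol_of_ksgn[OF this] show ?thesis unfolding 1 2 by simp
  qed
qed

section \<open>Additive maps on differential forms\<close>

lemma form_eq: "length fs = r \<Longrightarrow> form A a fs = frag_of (a, dds 1 fs) +o sym_sub (gr A) (smod 1) r"
  by (simp add: form_def dr_mod_def)

lemma Omega_eq: "Omega A r m = (\<lambda>x. x +o sym_sub (gr A) (smod 1) r) ` tens_pre (gr A) (smod 1) r (- m)"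
  by (simp add: Omega_def sym_pow_def dr_mod_def)

lemma sdeg_cdeg: "sdeg 1 fs = - cdeg fs"
  by (induction fs) auto

lemma form_Omega:
  "a \<in> gr A i \<Longrightarrow> fs \<in> homog_args A \<Longrightarrow> length fs = r \<Longrightarrow> cdeg fs - i = m \<Longrightarrow> form A a fs \<in> Omega A r m"
  unfolding form_eq Omega_eq
  by (intro imageI tens_preI[where i = i] dds_factors) (auto simp: sum_dds sdeg_cdeg simp del: map_map)

lemma Omega_add: "X \<in> Omega A r m \<Longrightarrow> Y \<in> Omega A r m \<Longrightarrow> X + Y \<in> Omega A r m"
  unfolding Omega_eq by (auto simp: coset_add intro!: imageI tens_pre_add)

text \<open>Classes of forms can be added, so the principle offers sums, while
  \<open>tens_span\<close> asks for differences. Therefore Q carries P for x and for - x; the minus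
  sign goes into the coefficient of a form.\<close>

lemma Omega_induct:
  assumes X: "X \<in> Omega A r m"
    and forms: "\<And>i a fs. a \<in> gr A i \<Longrightarrow> fs \<in> homog_args A \<Longrightarrow> length fs = r \<Longrightarrow> cdeg fs - i = m \<Longrightarrow> P (form A a fs)"
    and add: "\<And>X Y. X \<in> Omega A r m \<Longrightarrow> Y \<in> Omega A r m \<Longrightarrow> P X \<Longrightarrow> P Y \<Longrightarrow> P (X + Y)"
  shows "P X"
proof -
  let ?S = "sym_sub (gr A) (smod 1) r" and ?T = "tens_pre (gr A) (smod 1) r (- m)"
  obtain x where x: "x \<in> ?T" "X = x +o ?S" using X by (auto simp: Omega_eq)
  have cong: "x +o ?S = y +o ?S" if "x - y \<in> tsub 1 r" for x y
    using tens_sub_sym_sub[OF that] by (simp add: coset_eq_iff)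
  define Q where "Q x \<longleftrightarrow> x \<in> ?T \<and> P (x +o ?S) \<and> P (- x +o ?S)" for x
  have padd: "P ((x + y) +o ?S)" if "x \<in> ?T" "y \<in> ?T" "P (x +o ?S)" "P (y +o ?S)" for x y
    using add[of "x +o ?S" "y +o ?S"] that by (simp add: Omega_eq coset_add)
  have "Q x"
  proof (rule tens_span[OF x(1)])
    fix k a fs assume a: "a \<in> gr A k" "fs \<in> homog_args A" "length fs = r" "k + sdeg 1 fs = - m"
    have "- a \<in> gr A k" using a by blast
    have "frag_of (- a, dds 1 fs) +o ?S = - frag_of (a, dds 1 fs) +o ?S"
      using cong[OF tens_ksgn_coeff[OF a(1) dds_factors[OF a(2,3)], of 1]] by (simp add: ksgn_odd)
    moreover have "frag_of (a, dds 1 fs) \<in> ?T"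
      using a by (intro tens_preI[where i = k] dds_factors) (auto simp: sum_dds simp del: map_map)
    ultimately show "Q (frag_of (a, dds 1 fs))"
      using forms[OF a(1-3)] forms[OF \<open>- a \<in> gr A k\<close> a(2,3)] a(3,4) by (simp add: Q_def form_eq sdeg_cdeg)
  next
    \<comment> \<open>The zero class is a form with coefficient 0, which can be labelled with the
      degree that makes the total degree m.\<close>
    let ?z = "replicate r (0, 0) :: (int \<times> 'a) list"
    have z: "?z \<in> homog_args A" "length ?z = r" by (auto simp: homog_args_def)
    have "P (form A 0 ?z)" by (rule forms[of 0 "cdeg ?z - m"]) (use z in auto)
    moreover have "form A 0 ?z = 0 +o ?S"
      unfolding form_eq[OF z(2)] by (rule cong) (use tens_zero_coeff[OF dds_factors[OF z]] in simp)
    ultimately show "Q 0" by (simp add: Q_def)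
  next
    fix x y assume "Q x" "Q y"
    then show "Q (x - y)"
      using padd[of x "- y"] padd[of "- x" y] tens_pre_diff[of 0 "gr A" "smod 1" r "- m"]
      by (simp add: Q_def tens_pre_diff)
  next
    fix x y assume a: "x \<in> ?T" "Q y" "x - y \<in> tsub 1 r"
    then show "Q x"
      using cong[OF a(3)] cong[of "- x" "- y"] group_closure_minus_iff[of "x - y" "tens_rel (gr A) (smod 1) r"]
      by (simp add: Q_def)
  qed
  then show ?thesis by (simp add: Q_def x(2))
qed

text \<open>The choice in \<open>on_forms\<close> is justified by exhibiting one suitable map. W
  takes values in a group modulo H and q forgets the ambiguity: q is the passage to cosets for d and
  \<delta>, and the identity with trivial H for \<mu> and \<nu>.\<close>

lemma on_forms_spec:
  fixes q :: "'b::ab_group_add \<Rightarrow> 'c::plus"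
  assumes W: "mform 1 r H W" and q: "\<And>x y. q (x + y) = q x + q y" "\<And>x y. x - y \<in> H \<Longrightarrow> q x = q y"
    and V: "\<And>i a fs. a \<in> gr A i \<Longrightarrow> fs \<in> homog_args A \<Longrightarrow> length fs = r \<Longrightarrow> V i a fs = q (W i a fs)"
  shows "X \<in> Omega A r m \<Longrightarrow> Y \<in> Omega A r m \<Longrightarrow> on_forms A r V (X + Y) = on_forms A r V X + on_forms A r V Y"
    and "a \<in> gr A i \<Longrightarrow> fs \<in> homog_args A \<Longrightarrow> length fs = r \<Longrightarrow> on_forms A r V (form A a fs) = V i a fs"
proof -
  let ?S = "sym_sub (gr A) (smod 1) r"
  obtain F where F: "\<And>x y. F (x - y) = F x - F y" "\<And>x. x \<in> ?S \<Longrightarrow> F x \<in> H"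
    "\<And>k a fs. a \<in> gr A k \<Longrightarrow> fs \<in> homog_args A \<Longrightarrow> length fs = r \<Longrightarrow> F (frag_of (a, dds 1 fs)) - W k a fs \<in> H"
    using mform_extend[OF W] by blast
  have F0: "F 0 = 0" using F(1)[of 0 0] by simp
  have Fadd: "F (x + y) = F x + F y" for x y using F(1)[of x "0 - y"] F(1)[of 0 y] F0 by simp
  define g where "g X = q (F (SOME x. x \<in> X))" for X
  have g: "g (x +o ?S) = q (F x)" for x
  proof -
    have "(SOME y. y \<in> x +o ?S) \<in> x +o ?S" using coset_self by (rule someI)
    then have "(SOME y. y \<in> x +o ?S) - x \<in> ?S" by (auto simp: elt_set_plus_def)
    from F(2)[OF this] show ?thesis unfolding g_def by (intro q(2)) (simp add: F(1))
  qed
  let ?P = "\<lambda>g. (\<forall>m. \<forall>X \<in> Omega A r m. \<forall>Y \<in> Omega A r m. g (X + Y) = g X + g Y) \<and>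
    (\<forall>i. \<forall>a \<in> gr A i. \<forall>fs \<in> homog_args A. length fs = r \<longrightarrow> g (form A a fs) = V i a fs)"
  have "?P g"
    using F(3) by (auto simp: Omega_eq coset_add g Fadd q(1) form_eq V intro!: q(2))
  then have "?P (on_forms A r V)"
    unfolding on_forms_def by (rule someI[where P = ?P])
  then show "X \<in> Omega A r m \<Longrightarrow> Y \<in> Omega A r m \<Longrightarrow> on_forms A r V (X + Y) = on_forms A r V X + on_forms A r V Y"
    and "a \<in> gr A i \<Longrightarrow> fs \<in> homog_args A \<Longrightarrow> length fs = r \<Longrightarrow> on_forms A r V (form A a fs) = V i a fs"
    by blast+
qed

text \<open>The neutral element for sums of sets is {0} and not the zero class, so an empty sum of
  forms need not be a form; every sum is therefore started from some X.\<close>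

lemma Omega_sum:
  assumes "finite L" "\<And>l. l \<in> L \<Longrightarrow> Y l \<in> Omega A r m"
  shows "X \<in> Omega A r m \<Longrightarrow> X + (\<Sum>l\<in>L. Y l) \<in> Omega A r m"
  using assms
proof (induction L arbitrary: X)
  case (insert l L)
  then show ?case using Omega_add[of X r m "Y l"] by (simp add: add.assoc[symmetric])
qed simp

lemma Omega_sum_additive:
  fixes g :: "'a kahler_tens \<Rightarrow> 'b::comm_monoid_add"
  assumes "finite L" "\<And>l. l \<in> L \<Longrightarrow> Y l \<in> Omega A r m"
    and g: "\<And>X Y. X \<in> Omega A r m \<Longrightarrow> Y \<in> Omega A r m \<Longrightarrow> g (X + Y) = g X + g Y"
  shows "X \<in> Omega A r m \<Longrightarrow> g (X + (\<Sum>l\<in>L. Y l)) = g X + (\<Sum>l\<in>L. g (Y l))"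
  using assms(1,2)
proof (induction L arbitrary: X)
  case (insert l L)
  then show ?case using Omega_add[of X r m "Y l"] by (simp add: add.assoc[symmetric] g)
qed simp

lemma d_form:
  shows "X \<in> Omega A r m \<Longrightarrow> Y \<in> Omega A r m \<Longrightarrow> d_form A r (X + Y) = d_form A r X + d_form A r Y"
    and "a \<in> gr A i \<Longrightarrow> fs \<in> homog_args A \<Longrightarrow> length fs = r \<Longrightarrow> d_form A r (form A a fs) = form A 1 ((i, a) # fs)"
    and "X \<in> Omega A r m \<Longrightarrow> d_form A r X \<in> Omega A (Suc r) (m + 1)"
proof -
  have q: "x - y \<in> sym_sub (gr A) (smod 1) (Suc r) \<Longrightarrow> x +o sym_sub (gr A) (smod 1) (Suc r) = y +o sym_sub (gr A) (smod 1) (Suc r)" for x y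
    by (simp add: coset_eq_iff)
  note s = on_forms_spec[OF mform_d[OF mform_universal[of 1 "Suc r"]] coset_add[symmetric] q, of "\<lambda>i a fs. form A 1 ((i, a) # fs)",
      folded d_form_def]
  show add: "X \<in> Omega A r m \<Longrightarrow> Y \<in> Omega A r m \<Longrightarrow> d_form A r (X + Y) = d_form A r X + d_form A r Y" for X Y
    by (rule s(1)) (auto simp: form_eq)
  show val: "a \<in> gr A i \<Longrightarrow> fs \<in> homog_args A \<Longrightarrow> length fs = r \<Longrightarrow> d_form A r (form A a fs) = form A 1 ((i, a) # fs)" for a i fs
    by (rule s(2)) (auto simp: form_eq)
  show "d_form A r X \<in> Omega A (Suc r) (m + 1)" if "X \<in> Omega A r m"
    using that
  proof (rule Omega_induct)
    fix i a fs assume "a \<in> gr A i" "fs \<in> homog_args A" "length fs = r" "cdeg fs - i = m"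
    then show "d_form A r (form A a fs) \<in> Omega A (Suc r) (m + 1)"
      using form_Omega[OF gr_1, of "(i, a) # fs" "Suc r" "m + 1"] by (simp add: val)
  qed (simp add: add Omega_add)
qed

lemma homog_args_update:
  assumes "fs \<in> homog_args A" "l < length fs"
  shows "fs[l := (fst (fs ! l) - 1, del A (snd (fs ! l)))] \<in> homog_args A"
proof -
  have "snd (fs ! l) \<in> gr A (fst (fs ! l))"
    using assms(1) nth_mem[OF assms(2)] unfolding homog_args_def by (cases "fs ! l") force
  then show ?thesis using assms(1) del_gr
    by (auto simp: homog_args_def dest!: set_update_subset_insert[THEN subsetD])
qed

lemma cdeg_update: "l < length fs \<Longrightarrow> cdeg (fs[l := (fst (fs ! l) - 1, g)]) = cdeg fs + 1"
  by (induction fs arbitrary: l) (auto split: nat.splits)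

lemma delta_form:
  shows "X \<in> Omega A r m \<Longrightarrow> Y \<in> Omega A r m \<Longrightarrow> delta_form A r (X + Y) = delta_form A r X + delta_form A r Y"
    and "a \<in> gr A i \<Longrightarrow> fs \<in> homog_args A \<Longrightarrow> length fs = r \<Longrightarrow> delta_form A r (form A a fs) =
      form A (del A a) fs + (\<Sum>l < length fs. form A (ksgn (1 + i + sdeg 1 (take l fs)) a)
        (fs[l := (fst (fs ! l) - 1, del A (snd (fs ! l)))]))"
    and "X \<in> Omega A r m \<Longrightarrow> delta_form A r X \<in> Omega A r (m + 1)"
proof -
  let ?S = "sym_sub (gr A) (smod 1) r"
  have q: "x - y \<in> ?S \<Longrightarrow> x +o ?S = y +o ?S" for x y
    by (simp add: coset_eq_iff)
  let ?u = "\<lambda>fs l. fs[l := (fst (fs ! l) - 1, del A (snd (fs ! l)))]"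
  have qsum: "finite L \<Longrightarrow> (x +o ?S) + (\<Sum>l\<in>L. y l +o ?S) = (x + (\<Sum>l\<in>L. y l)) +o ?S" for x y and L :: "nat set"
    by (induction L arbitrary: x rule: finite_induct) (simp_all add: add.assoc[symmetric] coset_add)
  let ?V = "\<lambda>i a fs. form A (del A a) fs + (\<Sum>l < length fs. form A (ksgn (1 + i + sdeg 1 (take l fs)) a) (?u fs l))"
  have V: "?V i a fs = (frag_of (del A a, dds 1 fs) + dsum (\<lambda>fs. frag_of (a, dds 1 fs)) (1 + i) [] fs) +o ?S"
    if a: "a \<in> gr A i" "fs \<in> homog_args A" "length fs = r" for i a fs
  proof -
    \<comment> \<open>The sign moves from the coefficient to the front of the symbol, where
      \<open>dsum\<close> has it.\<close>
    have "form A (ksgn u a) (?u fs l) = ksgn u (frag_of (a, dds 1 (?u fs l))) +o ?S" if "l < length fs" for u l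
      using tens_sub_sym_sub[OF tens_ksgn_coeff[OF a(1) dds_factors[OF homog_args_update[OF a(2) that]]]] a(3)
      by (simp add: form_eq q del: list.map)
    then have "(\<Sum>l < length fs. form A (ksgn (1 + i + sdeg 1 (take l fs)) a) (?u fs l)) =
      (\<Sum>l < length fs. ksgn (1 + i + sdeg 1 (take l fs)) (frag_of (a, dds 1 (?u fs l))) +o ?S)"
      by (intro sum.cong refl) auto
    then show ?thesis by (simp only: form_eq[OF a(3)] qsum finite_lessThan dsum_eq_sum append_Nil)
  qed
  have D: "delta_form A r = on_forms A r ?V"
    by (simp add: delta_form_def sdeg_def)
  note s = on_forms_spec[where V = ?V, OF mform_delta[OF mform_universal[of 1 r]] coset_add[symmetric] q V, folded D]
  show add: "X \<in> Omega A r m \<Longrightarrow> Y \<in> Omega A r m \<Longrightarrow> delta_form A r (X + Y) = delta_form A r X + delta_form A r Y" for X Y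
    by (rule s(1))
  show val: "a \<in> gr A i \<Longrightarrow> fs \<in> homog_args A \<Longrightarrow> length fs = r \<Longrightarrow> delta_form A r (form A a fs) = ?V i a fs" for a i fs
    by (rule s(2))
  show "delta_form A r X \<in> Omega A r (m + 1)" if "X \<in> Omega A r m"
    using that
  proof (rule Omega_induct)
    fix i a fs assume a: "a \<in> gr A i" "fs \<in> homog_args A" "length fs = r" "cdeg fs - i = m"
    have "?V i a fs \<in> Omega A r (m + 1)"
      by (intro Omega_sum form_Omega[where i = "i - 1"] form_Omega[where i = i])
        (use a del_gr in \<open>auto simp: homog_args_update cdeg_update\<close>)
    then show "delta_form A r (form A a fs) \<in> Omega A r (m + 1)" by (simp only: val[OF a(1-3)])
  qed (simp add: add Omega_add)
qed

end

section \<open>The identities for \<open>\<mu>\<close> and \<open>\<nu>\<close>\<close>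

context graded_algebra
begin

lemma gr_half: "\<exists>u \<in> gr A 0. \<forall>x. u * (x + x) = x \<and> u * x + u * x = x"
proof -
  obtain u where u: "u \<in> gr A 0" "(\<Sum>l<2::nat. u) = 1" using gr_div[of 2] by auto
  then have 1: "u + u = 1" by (simp add: numeral_2_eq_2)
  have "u * (x + x) = x" for x using arg_cong[OF 1, of "\<lambda>y. y * x"] by (simp add: distrib_left distrib_right)
  moreover have "u * x + u * x = x" for x using arg_cong[OF 1, of "\<lambda>y. y * x"] by (simp add: distrib_right)
  ultimately show ?thesis using u(1) by blast
qed

lemma double_eqD:
  assumes "(x :: 'a) + x = y + y"
  shows "x = y"
proof -
  obtain u :: 'a where u: "\<And>x. u * (x + x) = x" using gr_half by blast
  show ?thesis using arg_cong[OF assms, of "(*) u"] unfolding u .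
qed

text \<open>\<open>half\<close> is a description; it is determined because 2 is invertible in A, so
  that doubling is injective on functions with values in A.\<close>

lemma half_double: "half (\<phi> + \<phi>) = (\<phi> :: 'a polyvec)"
  unfolding half_def
proof (rule the_equality)
  fix \<psi> :: "'a polyvec" assume eq: "\<psi> + \<psi> = \<phi> + \<phi>"
  have "\<psi> j t = \<phi> j t" for j t
    using fun_cong[OF fun_cong[OF eq, of j], of t] by - (rule double_eqD, simp)
  then show "\<psi> = \<phi>" by blast
qed simp

lemma Pol_halve:
  assumes "\<phi> \<in> Pol A n i"
  obtains \<eta> where "\<eta> \<in> Pol A n i" "\<eta> + \<eta> = \<phi>"
proof -
  obtain u :: 'a where u: "u \<in> gr A 0" "\<And>x. u * x + u * x = x" using gr_half by blast
  have d: "pder i (\<lambda>gs. u * nev \<phi> gs)" "Rlin (\<lambda>gs. u * nev \<phi> gs)"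
    by (rule pder_scaled[OF u(1) pder_nev[OF assms] Rlin_nev[OF assms]]; simp)+
  note p = pol_of[OF d refl]
  have "pol_of A n i (\<lambda>gs. u * nev \<phi> gs) + pol_of A n i (\<lambda>gs. u * nev \<phi> gs) = \<phi>"
    by (intro Pol_eqI[OF _ assms] Pol_add_closed p) (auto simp: nev_add p(2) u(2))
  with p(1) show ?thesis by (rule that)
qed

lemma mu_form:
  assumes P: "\<pi> \<in> Pol A n (n + 2)"
  shows "X \<in> Omega A r m \<Longrightarrow> Y \<in> Omega A r m \<Longrightarrow> mu_form A n \<pi> r (X + Y) = mu_form A n \<pi> r X + mu_form A n \<pi> r Y"
    and "a \<in> gr A i \<Longrightarrow> fs \<in> homog_args A \<Longrightarrow> length fs = r \<Longrightarrow>
      nev (mu_form A n \<pi> r (form A a fs)) = (\<lambda>gs. a * Pr n (nev \<pi>) fs gs)"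
    and "X \<in> Omega A r m \<Longrightarrow> mu_form A n \<pi> r X \<in> Pol A n m"
proof -
  note p = pder_nev[OF P] Rlin_nev[OF P]
  have W: "mform 1 r {0} (\<lambda>i a fs. pol_of A n (cdeg fs + 0 - i) (ksgn (0 * i) (\<lambda>gs. a * Pr n (nev \<pi>) fs gs)))"
  proof (rule mform_pol)
    fix d s fs assume s: "str A s \<in> gr A d"
    show "Pr n (nev \<pi>) ((d, str A s) # fs) = 0"
      by (simp only: Pr.simps Rlin_contr0[OF p(2) s] pmul_0_left)
  next
    fix k l f g fs assume "f \<in> gr A k" "g \<in> gr A l"
    from Pr_mult_arg[OF p(1) this]
    show "Pr n (nev \<pi>) ((k + l, f * g) # fs) = ksgn ((1 + 0) * k) (\<lambda>gs. f * Pr n (nev \<pi>) ((l, g) # fs) gs) +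
      ksgn (k * l + (1 + 0) * l) (\<lambda>gs. g * Pr n (nev \<pi>) ((k, f) # fs) gs)"
      by (simp only: add_0_right mult_1)
  qed (use p in \<open>auto intro: pder_Pr Rlin_Pr Pr_swap Pr_add_arg simp del: Pr.simps\<close>)
  have q: "x - y \<in> {0} \<Longrightarrow> x = y" for x y :: "'a polyvec" by simp
  have V: "pol_prod A n (mu_factors A n \<pi> i a fs) = pol_of A n (cdeg fs + 0 - i) (ksgn (0 * i) (\<lambda>gs. a * Pr n (nev \<pi>) fs gs))"
    if "a \<in> gr A i" "fs \<in> homog_args A" "length fs = r" for a i fs
    unfolding mult_zero_left ksgn_0 add_0_right by (rule mu_on_form[OF P that(1,2)])
  note s = on_forms_spec[where q = "\<lambda>x. x", OF W refl q V, folded mu_form_def]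
  show add: "X \<in> Omega A r m \<Longrightarrow> Y \<in> Omega A r m \<Longrightarrow> mu_form A n \<pi> r (X + Y) = mu_form A n \<pi> r X + mu_form A n \<pi> r Y" for X Y
    by (rule s(1))
  have val: "mu_form A n \<pi> r (form A a fs) = pol_of A n (cdeg fs - i) (\<lambda>gs. a * Pr n (nev \<pi>) fs gs)"
    if a: "a \<in> gr A i" "fs \<in> homog_args A" "length fs = r" for a i fs
  proof -
    have "mu_form A n \<pi> r (form A a fs) = pol_prod A n (mu_factors A n \<pi> i a fs)" by (rule s(2)) (assumption | rule a)+
    then show ?thesis unfolding mu_on_form[OF P a(1,2)] .
  qed
  have pol: "pol_of A n (cdeg fs - i) (\<lambda>gs. a * Pr n (nev \<pi>) fs gs) \<in> Pol A n (cdeg fs - i)"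
    "nev (pol_of A n (cdeg fs - i) (\<lambda>gs. a * Pr n (nev \<pi>) fs gs)) = (\<lambda>gs. a * Pr n (nev \<pi>) fs gs)"
    if "a \<in> gr A i" for a i fs
    by (rule pol_of[OF pder_scaled[OF that pder_Pr[OF p(1)] Rlin_Pr[OF p] refl] refl])+
  show "a \<in> gr A i \<Longrightarrow> fs \<in> homog_args A \<Longrightarrow> length fs = r \<Longrightarrow>
      nev (mu_form A n \<pi> r (form A a fs)) = (\<lambda>gs. a * Pr n (nev \<pi>) fs gs)"
    by (simp add: val pol(2))
  show "mu_form A n \<pi> r X \<in> Pol A n m" if "X \<in> Omega A r m"
    using that
  proof (rule Omega_induct)
    fix i a fs assume a: "a \<in> gr A i" "fs \<in> homog_args A" "length fs = r" "cdeg fs - i = m"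
    show "mu_form A n \<pi> r (form A a fs) \<in> Pol A n m"
      using pol(1)[OF a(1), of fs] unfolding val[OF a(1-3)] a(4) .
  qed (simp only: add Pol_add_closed)
qed

lemma nu_form:
  assumes P: "\<pi> \<in> Pol A n (n + 2)" and b: "b \<in> Pol A n (n + 3)"
  shows "X \<in> Omega A r m \<Longrightarrow> Y \<in> Omega A r m \<Longrightarrow>
      nu_form A n \<pi> (n + 3) b r (X + Y) = nu_form A n \<pi> (n + 3) b r X + nu_form A n \<pi> (n + 3) b r Y"
    and "a \<in> gr A i \<Longrightarrow> fs \<in> homog_args A \<Longrightarrow> length fs = r \<Longrightarrow>
      nev (nu_form A n \<pi> (n + 3) b r (form A a fs)) = ksgn i (\<lambda>gs. a * Rep n (nev \<pi>) (\<lambda>x. contr x (nev b)) fs gs)"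
    and "X \<in> Omega A r m \<Longrightarrow> nu_form A n \<pi> (n + 3) b r X \<in> Pol A n (m + 1)"
proof -
  note p = pder_nev[OF P] Rlin_nev[OF P] and q = pder_nev[OF b] Rlin_nev[OF b]
  let ?N = "nu_form A n \<pi> (n + 3) b r"
  let ?Z = "Rep n (nev \<pi>) (\<lambda>x. contr x (nev b))"
  have c: "pder (2 - fst x) (contr x (nev b))" "Rlin (contr x (nev b))" for x
    using pder_contr[OF q(1), of x] Rlin_contr[OF q, of x] by simp_all
  have Zp: "pder (cdeg fs + 1) (?Z fs)" "Rlin (?Z fs)" for fs
    using pder_Rep[OF p(1) c(1)] Rlin_Rep[OF p c(2)] by auto
  have W: "mform 1 r {0} (\<lambda>i a fs. pol_of A n (cdeg fs + 1 - i) (ksgn (1 * i) (\<lambda>gs. a * ?Z fs gs)))"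
  proof (rule mform_pol)
    fix xs ys and x y :: "int \<times> 'a"
    show "?Z (xs @ x # y # ys) = ksgn ((1 - fst x) * (1 - fst y)) (?Z (xs @ y # x # ys))"
      by (rule Rep_swap[OF p(1) c(1)])
  next
    fix d f g fs assume "f \<in> gr A d" "g \<in> gr A d"
    then show "?Z ((d, f + g) # fs) = ?Z ((d, f) # fs) + ?Z ((d, g) # fs)"
      by (intro Rep_add_arg[OF p(1)] contr_add_arg[OF q(1)])
  next
    fix k l f g fs assume fg: "f \<in> gr A k" "g \<in> gr A l"
    have k: "ksgn (2 * k) \<Phi> = \<Phi>" "ksgn (k * l + 2 * l) \<Phi> = ksgn (k * l) \<Phi>" for \<Phi> :: "(int \<times> 'a) list \<Rightarrow> 'a"
      by (simp_all add: ksgn_def)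
    \<comment> \<open>b is even in the shifted grading, so the Leibniz signs linear in the degrees
      drop out.\<close>
    have e: "n + 3 - n - 1 = 2" by simp
    note cm = contr_mult_arg[OF q(1) fg, unfolded e k]
    show "?Z ((k + l, f * g) # fs) = ksgn ((1 + 1) * k) (\<lambda>gs. f * ?Z ((l, g) # fs) gs) +
      ksgn (k * l + (1 + 1) * l) (\<lambda>gs. g * ?Z ((k, f) # fs) gs)"
      unfolding one_add_one k by (rule Rep_mult_arg[OF p(1) fg cm])
  next
    fix d s fs assume s: "str A s \<in> gr A d"
    show "?Z ((d, str A s) # fs) = 0"
      by (simp only: Rep.simps Rlin_contr0[OF p(2) s] Rlin_contr0[OF q(2) s] pmul_0_left ksgn_zero add_0_right)
  qed (rule Zp)+
  let ?V = "\<lambda>i a fs. \<Sum>l < length fs. ksgn ((n + 3 - n - 2) * (- i + (\<Sum>(d, f) \<leftarrow> take l fs. 1 - d)))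
      (pol_prod A n ((mu_factors A n \<pi> i a fs)[Suc l :=
        (case fs ! l of (d, f) \<Rightarrow>
           (n + 3 - d - n - 1, pol_bracket A n (n + 3) b (- d) (pol_fun A n d f)))]))"
  have q: "x - y \<in> {0} \<Longrightarrow> x = y" for x y :: "'a polyvec" by simp
  have V: "?V i a fs = pol_of A n (cdeg fs + 1 - i) (ksgn (1 * i) (\<lambda>gs. a * ?Z fs gs))"
    if "a \<in> gr A i" "fs \<in> homog_args A" "length fs = r" for a i fs
    unfolding mult_1 by (rule nu_on_form[OF P b that(1,2)])
  note s = on_forms_spec[where q = "\<lambda>x. x", OF W refl q V, folded nu_form_def]
  show add: "X \<in> Omega A r m \<Longrightarrow> Y \<in> Omega A r m \<Longrightarrow> ?N (X + Y) = ?N X + ?N Y" for X Y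
    by (rule s(1))
  have val: "?N (form A a fs) = pol_of A n (cdeg fs + 1 - i) (ksgn i (\<lambda>gs. a * ?Z fs gs))"
    if a: "a \<in> gr A i" "fs \<in> homog_args A" "length fs = r" for a i fs
  proof -
    have "?N (form A a fs) = ?V i a fs" by (rule s(2)) (assumption | rule a)+
    then show ?thesis unfolding V[OF a] mult_1 .
  qed
  have pol: "pol_of A n (cdeg fs + 1 - i) (ksgn i (\<lambda>gs. a * ?Z fs gs)) \<in> Pol A n (cdeg fs + 1 - i)"
    "nev (pol_of A n (cdeg fs + 1 - i) (ksgn i (\<lambda>gs. a * ?Z fs gs))) = ksgn i (\<lambda>gs. a * ?Z fs gs)"
    if "a \<in> gr A i" for a i fs
    by (rule pol_of[OF pder_ksgn[OF pder_scaled(1)[OF that Zp refl]] Rlin_ksgn[OF pder_scaled(2)[OF that Zp refl]] refl])+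
  show "a \<in> gr A i \<Longrightarrow> fs \<in> homog_args A \<Longrightarrow> length fs = r \<Longrightarrow> nev (?N (form A a fs)) = ksgn i (\<lambda>gs. a * ?Z fs gs)"
    by (simp only: val pol(2))
  show "?N X \<in> Pol A n (m + 1)" if "X \<in> Omega A r m"
    using that
  proof (rule Omega_induct)
    fix i a fs assume a: "a \<in> gr A i" "fs \<in> homog_args A" "length fs = r" "cdeg fs - i = m"
    have e: "cdeg fs + 1 - i = m + 1" using a(4) by simp
    show "?N (form A a fs) \<in> Pol A n (m + 1)"
      using pol(1)[OF a(1), of fs] unfolding val[OF a(1-3)] e .
  qed (simp only: add Pol_add_closed)
qed

text \<open>Applied to two equal summands to undo the half of [\<pi>, \<pi>], and to the two
  summands of \<kappa>(\<pi>).\<close>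

lemma nu_form_add:
  assumes P: "\<pi> \<in> Pol A n (n + 2)" and b: "b \<in> Pol A n (n + 3)" "c \<in> Pol A n (n + 3)" and X: "X \<in> Omega A r m"
  shows "nu_form A n \<pi> (n + 3) (b + c) r X = nu_form A n \<pi> (n + 3) b r X + nu_form A n \<pi> (n + 3) c r X"
  using X
proof (rule Omega_induct)
  note bc = Pol_add_closed[OF b]
  fix i a fs assume a: "a \<in> gr A i" "fs \<in> homog_args A" "length fs = r" "cdeg fs - i = m"
  note f = form_Omega[OF a]
  let ?R = "\<lambda>b. Rep n (nev \<pi>) (\<lambda>x. contr x (nev b)) fs"
  have R: "?R (b + c) = ?R b + ?R c"
    unfolding nev_add contr_plus Rep_add ..
  have "nev (nu_form A n \<pi> (n + 3) (b + c) r (form A a fs)) = ksgn i (\<lambda>gs. a * ?R (b + c) gs)"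
    by (rule nu_form(2)[OF P bc a(1-3)])
  also have "\<dots> = ksgn i (\<lambda>gs. a * ?R b gs) + ksgn i (\<lambda>gs. a * ?R c gs)"
    unfolding R by (rule ext) (simp only: ksgn_apply plus_fun_apply distrib_left ksgn_add)
  also have "\<dots> = nev (nu_form A n \<pi> (n + 3) b r (form A a fs) + nu_form A n \<pi> (n + 3) c r (form A a fs))"
    by (simp only: nev_add nu_form(2)[OF P b(1) a(1-3)] nu_form(2)[OF P b(2) a(1-3)])
  finally show "nu_form A n \<pi> (n + 3) (b + c) r (form A a fs) = nu_form A n \<pi> (n + 3) b r (form A a fs) + nu_form A n \<pi> (n + 3) c r (form A a fs)"
    by (rule Pol_eqI[OF nu_form(3)[OF P bc f] Pol_add_closed[OF nu_form(3)[OF P b(1) f] nu_form(3)[OF P b(2) f]]])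
qed (simp only: nu_form(1)[OF P] Pol_add_closed[OF b] b ac_simps)

lemma schouten_scaled_Pr:
  assumes "pder (n + 2) \<Theta>" "pder (n + 2) \<pi>" "a \<in> gr A i"
  shows "schouten n (n + 2) \<Theta> (cdeg fs - i) (\<lambda>gs. a * Pr n \<pi> fs gs) = pmul n (contr (i, a) \<Theta>) (cdeg fs) (Pr n \<pi> fs) +
    ksgn i (\<lambda>gs. a * Rep n \<pi> (\<lambda>x. schouten n (n + 2) \<Theta> (1 - fst x) (contr x \<pi>)) fs gs)"
  unfolding schouten_scale_right[OF assms(1) pder_Pr[OF assms(2)] assms(3)] schouten_Pr[OF assms(1,2)]
  by simp

lemma pol_bracket_add:
  assumes P: "\<pi> \<in> Pol A n (n + 2)" and Q: "\<phi> \<in> Pol A n m" "\<psi> \<in> Pol A n m"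
  shows "pol_bracket A n (n + 2) \<pi> m (\<phi> + \<psi>) = pol_bracket A n (n + 2) \<pi> m \<phi> + pol_bracket A n (n + 2) \<pi> m \<psi>"
  by (rule Pol_eqI[OF pol_bracket(1)[OF P Pol_add_closed[OF Q]] Pol_add_closed[OF pol_bracket(1)[OF P Q(1)] pol_bracket(1)[OF P Q(2)]]])
    (simp only: nev_add pol_bracket(2)[OF P Pol_add_closed[OF Q]] pol_bracket(2)[OF P Q(1)] pol_bracket(2)[OF P Q(2)]
      schouten_add_right[OF pder_nev[OF P] pder_nev[OF Q(1)] pder_nev[OF Q(2)]])

lemma delta_bracket_add:
  assumes Q: "\<phi> \<in> Pol A n m" "\<psi> \<in> Pol A n m"
  shows "delta_bracket A n m (\<phi> + \<psi>) = delta_bracket A n m \<phi> + delta_bracket A n m \<psi>"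
  by (rule Pol_eqI[OF delta_bracket(1)[OF Pol_add_closed[OF Q]] Pol_add_closed[OF delta_bracket(1)[OF Q(1)] delta_bracket(1)[OF Q(2)]]])
    (simp only: nev_add delta_bracket(2)[OF Pol_add_closed[OF Q]] delta_bracket(2)[OF Q(1)] delta_bracket(2)[OF Q(2)]
      schouten_add_right[OF pder_dfun pder_nev[OF Q(1)] pder_nev[OF Q(2)]])

text \<open>In a single de Rham degree the identity is exact; the filtration enters only when
  \<omega> is truncated. Half of [\<pi>, \<pi>] is represented by the polyvector \<eta>.\<close>

lemma bracket_mu_form:
  assumes P: "\<pi> \<in> Pol A n (n + 2)" and h: "\<eta> \<in> Pol A n (n + 3)" "\<eta> + \<eta> = pol_bracket A n (n + 2) \<pi> (n + 2) \<pi>"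
    and X: "X \<in> Omega A r m"
  shows "pol_bracket A n (n + 2) \<pi> m (mu_form A n \<pi> r X) =
    mu_form A n \<pi> (Suc r) (d_form A r X) + nu_form A n \<pi> (n + 3) \<eta> r X"
  using X
proof (rule Omega_induct)
  note p = pder_nev[OF P]
  have half: "contr x (nev \<eta>) = schouten n (n + 2) (nev \<pi>) (1 - fst x) (contr x (nev \<pi>))" for x
  proof
    fix gs
    have "contr x (nev \<eta> + nev \<eta>) = contr x (schouten n (n + 2) (nev \<pi>) (n + 2) (nev \<pi>))"
      using arg_cong[OF h(2), of nev] by (simp only: nev_add pol_bracket(2)[OF P P])
    from fun_cong[OF this[unfolded contr_schouten_self[OF p]], of gs]
    show "contr x (nev \<eta>) gs = schouten n (n + 2) (nev \<pi>) (1 - fst x) (contr x (nev \<pi>)) gs"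
      by - (rule double_eqD, simp)
  qed
  fix i a fs assume a: "a \<in> gr A i" "fs \<in> homog_args A" "length fs = r" "cdeg fs - i = m"
  note f = form_Omega[OF a]
  have af: "(i, a) # fs \<in> homog_args A" "length ((i, a) # fs) = Suc r" using a by auto
  have "nev (pol_bracket A n (n + 2) \<pi> m (mu_form A n \<pi> r (form A a fs))) =
      schouten n (n + 2) (nev \<pi>) (cdeg fs - i) (\<lambda>gs. a * Pr n (nev \<pi>) fs gs)"
    by (simp only: pol_bracket(2)[OF P mu_form(3)[OF P f]] mu_form(2)[OF P a(1-3)] a(4))
  also have "\<dots> = nev (mu_form A n \<pi> (Suc r) (d_form A r (form A a fs)) + nu_form A n \<pi> (n + 3) \<eta> r (form A a fs))"
    unfolding schouten_scaled_Pr[OF p p a(1)] nev_add d_form(2)[OF a(1-3)] mu_form(2)[OF P gr_1 af] nu_form(2)[OF P h(1) a(1-3)] half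
    by simp
  moreover have "pol_bracket A n (n + 2) \<pi> m (mu_form A n \<pi> r (form A a fs)) \<in> Pol A n (m + 1)"
    using pol_bracket(1)[OF P mu_form(3)[OF P f]] by (simp add: algebra_simps)
  ultimately show "pol_bracket A n (n + 2) \<pi> m (mu_form A n \<pi> r (form A a fs)) =
    mu_form A n \<pi> (Suc r) (d_form A r (form A a fs)) + nu_form A n \<pi> (n + 3) \<eta> r (form A a fs)"
    by (intro Pol_eqI[OF _ Pol_add_closed[OF mu_form(3)[OF P d_form(3)[OF f]] nu_form(3)[OF P h(1) f]]]) simp_all
next
  fix X Y assume X: "X \<in> Omega A r m" "Y \<in> Omega A r m"
  assume "pol_bracket A n (n + 2) \<pi> m (mu_form A n \<pi> r X) =
      mu_form A n \<pi> (Suc r) (d_form A r X) + nu_form A n \<pi> (n + 3) \<eta> r X"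
    "pol_bracket A n (n + 2) \<pi> m (mu_form A n \<pi> r Y) =
      mu_form A n \<pi> (Suc r) (d_form A r Y) + nu_form A n \<pi> (n + 3) \<eta> r Y"
  then show "pol_bracket A n (n + 2) \<pi> m (mu_form A n \<pi> r (X + Y)) =
      mu_form A n \<pi> (Suc r) (d_form A r (X + Y)) + nu_form A n \<pi> (n + 3) \<eta> r (X + Y)"
    by (simp only: mu_form(1)[OF P X] pol_bracket_add[OF P mu_form(3)[OF P X(1)] mu_form(3)[OF P X(2)]]
        d_form(1)[OF X] mu_form(1)[OF P d_form(3)[OF X(1)] d_form(3)[OF X(2)]] nu_form(1)[OF P h(1) X] ac_simps)
qed

text \<open>The degree \<open>2 - fst (fs ! l)\<close> of the modified factor is the one that
  belongs to \<delta> f_l, so replacing the factor amounts to replacing the argument.\<close>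

lemma Rep_contr_del:
  "Rep n \<pi> (\<lambda>x. contr (fst x - 1, del A (snd x)) \<pi>) fs =
    (\<Sum>l<length fs. ksgn (cdeg (take l fs)) (Pr n \<pi> (fs[l := (fst (fs ! l) - 1, del A (snd (fs ! l)))])))"
  unfolding Rep_eq_sum
proof (intro sum.cong refl)
  fix l
  have "(map (\<lambda>x. (1 - fst x, contr x \<pi>)) fs)[l := (2 - fst (fs ! l), contr (fst (fs ! l) - 1, del A (snd (fs ! l))) \<pi>)] =
     map (\<lambda>x. (1 - fst x, contr x \<pi>)) (fs[l := (fst (fs ! l) - 1, del A (snd (fs ! l)))])"
    by (simp add: map_update)
  then show "ksgn (cdeg (take l fs)) (PP n ((map (\<lambda>x. (1 - fst x, contr x \<pi>)) fs)[l := (2 - fst (fs ! l),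
      contr (fst (fs ! l) - 1, del A (snd (fs ! l))) \<pi>)])) =
    ksgn (cdeg (take l fs)) (Pr n \<pi> (fs[l := (fst (fs ! l) - 1, del A (snd (fs ! l)))]))"
    by (simp only: PP_Pr)
qed

lemma nev_sum: "nev (\<Sum>l\<in>L. \<phi> l) = (\<Sum>l\<in>L. nev (\<phi> l))"
  by (induction L rule: infinite_finite_induct) (simp_all only: sum.infinite sum.empty sum.insert nev_0 nev_add not_False_eq_True)

lemma sum_apply: "(\<Sum>l\<in>L. \<Phi> l) gs = (\<Sum>l\<in>L. \<Phi> l gs :: 'b::comm_monoid_add)"
  by (induction L rule: infinite_finite_induct) auto

lemma delta_bracket_mu_form:
  assumes P: "\<pi> \<in> Pol A n (n + 2)" and X: "X \<in> Omega A r m"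
  shows "delta_bracket A n m (mu_form A n \<pi> r X) =
    mu_form A n \<pi> r (delta_form A r X) + nu_form A n \<pi> (n + 3) (delta_bracket A n (n + 2) \<pi>) r X"
  using X
proof (rule Omega_induct)
  note p = pder_nev[OF P]
  have b: "delta_bracket A n (n + 2) \<pi> \<in> Pol A n (n + 3)" using delta_bracket(1)[OF P] by (simp add: add.assoc)
  fix i a fs assume a: "a \<in> gr A i" "fs \<in> homog_args A" "length fs = r" "cdeg fs - i = m"
  note f = form_Omega[OF a]
  let ?u = "\<lambda>l. fs[l := (fst (fs ! l) - 1, del A (snd (fs ! l)))]"
  let ?c = "\<lambda>x. schouten n (n + 2) dfun (1 - fst x) (contr x (nev \<pi>))"
  let ?d = "\<lambda>x. contr (fst x - 1, del A (snd x)) (nev \<pi>)"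
  have ku: "form A (ksgn k a) (?u l) \<in> Omega A r (m + 1)"
    "nev (mu_form A n \<pi> r (form A (ksgn k a) (?u l))) = (\<lambda>gs. ksgn k a * Pr n (nev \<pi>) (?u l) gs)" if l: "l < length fs" for l k
  proof -
    have h: "ksgn k a \<in> gr A i" "?u l \<in> homog_args A" "length (?u l) = r" "cdeg (?u l) - i = m + 1"
      using a gr_ksgn[OF a(1)] homog_args_update[OF a(2) l] cdeg_update[OF l] by simp_all
    show "form A (ksgn k a) (?u l) \<in> Omega A r (m + 1)" by (rule form_Omega[OF h])
    show "nev (mu_form A n \<pi> r (form A (ksgn k a) (?u l))) = (\<lambda>gs. ksgn k a * Pr n (nev \<pi>) (?u l) gs)"
      by (rule mu_form(2)[OF P h(1-3)])
  qed
  have da: "form A (del A a) fs \<in> Omega A r (m + 1)" by (rule form_Omega[OF del_gr[OF a(1)]]) (use a in auto)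
  have mu: "mu_form A n \<pi> r (delta_form A r (form A a fs)) = mu_form A n \<pi> r (form A (del A a) fs) +
      (\<Sum>l < length fs. mu_form A n \<pi> r (form A (ksgn (1 + i + sdeg 1 (take l fs)) a) (?u l)))"
    unfolding delta_form(2)[OF a(1-3)]
    by (rule Omega_sum_additive[where m = "m + 1", OF finite_lessThan _ _ da])
      (rule ku(1), simp, rule mu_form(1)[OF P], assumption, assumption)
  \<comment> \<open>The contributions [\<delta>, [\<pi>, f]] are therefore those of \<nu> minus
    those with \<delta> f, and the latter will cancel against \<mu> of the sum in
    \<open>delta_form\<close>.\<close>
  have c: "contr x (nev (delta_bracket A n (n + 2) \<pi>)) = ?c x + ?d x" if "x \<in> set fs" for x
  proof -
    have "snd x \<in> gr A (fst x)" using that a(2) by (auto simp: homog_args_def)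
    have e: "n + 2 - fst x - n - 1 = 1 - fst x" "n + 2 - n - 1 = 1" by simp_all
    have k: "\<Phi> - ksgn (1 :: int) \<Psi> = \<Phi> + \<Psi>" for \<Phi> \<Psi> :: "(int \<times> 'a) list \<Rightarrow> 'a"
      by (rule ext) (simp add: ksgn_def)
    from contr_schouten_dfun[OF p \<open>snd x \<in> gr A (fst x)\<close>] show ?thesis
      unfolding delta_bracket(2)[OF P] e k prod.collapse .
  qed
  have R: "Rep n (nev \<pi>) (\<lambda>x. contr x (nev (delta_bracket A n (n + 2) \<pi>))) fs = Rep n (nev \<pi>) ?c fs + Rep n (nev \<pi>) ?d fs"
    by (rule trans[OF Rep_cong Rep_add]) (rule c)
  have nu: "nev (nu_form A n \<pi> (n + 3) (delta_bracket A n (n + 2) \<pi>) r (form A a fs)) gs =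
      ksgn i (a * Rep n (nev \<pi>) ?c fs gs) +
      (\<Sum>l < length fs. ksgn (i + cdeg (take l fs)) (a * Pr n (nev \<pi>) (?u l) gs))" for gs
    unfolding nu_form(2)[OF P b a(1-3)] R Rep_contr_del
    by (simp only: ksgn_apply plus_fun_apply sum_apply distrib_left ksgn_add sum_distrib_left ksgn_sum ksgn_mult ksgn_ksgn)
  have mu': "nev (mu_form A n \<pi> r (delta_form A r (form A a fs))) gs = del A a * Pr n (nev \<pi>) fs gs +
      (\<Sum>l < length fs. - ksgn (i + cdeg (take l fs)) (a * Pr n (nev \<pi>) (?u l) gs))" for gs
  proof -
    \<comment> \<open>\<open>sdeg 1\<close> is minus \<open>cdeg\<close>, and the extra 1 is the
      sign in \<delta>(df) = - d(\<delta> f).\<close>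
    have "ksgn (1 + i + sdeg 1 (take l fs)) a * x = - ksgn (i + cdeg (take l fs)) (a * x)" for l x
      unfolding sdeg_cdeg by (auto simp: ksgn_def)
    then have "nev (mu_form A n \<pi> r (form A (ksgn (1 + i + sdeg 1 (take l fs)) a) (?u l))) gs =
        - ksgn (i + cdeg (take l fs)) (a * Pr n (nev \<pi>) (?u l) gs)" if "l \<in> {..<length fs}" for l
      using ku(2)[of l "1 + i + sdeg 1 (take l fs)"] that by (simp only: lessThan_iff)
    then show ?thesis
      unfolding mu nev_add nev_sum plus_fun_apply sum_apply mu_form(2)[OF P del_gr[OF a(1)] a(2,3)]
      by (intro arg_cong2[where f = "(+)", OF refl] sum.cong refl)
  qed
  have "nev (delta_bracket A n m (mu_form A n \<pi> r (form A a fs))) =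
      schouten n (n + 2) dfun (cdeg fs - i) (\<lambda>gs. a * Pr n (nev \<pi>) fs gs)"
    by (simp only: delta_bracket(2)[OF mu_form(3)[OF P f]] mu_form(2)[OF P a(1-3)] a(4))
  also have "\<dots> = nev (mu_form A n \<pi> r (delta_form A r (form A a fs)) + nu_form A n \<pi> (n + 3) (delta_bracket A n (n + 2) \<pi>) r (form A a fs))"
    unfolding schouten_scaled_Pr[OF pder_dfun p a(1)] contr_dfun[OF a(1)] pmul_cst nev_add
    by (rule ext) (simp only: plus_fun_apply nu mu' ksgn_apply sum_negf, simp)
  finally show "delta_bracket A n m (mu_form A n \<pi> r (form A a fs)) =
    mu_form A n \<pi> r (delta_form A r (form A a fs)) + nu_form A n \<pi> (n + 3) (delta_bracket A n (n + 2) \<pi>) r (form A a fs)"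
    by (rule Pol_eqI[OF delta_bracket(1)[OF mu_form(3)[OF P f]]
        Pol_add_closed[OF mu_form(3)[OF P delta_form(3)[OF f]] nu_form(3)[OF P b f]]])
next
  have b: "delta_bracket A n (n + 2) \<pi> \<in> Pol A n (n + 3)" using delta_bracket(1)[OF P] by (simp add: add.assoc)
  fix X Y assume X: "X \<in> Omega A r m" "Y \<in> Omega A r m"
  assume IH: "delta_bracket A n m (mu_form A n \<pi> r X) =
      mu_form A n \<pi> r (delta_form A r X) + nu_form A n \<pi> (n + 3) (delta_bracket A n (n + 2) \<pi>) r X"
    "delta_bracket A n m (mu_form A n \<pi> r Y) =
      mu_form A n \<pi> r (delta_form A r Y) + nu_form A n \<pi> (n + 3) (delta_bracket A n (n + 2) \<pi>) r Y"
  have "a + b + (c + d) = a + c + (b + d)" for a b c d :: "'a polyvec" by (simp only: ac_simps)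
  then show "delta_bracket A n m (mu_form A n \<pi> r (X + Y)) =
      mu_form A n \<pi> r (delta_form A r (X + Y)) + nu_form A n \<pi> (n + 3) (delta_bracket A n (n + 2) \<pi>) r (X + Y)"
    unfolding mu_form(1)[OF P X] delta_bracket_add[OF mu_form(3)[OF P X(1)] mu_form(3)[OF P X(2)]] IH
      delta_form(1)[OF X] mu_form(1)[OF P delta_form(3)[OF X(1)] delta_form(3)[OF X(2)]] nu_form(1)[OF P b X] .
qed

section \<open>The weight filtration\<close>

lemma pmul_vanish:
  assumes "\<Phi> [] = 0" "\<And>gs. length gs < k \<Longrightarrow> \<Psi> gs = 0" "length gs < Suc k"
  shows "pmul n \<Phi> j \<Psi> gs = 0"
  unfolding pmul_def
proof (rule sum.neutral, rule ballI)
  fix S assume "S \<in> Pow {..<length gs}"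
  then have S: "S \<subseteq> {..<length gs}" by simp
  \<comment> \<open>Either S is empty and the left factor vanishes, or the right factor has lost an
    argument and has fewer than k.\<close>
  show "ksgn (shuffle_exp n gs S + j * total_degree n (nths gs S)) (\<Phi> (nths gs S) * \<Psi> (nths gs (- S))) = 0"
  proof (cases "S = {}")
    case False
    then obtain s where "s \<in> S" by blast
    then have "{i. i < length gs \<and> i \<in> - S} \<subset> {..<length gs}" using S by auto
    from psubset_card_mono[OF _ this] have "length (nths gs (- S)) < length gs" by (simp add: length_nths)
    then show ?thesis using assms by simp
  qed (simp add: assms(1))
qed

text \<open>Without a weight 1 part of \<pi> each bracket [\<pi>, f] vanishes on the empty list, so
  every factor uses up at least one argument.\<close>

lemma Pr_vanish:
  assumes "\<And>x. \<pi> [x] = 0"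
  shows "length gs < length fs \<Longrightarrow> Pr n \<pi> fs gs = 0"
proof (induction fs arbitrary: gs)
  case (Cons x fs)
  show ?case
    unfolding Pr.simps by (rule pmul_vanish[of _ "length fs"]) (use assms Cons in auto)
qed simp

text \<open>\<open>Pol\<close> is a condition weight by weight, so the truncation \<psi> of \<phi>
  to weights below r is again a polyvector. Its values as a polyderivation are zero, hence so is
  \<psi> by \<open>Pol_eqI\<close>.\<close>

lemma Fil_nev:
  assumes P: "\<phi> \<in> Pol A n i" and v: "\<And>gs. length gs < r \<Longrightarrow> nev \<phi> gs = 0"
  shows "\<phi> \<in> Fil r"
proof -
  define \<psi> where "\<psi> j = (if j < r then \<phi> j else 0)" for j
  have "\<psi> \<in> Pol A n i" using P by (auto simp: \<psi>_def Pol_def)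
  moreover have "nev \<psi> = nev 0"
  proof
    fix gs show "nev \<psi> gs = nev 0 gs"
      using v[of gs] by (auto simp: nev_def ev_def \<psi>_def)
  qed
  ultimately have eq: "\<psi> = 0" by (intro Pol_eqI[OF _ Pol_0])
  have "\<phi> j = 0" if "j < r" for j
  proof -
    have "\<psi> j = 0" unfolding eq by (rule zero_fun_apply)
    moreover have "\<psi> j = \<phi> j" using that unfolding \<psi>_def by (rule if_P)
    ultimately show ?thesis by (simp only:)
  qed
  then show ?thesis unfolding Fil_def by blast
qed

lemma Fil_add: "\<phi> \<in> Fil r \<Longrightarrow> \<psi> \<in> Fil r \<Longrightarrow> \<phi> + \<psi> \<in> Fil r" for \<phi> \<psi> :: "'a polyvec"
  by (simp add: Fil_def fun_eq_iff)

lemma mu_form_Fil: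
  assumes P: "\<pi> \<in> Pol A n (n + 2)" "\<pi> \<in> Fil 2" and X: "X \<in> Omega A r m"
  shows "mu_form A n \<pi> r X \<in> Fil r"
  using X
proof (rule Omega_induct)
  have v: "nev \<pi> [x] = 0" for x using P(2) by (simp add: nev_def ev_def Fil_def)
  fix i a fs assume a: "a \<in> gr A i" "fs \<in> homog_args A" "length fs = r" "cdeg fs - i = m"
  show "mu_form A n \<pi> r (form A a fs) \<in> Fil r"
    by (rule Fil_nev[OF mu_form(3)[OF P(1) form_Omega[OF a]]])
      (simp add: mu_form(2)[OF P(1) a(1-3)] Pr_vanish[where \<pi> = "nev \<pi>", OF v] a(3))
qed (simp only: mu_form(1)[OF P(1)] Fil_add)

lemma zero_Omega: "sym_sub (gr A) (smod 1) r \<in> Omega A r m"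
proof -
  have "0 +o sym_sub (gr A) (smod 1) r \<in> Omega A r m" unfolding Omega_eq by (rule imageI) (rule tens_pre_0)
  then show ?thesis by simp
qed

lemma dDR_Omega:
  assumes "\<omega> \<in> DR A m"
  shows "dDR A \<omega> r \<in> Omega A r (m + 1)"
proof (cases r)
  case 0
  then show ?thesis using zero_Omega[of 0 "m + 1"] by (simp add: dDR_def dr_mod_def)
next
  case (Suc s)
  then show ?thesis using assms by (simp add: dDR_def DR_def d_form(3))
qed

lemma mu_dDR:
  assumes P: "\<pi> \<in> Pol A n (n + 2)"
  shows "(\<Sum>r < Suc q. mu_form A n \<pi> r (dDR A \<omega> r)) = (\<Sum>r < q. mu_form A n \<pi> (Suc r) (d_form A r (\<omega> r)))"
proof -
  let ?z = "dDR A \<omega> 0"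
  have z: "?z = 0 +o sym_sub (gr A) (smod 1) 0" by (simp add: dDR_def dr_mod_def)
  \<comment> \<open>The zero class is a coset and not the 0 of its type; \<mu> vanishes on it by
    additivity, since it equals its own double.\<close>
  have zz: "?z + ?z = ?z" unfolding z coset_add by simp
  have "?z \<in> Omega A 0 0" using zero_Omega[of 0 0] by (simp add: dDR_def dr_mod_def)
  from mu_form(1)[OF P this this] have 0: "mu_form A n \<pi> 0 ?z = 0" unfolding zz add_cancel_right_right .
  have "(\<Sum>r < Suc q. mu_form A n \<pi> r (dDR A \<omega> r)) =
      mu_form A n \<pi> 0 ?z + (\<Sum>r < q. mu_form A n \<pi> (Suc r) (dDR A \<omega> (Suc r)))"
    by (rule sum.lessThan_Suc_shift)
  then show ?thesis unfolding 0 add_0_left by (simp only: dDR_def nat.case)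
qed

lemma Pol_sum_additive:
  fixes G :: "'a polyvec \<Rightarrow> 'a polyvec"
  assumes G: "\<And>\<phi> \<psi>. \<phi> \<in> Pol A n m \<Longrightarrow> \<psi> \<in> Pol A n m \<Longrightarrow> G (\<phi> + \<psi>) = G \<phi> + G \<psi>"
    and "\<And>r. r \<in> L \<Longrightarrow> \<phi> r \<in> Pol A n m"
  shows "G (\<Sum>r\<in>L. \<phi> r) = (\<Sum>r\<in>L. G (\<phi> r))"
  using assms(2)
proof (induction L rule: infinite_finite_induct)
  case (insert x F)
  have 3: "\<And>r. r \<in> F \<Longrightarrow> \<phi> r \<in> Pol A n m" by (rule insert.prems) simp
  have 1: "\<phi> x \<in> Pol A n m" by (rule insert.prems) simp
  have 2: "(\<Sum>r\<in>F. \<phi> r) \<in> Pol A n m" by (rule Pol_sum_closed) (erule 3)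
  have 4: "G (\<Sum>r\<in>F. \<phi> r) = (\<Sum>r\<in>F. G (\<phi> r))" by (rule insert.IH) (erule 3)
  show ?case unfolding sum.insert[OF insert.hyps] G[OF 1 2] 4 ..
next
  have G0: "G 0 = 0" using G[OF Pol_0 Pol_0] by simp
  case empty
  show ?case by (simp only: G0 sum.empty)
next
  have G0: "G 0 = 0" using G[OF Pol_0 Pol_0] by simp
  case (infinite L)
  then show ?case by (simp only: G0 sum.infinite not_False_eq_True)
qed

text \<open>After the shift of indices in \<open>mu_dDR\<close> the two sums differ by a single
  term, \<mu> of d applied to the component of degree p - 1, which \<open>mu_form_Fil\<close> puts
  into F^p. \<psi> stands for everything else.\<close>

lemma eq_mod_Fil_mu:
  assumes P: "\<pi> \<in> Pol A n (n + 2)" "\<pi> \<in> Fil 2" and \<omega>: "\<omega> \<in> DR A m"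
    and eq: "\<phi> = (\<Sum>r < p. mu_form A n \<pi> (Suc r) (d_form A r (\<omega> r))) + \<psi>"
  shows "eq_mod_Fil p \<phi> ((\<Sum>r < p. mu_form A n \<pi> r (dDR A \<omega> r)) + \<psi>)"
proof (cases p)
  case 0
  then show ?thesis by (simp add: eq_mod_Fil_def Fil_def)
next
  case (Suc q)
  have "\<omega> q \<in> Omega A q m" using \<omega> by (simp add: DR_def)
  from mu_form_Fil[OF P d_form(3)[OF this]]
  show ?thesis
    unfolding eq_mod_Fil_def eq Suc mu_dDR[OF P(1)] by simp
qed

lemma bracket_mu:
  assumes P: "\<pi> \<in> Pol A n (n + 2)" "\<pi> \<in> Fil 2" and \<omega>: "\<omega> \<in> DR A m"
  shows "eq_mod_Fil p (pol_bracket A n (n + 2) \<pi> m (mu A n p \<omega> \<pi>))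
      (mu A n p (dDR A \<omega>) \<pi> + half (nu A n p \<omega> \<pi> (n + 3) (pol_bracket A n (n + 2) \<pi> (n + 2) \<pi>)))"
    and "eq_mod_Fil p (delta_pi_bracket A n \<pi> m (mu A n p \<omega> \<pi>))
      (mu A n p (DDR A \<omega>) \<pi> + nu A n p \<omega> \<pi> (n + 3) (kappa A n \<pi>))"
proof -
  let ?\<delta> = "delta_bracket A n (n + 2) \<pi>"
  have w: "\<omega> r \<in> Omega A r m" for r using \<omega> by (simp add: DR_def)
  note \<mu> = mu_form(3)[OF P(1) w]
  have "pol_bracket A n (n + 2) \<pi> (n + 2) \<pi> \<in> Pol A n (n + 3)"
  proof -
    have "n + 2 + (n + 2) - n - 1 = n + 3" by simp
    with pol_bracket(1)[OF P(1) P(1)] show ?thesis by (simp only:)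
  qed
  \<comment> \<open>Since \<nu> is additive in b, its value on the double of \<eta> is a double, so
    the half in the first identity and the one inside \<kappa> are both resolved by
    \<open>half_double\<close>.\<close>
  then obtain \<eta> where \<eta>: "\<eta> \<in> Pol A n (n + 3)" "\<eta> + \<eta> = pol_bracket A n (n + 2) \<pi> (n + 2) \<pi>" by (rule Pol_halve)
  have \<delta>: "?\<delta> \<in> Pol A n (n + 3)" using delta_bracket(1)[OF P(1)] by (simp add: add.assoc)
  have \<kappa>: "kappa A n \<pi> = ?\<delta> + \<eta>" unfolding kappa_def \<eta>(2)[symmetric] half_double ..
  have s1: "pol_bracket A n (n + 2) \<pi> m (\<Sum>r < p. mu_form A n \<pi> r (\<omega> r)) =
      (\<Sum>r < p. pol_bracket A n (n + 2) \<pi> m (mu_form A n \<pi> r (\<omega> r)))"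
    by (rule Pol_sum_additive[where G = "pol_bracket A n (n + 2) \<pi> m" and \<phi> = "\<lambda>r. mu_form A n \<pi> r (\<omega> r)"])
      (rule pol_bracket_add[OF P(1)], assumption, assumption, rule \<mu>)
  have s2: "delta_bracket A n m (\<Sum>r < p. mu_form A n \<pi> r (\<omega> r)) =
      (\<Sum>r < p. delta_bracket A n m (mu_form A n \<pi> r (\<omega> r)))"
    by (rule Pol_sum_additive[where G = "delta_bracket A n m" and \<phi> = "\<lambda>r. mu_form A n \<pi> r (\<omega> r)"])
      (rule delta_bracket_add, assumption, assumption, rule \<mu>)
  have br: "pol_bracket A n (n + 2) \<pi> m (mu A n p \<omega> \<pi>) =
    (\<Sum>r < p. mu_form A n \<pi> (Suc r) (d_form A r (\<omega> r))) + (\<Sum>r < p. nu_form A n \<pi> (n + 3) \<eta> r (\<omega> r))"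
    unfolding mu_def s1 bracket_mu_form[OF P(1) \<eta> w] sum.distrib ..
  have nu: "nu A n p \<omega> \<pi> (n + 3) (pol_bracket A n (n + 2) \<pi> (n + 2) \<pi>) =
    (\<Sum>r < p. nu_form A n \<pi> (n + 3) \<eta> r (\<omega> r)) + (\<Sum>r < p. nu_form A n \<pi> (n + 3) \<eta> r (\<omega> r))"
    unfolding nu_def \<eta>(2)[symmetric] nu_form_add[OF P(1) \<eta>(1) \<eta>(1) w] sum.distrib ..
  show "eq_mod_Fil p (pol_bracket A n (n + 2) \<pi> m (mu A n p \<omega> \<pi>))
      (mu A n p (dDR A \<omega>) \<pi> + half (nu A n p \<omega> \<pi> (n + 3) (pol_bracket A n (n + 2) \<pi> (n + 2) \<pi>)))"
    unfolding nu half_double mu_def[of A n p "dDR A \<omega>"] by (rule eq_mod_Fil_mu[OF P \<omega> br])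
  have "delta_pi_bracket A n \<pi> m (mu A n p \<omega> \<pi>) =
      delta_bracket A n m (mu A n p \<omega> \<pi>) + pol_bracket A n (n + 2) \<pi> m (mu A n p \<omega> \<pi>)"
    by (rule delta_pi_bracket[OF P(1)]) (unfold mu_def, rule Pol_sum_closed, rule \<mu>)
  also have "delta_bracket A n m (mu A n p \<omega> \<pi>) =
      (\<Sum>r < p. mu_form A n \<pi> r (delta_form A r (\<omega> r))) + (\<Sum>r < p. nu_form A n \<pi> (n + 3) ?\<delta> r (\<omega> r))"
    unfolding mu_def s2 delta_bracket_mu_form[OF P(1) w] sum.distrib ..
  finally have dbr: "delta_pi_bracket A n \<pi> m (mu A n p \<omega> \<pi>) = (\<Sum>r < p. mu_form A n \<pi> (Suc r) (d_form A r (\<omega> r))) +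
      ((\<Sum>r < p. mu_form A n \<pi> r (delta_form A r (\<omega> r))) + nu A n p \<omega> \<pi> (n + 3) (kappa A n \<pi>))"
    unfolding br nu_def \<kappa> nu_form_add[OF P(1) \<delta> \<eta>(1) w] sum.distrib by (simp only: ac_simps)
  have "mu A n p (DDR A \<omega>) \<pi> = (\<Sum>r < p. mu_form A n \<pi> r (dDR A \<omega> r)) + (\<Sum>r < p. mu_form A n \<pi> r (delta_form A r (\<omega> r)))"
    unfolding mu_def DDR_def mu_form(1)[OF P(1) dDR_Omega[OF \<omega>] delta_form(3)[OF w]] sum.distrib ..
  then show "eq_mod_Fil p (delta_pi_bracket A n \<pi> m (mu A n p \<omega> \<pi>))
      (mu A n p (DDR A \<omega>) \<pi> + nu A n p \<omega> \<pi> (n + 3) (kappa A n \<pi>))"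
    using eq_mod_Fil_mu[OF P \<omega> dbr] by (simp only: add.assoc)
qed

end

section \<open>From differential graded algebras to homogeneous structure\<close>

lemma add_pow_dga_of: "add_pow (dga_of G \<delta>) (k::nat) x = (\<Sum>l<k. x)"
  by (induction k) (simp_all add: add_pow_def nat_pow_def dga_of_def add.commute)

lemma graded_algebra_cdga:
  assumes R: "cdga (dga_of R\<^sub>g R\<^sub>\<delta>)" and A: "cdga (dga_of (gr A) (del A))"
    and h: "str A \<in> dga_hom (dga_of R\<^sub>g R\<^sub>\<delta>) (dga_of (gr A) (del A))"
  shows "graded_algebra A"
proof -
  let ?B = "dga_of (gr A) (del A)"
  note d [simp] = dga_of_def
  have ring: "ring ?B" and sub: "additive_subgroup (gr A i) ?B" for i
    using A by (simp_all add: cdga_def)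
  interpret ring ?B by (rule ring)
  have minus: "a_inv ?B x = - x" for x
    by (rule minus_equality) auto
  have fs: "finsum ?B c I = sum c I" if "finite I" for c :: "'c \<Rightarrow> 'b" and I
    using that
  proof (induction I rule: finite_induct)
    case empty
    show ?case using finsum_empty[of c] by simp
  next
    case (insert x F)
    then show ?case using finsum_insert[of F x c] by simp
  qed
  have units: "0 < k \<Longrightarrow> add_pow ?B k (1 :: 'b) \<in> Units ?B" for k :: nat
    using A by (simp add: cdga_def)
  have dec: "\<exists>!c. (\<forall>i. c i \<in> gr A i) \<and> finite {i. c i \<noteq> 0} \<and> x = sum c {i. c i \<noteq> 0}" for x :: 'b
  proof -
    have "\<exists>!c. (\<forall>i. c i \<in> gr A i) \<and> finite {i. c i \<noteq> 0} \<and> x = finsum ?B c {i. c i \<noteq> 0}"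
      using A by (simp add: cdga_def)
    moreover have "(finite {i. c i \<noteq> 0} \<and> x = finsum ?B c {i. c i \<noteq> 0}) \<longleftrightarrow>
       (finite {i. c i \<noteq> 0} \<and> x = sum c {i. c i \<noteq> 0})" for c :: "int \<Rightarrow> 'b"
      using fs by (metis (no_types))
    ultimately show ?thesis by simp
  qed
  have zero: "0 \<in> gr A i" for i using additive_subgroup.zero_closed[OF sub] by simp
  have add: "x + y \<in> gr A i" if "x \<in> gr A i" "y \<in> gr A i" for x y i
    using additive_subgroup.a_closed[OF sub that] by simp
  have um: "- x \<in> gr A i" if "x \<in> gr A i" for x i
    using additive_subgroup.a_inv_closed[OF sub that] unfolding minus .
  have S: "monoid.mult ?B = (*)" "ring.add ?B = (+)" "part ?B = gr A" "bdry ?B = del A" "monoid.one ?B = 1" "carrier ?B = UNIV"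
    by simp_all
  have one: "1 \<in> gr A 0"
  proof -
    have "monoid.one ?B \<in> part ?B 0" using A unfolding cdga_def by (elim conjE) assumption
    then show ?thesis unfolding S .
  qed
  note c5 = iffD1[OF cdga_def A, THEN conjunct2, THEN conjunct2, THEN conjunct2, THEN conjunct2, THEN conjunct2]
  note c6 = c5[THEN conjunct2]
  note c7 = c6[THEN conjunct2]
  have "x \<otimes>\<^bsub>?B\<^esub> y \<in> part ?B (i + j) \<and>
      x \<otimes>\<^bsub>?B\<^esub> y = (if even (i * j) then y \<otimes>\<^bsub>?B\<^esub> x else \<ominus>\<^bsub>?B\<^esub> (y \<otimes>\<^bsub>?B\<^esub> x))"
    if "x \<in> part ?B i" "y \<in> part ?B j" for x y i j
    by (rule c5[THEN conjunct1, rule_format, OF that])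
  note m = this[unfolded S minus]
  have mult: "x * y \<in> gr A (i + j)" and comm: "x * y = ksgn (i * j) (y * x)"
    if "x \<in> gr A i" "y \<in> gr A j" for x y i j
    unfolding ksgn_def by (rule m[OF that, THEN conjunct1], rule m[OF that, THEN conjunct2])
  have "bdry ?B (x \<oplus>\<^bsub>?B\<^esub> y) = bdry ?B x \<oplus>\<^bsub>?B\<^esub> bdry ?B y" if "x \<in> carrier ?B" "y \<in> carrier ?B" for x y
    by (rule c6[THEN conjunct1, rule_format, OF that])
  note deladd = this[unfolded S, OF UNIV_I UNIV_I]
  have "bdry ?B x \<in> part ?B (i - 1)" if "x \<in> part ?B i" for x i
    by (rule c7[THEN conjunct1, rule_format, OF that, THEN conjunct1])
  note delgr = this[unfolded S]
  have "bdry ?B (x \<otimes>\<^bsub>?B\<^esub> y) = (bdry ?B x \<otimes>\<^bsub>?B\<^esub> y) \<oplus>\<^bsub>?B\<^esub>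
      (if even i then x \<otimes>\<^bsub>?B\<^esub> bdry ?B y else \<ominus>\<^bsub>?B\<^esub> (x \<otimes>\<^bsub>?B\<^esub> bdry ?B y))"
    if "x \<in> part ?B i" "y \<in> carrier ?B" for x y i
    by (rule c7[THEN conjunct2, rule_format, OF that])
  note delmult = this[unfolded S minus, OF _ UNIV_I, folded ksgn_def]
  define P where "P x c \<longleftrightarrow> (\<forall>i. c i \<in> gr A i) \<and> finite {i. c i \<noteq> 0} \<and> x = sum c {i. c i \<noteq> 0}" for x :: 'b and c
  have uniq: "c = c'" if "P x c" "P x c'" for x c c'
  proof -
    have "\<exists>!c. P x c" unfolding P_def by (rule dec)
    then show ?thesis using that by metis
  qed
  have unique: "i = j" if x: "x \<in> gr A i" "x \<in> gr A j" "x \<noteq> 0" for x i j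
  proof -
    have s: "{l. (if l = i then x else 0) \<noteq> 0} = {i}" for i :: int using x(3) by auto
    \<comment> \<open>An element of two degrees has two decompositions, concentrated in i and in j,
      which must coincide.\<close>
    have "P x (\<lambda>l. if l = i then x else 0)" if "x \<in> gr A i" for i
      unfolding P_def s using that zero by simp
    from uniq[OF this[OF x(1)] this[OF x(2)]]
    have "(\<lambda>l. if l = i then x else 0) = (\<lambda>l. if l = j then x else 0)" .
    from fun_cong[OF this, of i] show ?thesis using x(3) by (auto split: if_splits)
  qed
  \<comment> \<open>The inverse u of k is not known to be homogeneous. Its component of degree 0 is
    an inverse too, because k times the decomposition of u is a decomposition of 1, and 1 has degree
    0.\<close>
  have proj: "\<exists>u0 \<in> gr A 0. (\<Sum>l<k. u0) = 1" if k: "0 < k" for k :: nat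
  proof -
    obtain u where u: "u * (\<Sum>l<k. 1) = (1 :: 'b)"
      using units[OF k] unfolding add_pow_dga_of by (auto simp: Units_def)
    then have u1: "(\<Sum>l<k. u) = 1" by (simp add: sum_distrib_left)
    obtain c where c: "\<And>i. c i \<in> gr A i" "finite {i. c i \<noteq> 0}" "u = sum c {i. c i \<noteq> 0}"
      using ex1_implies_ex[OF dec[of u]] by blast
    have supp: "c i = 0 \<Longrightarrow> (\<Sum>l<k. c i) = 0" for i by simp
    let ?c = "\<lambda>i. \<Sum>l<k. c i"
    have mem: "?c i \<in> gr A i" for i
      by (induction k) (simp_all add: zero add c(1))
    have fin: "finite {i. ?c i \<noteq> 0}" by (rule finite_subset[OF _ c(2)]) (use supp in blast)
    have "1 = (\<Sum>l<k. sum c {i. c i \<noteq> 0})" unfolding c(3)[symmetric] by (rule u1[symmetric])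
    also have "\<dots> = sum ?c {i. c i \<noteq> 0}" by (rule sum.swap)
    also have "\<dots> = sum ?c {i. ?c i \<noteq> 0}"
      by (rule sum.mono_neutral_right[OF c(2)]) (use supp in auto)
    finally have 1: "P 1 ?c" unfolding P_def using mem fin by blast
    have 2: "P 1 (\<lambda>i. if i = 0 then 1 else 0)"
    proof (cases "(1 :: 'b) = 0")
      case True
      then show ?thesis unfolding P_def using zero by simp
    next
      case False
      then have s: "{i. (if i = 0 then 1 else 0 :: 'b) \<noteq> 0} = {0 :: int}" by auto
      show ?thesis unfolding P_def s using zero one by simp
    qed
    from fun_cong[OF uniq[OF 1 2], of 0] have "?c 0 = 1" unfolding if_P[OF refl] .
    then show ?thesis using c(1)[of 0] by blast
  qed
  have str: "\<exists>r'. del A (str A r) = str A r'" for r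
  proof -
    have "str A (R\<^sub>\<delta> r) = del A (str A r)" using h by (simp add: dga_hom_def)
    then show ?thesis by (intro exI[of _ "R\<^sub>\<delta> r"]) (rule sym)
  qed
  show ?thesis
    by unfold_locales (fact zero | rule add um one mult comm unique proj delgr deladd delmult str; assumption)+
qed

theorem lemma1p17:
  fixes R\<^sub>g :: "int \<Rightarrow> ('r::{ring, monoid_mult}) set" and R\<^sub>\<delta> :: "'r \<Rightarrow> 'r"
    and A :: "('r, 'a::{ring, monoid_mult}) alg"
    and n m :: int and p :: nat
    and \<omega> :: "nat \<Rightarrow> 'a kahler_tens" and \<pi> :: "'a polyvec"
  assumes "cdga (dga_of R\<^sub>g R\<^sub>\<delta>)"
    and "cdga (dga_of (gr A) (del A))"
    and "str A \<in> dga_hom (dga_of R\<^sub>g R\<^sub>\<delta>) (dga_of (gr A) (del A))"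
    and "cofibrant (dga_of R\<^sub>g R\<^sub>\<delta>) (dga_of (gr A) (del A)) (str A)"
    and "\<omega> \<in> DR A m"
    and "\<pi> \<in> Pol A n (n + 2) \<inter> Fil 2"
  shows "eq_mod_Fil p
           (pol_bracket A n (n + 2) \<pi> m (mu A n p \<omega> \<pi>))
           (mu A n p (dDR A \<omega>) \<pi> +
            half (nu A n p \<omega> \<pi> (n + 3) (pol_bracket A n (n + 2) \<pi> (n + 2) \<pi>))) \<and>
         eq_mod_Fil p
           (delta_pi_bracket A n \<pi> m (mu A n p \<omega> \<pi>))
           (mu A n p (DDR A \<omega>) \<pi> + nu A n p \<omega> \<pi> (n + 3) (kappa A n \<pi>))"
proof -
  interpret graded_algebra A n
    by (rule graded_algebra_cdga[OF assms(1-3)])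
  show ?thesis
    using bracket_mu[OF _ _ assms(5), of \<pi> p] assms(6) by blast
qed

end
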